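(* Let $p$ be an odd prime. Let $L/K$ be a separable field extension of degree $p^3$, let $\widetilde{L}$ be its normal closure and $G=\operatorname{Gal}(\widetilde{L}/K)$. Then $L/K$ has a Hopf Galois structure of type $C_{p^3}$ if and only if $G$ is isomorphic to the semidirect product $C_{p^3}\rtimes C_D$ of the cyclic group $C_{p^3}$ of order $p^3$ and a cyclic group $C_D$ of order $D=p^a d$, with $0\leq a\leq 2$ and $d$ a divisor of $p-1$. Moreover, when $G\simeq C_{p^3}\rtimes C_D$ with $D=p^ad$, where $0\leq a\leq 2$ and $d$ is a divisor of $p-1$, the number of Hopf Galois structures of type $C_{p^3}$ on $L/K$ is $1$ if $d>1$, it is $p^2$ if $D=1$, and it is $p^{3-a}$ if $D=p^a$ with $a=1$ or $2$.
   Context: $C_m$ denotes the cyclic group of order $m$. In the semidirect product $C_{p^3}\rtimes C_D$, the morphism $C_D\to\operatorname{Aut}(C_{p^3})$ giving the action is injective. A Hopf Galois structure on a finite field extension $L/K$ is a pair $(\mathcal{H},\mu)$, where $\mathcal{H}$ is a finite cocommutative $K$-Hopf algebra and $\mu:\mathcal{H}\to \operatorname{End}_K(L)$ is a $K$-linear map giving $L$ a left $\mathcal{H}$-module algebra structure and inducing a $K$-vector space isomorphism $L\otimes_K \mathcal{H}\to \operatorname{End}_K(L)$. Let $L/K$ be finite separable of degree $g$ with normal closure $\widetilde{L}$, $G=\operatorname{Gal}(\widetilde{L}/K)$, $G'=\operatorname{Gal}(\widetilde{L}/L)$, and let $\lambda:G\hookrightarrow \operatorname{Sym}(G/G')\cong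 S_g$ be the action of $G$ on the left cosets $G/G'$. By the theorem of Greither and Pareigis, isomorphism classes of Hopf Galois structures on $L/K$ are in bijection with regular subgroups $N$ of $\operatorname{Sym}(G/G')$ normalized by $\lambda(G)$ (the Hopf algebra corresponding to $N$ is $\widetilde{L}[N]^G$, with $G$ acting on $\widetilde{L}$ by automorphisms and on $N$ by conjugation through $\lambda$). The type of a Hopf Galois structure is the isomorphism class of the corresponding group $N$. Hopf Galois structures are counted up to isomorphism, i.e. the number of Hopf Galois structures of a given type is the number of such regular subgroups $N$ in the given isomorphism class. *)

theory Defs
  imports "HOL-Algebra.Algebra"
begin

section \<open>Field extensions\<close>

text \<open>Fields are subfields of one ambient field \<open>E\<close>, and \<open>E\<close> plays the role of the normal
  closure of \<open>L\<close> over \<open>K\<close>.\<close>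

definition normal_extension :: "('e, 'm) ring_scheme \<Rightarrow> 'e set \<Rightarrow> 'e set \<Rightarrow> bool" where
  "normal_extension E K M \<longleftrightarrow>
     (\<forall>x\<in>M. (ring.algebraic E over K) x) \<and>
     (\<forall>p\<in>carrier (K[X]\<^bsub>E\<^esub>).
        pirreducible\<^bsub>E\<^esub> K p \<and> (\<exists>x\<in>M. ring.eval E p x = \<zero>\<^bsub>E\<^esub>)
          \<longrightarrow> ring.splitted (E\<lparr>carrier := M\<rparr>) p)"

text \<open>\<open>E\<close> is a normal closure of \<open>L/K\<close>: no proper intermediate field containing \<open>L\<close> is normal
  over \<open>K\<close>.\<close>

definition normal_closure :: "('e, 'm) ring_scheme \<Rightarrow> 'e set \<Rightarrow> 'e set \<Rightarrow> bool" where
  "normal_closure E K L \<longleftrightarrow>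
     normal_extension E K (carrier E) \<and>
     (\<forall>M. subfield M E \<and> L \<subseteq> M \<and> normal_extension E K M \<longrightarrow> M = carrier E)"

text \<open>Every minimal polynomial has as many distinct roots in \<open>E\<close> as its degree. This is
  separability as soon as the minimal polynomials of the elements of \<open>L\<close> split in \<open>E\<close>, in
  particular if \<open>E\<close> is a normal closure of \<open>L/K\<close>.\<close>

definition separable_extension :: "('e, 'm) ring_scheme \<Rightarrow> 'e set \<Rightarrow> 'e set \<Rightarrow> bool" where
  "separable_extension E K L \<longleftrightarrow>
     (\<forall>x\<in>L. (ring.algebraic E over K) x \<and>
        card {y \<in> carrier E. ring.eval E (ring.Irr E K x) y = \<zero>\<^bsub>E\<^esub>} = degree (ring.Irr E K x))"

definition galois_group :: "('e, 'm) ring_scheme \<Rightarrow> 'e set \<Rightarrow> ('e \<Rightarrow> 'e) monoid" where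
  "galois_group E K =
     (BijGroup (carrier E))
       \<lparr>carrier := {\<sigma> \<in> Bij (carrier E). \<sigma> \<in> ring_hom E E \<and> (\<forall>x\<in>K. \<sigma> x = x)}\<rparr>"


section \<open>Semidirect products\<close>

definition semidirect_product ::
  "('a, 'm) monoid_scheme \<Rightarrow> ('b, 'n) monoid_scheme \<Rightarrow> ('b \<Rightarrow> 'a \<Rightarrow> 'a) \<Rightarrow> ('a \<times> 'b) monoid" where
  "semidirect_product A B \<theta> =
     \<lparr>carrier = carrier A \<times> carrier B,
      monoid.mult = (\<lambda>(a, b) (a', b'). (a \<otimes>\<^bsub>A\<^esub> \<theta> b a', b \<otimes>\<^bsub>B\<^esub> b')),
      monoid.one = (\<one>\<^bsub>A\<^esub>, \<one>\<^bsub>B\<^esub>)\<rparr>"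

text \<open>\<open>G \<cong> C\<^sub>m \<rtimes> C\<^sub>D\<close> for some faithful action of \<open>C\<^sub>D\<close> on \<open>C\<^sub>m\<close>.\<close>

definition is_cyclic_semidirect :: "('g, 'm) monoid_scheme \<Rightarrow> nat \<Rightarrow> nat \<Rightarrow> bool" where
  "is_cyclic_semidirect G m D \<longleftrightarrow>
     (\<exists>\<theta> \<in> hom (integer_mod_group D) (AutoGroup (integer_mod_group m)).
        inj_on \<theta> (carrier (integer_mod_group D)) \<and>
        G \<cong> semidirect_product (integer_mod_group m) (integer_mod_group D) \<theta>)"


section \<open>Finite cocommutative Hopf algebras\<close>

text \<open>An element of a tensor product \<open>M \<otimes> N\<close> over \<open>R\<close> is written as a formal sum of pure tensors,
  that is, as a list of pairs (similarly for triples). Two formal sums denote the same tensor iff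
  every bilinear form takes the same value on both: over a field, the bilinear forms on \<open>M \<times> N\<close>
  are the linear forms on \<open>M \<otimes> N\<close>, and linear forms separate points.\<close>

definition list_sum :: "('a, 'm) ring_scheme \<Rightarrow> ('b \<Rightarrow> 'a) \<Rightarrow> 'b list \<Rightarrow> 'a" where
  "list_sum A f xs = foldr (\<lambda>x s. f x \<oplus>\<^bsub>A\<^esub> s) xs \<zero>\<^bsub>A\<^esub>"

definition linear_form ::
  "('k, 'r) ring_scheme \<Rightarrow> ('k, 'a, 's) module_scheme \<Rightarrow> ('a \<Rightarrow> 'k) \<Rightarrow> bool" where
  "linear_form R M f \<longleftrightarrow>
     f \<in> carrier M \<rightarrow> carrier R \<and>
     (\<forall>x\<in>carrier M. \<forall>y\<in>carrier M. f (x \<oplus>\<^bsub>M\<^esub> y) = f x \<oplus>\<^bsub>R\<^esub> f y) \<and>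
     (\<forall>c\<in>carrier R. \<forall>x\<in>carrier M. f (c \<odot>\<^bsub>M\<^esub> x) = c \<otimes>\<^bsub>R\<^esub> f x)"

definition bilinear_form ::
  "('k, 'r) ring_scheme \<Rightarrow> ('k, 'a, 's) module_scheme \<Rightarrow> ('k, 'b, 't) module_scheme
     \<Rightarrow> ('a \<Rightarrow> 'b \<Rightarrow> 'k) \<Rightarrow> bool" where
  "bilinear_form R M N \<beta> \<longleftrightarrow>
     (\<forall>y\<in>carrier N. linear_form R M (\<lambda>x. \<beta> x y)) \<and>
     (\<forall>x\<in>carrier M. linear_form R N (\<lambda>y. \<beta> x y))"

definition trilinear_form ::
  "('k, 'r) ring_scheme \<Rightarrow> ('k, 'a, 's) module_scheme \<Rightarrow> ('a \<Rightarrow> 'a \<Rightarrow> 'a \<Rightarrow> 'k) \<Rightarrow> bool" where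
  "trilinear_form R M \<beta> \<longleftrightarrow>
     (\<forall>x\<in>carrier M. \<forall>y\<in>carrier M.
        linear_form R M (\<lambda>z. \<beta> z x y) \<and> linear_form R M (\<lambda>z. \<beta> x z y) \<and>
        linear_form R M (\<lambda>z. \<beta> x y z))"

definition tensor_eq ::
  "('k, 'r) ring_scheme \<Rightarrow> ('k, 'a, 's) module_scheme \<Rightarrow> ('k, 'b, 't) module_scheme
     \<Rightarrow> ('a \<times> 'b) list \<Rightarrow> ('a \<times> 'b) list \<Rightarrow> bool" where
  "tensor_eq R M N s t \<longleftrightarrow>
     (\<forall>\<beta>. bilinear_form R M N \<beta> \<longrightarrow>
        list_sum R (\<lambda>(x, y). \<beta> x y) s = list_sum R (\<lambda>(x, y). \<beta> x y) t)"

definition tensor3_eq ::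
  "('k, 'r) ring_scheme \<Rightarrow> ('k, 'a, 's) module_scheme
     \<Rightarrow> ('a \<times> 'a \<times> 'a) list \<Rightarrow> ('a \<times> 'a \<times> 'a) list \<Rightarrow> bool" where
  "tensor3_eq R M s t \<longleftrightarrow>
     (\<forall>\<beta>. trilinear_form R M \<beta> \<longrightarrow>
        list_sum R (\<lambda>(x, y, z). \<beta> x y z) s = list_sum R (\<lambda>(x, y, z). \<beta> x y z) t)"

text \<open>The list \<open>comult H h\<close> is a Sweedler representation \<open>\<Sum> h\<^sub>1 \<otimes> h\<^sub>2\<close> of the comultiplication of
  \<open>h\<close>; only the tensor it denotes matters.\<close>

record ('k, 'h) hopf = "('k, 'h) module" +
  comult :: "'h \<Rightarrow> ('h \<times> 'h) list"
  counit :: "'h \<Rightarrow> 'k"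
  antipode :: "'h \<Rightarrow> 'h"

locale hopf_algebra = field R + module R H + H: ring H
  for R :: "('k, 'r) ring_scheme" (structure) and H :: "('k, 'h) hopf" (structure) +
  assumes smult_mult_left:
      "\<lbrakk>c \<in> carrier R; x \<in> carrier H; y \<in> carrier H\<rbrakk> \<Longrightarrow>
         (c \<odot>\<^bsub>H\<^esub> x) \<otimes>\<^bsub>H\<^esub> y = c \<odot>\<^bsub>H\<^esub> (x \<otimes>\<^bsub>H\<^esub> y)"
    and smult_mult_right:
      "\<lbrakk>c \<in> carrier R; x \<in> carrier H; y \<in> carrier H\<rbrakk> \<Longrightarrow>
         x \<otimes>\<^bsub>H\<^esub> (c \<odot>\<^bsub>H\<^esub> y) = c \<odot>\<^bsub>H\<^esub> (x \<otimes>\<^bsub>H\<^esub> y)"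
    and comult_closed:
      "x \<in> carrier H \<Longrightarrow> set (comult H x) \<subseteq> carrier H \<times> carrier H"
    and comult_add:
      "\<lbrakk>x \<in> carrier H; y \<in> carrier H\<rbrakk> \<Longrightarrow>
         tensor_eq R H H (comult H (x \<oplus>\<^bsub>H\<^esub> y)) (comult H x @ comult H y)"
    and comult_smult:
      "\<lbrakk>c \<in> carrier R; x \<in> carrier H\<rbrakk> \<Longrightarrow>
         tensor_eq R H H (comult H (c \<odot>\<^bsub>H\<^esub> x)) [(c \<odot>\<^bsub>H\<^esub> u, v). (u, v) \<leftarrow> comult H x]"
    and counit_linear: "linear_form R H (counit H)"
    and comult_assoc:
      "x \<in> carrier H \<Longrightarrow>
         tensor3_eq R H [(u1, u2, v). (u, v) \<leftarrow> comult H x, (u1, u2) \<leftarrow> comult H u]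
                        [(u, v1, v2). (u, v) \<leftarrow> comult H x, (v1, v2) \<leftarrow> comult H v]"
    and counit_left:
      "x \<in> carrier H \<Longrightarrow> list_sum H (\<lambda>(u, v). counit H u \<odot>\<^bsub>H\<^esub> v) (comult H x) = x"
    and counit_right:
      "x \<in> carrier H \<Longrightarrow> list_sum H (\<lambda>(u, v). counit H v \<odot>\<^bsub>H\<^esub> u) (comult H x) = x"
    and comult_mult:
      "\<lbrakk>x \<in> carrier H; y \<in> carrier H\<rbrakk> \<Longrightarrow>
         tensor_eq R H H (comult H (x \<otimes>\<^bsub>H\<^esub> y))
           [(u \<otimes>\<^bsub>H\<^esub> u', v \<otimes>\<^bsub>H\<^esub> v'). (u, v) \<leftarrow> comult H x, (u', v') \<leftarrow> comult H y]"
    and comult_one: "tensor_eq R H H (comult H \<one>\<^bsub>H\<^esub>) [(\<one>\<^bsub>H\<^esub>, \<one>\<^bsub>H\<^esub>)]"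
    and counit_mult:
      "\<lbrakk>x \<in> carrier H; y \<in> carrier H\<rbrakk> \<Longrightarrow>
         counit H (x \<otimes>\<^bsub>H\<^esub> y) = counit H x \<otimes>\<^bsub>R\<^esub> counit H y"
    and counit_one: "counit H \<one>\<^bsub>H\<^esub> = \<one>\<^bsub>R\<^esub>"
    and antipode_closed: "x \<in> carrier H \<Longrightarrow> antipode H x \<in> carrier H"
    and antipode_add:
      "\<lbrakk>x \<in> carrier H; y \<in> carrier H\<rbrakk> \<Longrightarrow>
         antipode H (x \<oplus>\<^bsub>H\<^esub> y) = antipode H x \<oplus>\<^bsub>H\<^esub> antipode H y"
    and antipode_smult:
      "\<lbrakk>c \<in> carrier R; x \<in> carrier H\<rbrakk> \<Longrightarrow> antipode H (c \<odot>\<^bsub>H\<^esub> x) = c \<odot>\<^bsub>H\<^esub> antipode H x"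
    and antipode_left:
      "x \<in> carrier H \<Longrightarrow>
         list_sum H (\<lambda>(u, v). antipode H u \<otimes>\<^bsub>H\<^esub> v) (comult H x) = counit H x \<odot>\<^bsub>H\<^esub> \<one>\<^bsub>H\<^esub>"
    and antipode_right:
      "x \<in> carrier H \<Longrightarrow>
         list_sum H (\<lambda>(u, v). u \<otimes>\<^bsub>H\<^esub> antipode H v) (comult H x) = counit H x \<odot>\<^bsub>H\<^esub> \<one>\<^bsub>H\<^esub>"

locale finite_cocommutative_hopf_algebra = hopf_algebra +
  assumes finite_dimensional:
      "\<exists>B. finite B \<and> B \<subseteq> carrier H \<and>
         (\<forall>x\<in>carrier H. \<exists>c\<in>B \<rightarrow> carrier R. x = finsum H (\<lambda>b. c b \<odot>\<^bsub>H\<^esub> b) B)"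
    and cocommutative:
      "x \<in> carrier H \<Longrightarrow> tensor_eq R H H (comult H x) [(v, u). (u, v) \<leftarrow> comult H x]"


section \<open>Hopf Galois structures\<close>

definition vector_space_of :: "('e, 'm) ring_scheme \<Rightarrow> 'e set \<Rightarrow> ('e, 'e) module" where
  "vector_space_of E L =
     \<lparr>carrier = L, monoid.mult = monoid.mult E, monoid.one = \<one>\<^bsub>E\<^esub>,
      ring.zero = \<zero>\<^bsub>E\<^esub>, ring.add = ring.add E, module.smult = monoid.mult E\<rparr>"

definition linear_endos :: "('e, 'm) ring_scheme \<Rightarrow> 'e set \<Rightarrow> 'e set \<Rightarrow> ('e \<Rightarrow> 'e) set" where
  "linear_endos E K L =
     {f \<in> L \<rightarrow> L. (\<forall>x\<in>L. \<forall>y\<in>L. f (x \<oplus>\<^bsub>E\<^esub> y) = f x \<oplus>\<^bsub>E\<^esub> f y) \<and>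
                  (\<forall>c\<in>K. \<forall>x\<in>L. f (c \<otimes>\<^bsub>E\<^esub> x) = c \<otimes>\<^bsub>E\<^esub> f x)}"

locale hopf_galois_structure =
  finite_cocommutative_hopf_algebra "E\<lparr>carrier := K\<rparr>" H
  for E :: "('e, 'm) ring_scheme" and K L :: "'e set"
    and H :: "('e, 'h) hopf" and \<mu> :: "'h \<Rightarrow> 'e \<Rightarrow> 'e" +
  assumes action_endo: "h \<in> carrier H \<Longrightarrow> \<mu> h \<in> linear_endos E K L"
    and action_add:
      "\<lbrakk>h \<in> carrier H; h' \<in> carrier H; x \<in> L\<rbrakk> \<Longrightarrow> \<mu> (h \<oplus>\<^bsub>H\<^esub> h') x = \<mu> h x \<oplus>\<^bsub>E\<^esub> \<mu> h' x"
    and action_smult: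
      "\<lbrakk>c \<in> K; h \<in> carrier H; x \<in> L\<rbrakk> \<Longrightarrow> \<mu> (c \<odot>\<^bsub>H\<^esub> h) x = c \<otimes>\<^bsub>E\<^esub> \<mu> h x"
    and action_one: "x \<in> L \<Longrightarrow> \<mu> \<one>\<^bsub>H\<^esub> x = x"
    and action_mult:
      "\<lbrakk>h \<in> carrier H; h' \<in> carrier H; x \<in> L\<rbrakk> \<Longrightarrow> \<mu> (h \<otimes>\<^bsub>H\<^esub> h') x = \<mu> h (\<mu> h' x)"
    and module_algebra_mult:
      "\<lbrakk>h \<in> carrier H; x \<in> L; y \<in> L\<rbrakk> \<Longrightarrow>
         \<mu> h (x \<otimes>\<^bsub>E\<^esub> y) = list_sum E (\<lambda>(u, v). \<mu> u x \<otimes>\<^bsub>E\<^esub> \<mu> v y) (comult H h)"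
    and module_algebra_one: "h \<in> carrier H \<Longrightarrow> \<mu> h \<one>\<^bsub>E\<^esub> = counit H h"
    \<comment> \<open>bijectivity of \<open>L \<otimes> H \<rightarrow> End(L)\<close>, \<open>x \<otimes> h \<mapsto> (y \<mapsto> x \<cdot> \<mu> h y)\<close>\<close>
    and galois_map_inj:
      "\<lbrakk>set t \<subseteq> L \<times> carrier H;
        \<And>y. y \<in> L \<Longrightarrow> list_sum E (\<lambda>(x, h). x \<otimes>\<^bsub>E\<^esub> \<mu> h y) t = \<zero>\<^bsub>E\<^esub>\<rbrakk> \<Longrightarrow>
         tensor_eq (E\<lparr>carrier := K\<rparr>) (vector_space_of E L) H t []"
    and galois_map_surj:
      "f \<in> linear_endos E K L \<Longrightarrow>
         \<exists>t. set t \<subseteq> L \<times> carrier H \<and>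
             (\<forall>y\<in>L. f y = list_sum E (\<lambda>(x, h). x \<otimes>\<^bsub>E\<^esub> \<mu> h y) t)"

definition hopf_galois_iso ::
  "('e, 'm) ring_scheme \<Rightarrow> 'e set \<Rightarrow> 'e set \<Rightarrow> ('e, 'h) hopf \<times> ('h \<Rightarrow> 'e \<Rightarrow> 'e)
     \<Rightarrow> ('e, 'i) hopf \<times> ('i \<Rightarrow> 'e \<Rightarrow> 'e) \<Rightarrow> bool" where
  "hopf_galois_iso E K L = (\<lambda>(H, \<mu>) (H', \<mu>').
     \<exists>\<phi> \<in> ring_iso H H'.
       (\<forall>c\<in>K. \<forall>h\<in>carrier H. \<phi> (c \<odot>\<^bsub>H\<^esub> h) = c \<odot>\<^bsub>H'\<^esub> \<phi> h) \<and>
       (\<forall>h\<in>carrier H. counit H' (\<phi> h) = counit H h) \<and>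
       (\<forall>h\<in>carrier H. tensor_eq (E\<lparr>carrier := K\<rparr>) H' H'
          (comult H' (\<phi> h)) [(\<phi> u, \<phi> v). (u, v) \<leftarrow> comult H h]) \<and>
       (\<forall>h\<in>carrier H. antipode H' (\<phi> h) = \<phi> (antipode H h)) \<and>
       (\<forall>h\<in>carrier H. \<forall>x\<in>L. \<mu>' (\<phi> h) x = \<mu> h x))"


section \<open>The Greither-Pareigis correspondence and the type\<close>

type_synonym 'e coset = "('e \<Rightarrow> 'e) set"
type_synonym 'e coset_perm = "'e coset \<Rightarrow> 'e coset"

definition galois_cosets :: "('e, 'm) ring_scheme \<Rightarrow> 'e set \<Rightarrow> 'e set \<Rightarrow> 'e coset set" where
  "galois_cosets E K L = lcosets\<^bsub>galois_group E K\<^esub> (carrier (galois_group E L))"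

abbreviation coset_sym :: "('e, 'm) ring_scheme \<Rightarrow> 'e set \<Rightarrow> 'e set \<Rightarrow> 'e coset_perm monoid" where
  "coset_sym E K L \<equiv> BijGroup (galois_cosets E K L)"

definition left_translation ::
  "('e, 'm) ring_scheme \<Rightarrow> 'e set \<Rightarrow> 'e set \<Rightarrow> ('e \<Rightarrow> 'e) \<Rightarrow> 'e coset_perm" where
  "left_translation E K L g = (\<lambda>C \<in> galois_cosets E K L. g <#\<^bsub>galois_group E K\<^esub> C)"

definition conj_translation ::
  "('e, 'm) ring_scheme \<Rightarrow> 'e set \<Rightarrow> 'e set \<Rightarrow> ('e \<Rightarrow> 'e) \<Rightarrow> 'e coset_perm \<Rightarrow> 'e coset_perm" where
  "conj_translation E K L g n =
     left_translation E K L g \<otimes>\<^bsub>coset_sym E K L\<^esub> n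
       \<otimes>\<^bsub>coset_sym E K L\<^esub> inv\<^bsub>coset_sym E K L\<^esub> (left_translation E K L g)"

definition regular_subgroup :: "'x set \<Rightarrow> ('x \<Rightarrow> 'x) set \<Rightarrow> bool" where
  "regular_subgroup S N \<longleftrightarrow>
     subgroup N (BijGroup S) \<and> (\<forall>x\<in>S. \<forall>y\<in>S. \<exists>!n. n \<in> N \<and> n x = y)"

definition greither_pareigis ::
  "('e, 'm) ring_scheme \<Rightarrow> 'e set \<Rightarrow> 'e set \<Rightarrow> 'e coset_perm set set" where
  "greither_pareigis E K L =
     {N. regular_subgroup (galois_cosets E K L) N \<and>
         (\<forall>g\<in>carrier (galois_group E K). \<forall>n\<in>N. conj_translation E K L g n \<in> N)}"

text \<open>The fixed Hopf algebra \<open>E[N]\<^sup>G\<close>: the element \<open>\<Sum> c\<^sub>n n\<close> of \<open>E[N]\<close> is the function \<open>n \<mapsto> c\<^sub>n\<close>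
  on \<open>N\<close>. The comultiplication \<open>n \<mapsto> n \<otimes> n\<close> of \<open>E[N]\<close> maps \<open>\<Sum> c\<^sub>n n\<close> to \<open>\<Sum> c\<^sub>n n \<otimes> n\<close>, which by
  Galois descent is the image of exactly one element of \<open>E[N]\<^sup>G \<otimes> E[N]\<^sup>G\<close> (over \<open>K\<close>); any list
  representing that element may be chosen.\<close>

definition fixed_group_algebra ::
  "('e, 'm) ring_scheme \<Rightarrow> 'e set \<Rightarrow> 'e set \<Rightarrow> 'e coset_perm set \<Rightarrow> ('e coset_perm \<Rightarrow> 'e) set" where
  "fixed_group_algebra E K L N =
     {c \<in> N \<rightarrow>\<^sub>E carrier E.
        \<forall>g\<in>carrier (galois_group E K). \<forall>n\<in>N. c (conj_translation E K L g n) = g (c n)}"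

definition gp_hopf ::
  "('e, 'm) ring_scheme \<Rightarrow> 'e set \<Rightarrow> 'e set \<Rightarrow> 'e coset_perm set
     \<Rightarrow> ('e, 'e coset_perm \<Rightarrow> 'e) hopf" where
  "gp_hopf E K L N =
     \<lparr>carrier = fixed_group_algebra E K L N,
      monoid.mult = (\<lambda>c d. \<lambda>n\<in>N. \<Oplus>\<^bsub>E\<^esub>m\<in>N.
                c m \<otimes>\<^bsub>E\<^esub> d (inv\<^bsub>coset_sym E K L\<^esub> m \<otimes>\<^bsub>coset_sym E K L\<^esub> n)),
      monoid.one = (\<lambda>n\<in>N. if n = \<one>\<^bsub>coset_sym E K L\<^esub> then \<one>\<^bsub>E\<^esub> else \<zero>\<^bsub>E\<^esub>),
      ring.zero = (\<lambda>n\<in>N. \<zero>\<^bsub>E\<^esub>),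
      ring.add = (\<lambda>c d. \<lambda>n\<in>N. c n \<oplus>\<^bsub>E\<^esub> d n),
      module.smult = (\<lambda>k c. \<lambda>n\<in>N. k \<otimes>\<^bsub>E\<^esub> c n),
      comult = (\<lambda>c. SOME t.
                  set t \<subseteq> fixed_group_algebra E K L N \<times> fixed_group_algebra E K L N \<and>
                  (\<forall>m\<in>N. \<forall>n\<in>N. list_sum E (\<lambda>(u, v). u m \<otimes>\<^bsub>E\<^esub> v n) t =
                     (if m = n then c n else \<zero>\<^bsub>E\<^esub>))),
      counit = (\<lambda>c. \<Oplus>\<^bsub>E\<^esub>n\<in>N. c n),
      antipode = (\<lambda>c. \<lambda>n\<in>N. c (inv\<^bsub>coset_sym E K L\<^esub> n))\<rparr>"

text \<open>The action of \<open>E[N]\<^sup>G\<close> on \<open>L\<close> is \<open>(\<Sum> c\<^sub>n n) x = \<Sum> c\<^sub>n (n\<^sup>-\<^sup>1 G') x\<close>, where \<open>G'\<close> is the trivial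
  coset and a coset acts on \<open>L\<close> through any of its elements (they agree on \<open>L\<close>).\<close>

definition gp_action ::
  "('e, 'm) ring_scheme \<Rightarrow> 'e set \<Rightarrow> 'e set \<Rightarrow> 'e coset_perm set
     \<Rightarrow> ('e coset_perm \<Rightarrow> 'e) \<Rightarrow> 'e \<Rightarrow> 'e" where
  "gp_action E K L N c x =
     (\<Oplus>\<^bsub>E\<^esub>n\<in>N. c n \<otimes>\<^bsub>E\<^esub>
        (SOME g. g \<in> (inv\<^bsub>coset_sym E K L\<^esub> n) (carrier (galois_group E L))) x)"

text \<open>The Hopf Galois structures whose type is the isomorphism class of \<open>T\<close>: by the theorem of
  Greither and Pareigis, each \<open>(H, \<mu>)\<close> is isomorphic to \<open>E[N]\<^sup>G\<close> for a unique \<open>N\<close>. Counting isomorphism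
  classes requires the underlying set of the Hopf algebra to lie in a fixed type. The chosen type
  holds the algebras \<open>E[N]\<^sup>G\<close>; moreover, since \<open>L \<otimes> H \<cong> End(L)\<close> forces the dimension of \<open>H\<close> to be
  the degree of \<open>L/K\<close>, i.e. the number of cosets, every Hopf Galois structure on \<open>L/K\<close> has an
  isomorphic copy in it.\<close>

definition hopf_galois_of_type ::
  "('e, 'm) ring_scheme \<Rightarrow> 'e set \<Rightarrow> 'e set \<Rightarrow> ('t, 'n) monoid_scheme
     \<Rightarrow> (('e, 'e coset_perm \<Rightarrow> 'e) hopf \<times> (('e coset_perm \<Rightarrow> 'e) \<Rightarrow> 'e \<Rightarrow> 'e)) set" where
  "hopf_galois_of_type E K L T =
     {(H, \<mu>). hopf_galois_structure E K L H \<mu> \<and>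
        (\<exists>N\<in>greither_pareigis E K L.
           hopf_galois_iso E K L (H, \<mu>) (gp_hopf E K L N, gp_action E K L N) \<and>
           (coset_sym E K L)\<lparr>carrier := N\<rparr> \<cong> T)}"

definition num_hopf_galois_of_type ::
  "('e, 'm) ring_scheme \<Rightarrow> 'e set \<Rightarrow> 'e set \<Rightarrow> ('t, 'n) monoid_scheme \<Rightarrow> nat" where
  "num_hopf_galois_of_type E K L T =
     card (hopf_galois_of_type E K L T //
       {(S, S'). S \<in> hopf_galois_of_type E K L T \<and> S' \<in> hopf_galois_of_type E K L T \<and>
                 hopf_galois_iso E K L S S'})"

end

theory Submission
  imports Defs "HOL-Number_Theory.Residue_Primitive_Roots"
begin

text \<open>
  Galois descent identifies the Hopf Galois structures of type \<open>C\<^sub>q\<close>, \<open>q = p\<^sup>3\<close>, with the cyclic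
  regular subgroups \<open>N\<close> of the permutations of \<open>G/G'\<close> normalized by \<open>G\<close>. Descent works without bases:
  from \<open>e\<^sub>j, f\<^sub>j\<close> in \<open>E\<close> with \<open>\<Sum> e\<^sub>j g(f\<^sub>j) = \<delta>\<^sub>g\<^sub>,\<^sub>1\<close> and an element of trace one, every finite \<open>G\<close>-set \<open>Y\<close>
  gets equivariant functions \<open>a\<^sub>i, d\<^sub>i : Y \<rightarrow> E\<close> with \<open>\<Sum> d\<^sub>i(m) a\<^sub>i(n) = \<delta>\<^sub>m\<^sub>n\<close>, so that the \<open>a\<^sub>i\<close> generate the
  \<open>K\<close>-space of equivariant functions and tensors over \<open>K\<close> can be compared pointwise on \<open>Y \<times> Y\<close>.

  A cyclic regular \<open>N\<close> is the group of translations in a coordinate \<open>g : G/G' \<rightarrow> \<int>/q\<close>, and \<open>G\<close> normalizes \<open>N\<close>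
  iff it acts by affine maps in \<open>g\<close>. A transitive group of affine maps contains a \<open>q\<close>-cycle generating
  a subgroup normalized by the stabilizer of a point, and linear parts embed that stabilizer into the
  cyclic group of units modulo \<open>q\<close>; this gives the semidirect product.

  Conversely, let \<open>G = \<langle>\<tau>\<rangle> \<rtimes> \<langle>\<upsilon>\<rangle>\<close> with \<open>\<tau>\<close> of order \<open>q\<close> and \<open>\<upsilon> \<tau> \<upsilon>\<^sup>-\<^sup>1 = \<tau>\<^sup>u\<close>. Then \<open>\<langle>\<tau>\<rangle>\<close> acts regularly and \<open>\<upsilon>\<close> may be
  taken to fix a point \<open>x\<close>. In a coordinate with \<open>g(x) = 0\<close> and \<open>g(\<tau> x) = 1\<close> the map \<open>\<tau>\<close> is \<open>z \<mapsto> c z + 1\<close>, where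
  \<open>c \<equiv> 1\<close> modulo \<open>p\<close> because \<open>\<tau>\<close> is a \<open>q\<close>-cycle; hence \<open>g(\<tau>\<^sup>k x) = 1 + c + \<dots> + c\<^sup>k\<^sup>-\<^sup>1\<close>, and \<open>\<upsilon>\<close> is affine iff
  \<open>c\<^sup>u \<equiv> c\<close>, i.e. iff \<open>q\<close> divides \<open>(c - 1) (u - 1)\<close>. The count is the number of such \<open>c\<close> modulo \<open>q\<close>.
\<close>


section \<open>Automorphisms of a normal closure\<close>

text \<open>The coset action is only known to be transitive, faithful and affine, so no element
  acting as a translation by one is given, and there need not be any. If some linear part is not 1
  modulo \<open>p\<close>, a commutator yields a translation by a unit. If there is no such
  translation, all linear parts are 1 modulo \<open>p\<close>, and any element moving the base point
  by one unit generates a suitable cyclic subgroup. Oddness of \<open>p\<close> enters through the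
  geometric sums, which are divisible by exactly the same powers of \<open>p\<close> as their
  length, and through the primitive root modulo \<open>p^3\<close>.

  The cases \<open>a = 0\<close> and \<open>a = 1\<close> give the same count because
  \<open>c = 1\<close> modulo \<open>p\<close> is required in any case: a condition from
  \<open>u\<close> of the same strength adds nothing.

  On the Hopf side, \<open>comult\<close> is an arbitrarily chosen list and equality of tensors
  quantifies over all bilinear forms, so neither can be computed with directly; both are only ever
  used through values at points. Different \<open>N\<close> give different classes because the
  action on \<open>L\<close>, seen through the embeddings of \<open>L\<close>, is a matrix whose
  entries are indexed by the elements of \<open>N\<close> that carry one coset to another.\<close>

lemma (in field) roots_finite_card:
  assumes "p \<in> carrier (poly_ring R)" "p \<noteq> []"
  shows "finite {y \<in> carrier R. eval p y = \<zero>}"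
    and "card {y \<in> carrier R. eval p y = \<zero>} \<le> degree p"
proof -
  have eq: "{y \<in> carrier R. eval p y = \<zero>} = set_mset (roots p)"
    using roots_mem_iff_is_root[OF assms(1)] assms(2) by (auto simp: is_root_def)
  show "finite {y \<in> carrier R. eval p y = \<zero>}" unfolding eq by simp
  have "card (set_mset (roots p)) \<le> size (roots p)"
    by (metis card_mono finite_set_mset mset_set_set_mset_msubset size_mset_set size_mset_mono)
  thus "card {y \<in> carrier R. eval p y = \<zero>} \<le> degree p"
    unfolding eq using size_roots_le_degree[OF assms(1)] by linarith
qed

text \<open>A product has at most as many roots as its factors together, a factor has at most as
  many as its degree, and degrees add; so no factor of a polynomial with a full set of roots can
  miss one. Separability passes to factors in this way.\<close>

lemma (in field) factor_root_count:
  assumes "p \<in> carrier (poly_ring R)" "q \<in> carrier (poly_ring R)" "p \<noteq> []" "q \<noteq> []"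
    and "card {y \<in> carrier R. eval (poly_mult p q) y = \<zero>} = degree (poly_mult p q)"
  shows "card {y \<in> carrier R. eval p y = \<zero>} = degree p"
proof -
  let ?Z = "\<lambda>p. {y \<in> carrier R. eval p y = \<zero>}"
  have pol: "polynomial (carrier R) p" "polynomial (carrier R) q"
    using assms(1,2) by (simp_all add: univ_poly_carrier)
  note set = pol[THEN polynomial_incl]
  have "?Z (poly_mult p q) = ?Z p \<union> ?Z q"
    using eval_poly_mult[OF set] eval_in_carrier[OF set(1)] eval_in_carrier[OF set(2)]
    by (auto simp: integral_iff)
  hence "card (?Z (poly_mult p q)) = card (?Z p \<union> ?Z q)" by (rule arg_cong)
  hence "degree (poly_mult p q) \<le> card (?Z p) + card (?Z q)"
    using assms(5) card_Un_le[of "?Z p" "?Z q"] by linarith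
  moreover have "degree (poly_mult p q) = degree p + degree q"
    using poly_mult_degree_eq[OF carrier_is_subring pol] assms(3,4) by simp
  ultimately show ?thesis
    using roots_finite_card(2)[OF assms(1,3)] roots_finite_card(2)[OF assms(2,4)] by linarith
qed

text \<open>Separability of a single element, with the base field as a parameter because it grows
  along a tower. Counting roots in the ambient field also guarantees that roots exist there, which
  is what extending an embedding needs.\<close>

definition (in ring) separable_over :: "'a set \<Rightarrow> 'a \<Rightarrow> bool" where
  "separable_over F z \<longleftrightarrow> (algebraic over F) z \<and>
     card {y \<in> carrier R. eval (Irr F z) y = \<zero>} = degree (Irr F z)"

text \<open>The minimal polynomial over the larger field divides the one over \<open>K\<close>, so
  \<open>factor_root_count\<close> applies. The cofactor is exported because
  \<open>map_Irr_root_count\<close> transports the same factorization by an embedding.\<close>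

lemma (in field) separable_over_mono:
  assumes "subfield K R" "subfield F R" "K \<subseteq> F" "z \<in> carrier R" "separable_over K z"
  shows "separable_over F z"
    and "\<exists>r \<in> carrier (F[X]). r \<noteq> [] \<and> Irr K z = poly_mult (Irr F z) r"
proof -
  have algK: "(algebraic over K) z" using assms(5) by (simp add: separable_over_def)
  have algF: "(algebraic over F) z" using algebraic_mono[OF assms(3) algK] .
  note IK = IrrE[OF assms(1,4) algK]
  note IF = IrrE[OF assms(2,4) algF]
  have KF: "carrier (K[X]) \<subseteq> carrier (F[X])"
    using assms(3) unfolding univ_poly_def polynomial_def by auto
  have inR: "Irr F z \<in> carrier (poly_ring R)" "Irr K z \<in> carrier (poly_ring R)"
    using IF(1) IK(1) carrier_polynomial_shell subfieldE(1)[OF assms(1)] subfieldE(1)[OF assms(2)] by auto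
  have ne: "Irr K z \<noteq> []" "Irr F z \<noteq> []"
    using pirreducibleE(1)[OF subfieldE(1)[OF assms(1)] IK(1,2)]
      pirreducibleE(1)[OF subfieldE(1)[OF assms(2)] IF(1,2)] by auto
  have "Irr F z pdivides Irr K z"
    using Irr_minimal[OF assms(2,4) algF _ IK(4)] IK(1) KF by auto
  then obtain r where r: "r \<in> carrier (F[X])" "Irr K z = poly_mult (Irr F z) r"
    unfolding pdivides_iff_shell[OF assms(2) IF(1) subsetD[OF KF IK(1)]] factor_def univ_poly_mult
    by blast
  have rR: "r \<in> carrier (poly_ring R)"
    using r(1) carrier_polynomial_shell subfieldE(1)[OF assms(2)] by auto
  have "r \<noteq> []" using r(2) ne(1) poly_mult_zero(2)[of "Irr F z"] polynomial_incl inR(1)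
    by (metis univ_poly_carrier)
  thus "\<exists>r \<in> carrier (F[X]). r \<noteq> [] \<and> Irr K z = poly_mult (Irr F z) r" using r by blast
  show "separable_over F z"
    unfolding separable_over_def
    using factor_root_count[OF inR(1) rR ne(2) \<open>r \<noteq> []\<close>] assms(5) algF
    by (simp add: separable_over_def r(2)[symmetric])
qed

section \<open>Extending embeddings of fields one generator at a time\<close>

lemma (in field) subfield_hom:
  assumes "subfield F R" "\<tau> \<in> ring_hom (R\<lparr>carrier := F\<rparr>) R"
  shows "ring_hom_ring (R\<lparr>carrier := F\<rparr>) R \<tau>"
  using subring_is_ring[OF subfieldE(1)[OF assms(1)]] assms(2) ring_axioms
  by (simp add: ring_hom_ring_def ring_hom_ring_axioms_def)

lemma (in field) subfield_hom_inj:
  assumes "subfield F R" "\<tau> \<in> ring_hom (R\<lparr>carrier := F\<rparr>) R"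
  shows "inj_on \<tau> F" and "\<And>x. x \<in> F \<Longrightarrow> \<tau> x = \<zero> \<Longrightarrow> x = \<zero>"
proof -
  interpret h: ring_hom_ring "R\<lparr>carrier := F\<rparr>" R \<tau> using subfield_hom[OF assms] .
  have *: "x = \<zero>" if "x \<in> F" "\<tau> x = \<zero>" for x
  proof (rule ccontr)
    assume "x \<noteq> \<zero>"
    hence i: "inv x \<in> F" "x \<otimes> inv x = \<one>"
      using subfield_m_inv[OF assms(1)] that by auto
    have "\<tau> \<one> = \<tau> x \<otimes> \<tau> (inv x)" using h.hom_mult[of x "inv x"] that(1) i by simp
    moreover have "\<tau> (inv x) \<in> carrier R" using i h.hom_closed by auto
    ultimately have "\<one> = \<zero>" using i that h.hom_one by simp
    thus False by simp
  qed
  thus "\<And>x. x \<in> F \<Longrightarrow> \<tau> x = \<zero> \<Longrightarrow> x = \<zero>" .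
  show "inj_on \<tau> F"
  proof (rule inj_onI)
    fix x y assume xy: "x \<in> F" "y \<in> F" "\<tau> x = \<tau> y"
    have my: "\<ominus> y \<in> F" using subringE(5)[OF subfieldE(1)[OF assms(1)] xy(2)] .
    have "\<tau> (y \<oplus> (\<ominus> y)) = \<tau> y \<oplus> \<tau> (\<ominus> y)" "\<tau> (x \<oplus> \<ominus> y) = \<tau> x \<oplus> \<tau> (\<ominus> y)"
      using h.hom_add xy my by auto
    moreover have "y \<in> carrier R" "x \<in> carrier R" using xy subfieldE(3)[OF assms(1)] by auto
    ultimately have "\<tau> (x \<oplus> \<ominus> y) = \<zero>"
      using xy(3) h.hom_zero r_neg by simp
    moreover have "x \<oplus> \<ominus> y \<in> F" using subringE(7)[OF subfieldE(1)[OF assms(1)] xy(1) my] .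
    ultimately have "x \<oplus> \<ominus> y = \<zero>" using * by blast
    thus "x = y" using \<open>y \<in> carrier R\<close> \<open>x \<in> carrier R\<close> by (metis add.inv_solve_right' l_zero zero_closed)
  qed
qed

text \<open>Twist the coefficients by \<tau>, then evaluate. Sums and products are compared with
  their twists up to leading zeros; \<open>normalize\<close> removes those and evaluation does not
  see them.\<close>

lemma (in field) eval_map_hom:
  assumes "subfield F R" "\<tau> \<in> ring_hom (R\<lparr>carrier := F\<rparr>) R" "a \<in> carrier R"
  shows "(\<lambda>p. eval (map \<tau> p) a) \<in> ring_hom (F[X]) R"
proof -
  interpret h: ring_hom_ring "R\<lparr>carrier := F\<rparr>" R \<tau> using subfield_hom[OF assms(1,2)] .
  note sr = subfieldE(1)[OF assms(1)]
  have setF: "set p \<subseteq> F" if "p \<in> carrier (F[X])" for p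
    using that polynomial_incl by (simp add: univ_poly_carrier[symmetric])
  have setR: "set (map \<tau> p) \<subseteq> carrier R" if "set p \<subseteq> F" for p
    using that h.hom_closed by auto
  show ?thesis
  proof (rule ring_hom_memI)
    fix p assume "p \<in> carrier (F[X])"
    thus "eval (map \<tau> p) a \<in> carrier R" using setF setR eval_in_carrier assms(3) by blast
  next
    fix p q assume pq: "p \<in> carrier (F[X])" "q \<in> carrier (F[X])"
    note s = setF[OF pq(1)] setF[OF pq(2)]
    have c: "set (poly_mult p q) \<subseteq> F" "set (poly_add p q) \<subseteq> F"
      using poly_mult_closed[OF sr] poly_add_closed[OF sr] pq polynomial_incl
      by (simp_all add: univ_poly_carrier del: poly_mult.simps poly_add.simps)
    have "eval (map \<tau> (poly_mult p q)) a = eval (normalize (map \<tau> (poly_mult p q))) a"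
      using eval_normalize[OF setR[OF c(1)] assms(3)] by simp
    also have "\<dots> = eval (poly_mult (map \<tau> p) (map \<tau> q)) a"
      using h.poly_mult_hom'[of p q] s poly_mult_consistent[OF sr] by simp
    also have "\<dots> = eval (map \<tau> p) a \<otimes> eval (map \<tau> q) a"
      using eval_poly_mult[OF setR[OF s(1)] setR[OF s(2)] assms(3)] .
    finally show "eval (map \<tau> (p \<otimes>\<^bsub>F[X]\<^esub> q)) a = eval (map \<tau> p) a \<otimes> eval (map \<tau> q) a"
      by (simp add: univ_poly_mult)
    have "eval (map \<tau> (poly_add p q)) a = eval (normalize (map \<tau> (poly_add p q))) a"
      using eval_normalize[OF setR[OF c(2)] assms(3)] by simp
    also have "\<dots> = eval (poly_add (map \<tau> p) (map \<tau> q)) a"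
      using h.poly_add_hom'[of p q] s poly_add_consistent[OF sr] by (simp del: poly_add.simps)
    also have "\<dots> = eval (map \<tau> p) a \<oplus> eval (map \<tau> q) a"
      using eval_poly_add[OF setR[OF s(1)] setR[OF s(2)] assms(3)] .
    finally show "eval (map \<tau> (p \<oplus>\<^bsub>F[X]\<^esub> q)) a = eval (map \<tau> p) a \<oplus> eval (map \<tau> q) a"
      by (simp add: univ_poly_add del: poly_add.simps)
  next
    show "eval (map \<tau> \<one>\<^bsub>F[X]\<^esub>) a = \<one>"
      using h.hom_one assms(3) by (simp add: univ_poly_one)
  qed
qed

text \<open>\<open>simple_extension F z\<close> is \<open>F[X]\<close> modulo the multiples of
  \<open>Irr F z\<close>. Evaluating the twisted polynomial at \<open>a\<close> kills
  \<open>Irr F z\<close>, hence factors through evaluation at \<open>z\<close>; the induced map is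
  \<tau>'.\<close>

lemma (in field) extend_simple:
  assumes F: "subfield F R" and \<tau>: "\<tau> \<in> ring_hom (R\<lparr>carrier := F\<rparr>) R"
    and z: "z \<in> carrier R" "(algebraic over F) z"
    and a: "a \<in> carrier R" "eval (map \<tau> (Irr F z)) a = \<zero>"
  shows "\<exists>\<tau>' \<in> ring_hom (R\<lparr>carrier := simple_extension F z\<rparr>) R.
           (\<forall>x\<in>F. \<tau>' x = \<tau> x) \<and> (\<forall>p\<in>carrier (F[X]). \<tau>' (eval p z) = eval (map \<tau> p) a) \<and> \<tau>' z = a"
proof -
  note sr = subfieldE(1)[OF F]
  interpret h: ring_hom_ring "R\<lparr>carrier := F\<rparr>" R \<tau> using subfield_hom[OF F \<tau>] .
  interpret UP: domain "F[X]" using univ_poly_is_domain[OF sr] .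
  interpret \<Phi>: ring_hom_ring "F[X]" R "\<lambda>p. eval (map \<tau> p) a"
    using eval_map_hom[OF F \<tau> a(1)] UP.ring_axioms ring_axioms
    by (simp add: ring_hom_ring_def ring_hom_ring_axioms_def)
  interpret \<Psi>: ring_hom_ring "F[X]" R "\<lambda>p. eval p z" using eval_ring_hom[OF sr z(1)] .
  note I = IrrE[OF F z]
  have ker: "eval (map \<tau> p) a = \<zero>" if p: "p \<in> carrier (F[X])" "eval p z = \<zero>" for p
  proof -
    obtain r where r: "r \<in> carrier (F[X])" "p = Irr F z \<otimes>\<^bsub>F[X]\<^esub> r"
      using Irr_minimal[OF F z p] unfolding pdivides_iff_shell[OF F I(1) p(1)] factor_def by blast
    show ?thesis using \<Phi>.hom_mult[OF I(1) r(1)] r a(2) \<Phi>.hom_closed[OF r(1)] by simp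
  qed
  have wd: "eval (map \<tau> p) a = eval (map \<tau> q) a"
    if pq: "p \<in> carrier (F[X])" "q \<in> carrier (F[X])" "eval p z = eval q z" for p q
  proof -
    have "eval (p \<ominus>\<^bsub>F[X]\<^esub> q) z = \<zero>"
      using pq \<Psi>.hom_closed[OF pq(2)] by (simp add: a_minus_def r_neg)
    hence "eval (map \<tau> (p \<ominus>\<^bsub>F[X]\<^esub> q)) a = \<zero>" using ker pq by blast
    hence "eval (map \<tau> p) a \<ominus> eval (map \<tau> q) a = \<zero>"
      using pq by (simp add: a_minus_def)
    thus ?thesis using pq by (simp add: \<Phi>.hom_closed)
  qed
  \<comment> \<open>Any polynomial representing \<open>y\<close> will do, by \<open>wd\<close>;
    elements outside the extension receive a junk value.\<close>
  define \<tau>' where "\<tau>' = (\<lambda>y. eval (map \<tau> (SOME p. p \<in> carrier (F[X]) \<and> eval p z = y)) a)"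
  have val: "\<tau>' (eval p z) = eval (map \<tau> p) a" if "p \<in> carrier (F[X])" for p
  proof -
    have "(SOME q. q \<in> carrier (F[X]) \<and> eval q z = eval p z) \<in> carrier (F[X]) \<and>
          eval (SOME q. q \<in> carrier (F[X]) \<and> eval q z = eval p z) z = eval p z"
      by (rule someI[of _ p]) (use that in simp)
    thus ?thesis unfolding \<tau>'_def using wd that by blast
  qed
  have img: "simple_extension F z = (\<lambda>p. eval p z) ` carrier (F[X])"
    using simple_extension_as_eval_img[OF subfieldE(3)[OF F] z(1)] .
  have hom: "\<tau>' \<in> ring_hom (R\<lparr>carrier := simple_extension F z\<rparr>) R"
  proof (rule ring_hom_memI)
    fix x assume "x \<in> carrier (R\<lparr>carrier := simple_extension F z\<rparr>)"
    thus "\<tau>' x \<in> carrier R" using img val \<Phi>.hom_closed by auto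
  next
    fix x y assume "x \<in> carrier (R\<lparr>carrier := simple_extension F z\<rparr>)"
      "y \<in> carrier (R\<lparr>carrier := simple_extension F z\<rparr>)"
    then obtain p q where pq: "p \<in> carrier (F[X])" "q \<in> carrier (F[X])" "x = eval p z" "y = eval q z"
      using img by auto
    show "\<tau>' (x \<otimes>\<^bsub>R\<lparr>carrier := simple_extension F z\<rparr>\<^esub> y) = \<tau>' x \<otimes> \<tau>' y"
      using val[of "p \<otimes>\<^bsub>F[X]\<^esub> q"] pq val by simp
    show "\<tau>' (x \<oplus>\<^bsub>R\<lparr>carrier := simple_extension F z\<rparr>\<^esub> y) = \<tau>' x \<oplus> \<tau>' y"
      using val[of "p \<oplus>\<^bsub>F[X]\<^esub> q"] pq val by simp
  next
    show "\<tau>' \<one>\<^bsub>R\<lparr>carrier := simple_extension F z\<rparr>\<^esub> = \<one>"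
      using val[of "\<one>\<^bsub>F[X]\<^esub>"] \<Phi>.hom_one \<Psi>.hom_one UP.one_closed by simp
  qed
  have const: "\<tau>' x = \<tau> x" if "x \<in> F" for x
  proof (cases "x = \<zero>")
    case True
    have "[] \<in> carrier (F[X])" ..
    from val[OF this] show ?thesis using True h.hom_zero by simp
  next
    case False
    hence "[x] \<in> carrier (F[X])" using that by (simp add: univ_poly_def polynomial_def)
    from val[OF this] show ?thesis using that subfieldE(3)[OF F] h.hom_closed[of x] z(1) a(1) by auto
  qed
  have "\<tau>' z = a"
  proof -
    have X: "[\<one>, \<zero>] \<in> carrier (F[X])"
      using subringE(2,3)[OF sr] by (simp add: univ_poly_def polynomial_def)
    from val[OF this] show ?thesis using z(1) a(1) h.hom_one h.hom_zero by simp
  qed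
  thus ?thesis using hom const val by blast
qed


text \<open>\<tau> fixes \<open>Irr K z\<close> but moves its factor \<open>Irr F z\<close> to a
  possibly different factor of it, and every factor of \<open>Irr K z\<close> has a full set of
  roots.\<close>

lemma (in field) map_Irr_root_count:
  assumes "subfield K R" "subfield F R" "K \<subseteq> F" "z \<in> carrier R" "separable_over K z"
    and \<tau>: "\<tau> \<in> ring_hom (R\<lparr>carrier := F\<rparr>) R" "\<And>k. k \<in> K \<Longrightarrow> \<tau> k = k"
  shows "card {y \<in> carrier R. eval (map \<tau> (Irr F z)) y = \<zero>} = degree (Irr F z)"
proof -
  interpret h: ring_hom_ring "R\<lparr>carrier := F\<rparr>" R \<tau> using subfield_hom[OF assms(2) \<tau>(1)] .
  note sr = subfieldE(1)[OF assms(2)]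
  have alg: "(algebraic over K) z" using assms(5) by (simp add: separable_over_def)
  note IK = IrrE[OF assms(1,4) alg]
  note IF = IrrE[OF assms(2,4) algebraic_mono[OF assms(3) alg]]
  obtain r where r: "r \<in> carrier (F[X])" "r \<noteq> []" "Irr K z = poly_mult (Irr F z) r"
    using separable_over_mono(2)[OF assms(1-5)] by blast
  have setF: "set p \<subseteq> F" if "p \<in> carrier (F[X])" for p
    using that polynomial_incl by (simp add: univ_poly_carrier[symmetric])
  have mapR: "map \<tau> p \<in> carrier (poly_ring R)" if "p \<in> carrier (F[X])" for p
    using that subfield_hom_inj(2)[OF assms(2) \<tau>(1)] h.hom_closed
    by (cases p) (auto simp: univ_poly_carrier[symmetric] polynomial_def)
  have setK: "set (Irr K z) \<subseteq> K"
    using IK(1) polynomial_incl by (simp add: univ_poly_carrier[symmetric])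
  have fixK: "map \<tau> (Irr K z) = Irr K z"
    using setK \<tau>(2) by (intro map_idI) auto
  have "normalize (map \<tau> (Irr K z)) = poly_mult (map \<tau> (Irr F z)) (map \<tau> r)"
    using h.poly_mult_hom'[of "Irr F z" r] setF[OF IF(1)] setF[OF r(1)] r(3) poly_mult_consistent[OF sr]
    by simp
  hence "Irr K z = poly_mult (map \<tau> (Irr F z)) (map \<tau> r)"
    using fixK IK(1) normalize_polynomial by (simp add: univ_poly_carrier[symmetric])
  moreover have "Irr F z \<noteq> []"
    using pirreducibleE(1)[OF sr IF(1,2)] by auto
  ultimately show ?thesis
    using factor_root_count[OF mapR[OF IF(1)] mapR[OF r(1)]] r(2) assms(5)
    by (simp add: separable_over_def)
qed

lemma (in field) Irr_degree_pos:
  assumes "subfield F R" "z \<in> carrier R" "(algebraic over F) z"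
  shows "degree (Irr F z) \<ge> 1" "Irr F z \<noteq> []"
  using pirreducible_degree[OF assms(1) IrrE(1,2)[OF assms]]
    pirreducibleE(1)[OF subfieldE(1)[OF assms(1)] IrrE(1,2)[OF assms]] by auto

text \<open>The tail of the list is adjoined before its head \<open>z\<close>. The twisted minimal
  polynomial of \<open>z\<close> has as many roots as its degree, in particular one, and
  \<open>z\<close> is sent there.\<close>

lemma (in field) extend_finite:
  assumes K: "subfield K R" and F: "subfield F R" "K \<subseteq> F"
    and \<tau>: "\<tau> \<in> ring_hom (R\<lparr>carrier := F\<rparr>) R" "\<And>k. k \<in> K \<Longrightarrow> \<tau> k = k"
    and xs: "set xs \<subseteq> carrier R" "\<And>x. x \<in> set xs \<Longrightarrow> separable_over K x"
  shows "\<exists>\<tau>' \<in> ring_hom (R\<lparr>carrier := finite_extension F xs\<rparr>) R. \<forall>x\<in>F. \<tau>' x = \<tau> x"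
  using xs
proof (induction xs)
  case Nil
  thus ?case using \<tau> by auto
next
  case (Cons z xs)
  define F' where "F' = finite_extension F xs"
  obtain \<tau>1 where \<tau>1: "\<tau>1 \<in> ring_hom (R\<lparr>carrier := F'\<rparr>) R" "\<And>x. x \<in> F \<Longrightarrow> \<tau>1 x = \<tau> x"
    using Cons unfolding F'_def by auto
  have z: "z \<in> carrier R" "separable_over K z" using Cons by auto
  have F': "subfield F' R" unfolding F'_def
    using finite_extension_is_subfield[OF F(1)] Cons(2,3) algebraic_mono[OF F(2)]
    by (auto simp: separable_over_def)
  have FF': "F \<subseteq> F'" unfolding F'_def
    using finite_extension_incl subfieldE(3)[OF F(1)] Cons(2) by auto
  hence KF': "K \<subseteq> F'" using F(2) by auto
  have alg: "(algebraic over F') z"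
    using z(2) algebraic_mono[OF KF'] by (simp add: separable_over_def)
  have "card {y \<in> carrier R. eval (map \<tau>1 (Irr F' z)) y = \<zero>} = degree (Irr F' z)"
  proof (rule map_Irr_root_count[OF K F' KF' z \<tau>1(1)])
    show "\<tau>1 k = k" if "k \<in> K" for k using that \<tau>1(2) \<tau>(2) F(2) by auto
  qed
  hence "{y \<in> carrier R. eval (map \<tau>1 (Irr F' z)) y = \<zero>} \<noteq> {}"
    using Irr_degree_pos(1)[OF F' z(1) alg] by (metis card.empty not_one_le_zero)
  then obtain a where a: "a \<in> carrier R" "eval (map \<tau>1 (Irr F' z)) a = \<zero>" by auto
  obtain \<tau>' where "\<tau>' \<in> ring_hom (R\<lparr>carrier := simple_extension F' z\<rparr>) R" "\<forall>x\<in>F'. \<tau>' x = \<tau>1 x"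
    using extend_simple[OF F' \<tau>1(1) z(1) alg a] by blast
  thus ?case using \<tau>1(2) FF' F'_def by (intro bexI[of _ \<tau>']) auto
qed

lemma (in field) hom_root:
  assumes "subfield F R" "\<tau> \<in> ring_hom (R\<lparr>carrier := F\<rparr>) R" "\<And>k. k \<in> K \<Longrightarrow> \<tau> k = k"
    "K \<subseteq> F" "p \<in> carrier (K[X])" "x \<in> F"
  shows "\<tau> (eval p x) = eval p (\<tau> x)" "eval p x = \<zero> \<Longrightarrow> eval p (\<tau> x) = \<zero>"
proof -
  interpret h: ring_hom_ring "R\<lparr>carrier := F\<rparr>" R \<tau> using subfield_hom[OF assms(1,2)] .
  have setK: "set p \<subseteq> K"
    using assms(5) polynomial_incl by (simp add: univ_poly_carrier[symmetric])
  have "map \<tau> p = p" using setK assms(3) by (intro map_idI) auto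
  thus *: "\<tau> (eval p x) = eval p (\<tau> x)"
    using h.eval_hom'[of x p] setK assms(4,6) eval_consistent[OF subfieldE(1)[OF assms(1)]] by auto
  show "eval p (\<tau> x) = \<zero>" if "eval p x = \<zero>"
    using * that h.hom_zero by simp
qed

lemma (in field) Irr_conjugate:
  assumes "subfield K R" "x \<in> carrier R" "(algebraic over K) x" "y \<in> carrier R" "eval (Irr K x) y = \<zero>"
  shows "(algebraic over K) y" "Irr K y = Irr K x"
proof -
  note I = IrrE[OF assms(1-3)]
  show alg: "(algebraic over K) y"
    using algebraicI[OF I(1) _ assms(5)] Irr_degree_pos(2)[OF assms(1-3)] by blast
  show "Irr K y = Irr K x"
    using minimal_polynomial_is_unique[OF assms(1,4) alg] I assms(5) IrrE[OF assms(1,4) alg] by blast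
qed

lemma (in field) homs_eq_on_extension:
  fixes \<sigma> \<tau> :: "'a \<Rightarrow> 'a"
  assumes "subfield K R" "set xs \<subseteq> carrier R"
    "\<sigma> \<in> ring_hom (R\<lparr>carrier := finite_extension K xs\<rparr>) R" "\<tau> \<in> ring_hom (R\<lparr>carrier := finite_extension K xs\<rparr>) R"
    "\<And>k. k \<in> K \<union> set xs \<Longrightarrow> \<sigma> k = \<tau> k" "x \<in> finite_extension K xs"
  shows "\<sigma> x = \<tau> x"
proof -
  let ?F = "finite_extension K xs"
  note sK = subfieldE(1)[OF assms(1)]
  have sF: "subring ?F R" using finite_extension_is_subring[OF sK assms(2)] .
  interpret s: ring_hom_ring "R\<lparr>carrier := ?F\<rparr>" R \<sigma>
    using subring_is_ring[OF sF] assms(3) ring_axioms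
    by (simp add: ring_hom_ring_def ring_hom_ring_axioms_def)
  interpret t: ring_hom_ring "R\<lparr>carrier := ?F\<rparr>" R \<tau>
    using subring_is_ring[OF sF] assms(4) ring_axioms
    by (simp add: ring_hom_ring_def ring_hom_ring_axioms_def)
  have KF: "K \<subseteq> ?F" using finite_extension_incl subfieldE(3)[OF assms(1)] assms(2) by auto
  let ?A = "{x \<in> ?F. \<sigma> x = \<tau> x}"
  \<comment> \<open>Negation is multiplication by -1, an element of \<open>K\<close>, where the two
    maps agree.\<close>
  have neg: "\<sigma> (\<ominus> x) = \<tau> (\<ominus> x)" if "x \<in> ?F" "\<sigma> x = \<tau> x" for x
  proof -
    have x: "x \<in> carrier R" "\<ominus> x \<in> ?F" "\<one> \<in> ?F" "\<ominus> \<one> \<in> ?F"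
      using that(1) subringE(1,3,5)[OF sF] by auto
    have m: "\<ominus> \<one> \<in> K" using subringE(3,5)[OF sK] by blast
    have "\<ominus> x = (\<ominus> \<one>) \<otimes> x" using x by algebra
    thus ?thesis using s.hom_mult[of "\<ominus> \<one>" x] t.hom_mult[of "\<ominus> \<one>" x] that x m assms(5) by auto
  qed
  have "subring ?A R"
    by (rule subringI) (use sF[THEN subringE(1)] neg subringE(3,5,6,7)[OF sF] s.hom_one t.hom_one
        s.hom_mult t.hom_mult s.hom_add t.hom_add in auto)
  hence "?F \<subseteq> ?A"
    using finite_extension_subring_incl[of ?A K xs] assms(5) KF finite_extension_mem[OF sK assms(2)] by auto
  thus ?thesis using assms(6) by auto
qed


text \<open>The shape in which normality, separability and finite degree are used: a finite list of
  field generators, each separable, closed under passing to conjugates over \<open>K\<close>.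
  Endomorphisms over \<open>K\<close> then map \<open>set xs\<close> into itself.\<close>

definition (in field) root_closed_generators :: "'a set \<Rightarrow> 'a list \<Rightarrow> bool" where
  "root_closed_generators K xs \<longleftrightarrow>
     set xs \<subseteq> carrier R \<and> finite_extension K xs = carrier R \<and>
     (\<forall>z\<in>set xs. separable_over K z \<and> (\<forall>y\<in>carrier R. eval (Irr K z) y = \<zero> \<longrightarrow> y \<in> set xs))"

lemma (in field) finite_extension_upper:
  assumes "subfield K R" "subring F R" "K \<subseteq> F" "set xs \<subseteq> carrier R" "finite_extension K xs = carrier R"
  shows "finite_extension F xs = carrier R"
  using mono_finite_extension[OF assms(3), of xs] finite_extension_in_carrier[OF subringE(1)[OF assms(2)] assms(4)]
    assms(5) by blast

text \<open>An endomorphism over \<open>K\<close> is injective and maps the finite set of generators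
  into itself, hence onto itself, so its image contains all generators. The restriction only makes
  it extensional, as members of \<open>Bij\<close> are.\<close>

lemma (in field) endo_is_auto:
  fixes \<tau> :: "'a \<Rightarrow> 'a"
  assumes K: "subfield K R" and xs: "root_closed_generators K xs"
    and F: "K \<subseteq> F" and \<tau>: "\<tau> \<in> ring_hom R R" "\<And>k. k \<in> F \<Longrightarrow> \<tau> k = k" "F \<subseteq> carrier R"
  shows "restrict \<tau> (carrier R) \<in> carrier (galois_group R F)"
proof -
  note sub = xs[unfolded root_closed_generators_def]
  have cR: "R\<lparr>carrier := carrier R\<rparr> = R" by simp
  interpret h: ring_hom_ring R R \<tau>
    using \<tau>(1) ring_axioms by (simp add: ring_hom_ring_def ring_hom_ring_axioms_def)
  have inj: "inj_on \<tau> (carrier R)"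
    using subfield_hom_inj(1)[OF carrier_is_subfield] \<tau>(1) by simp
  have "\<tau> ` set xs \<subseteq> set xs"
  proof
    fix y assume "y \<in> \<tau> ` set xs"
    then obtain z where z: "z \<in> set xs" "y = \<tau> z" by auto
    hence zc: "z \<in> carrier R" "(algebraic over K) z" using sub by (auto simp: separable_over_def)
    have "eval (Irr K z) (\<tau> z) = \<zero>"
      using hom_root(2)[OF carrier_is_subfield, of \<tau> K "Irr K z" z] \<tau> F IrrE(1,4)[OF K zc] zc subfieldE(3)[OF K]
      by auto
    thus "y \<in> set xs" using sub z zc h.hom_closed by auto
  qed
  hence "\<tau> ` set xs = set xs"
    using inj sub by (meson List.finite_set endo_inj_surj inj_on_subset)
  hence "set xs \<subseteq> \<tau> ` carrier R" using sub by blast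
  moreover have "K \<subseteq> \<tau> ` carrier R" using \<tau>(2,3) F by (metis image_eqI subsetD subsetI)
  moreover have "subring (\<tau> ` carrier R) R" using h.img_is_subring[OF carrier_is_subring] .
  ultimately have "finite_extension K xs \<subseteq> \<tau> ` carrier R"
    using finite_extension_subring_incl by blast
  hence "\<tau> ` carrier R = carrier R" using sub h.hom_closed by auto
  hence "restrict \<tau> (carrier R) \<in> Bij (carrier R)"
    using inj by (simp add: Bij_def bij_betw_def inj_on_restrict_eq)
  moreover have "restrict \<tau> (carrier R) \<in> ring_hom R R"
    by (rule ring_hom_memI) auto
  ultimately show ?thesis using \<tau>(2,3) by (auto simp: galois_group_def)
qed

text \<open>Send \<open>z\<close> to \<open>a\<close> on \<open>simple_extension F z\<close>, then
  extend along \<open>xs\<close>; adjoining \<open>xs\<close> already yields the whole field, so the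
  extension is an automorphism.\<close>

lemma (in field) exists_automorphism:
  assumes K: "subfield K R" and F: "subfield F R" "K \<subseteq> F" and xs: "root_closed_generators K xs"
    and z: "z \<in> carrier R" "(algebraic over F) z" and a: "a \<in> carrier R" "eval (Irr F z) a = \<zero>"
  shows "\<exists>s \<in> carrier (galois_group R F). s z = a"
proof -
  note sub = xs[unfolded root_closed_generators_def]
  have sF: "set (Irr F z) \<subseteq> F"
    using IrrE(1)[OF F(1) z] polynomial_incl by (simp add: univ_poly_carrier[symmetric])
  have idF: "id \<in> ring_hom (R\<lparr>carrier := F\<rparr>) R"
    using subfieldE(3)[OF F(1)] by (intro ring_hom_memI) auto
  obtain \<tau>1 where \<tau>1: "\<tau>1 \<in> ring_hom (R\<lparr>carrier := simple_extension F z\<rparr>) R"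
    "\<And>x. x \<in> F \<Longrightarrow> \<tau>1 x = x" "\<tau>1 z = a"
    using extend_simple[OF F(1) idF z a(1)] a(2) by auto
  have F1: "subfield (simple_extension F z) R"
    using simple_extension_is_subfield[OF F(1) z(1)] z(2) by blast
  have FF1: "F \<subseteq> simple_extension F z"
    using simple_extension_incl[OF subfieldE(3)[OF F(1)] z(1)] .
  obtain \<tau> where \<tau>: "\<tau> \<in> ring_hom (R\<lparr>carrier := finite_extension (simple_extension F z) xs\<rparr>) R"
     "\<And>x. x \<in> simple_extension F z \<Longrightarrow> \<tau> x = \<tau>1 x"
    using extend_finite[OF K F1 _ \<tau>1(1), of xs] FF1 F(2) \<tau>1(2) sub by blast
  have "finite_extension (simple_extension F z) xs = carrier R"
    using finite_extension_upper[OF K subfieldE(1)[OF F1]] FF1 F(2) sub by blast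
  hence "\<tau> \<in> ring_hom R R" using \<tau>(1) by simp
  moreover have "\<tau> x = x" if "x \<in> F" for x using that \<tau>(2) \<tau>1(2) FF1 by auto
  ultimately have "restrict \<tau> (carrier R) \<in> carrier (galois_group R F)"
    using endo_is_auto[OF K xs F(2)] subfieldE(3)[OF F(1)] by blast
  moreover have "restrict \<tau> (carrier R) z = a"
    using z(1) \<tau>(2)[OF simple_extension_mem[OF subfieldE(1)[OF F(1)] z(1)]] \<tau>1(3) by simp
  ultimately show ?thesis by blast
qed

section \<open>The fixed field of the Galois group\<close>

lemma galois_groupD:
  assumes "s \<in> carrier (galois_group R F)"
  shows "s \<in> ring_hom R R" "\<And>x. x \<in> F \<Longrightarrow> s x = x" "s \<in> Bij (carrier R)"
  using assms by (auto simp: galois_group_def)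

text \<open>Remove one generator \<open>z\<close> at a time. Write \<open>x\<close> as a polynomial
  \<open>f\<close> in \<open>z\<close> of degree below that of the minimal polynomial over the
  smaller field \<open>F'\<close>. Automorphisms over \<open>F'\<close> carry \<open>z\<close> to
  each of its conjugates and fix \<open>x\<close>, so \<open>f - x\<close> vanishes at all of them,
  more often than its degree allows unless \<open>f\<close> is constant.\<close>

lemma (in field) fixed_field_aux:
  assumes K: "subfield K R" and F: "subfield F R" "K \<subseteq> F" and xs: "root_closed_generators K xs"
    and ys: "set ys \<subseteq> set xs" and x: "x \<in> finite_extension F ys"
    and fix_x: "\<And>s. s \<in> carrier (galois_group R F) \<Longrightarrow> s x = x"
  shows "x \<in> F"
  using ys x
proof (induction ys)
  case (Cons z ys)
  note sub = xs[unfolded root_closed_generators_def]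
  define F' where "F' = finite_extension F ys"
  have z: "z \<in> carrier R" "separable_over K z" using Cons sub by auto
  have ysc: "set ys \<subseteq> carrier R" using Cons sub by auto
  have F': "subfield F' R" unfolding F'_def
  proof (rule finite_extension_is_subfield[OF F(1) ysc])
    fix y assume "y \<in> set ys"
    thus "(algebraic over F) y"
      using Cons(2) sub algebraic_mono[OF F(2)] by (auto simp: separable_over_def)
  qed
  have FF': "F \<subseteq> F'" unfolding F'_def
    using finite_extension_incl subfieldE(3)[OF F(1)] ysc by auto
  hence KF': "K \<subseteq> F'" using F(2) by auto
  have sep: "separable_over F' z" using separable_over_mono(1)[OF K F' KF' z] .
  hence alg: "(algebraic over F') z" by (simp add: separable_over_def)
  have "x \<in> Span F' (exp_base z (degree (Irr F' z)))"
    using Cons(3) Span_exp_base[OF F' z(1) alg] by (simp add: F'_def)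
  then obtain f where f: "f \<in> carrier (F'[X])" "length f \<le> degree (Irr F' z)" "x = eval f z"
    unfolding Span_eq_eval_img[OF F' z(1)] by auto
  have sf: "set f \<subseteq> F'" using f(1) polynomial_incl by (simp add: univ_poly_carrier[symmetric])
  have xc: "x \<in> carrier R"
    using f(3) eval_in_carrier sf subfieldE(3)[OF F'] z(1) by blast
  have root: "eval f a = x" if a: "a \<in> carrier R" "eval (Irr F' z) a = \<zero>" for a
  proof -
    obtain s where s: "s \<in> carrier (galois_group R F')" "s z = a"
      using exists_automorphism[OF K F' KF' xs z(1) alg a] by blast
    have "s \<in> carrier (galois_group R F)" using s(1) FF' by (auto simp: galois_group_def)
    hence "x = s (eval f z)" using fix_x[of s] f(3) by simp
    also have "\<dots> = eval f (s z)"
      using hom_root(1)[OF carrier_is_subfield, of s F' f z] galois_groupD[OF s(1)] f(1) z(1)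
        subfieldE(3)[OF F'] by simp
    finally show ?thesis using s(2) by simp
  qed
  have "x \<in> F'"
  proof (cases f rule: rev_cases)
    case Nil
    thus ?thesis using f(3) subringE(2)[OF subfieldE(1)[OF F']] by simp
  next
    case (snoc g b)
    have gb: "set g \<subseteq> carrier R" "b \<in> carrier R" "b \<in> F'" using sf snoc subfieldE(3)[OF F'] by auto
    show ?thesis
    proof (cases g)
      case Nil
      thus ?thesis using snoc f(3) gb z(1) by simp
    next
      case (Cons c g')
      \<comment> \<open>Coefficients are listed from the leading one, so the last entry is the
        constant term and this list is \<open>f - x\<close>. Its leading coefficient
        \<open>c\<close> survives because \<open>g\<close> is nonempty.\<close>
      let ?f = "g @ [b \<ominus> x]"
      have "c \<noteq> \<zero>" using f(1) snoc Cons by (simp add: univ_poly_carrier[symmetric] polynomial_def)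
      hence fc: "?f \<in> carrier (poly_ring R)"
        using gb xc Cons by (auto simp: univ_poly_carrier[symmetric] polynomial_def)
      have ev: "eval ?f a = \<zero>" if a: "a \<in> carrier R" "eval (Irr F' z) a = \<zero>" for a
      proof -
        have e: "eval g a \<in> carrier R" using eval_in_carrier gb(1) a(1) by blast
        have "eval ?f a = eval g a \<otimes> a \<oplus> (b \<ominus> x)"
          using eval_append_aux[of g "b \<ominus> x" a] gb xc a by simp
        moreover have "x = eval g a \<otimes> a \<oplus> b"
          using eval_append_aux[of g b a] gb a root[OF a] snoc by simp
        ultimately show ?thesis using e a(1) gb(2) by algebra
      qed
      have "degree (Irr F' z) = card {y \<in> carrier R. eval (Irr F' z) y = \<zero>}"
        using sep by (simp add: separable_over_def)
      also have "\<dots> \<le> card {y \<in> carrier R. eval ?f y = \<zero>}"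
        by (rule card_mono) (use roots_finite_card(1)[OF fc] ev in auto)
      also have "\<dots> \<le> degree ?f" using roots_finite_card(2)[OF fc] by simp
      finally show ?thesis using f(2) snoc Cons by simp
    qed
  qed
  thus ?case using Cons unfolding F'_def by simp
qed simp

theorem (in field) fixed_field:
  assumes "subfield K R" "subfield F R" "K \<subseteq> F" "root_closed_generators K xs"
    and "x \<in> carrier R" "\<And>s. s \<in> carrier (galois_group R F) \<Longrightarrow> s x = x"
  shows "x \<in> F"
proof -
  note sub = assms(4)[unfolded root_closed_generators_def]
  have "x \<in> finite_extension F xs"
    using finite_extension_upper[OF assms(1) subfieldE(1)[OF assms(2)] assms(3)] sub assms(5) by simp
  thus ?thesis using fixed_field_aux[OF assms(1-4) order_refl] assms(6) by blast
qed

lemma (in field) galois_group_eqI: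
  assumes K: "subfield K R" and xs: "root_closed_generators K xs"
    and st: "s \<in> carrier (galois_group R K)" "t \<in> carrier (galois_group R K)"
    and eq: "\<And>z. z \<in> set xs \<Longrightarrow> s z = t z"
  shows "s = t"
proof -
  note sub = xs[unfolded root_closed_generators_def]
  have "s x = t x" if "x \<in> carrier R" for x
  proof (rule homs_eq_on_extension[OF K, of xs s t x])
    show "s k = t k" if "k \<in> K \<union> set xs" for k
      using that galois_groupD(2)[OF st(1)] galois_groupD(2)[OF st(2)] eq by auto
  qed (use sub galois_groupD(1)[OF st(1)] galois_groupD(1)[OF st(2)] that in simp_all)
  moreover have "s \<in> extensional (carrier R)" "t \<in> extensional (carrier R)"
    using galois_groupD(3)[OF st(1)] galois_groupD(3)[OF st(2)] by (auto simp: Bij_def)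
  ultimately show ?thesis by (rule extensionalityI[rotated 2])
qed

text \<open>An automorphism maps the finite \<open>set xs\<close> into itself and is determined by
  its values there.\<close>

lemma (in field) finite_galois_group:
  assumes K: "subfield K R" and xs: "root_closed_generators K xs"
  shows "finite (carrier (galois_group R K))"
proof (rule inj_on_finite)
  note sub = xs[unfolded root_closed_generators_def]
  show "inj_on (\<lambda>s. restrict s (set xs)) (carrier (galois_group R K))"
    by (rule inj_onI, rule galois_group_eqI[OF K xs]) (auto simp: restrict_def fun_eq_iff, metis)
  show "(\<lambda>s. restrict s (set xs)) ` carrier (galois_group R K) \<subseteq> set xs \<rightarrow>\<^sub>E set xs"
  proof clarify
    fix s assume s: "s \<in> carrier (galois_group R K)"
    have "s z \<in> set xs" if z: "z \<in> set xs" for z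
    proof -
      have zc: "z \<in> carrier R" "(algebraic over K) z" using sub z by (auto simp: separable_over_def)
      have "eval (Irr K z) (s z) = \<zero>"
        using hom_root(2)[OF carrier_is_subfield, of s K "Irr K z" z] galois_groupD[OF s]
          IrrE(1,4)[OF K zc] zc subfieldE(3)[OF K] by auto
      moreover have "s z \<in> carrier R" using ring_hom_memE(1)[OF galois_groupD(1)[OF s]] zc by auto
      ultimately show ?thesis using sub z by blast
    qed
    thus "restrict s (set xs) \<in> set xs \<rightarrow>\<^sub>E set xs" by auto
  qed
  show "finite (set xs \<rightarrow>\<^sub>E set xs)" by (simp add: finite_PiE)
qed


section \<open>Field generators of a normal closure\<close>

lemma (in field) splitted_descends:
  assumes K: "subfield K R" and M: "subfield M R" "K \<subseteq> M" and p: "p \<in> carrier (K[X])" "p \<noteq> []"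
    and spl: "splitted p" and roots: "\<And>y. y \<in> carrier R \<Longrightarrow> eval p y = \<zero> \<Longrightarrow> y \<in> M"
  shows "ring.splitted (R\<lparr>carrier := M\<rparr>) p"
proof -
  let ?A = "R\<lparr>carrier := M\<rparr>"
  note sM = subfieldE(1)[OF M(1)]
  interpret A: field ?A using subfield_iff(2)[OF M(1)] .
  have up: "carrier (poly_ring ?A) = carrier (M[X])"
    using univ_poly_consistent[OF sM] by simp
  have pM: "p \<in> carrier (M[X])"
    using p(1) M(2) unfolding univ_poly_def polynomial_def by auto
  have pR: "p \<in> carrier (poly_ring R)" using pM carrier_polynomial_shell[OF sM] by auto
  show ?thesis
  proof (rule A.trivial_factors_imp_splitted)
    show "p \<in> carrier (poly_ring ?A)" using pM up by simp
    fix q assume q: "q \<in> carrier (poly_ring ?A)" "pirreducible\<^bsub>?A\<^esub> (carrier ?A) q" "q pdivides\<^bsub>?A\<^esub> p"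
    have qM: "q \<in> carrier (M[X])" using q(1) up by simp
    have qR: "q \<in> carrier (poly_ring R)" using qM carrier_polynomial_shell[OF sM] by auto
    have "q divides\<^bsub>M[X]\<^esub> p"
      using q(3) univ_poly_consistent[OF sM] by (simp add: pdivides_def)
    hence qp: "q pdivides p" using pdivides_iff_shell[OF M(1) qM pM] by simp
    \<comment> \<open>An irreducible factor over \<open>M\<close> splits over the large field, so it
      has a root there; being a root of \<open>p\<close>, that root lies in \<open>M\<close>, and an
      irreducible polynomial with a root in its base field is linear.\<close>
    hence "splitted q" using pdivides_imp_splitted[OF qR pR p(2) spl] by blast
    have deg: "degree q \<ge> 1" "q \<noteq> []"
      using A.pirreducible_degree[OF A.carrier_is_subfield q(1,2)]
        A.pirreducibleE(1)[OF A.carrier_is_subring q(1,2)] by auto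
    hence "roots q \<noteq> {#}" using \<open>splitted q\<close> by (auto simp: splitted_def)
    then obtain a where a: "a \<in># roots q" by blast
    hence ar: "a \<in> carrier R" "eval q a = \<zero>"
      using roots_mem_iff_is_root[OF qR] by (auto simp: is_root_def)
    hence "eval p a = \<zero>" using pdivides_imp_root_sharing[OF qR qp] by auto
    hence "a \<in> M" using roots ar by blast
    hence "A.is_root q a" using ar deg eval_consistent[OF sM] by (simp add: A.is_root_def)
    hence "a \<in># A.roots q" using A.roots_mem_iff_is_root[OF q(1)] by simp
    thus "degree q \<le> 1" using A.pirreducible_roots[OF q(1,2)]
      by (cases "degree q = 1") auto
  qed
qed

text \<open>The generators are all conjugates of a spanning list of \<open>L\<close> over
  \<open>K\<close>. The field \<open>M\<close> they generate contains \<open>L\<close>; once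
  \<open>M\<close> is shown normal over \<open>K\<close>, minimality of the normal closure makes it
  everything. For normality, an embedding taking one root \<open>x\<close> of \<open>p\<close> in
  \<open>M\<close> to another root \<open>y\<close> is extended to a field containing
  \<open>M\<close>; it maps \<open>M\<close> into itself because it preserves \<open>set xs\<close>,
  so \<open>y\<close> lies in \<open>M\<close>.\<close>

theorem (in field) normal_closure_generators:
  assumes K: "subfield K R" and L: "subfield L R" "K \<subseteq> L" and dim: "dimension n K L"
    and sep: "separable_extension R K L" and nc: "normal_closure R K L"
  shows "\<exists>xs. root_closed_generators K xs \<and> (\<forall>z\<in>set xs. \<exists>u\<in>L. eval (Irr K u) z = \<zero>)"
proof -
  note sK = subfieldE(1)[OF K]
  have LR: "L \<subseteq> carrier R" using subfieldE(3)[OF L(1)] .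
  have algL: "(algebraic over K) u" "separable_over K u" if "u \<in> L" for u
    using sep that by (simp_all add: separable_extension_def separable_over_def)
  obtain Us where Us: "set Us \<subseteq> carrier R" "Span K Us = L" using exists_base[OF K dim] by blast
  have UsL: "set Us \<subseteq> L" using Span_base_incl[OF K Us(1)] Us(2) by simp
  let ?Z = "{z \<in> carrier R. \<exists>u\<in>set Us. eval (Irr K u) z = \<zero>}"
  have "finite ?Z"
  proof -
    have "?Z = (\<Union>u\<in>set Us. {z \<in> carrier R. eval (Irr K u) z = \<zero>})" by auto
    moreover have "finite {z \<in> carrier R. eval (Irr K u) z = \<zero>}" if "u \<in> set Us" for u
    proof -
      have u: "u \<in> carrier R" "(algebraic over K) u" using that UsL LR algL by auto
      show ?thesis
        using roots_finite_card(1)[of "Irr K u"] IrrE(1)[OF K u] Irr_degree_pos(2)[OF K u]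
          carrier_polynomial_shell[OF sK] by auto
    qed
    ultimately show ?thesis by simp
  qed
  then obtain xs where xs: "set xs = ?Z" using finite_list by blast
  have xsR: "set xs \<subseteq> carrier R" using xs by auto
  have xsep: "separable_over K z" and xcl: "\<forall>y\<in>carrier R. eval (Irr K z) y = \<zero> \<longrightarrow> y \<in> set xs"
    if z: "z \<in> set xs" for z
  proof -
    obtain u where u: "u \<in> set Us" "eval (Irr K u) z = \<zero>" "z \<in> carrier R" using z xs by auto
    have uL: "u \<in> carrier R" "(algebraic over K) u" "separable_over K u" using u(1) UsL LR algL by auto
    note C = Irr_conjugate[OF K uL(1,2) u(3,2)]
    show "separable_over K z" using C uL(3) by (simp add: separable_over_def)
    show "\<forall>y\<in>carrier R. eval (Irr K z) y = \<zero> \<longrightarrow> y \<in> set xs"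
      unfolding C(2) xs using u(1) by blast
  qed
  have xalg: "(algebraic over K) z" if "z \<in> set xs" for z
    using xsep[OF that] by (simp add: separable_over_def)
  define M where "M = finite_extension K xs"
  have M: "subfield M R" unfolding M_def
    by (rule finite_extension_is_subfield[OF K xsR]) (rule xalg)
  note sM = subfieldE(1)[OF M]
  have KM: "K \<subseteq> M" unfolding M_def using finite_extension_incl[OF subringE(1)[OF sK] xsR] .
  have xsM: "set xs \<subseteq> M" unfolding M_def using finite_extension_mem[OF sK xsR] .
  have "set Us \<subseteq> set xs"
  proof
    fix u assume u: "u \<in> set Us"
    have uL: "u \<in> carrier R" "(algebraic over K) u" using u UsL LR algL by auto
    show "u \<in> set xs" unfolding xs using u uL(1) IrrE(4)[OF K uL] by blast
  qed
  hence UsM: "set Us \<subseteq> M" using xsM by blast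
  have comb: "set Ks \<subseteq> K \<Longrightarrow> set Vs \<subseteq> M \<Longrightarrow> combine Ks Vs \<in> M" for Ks Vs
  proof (induction Ks Vs rule: combine.induct)
    case (1 k Ks u Us)
    thus ?case using KM subringE(6,7)[OF sM] by auto
  qed (use subringE(2)[OF sM] in simp_all)
  have LM: "L \<subseteq> M"
    using comb UsM unfolding Us(2)[symmetric] Span_eq_combine_set[OF K Us(1)] by auto
  have normE: "normal_extension R K (carrier R)" using nc by (simp add: normal_closure_def)
  have "normal_extension R K M"
    unfolding normal_extension_def
  proof (intro conjI ballI impI)
    fix x assume "x \<in> M"
    thus "(algebraic over K) x"
      unfolding M_def by (rule finite_extesion_mem_imp_algebraic[OF K xsR, rotated]) (rule xalg)
  next
    fix p assume p: "p \<in> carrier (K[X])" and "pirreducible K p \<and> (\<exists>x\<in>M. eval p x = \<zero>)"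
    then obtain x where irr: "pirreducible K p" and x: "x \<in> M" "eval p x = \<zero>" by blast
    have pne: "p \<noteq> []" using pirreducibleE(1)[OF sK p irr] by auto
    have xR: "x \<in> carrier R" using x subfieldE(3)[OF M] by auto
    have xa: "(algebraic over K) x" using algebraicI[OF p pne x(2)] .
    have "splitted p"
    proof -
      have "ring.splitted (R\<lparr>carrier := carrier R\<rparr>) p"
        using normE p irr x(2) xR unfolding normal_extension_def by blast
      thus ?thesis by simp
    qed
    moreover have "y \<in> M" if y: "y \<in> carrier R" "eval p y = \<zero>" for y
    proof -
      note I = IrrE[OF K xR xa]
      have ya: "(algebraic over K) y" using algebraicI[OF p pne y(2)] .
      note J = IrrE[OF K y(1) ya]
      interpret UP: principal_domain "K[X]" using univ_poly_is_principal[OF K] .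
      \<comment> \<open>Irreducibility of \<open>p\<close> makes \<open>Irr K x\<close> associated
        to it, so \<open>y\<close> is also a root of \<open>Irr K x\<close> and \<open>x\<close> can
        be sent to \<open>y\<close>.\<close>
      have "Irr K x divides\<^bsub>K[X]\<^esub> p" "Irr K y divides\<^bsub>K[X]\<^esub> p"
        using Irr_minimal[OF K xR xa p x(2)] Irr_minimal[OF K y(1) ya p y(2)]
          pdivides_iff_shell[OF K I(1) p] pdivides_iff_shell[OF K J(1) p] by auto
      moreover have "Irr K x \<notin> Units (K[X])"
        using pirreducibleE(2)[OF sK I(1,2)] .
      ultimately have "Irr K x \<sim>\<^bsub>K[X]\<^esub> p"
        using divides_pirreducible_condition[OF irr I(1)] by auto
      hence "p divides\<^bsub>K[X]\<^esub> Irr K x" by (simp add: associated_def)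
      then obtain r where r: "r \<in> carrier (K[X])" "Irr K x = poly_mult p r"
        unfolding factor_def univ_poly_mult by blast
      have sR: "set q \<subseteq> carrier R" if "q \<in> carrier (K[X])" for q
        using that polynomial_incl subfieldE(3)[OF K] by (fastforce simp: univ_poly_carrier[symmetric])
      have "eval (Irr K x) y = \<zero>"
        using r(2) eval_poly_mult[OF sR[OF p] sR[OF r(1)] y(1)] y(2) eval_in_carrier[OF sR[OF r(1)] y(1)]
        by simp
      moreover have "id \<in> ring_hom (R\<lparr>carrier := K\<rparr>) R"
        using subfieldE(3)[OF K] by (intro ring_hom_memI) auto
      ultimately obtain t where t: "t \<in> ring_hom (R\<lparr>carrier := simple_extension K x\<rparr>) R"
         "\<forall>k\<in>K. t k = k" "t x = y"
        using extend_simple[OF K _ xR xa y(1), of id] by auto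
      have S: "subfield (simple_extension K x) R"
        using simple_extension_is_subfield[OF K xR] xa by blast
      have KS: "K \<subseteq> simple_extension K x" using simple_extension_incl[OF subfieldE(3)[OF K] xR] .
      have xS: "x \<in> simple_extension K x" using simple_extension_mem[OF sK xR] .
      \<comment> \<open>The embedding starts on \<open>simple_extension K x\<close>, so
        \<open>xs\<close> is adjoined to that field; the result contains \<open>M\<close>.\<close>
      let ?F = "finite_extension (simple_extension K x) xs"
      obtain t' where t': "t' \<in> ring_hom (R\<lparr>carrier := ?F\<rparr>) R" "\<forall>k\<in>simple_extension K x. t' k = t k"
        using extend_finite[OF K S KS t(1) _ xsR xsep] t(2) by blast
      have sF: "subfield ?F R"
      proof (rule finite_extension_is_subfield[OF S xsR])
        show "(algebraic over (simple_extension K x)) z" if "z \<in> set xs" for z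
          using algebraic_mono[OF KS xalg[OF that]] .
      qed
      have MF: "M \<subseteq> ?F" unfolding M_def using mono_finite_extension[OF KS] .
      have KF: "K \<subseteq> ?F" using KM MF by blast
      have t'K: "t' k = k" if "k \<in> K" for k using that t'(2) t(2) KS by auto
      interpret h: ring_hom_ring "R\<lparr>carrier := ?F\<rparr>" R t' using subfield_hom[OF sF t'(1)] .
      have t'xs: "t' z \<in> set xs" if z: "z \<in> set xs" for z
      proof -
        have zc: "z \<in> carrier R" using z xsR by auto
        have zF: "z \<in> ?F" using z xsM MF by auto
        have "eval (Irr K z) (t' z) = \<zero>"
          using hom_root(2)[OF sF t'(1) _ KF IrrE(1)[OF K zc xalg[OF z]] zF IrrE(4)[OF K zc xalg[OF z]]] t'K by blast
        moreover have "t' z \<in> carrier R" using h.hom_closed zF by simp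
        ultimately show ?thesis using xcl[OF z] by blast
      qed
      have "finite_extension K xs \<subseteq> {m \<in> ?F. t' m \<in> M}"
      proof (rule finite_extension_subring_incl)
        show "K \<subseteq> {m \<in> ?F. t' m \<in> M}" using KF KM t'K by auto
        show "set xs \<subseteq> {m \<in> ?F. t' m \<in> M}" using xsM MF t'xs by auto
        have neg: "t' (\<ominus> m) \<in> M" if m: "m \<in> ?F" "t' m \<in> M" for m
        proof -
          have c: "m \<in> carrier R" "\<ominus> \<one> \<in> K" "t' m \<in> carrier R"
            using m subfieldE(3)[OF sF] subringE(3,5)[OF sK] subfieldE(3)[OF M] by auto
          have "\<ominus> m = (\<ominus> \<one>) \<otimes> m" using c(1) by algebra
          hence "t' (\<ominus> m) = (\<ominus> \<one>) \<otimes> t' m"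
            using h.hom_mult[of "\<ominus> \<one>" m] m(1) c(2) KF t'K[OF c(2)] by auto
          thus ?thesis using c KM subringE(6)[OF sM _ m(2), of "\<ominus> \<one>"] by auto
        qed
        show "subring {m \<in> ?F. t' m \<in> M} R"
          by (rule subringI) (use subfieldE(3)[OF sF] neg subringE(3,5,6,7)[OF subfieldE(1)[OF sF]]
              h.hom_one h.hom_mult h.hom_add subringE(3,6,7)[OF sM] in auto)
      qed
      hence "t' x \<in> M" using x(1) unfolding M_def by blast
      thus "y \<in> M" using t'(2) xS t(3) by simp
    qed
    ultimately show "ring.splitted (R\<lparr>carrier := M\<rparr>) p"
      using splitted_descends[OF K M KM p pne] by blast
  qed
  hence "M = carrier R" using nc M LM by (auto simp: normal_closure_def)
  hence "root_closed_generators K xs"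
    using xsR xsep xcl unfolding root_closed_generators_def M_def by blast
  moreover have "\<exists>u\<in>L. eval (Irr K u) z = \<zero>" if "z \<in> set xs" for z
    using that xs UsL by auto
  ultimately show ?thesis by blast
qed

text \<open>Every generator is a conjugate \<open>h u\<close> of some \<open>u\<close> in
  \<open>L\<close>. In terms of cosets of \<open>Gal(E/L)\<close> this says that the coset action is
  faithful.\<close>

lemma (in field) galois_group_faithful:
  assumes K: "subfield K R" and L: "subfield L R" "\<And>u. u \<in> L \<Longrightarrow> (algebraic over K) u"
    and xs: "root_closed_generators K xs" "\<And>z. z \<in> set xs \<Longrightarrow> \<exists>u\<in>L. eval (Irr K u) z = \<zero>"
    and st: "s \<in> carrier (galois_group R K)" "t \<in> carrier (galois_group R K)"
    and eq: "\<And>h u. h \<in> carrier (galois_group R K) \<Longrightarrow> u \<in> L \<Longrightarrow> s (h u) = t (h u)"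
  shows "s = t"
proof (rule galois_group_eqI[OF K xs(1) st])
  fix z assume z: "z \<in> set xs"
  then obtain u where u: "u \<in> L" "eval (Irr K u) z = \<zero>" using xs(2) by blast
  have "z \<in> carrier R" using z xs(1) by (auto simp: root_closed_generators_def)
  moreover have "u \<in> carrier R" using u(1) subfieldE(3)[OF L(1)] by auto
  ultimately obtain h where "h \<in> carrier (galois_group R K)" "h u = z"
    using exists_automorphism[OF K K order_refl xs(1) _ L(2)[OF u(1)] _ u(2)] by blast
  thus "s z = t z" using eq u(1) by blast
qed


section \<open>List sums\<close>

lemma list_sum_Nil [simp]: "list_sum A f [] = \<zero>\<^bsub>A\<^esub>"
  by (simp add: list_sum_def)

lemma list_sum_Cons [simp]: "list_sum A f (x # xs) = f x \<oplus>\<^bsub>A\<^esub> list_sum A f xs"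
  by (simp add: list_sum_def)

lemma list_sum_map [simp]: "list_sum A f (map h xs) = list_sum A (\<lambda>x. f (h x)) xs"
  by (induction xs) auto

lemma list_sum_carrier_update [simp]: "list_sum (A\<lparr>carrier := B\<rparr>) f xs = list_sum A f xs"
  by (induction xs) auto

lemma list_sum_cong:
  "xs = ys \<Longrightarrow> (\<And>x. x \<in> set ys \<Longrightarrow> f x = g x) \<Longrightarrow> list_sum A f xs = list_sum A g ys"
  by (induction ys arbitrary: xs) auto

lemma (in abelian_monoid) list_sum_closed [simp, intro]:
  "(\<And>x. x \<in> set xs \<Longrightarrow> f x \<in> carrier G) \<Longrightarrow> list_sum G f xs \<in> carrier G"
  by (induction xs) auto

lemma (in abelian_monoid) list_sum_append:
  assumes "\<And>x. x \<in> set xs \<union> set ys \<Longrightarrow> f x \<in> carrier G"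
  shows "list_sum G f (xs @ ys) = list_sum G f xs \<oplus> list_sum G f ys"
  using assms by (induction xs) (auto simp: a_assoc)

lemma (in abelian_monoid) list_sum_concat:
  assumes "\<And>xs x. xs \<in> set xss \<Longrightarrow> x \<in> set xs \<Longrightarrow> f x \<in> carrier G"
  shows "list_sum G f (concat xss) = list_sum G (list_sum G f) xss"
  using assms
proof (induction xss)
  case (Cons xs xss)
  have "list_sum G f (xs @ concat xss) = list_sum G f xs \<oplus> list_sum G f (concat xss)"
    by (rule list_sum_append) (use Cons.prems in auto)
  moreover have "list_sum G f (concat xss) = list_sum G (list_sum G f) xss"
    by (rule Cons.IH) (use Cons.prems in auto)
  ultimately show ?case by simp
qed simp

lemma (in abelian_monoid) list_sum_zero [simp]: "list_sum G (\<lambda>x. \<zero>) xs = \<zero>"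
  by (induction xs) auto

lemma (in abelian_monoid) list_sum_zero':
  "(\<And>x. x \<in> set xs \<Longrightarrow> f x = \<zero>) \<Longrightarrow> list_sum G f xs = \<zero>"
  by (induction xs) auto

lemma (in abelian_monoid) list_sum_add:
  assumes "\<And>x. x \<in> set xs \<Longrightarrow> f x \<in> carrier G" "\<And>x. x \<in> set xs \<Longrightarrow> g x \<in> carrier G"
  shows "list_sum G (\<lambda>x. f x \<oplus> g x) xs = list_sum G f xs \<oplus> list_sum G g xs"
  using assms by (induction xs) (auto simp: a_ac)

lemma (in abelian_monoid) list_sum_swap:
  assumes "\<And>x y. x \<in> set xs \<Longrightarrow> y \<in> set ys \<Longrightarrow> f x y \<in> carrier G"
  shows "list_sum G (\<lambda>x. list_sum G (f x) ys) xs = list_sum G (\<lambda>y. list_sum G (\<lambda>x. f x y) xs) ys"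
  using assms by (induction xs) (auto simp: list_sum_add)

lemma (in abelian_monoid) finsum_list_sum:
  assumes "distinct xs" "\<And>x. x \<in> set xs \<Longrightarrow> f x \<in> carrier G"
  shows "finsum G f (set xs) = list_sum G f xs"
  using assms by (induction xs) (auto simp: finsum_insert Pi_def)

lemma (in abelian_monoid) list_sum_delta:
  assumes "distinct xs" "a \<in> set xs" "f a \<in> carrier G"
  shows "list_sum G (\<lambda>x. if x = a then f x else \<zero>) xs = f a"
    and "list_sum G (\<lambda>x. if a = x then f x else \<zero>) xs = f a"
proof -
  show *: "list_sum G (\<lambda>x. if x = a then f x else \<zero>) xs = f a"
    using assms
  proof (induction xs)
    case (Cons y xs)
    show ?case
    proof (cases "y = a")
      case True
      hence "list_sum G (\<lambda>x. if x = a then f x else \<zero>) xs = list_sum G (\<lambda>x. \<zero>) xs"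
        using Cons by (intro list_sum_cong) auto
      thus ?thesis using True Cons by simp
    qed (use Cons in simp)
  qed simp
  thus "list_sum G (\<lambda>x. if a = x then f x else \<zero>) xs = f a"
    by (simp add: eq_commute[of a])
qed

lemma (in abelian_monoid) list_sum_reindex:
  assumes "distinct xs" "distinct ys" "bij_betw h (set xs) (set ys)"
    "\<And>y. y \<in> set ys \<Longrightarrow> f y \<in> carrier G"
  shows "list_sum G f ys = list_sum G (\<lambda>x. f (h x)) xs"
proof -
  have h: "inj_on h (set xs)" "h ` set xs = set ys" using assms(3) by (auto simp: bij_betw_def)
  have "list_sum G f ys = finsum G f (h ` set xs)"
    using finsum_list_sum[OF assms(2), of f] assms(4) h by simp
  also have "\<dots> = finsum G (\<lambda>x. f (h x)) (set xs)"
    by (rule finsum_reindex) (use h assms(4) in auto)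
  also have "\<dots> = list_sum G (\<lambda>x. f (h x)) xs"
    using finsum_list_sum[OF assms(1), of "\<lambda>x. f (h x)"] assms(4) h by auto
  finally show ?thesis .
qed

lemma (in semiring) list_sum_rdistr:
  assumes "c \<in> carrier R" "\<And>x. x \<in> set xs \<Longrightarrow> f x \<in> carrier R"
  shows "c \<otimes> list_sum R f xs = list_sum R (\<lambda>x. c \<otimes> f x) xs"
  using assms by (induction xs) (auto simp: r_distr)

lemma (in semiring) list_sum_ldistr:
  assumes "c \<in> carrier R" "\<And>x. x \<in> set xs \<Longrightarrow> f x \<in> carrier R"
  shows "list_sum R f xs \<otimes> c = list_sum R (\<lambda>x. f x \<otimes> c) xs"
  using assms by (induction xs) (auto simp: l_distr)

lemma (in semiring) list_sum_product:
  assumes "\<And>x. x \<in> set xs \<Longrightarrow> f x \<in> carrier R" "\<And>x. x \<in> set ys \<Longrightarrow> g x \<in> carrier R"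
  shows "list_sum R f xs \<otimes> list_sum R g ys = list_sum R (\<lambda>x. list_sum R (\<lambda>y. f x \<otimes> g y) ys) xs"
proof -
  have "list_sum R f xs \<otimes> list_sum R g ys = list_sum R (\<lambda>x. f x \<otimes> list_sum R g ys) xs"
    using assms by (intro list_sum_ldistr) auto
  also have "\<dots> = list_sum R (\<lambda>x. list_sum R (\<lambda>y. f x \<otimes> g y) ys) xs"
    using assms by (intro list_sum_cong refl list_sum_rdistr) auto
  finally show ?thesis .
qed

lemma (in ring_hom_ring) hom_list_sum:
  assumes "\<And>x. x \<in> set xs \<Longrightarrow> f x \<in> carrier R"
  shows "h (list_sum R f xs) = list_sum S (\<lambda>x. h (f x)) xs"
  using assms by (induction xs) auto


section \<open>Galois coordinates\<close>

text \<open>The Galois theoretic input of the later sections. The last assumption says that only the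
  identity fixes every conjugate of \<open>L\<close>; this is what remains of the minimality of the
  normal closure.\<close>

locale galois_extension = field E for E :: "('e, 'm) ring_scheme" (structure) +
  fixes K L :: "'e set"
  assumes K: "subfield K E" and L: "subfield L E" and KL: "K \<subseteq> L"
    and finite_G: "finite (carrier (galois_group E K))"
    and fixed_K: "\<lbrakk>x \<in> carrier E; \<And>s. s \<in> carrier (galois_group E K) \<Longrightarrow> s x = x\<rbrakk> \<Longrightarrow> x \<in> K"
    and fixed_L: "\<lbrakk>x \<in> carrier E; \<And>s. s \<in> carrier (galois_group E L) \<Longrightarrow> s x = x\<rbrakk> \<Longrightarrow> x \<in> L"
    and faithful: "\<lbrakk>s \<in> carrier (galois_group E K);
        \<And>h u. h \<in> carrier (galois_group E K) \<Longrightarrow> u \<in> L \<Longrightarrow> s (h u) = h u\<rbrakk> \<Longrightarrow> s = \<one>\<^bsub>galois_group E K\<^esub>"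

lemma subgroup_galois:
  assumes "field E" "F \<subseteq> carrier E"
  shows "subgroup (carrier (galois_group E F)) (BijGroup (carrier E))"
proof -
  interpret E: field E by fact
  let ?B = "BijGroup (carrier E)"
  interpret B: group ?B by (rule group_BijGroup)
  show ?thesis
  proof (rule B.subgroupI)
    show "carrier (galois_group E F) \<subseteq> carrier ?B" by (auto simp: galois_group_def BijGroup_def)
    have "(\<lambda>x\<in>carrier E. x) \<in> carrier (galois_group E F)"
      using assms id_Bij[of "carrier E"] by (auto simp: galois_group_def intro!: ring_hom_memI)
    thus "carrier (galois_group E F) \<noteq> {}" by blast
  next
    fix a assume a: "a \<in> carrier (galois_group E F)"
    have aB: "a \<in> Bij (carrier E)" and ah: "a \<in> ring_hom E E" and aF: "\<And>x. x \<in> F \<Longrightarrow> a x = x"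
      using a by (auto simp: galois_group_def)
    have bij: "bij_betw a (carrier E) (carrier E)" using aB by (simp add: Bij_def)
    note h = ring_hom_memE[OF ah]
    have eq: "inv\<^bsub>?B\<^esub> a = restrict (inv_into (carrier E) a) (carrier E)" using inv_BijGroup[OF aB] .
    have i: "inv_into (carrier E) a y \<in> carrier E" "a (inv_into (carrier E) a y) = y" if "y \<in> carrier E" for y
      using bij that by (auto simp: bij_betw_def inv_into_into f_inv_into_f)
    have u: "inv_into (carrier E) a y = x" if "x \<in> carrier E" "a x = y" for x y
      using bij that by (auto simp: bij_betw_def)
    have "inv_into (carrier E) a x = x" if "x \<in> F" for x using u that aF assms(2) by auto
    moreover have "restrict (inv_into (carrier E) a) (carrier E) \<in> ring_hom E E"
      by (rule ring_hom_memI) (use i in \<open>auto intro!: u simp: h\<close>)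
    ultimately show "inv\<^bsub>?B\<^esub> a \<in> carrier (galois_group E F)"
      unfolding eq using restrict_inv_into_Bij[OF aB] assms(2) by (auto simp: galois_group_def)
  next
    fix a b assume ab: "a \<in> carrier (galois_group E F)" "b \<in> carrier (galois_group E F)"
    have aB: "a \<in> Bij (carrier E)" "b \<in> Bij (carrier E)" and ah: "a \<in> ring_hom E E" "b \<in> ring_hom E E"
      using ab by (auto simp: galois_group_def)
    have "compose (carrier E) a b \<in> ring_hom E E"
      using ring_hom_memE[OF ah(1)] ring_hom_memE[OF ah(2)]
      by (intro ring_hom_memI) (auto simp: compose_eq)
    thus "a \<otimes>\<^bsub>?B\<^esub> b \<in> carrier (galois_group E F)"
      using ab compose_Bij[OF aB] assms(2)
      by (auto simp: galois_group_def BijGroup_def compose_eq subset_iff)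
  qed
qed

context galois_extension
begin

abbreviation "G \<equiv> galois_group E K"
abbreviation "B \<equiv> carrier (galois_group E L)"

lemma group_G: "group G"
  using subgroup.subgroup_is_group[OF subgroup_galois[OF field_axioms subfieldE(3)[OF K]] group_BijGroup]
  by (simp add: galois_group_def)

sublocale G: group G by (rule group_G)

lemma G_mult: "a \<in> carrier G \<Longrightarrow> b \<in> carrier G \<Longrightarrow> x \<in> carrier E \<Longrightarrow> (a \<otimes>\<^bsub>G\<^esub> b) x = a (b x)"
  by (simp add: galois_group_def BijGroup_def compose_eq)

lemma G_one: "x \<in> carrier E \<Longrightarrow> \<one>\<^bsub>G\<^esub> x = x"
  by (simp add: galois_group_def BijGroup_def)

lemma G_ring_hom: "g \<in> carrier G \<Longrightarrow> ring_hom_ring E E g"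
  using galois_groupD(1)[of g E K] ring_axioms by (simp add: ring_hom_ring_def ring_hom_ring_axioms_def)

lemma G_closed [simp]: "g \<in> carrier G \<Longrightarrow> x \<in> carrier E \<Longrightarrow> g x \<in> carrier E"
  by (rule ring_hom_memE(1)[OF galois_groupD(1)])

lemma G_K: "g \<in> carrier G \<Longrightarrow> x \<in> K \<Longrightarrow> g x = x"
  by (rule galois_groupD(2))

lemmas K_carrier [simp, intro] = subsetD[OF subfieldE(3)[OF K]]
lemmas L_carrier [simp, intro] = subsetD[OF subfieldE(3)[OF L]]

lemma G_hom [simp]:
  assumes "g \<in> carrier G"
  shows "x \<in> carrier E \<Longrightarrow> y \<in> carrier E \<Longrightarrow> g (x \<otimes> y) = g x \<otimes> g y"
    "x \<in> carrier E \<Longrightarrow> y \<in> carrier E \<Longrightarrow> g (x \<oplus> y) = g x \<oplus> g y"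
    "g \<one> = \<one>" "g \<zero> = \<zero>"
proof -
  interpret h: ring_hom_ring E E g using G_ring_hom[OF assms] .
  show "x \<in> carrier E \<Longrightarrow> y \<in> carrier E \<Longrightarrow> g (x \<otimes> y) = g x \<otimes> g y"
    "x \<in> carrier E \<Longrightarrow> y \<in> carrier E \<Longrightarrow> g (x \<oplus> y) = g x \<oplus> g y"
    "g \<one> = \<one>" "g \<zero> = \<zero>" by auto
qed

lemma G_list_sum:
  "g \<in> carrier G \<Longrightarrow> (\<And>x. x \<in> set xs \<Longrightarrow> f x \<in> carrier E) \<Longrightarrow> g (list_sum E f xs) = list_sum E (\<lambda>x. g (f x)) xs"
  by (rule ring_hom_ring.hom_list_sum[OF G_ring_hom])

text \<open>For one \<open>g\<close> other than the identity, an element \<open>c\<close> moved by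
  \<open>g\<close> gives the form \<open>h \<mapsto> w (h c - g c)\<close>, which is 1 at the
  identity and 0 at \<open>g\<close>. Forms multiply when their tensors do, so the product over
  \<open>A\<close> vanishes on \<open>A\<close> and is still 1 at the identity.\<close>

lemma coordinates_aux:
  assumes "finite A" "A \<subseteq> carrier G - {\<one>\<^bsub>G\<^esub>}"
  shows "\<exists>ps. set ps \<subseteq> carrier E \<times> carrier E \<and> list_sum E (\<lambda>(e, f). e \<otimes> f) ps = \<one> \<and>
           (\<forall>g\<in>A. list_sum E (\<lambda>(e, f). e \<otimes> g f) ps = \<zero>)"
  using assms
proof (induction A rule: finite_induct)
  case empty
  show ?case by (intro exI[of _ "[(\<one>, \<one>)]"]) auto
next
  case (insert g A)
  then obtain ps where ps: "set ps \<subseteq> carrier E \<times> carrier E" "list_sum E (\<lambda>(e, f). e \<otimes> f) ps = \<one>"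
     "\<And>h. h \<in> A \<Longrightarrow> list_sum E (\<lambda>(e, f). e \<otimes> h f) ps = \<zero>" by auto
  have g: "g \<in> carrier G" "g \<noteq> \<one>\<^bsub>G\<^esub>" using insert by auto
  obtain c where c: "c \<in> carrier E" "g c \<noteq> c"
  proof (rule ccontr)
    assume "\<not> thesis"
    hence *: "\<And>c. c \<in> carrier E \<Longrightarrow> g c = c" using that by blast
    have "g = \<one>\<^bsub>G\<^esub>"
    proof (rule extensionalityI[of _ "carrier E"])
      show "g \<in> extensional (carrier E)" "\<one>\<^bsub>G\<^esub> \<in> extensional (carrier E)"
        using galois_groupD(3)[OF g(1)] galois_groupD(3)[OF G.one_closed] by (auto simp: Bij_def)
    qed (simp add: * G_one)
    thus False using g by simp
  qed
  define w where "w = inv (c \<ominus> g c)"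
  have gc: "g c \<in> carrier E" using c g by auto
  have "c \<ominus> g c \<noteq> \<zero>" using c gc by auto
  hence w: "w \<in> carrier E" "w \<otimes> (c \<ominus> g c) = \<one>"
    using c gc field_Units by (auto simp: w_def)
  \<comment> \<open>The tensor \<open>w \<otimes> c - w g(c) \<otimes> 1\<close>; the factor
    \<open>w\<close> makes its value at the identity 1.\<close>
  define qs where "qs = [(w, c), (\<ominus> (w \<otimes> g c), \<one>)]"
  have qs: "set qs \<subseteq> carrier E \<times> carrier E" using w c gc by (auto simp: qs_def)
  have q: "list_sum E (\<lambda>(e, f). e \<otimes> h f) qs = w \<otimes> (h c \<ominus> g c)" if "h \<in> carrier G" for h
  proof -
    have "h c \<in> carrier E" "h \<one> = \<one>" using that c by auto
    hence "w \<otimes> h c \<oplus> (\<ominus> (w \<otimes> g c) \<otimes> \<one> \<oplus> \<zero>) = w \<otimes> (h c \<ominus> g c)" using w gc by algebra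
    thus ?thesis using \<open>h \<one> = \<one>\<close> by (simp add: qs_def)
  qed
  \<comment> \<open>The product of the two tensors: first components and second components are
    multiplied separately.\<close>
  define rs where "rs = concat (map (\<lambda>(e, f). map (\<lambda>(e', f'). (e \<otimes> e', f \<otimes> f')) qs) ps)"
  have rs: "set rs \<subseteq> carrier E \<times> carrier E" using ps(1) qs by (fastforce simp: rs_def)
  have pc: "fst x \<in> carrier E" "snd x \<in> carrier E" if "x \<in> set ps" for x using ps(1) that by auto
  have qc: "fst x \<in> carrier E" "snd x \<in> carrier E" if "x \<in> set qs" for x using qs that by auto
  have r: "list_sum E (\<lambda>(e, f). e \<otimes> h f) rs =
      list_sum E (\<lambda>(e, f). e \<otimes> h f) ps \<otimes> list_sum E (\<lambda>(e, f). e \<otimes> h f) qs" if h: "h \<in> carrier G" for h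
  proof -
    have "list_sum E (\<lambda>(e, f). e \<otimes> h f) rs =
        list_sum E (\<lambda>(e, f). list_sum E (\<lambda>(e', f'). (e \<otimes> e') \<otimes> h (f \<otimes> f')) qs) ps"
      unfolding rs_def
      by (subst list_sum_concat)
         (use pc qc h in \<open>auto simp: split_def intro!: list_sum_cong\<close>)
    also have "\<dots> = list_sum E (\<lambda>(e, f). list_sum E (\<lambda>(e', f'). (e \<otimes> h f) \<otimes> (e' \<otimes> h f')) qs) ps"
    proof (intro list_sum_cong refl, clarify, intro list_sum_cong refl, clarify)
      fix e f e' f' assume "(e, f) \<in> set ps" "(e', f') \<in> set qs"
      hence "e \<in> carrier E" "f \<in> carrier E" "e' \<in> carrier E" "f' \<in> carrier E" using ps(1) qs by auto
      thus "(e \<otimes> e') \<otimes> h (f \<otimes> f') = (e \<otimes> h f) \<otimes> (e' \<otimes> h f')" using h by (simp add: m_ac)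
    qed
    also have "\<dots> = list_sum E (\<lambda>(e, f). e \<otimes> h f) ps \<otimes> list_sum E (\<lambda>(e, f). e \<otimes> h f) qs"
      by (subst list_sum_product) (use pc qc h in \<open>auto simp: split_def\<close>)
    finally show ?thesis .
  qed
  have ext: "list_sum E (\<lambda>(e, f). e \<otimes> \<one>\<^bsub>G\<^esub> f) xs = list_sum E (\<lambda>(e, f). e \<otimes> f) xs"
    if "set xs \<subseteq> carrier E \<times> carrier E" for xs
    using that by (intro list_sum_cong) (auto simp: G_one)
  have "list_sum E (\<lambda>(e, f). e \<otimes> f) rs = \<one>"
    using r[OF G.one_closed] q[OF G.one_closed] ps(2) w c
    by (simp add: ext[OF rs] ext[OF ps(1)] G_one)
  moreover have "list_sum E (\<lambda>(e, f). e \<otimes> h f) rs = \<zero>" if h: "h \<in> insert g A" for h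
  proof -
    have hG: "h \<in> carrier G" using h insert by auto
    have lc: "list_sum E (\<lambda>(e, f). e \<otimes> h f) ps \<in> carrier E"
      using ps(1) hG by (intro list_sum_closed) auto
    show ?thesis
    proof (cases "h = g")
      case True
      thus ?thesis using r[OF hG] q[OF hG] lc w gc by (simp add: a_minus_def r_neg)
    next
      case False
      hence "list_sum E (\<lambda>(e, f). e \<otimes> h f) ps = \<zero>" using ps(3) h by auto
      thus ?thesis using r[OF hG] q[OF hG] w hG c gc by simp
    qed
  qed
  ultimately show ?case using rs by blast
qed

lemma coordinates:
  "\<exists>ps. set ps \<subseteq> carrier E \<times> carrier E \<and>
     (\<forall>g\<in>carrier G. list_sum E (\<lambda>(e, f). e \<otimes> g f) ps = (if g = \<one>\<^bsub>G\<^esub> then \<one> else \<zero>))"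
proof -
  obtain ps where ps: "set ps \<subseteq> carrier E \<times> carrier E" "list_sum E (\<lambda>(e, f). e \<otimes> f) ps = \<one>"
    "\<forall>g\<in>carrier G - {\<one>\<^bsub>G\<^esub>}. list_sum E (\<lambda>(e, f). e \<otimes> g f) ps = \<zero>"
    using coordinates_aux[OF finite_Diff[OF finite_G] order_refl] by blast
  have "list_sum E (\<lambda>(e, f). e \<otimes> \<one>\<^bsub>G\<^esub> f) ps = list_sum E (\<lambda>(e, f). e \<otimes> f) ps"
    using ps(1) by (intro list_sum_cong) (auto simp: G_one)
  thus ?thesis using ps by (intro exI[of _ ps]) auto
qed

lemma bij_left_mult: "g \<in> carrier G \<Longrightarrow> bij_betw (\<lambda>h. g \<otimes>\<^bsub>G\<^esub> h) (carrier G) (carrier G)"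
  by (rule bij_betw_byWitness[of _ "\<lambda>h. inv\<^bsub>G\<^esub> g \<otimes>\<^bsub>G\<^esub> h"])
     (auto simp: G.m_assoc[symmetric])

text \<open>Sum \<open>coordinates\<close> over the group: 1 equals \<open>\<Sum> e T(f)\<close>
  with \<open>T\<close> the trace, so \<open>T\<close> is not identically zero. A nonzero value lies
  in \<open>K\<close> and can be divided out.\<close>

lemma trace_one:
  assumes gs: "distinct gs" "set gs = carrier G"
  shows "\<exists>t\<in>carrier E. list_sum E (\<lambda>g. g t) gs = \<one>"
proof -
  let ?T = "\<lambda>x. list_sum E (\<lambda>g. g x) gs"
  obtain ps where ps: "set ps \<subseteq> carrier E \<times> carrier E"
    "\<And>g. g \<in> carrier G \<Longrightarrow> list_sum E (\<lambda>(e, f). e \<otimes> g f) ps = (if g = \<one>\<^bsub>G\<^esub> then \<one> else \<zero>)"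
    using coordinates by blast
  have T: "?T x \<in> carrier E" if "x \<in> carrier E" for x using that gs by auto
  have TK: "?T x \<in> K" if x: "x \<in> carrier E" for x
  proof (rule fixed_K[OF T[OF x]])
    fix s assume s: "s \<in> carrier G"
    have "s (?T x) = list_sum E (\<lambda>g. s (g x)) gs"
      by (rule G_list_sum[OF s]) (use x gs in auto)
    also have "\<dots> = list_sum E (\<lambda>g. (s \<otimes>\<^bsub>G\<^esub> g) x) gs"
      using s x gs by (intro list_sum_cong refl) (simp add: G_mult)
    also have "\<dots> = ?T x"
      using list_sum_reindex[OF gs(1) gs(1), of "\<lambda>h. s \<otimes>\<^bsub>G\<^esub> h" "\<lambda>g. g x"] bij_left_mult[OF s] gs x
      by simp
    finally show "s (?T x) = ?T x" .
  qed
  have "\<exists>x\<in>carrier E. ?T x \<noteq> \<zero>"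
  proof (rule ccontr)
    assume "\<not> (\<exists>x\<in>carrier E. ?T x \<noteq> \<zero>)"
    hence 0: "\<And>x. x \<in> carrier E \<Longrightarrow> ?T x = \<zero>" by blast
    have "\<one> = list_sum E (\<lambda>g. if g = \<one>\<^bsub>G\<^esub> then \<one> else \<zero>) gs"
      using list_sum_delta(1)[OF gs(1), of "\<one>\<^bsub>G\<^esub>" "\<lambda>_. \<one>"] gs(2) by simp
    also have "\<dots> = list_sum E (\<lambda>g. list_sum E (\<lambda>(e, f). e \<otimes> g f) ps) gs"
      using ps(2) gs(2) by (intro list_sum_cong) auto
    also have "\<dots> = list_sum E (\<lambda>p. list_sum E (\<lambda>g. fst p \<otimes> g (snd p)) gs) ps"
      unfolding split_def by (rule list_sum_swap) (use ps(1) gs in auto)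
    also have "\<dots> = list_sum E (\<lambda>p. fst p \<otimes> ?T (snd p)) ps"
      using ps(1) gs by (intro list_sum_cong refl list_sum_rdistr[symmetric]) auto
    also have "\<dots> = \<zero>" using ps(1) by (intro list_sum_zero') (auto simp: 0)
    finally show False by simp
  qed
  then obtain x where x: "x \<in> carrier E" "?T x \<noteq> \<zero>" by blast
  let ?y = "inv (?T x)"
  have y: "?y \<in> K" "?T x \<otimes> ?y = \<one>" using subfield_m_inv[OF K, of "?T x"] TK[OF x(1)] x(2) by auto
  have "?T (x \<otimes> ?y) = list_sum E (\<lambda>g. g x \<otimes> ?y) gs"
    using x y gs by (intro list_sum_cong) (auto simp: G_K)
  also have "\<dots> = ?T x \<otimes> ?y" using x y gs by (intro list_sum_ldistr[symmetric]) auto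
  finally show ?thesis using y x by (intro bexI[of _ "x \<otimes> ?y"]) auto
qed


section \<open>Descent\<close>

text \<open>The trace over the group of the function with value \<open>c\<close> at \<open>x\<close>
  and 0 elsewhere, for the action \<open>(g u)(y) = g (u (g\<^sup>-\<^sup>1 y))\<close> on
  functions.\<close>

definition orbit_sum :: "(('e \<Rightarrow> 'e) \<Rightarrow> 'x \<Rightarrow> 'x) \<Rightarrow> ('e \<Rightarrow> 'e) list \<Rightarrow> 'x \<Rightarrow> 'e \<Rightarrow> 'x \<Rightarrow> 'e" where
  "orbit_sum act gs x c y = list_sum E (\<lambda>g. if act g x = y then g c else \<zero>) gs"

lemma orbit_sum_closed:
  "set gs = carrier G \<Longrightarrow> c \<in> carrier E \<Longrightarrow> orbit_sum act gs x c y \<in> carrier E"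
  unfolding orbit_sum_def by (intro list_sum_closed) auto

lemma orbit_sum_equivariant:
  assumes gs: "distinct gs" "set gs = carrier G" and c: "c \<in> carrier E" and Y: "x \<in> Y" "y \<in> Y"
    and act: "\<And>g x. g \<in> carrier G \<Longrightarrow> x \<in> Y \<Longrightarrow> act g x \<in> Y"
      "\<And>g h x. g \<in> carrier G \<Longrightarrow> h \<in> carrier G \<Longrightarrow> x \<in> Y \<Longrightarrow> act (g \<otimes>\<^bsub>G\<^esub> h) x = act g (act h x)"
      "\<And>g x y. g \<in> carrier G \<Longrightarrow> x \<in> Y \<Longrightarrow> y \<in> Y \<Longrightarrow> act g x = act g y \<Longrightarrow> x = y"
    and h: "h \<in> carrier G"
  shows "orbit_sum act gs x c (act h y) = h (orbit_sum act gs x c y)"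
proof -
  have "h (orbit_sum act gs x c y) = list_sum E (\<lambda>g. h (if act g x = y then g c else \<zero>)) gs"
    unfolding orbit_sum_def by (rule G_list_sum[OF h]) (use c gs in auto)
  also have "\<dots> = list_sum E (\<lambda>g. if act (h \<otimes>\<^bsub>G\<^esub> g) x = act h y then (h \<otimes>\<^bsub>G\<^esub> g) c else \<zero>) gs"
  proof (intro list_sum_cong refl)
    fix g assume "g \<in> set gs"
    hence g: "g \<in> carrier G" using gs by simp
    have "act (h \<otimes>\<^bsub>G\<^esub> g) x = act h y \<longleftrightarrow> act g x = y"
      using act(2)[OF h g Y(1)] act(3)[OF h act(1)[OF g Y(1)] Y(2)] by auto
    thus "h (if act g x = y then g c else \<zero>) =
        (if act (h \<otimes>\<^bsub>G\<^esub> g) x = act h y then (h \<otimes>\<^bsub>G\<^esub> g) c else \<zero>)"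
      using h g c by (simp add: G_mult)
  qed
  also have "\<dots> = orbit_sum act gs x c (act h y)"
    unfolding orbit_sum_def
    using list_sum_reindex[OF gs(1) gs(1), of "\<lambda>g. h \<otimes>\<^bsub>G\<^esub> g" "\<lambda>g. if act g x = act h y then g c else \<zero>"]
      bij_left_mult[OF h] gs c by simp
  finally show ?thesis by simp
qed

definition is_action :: "'x set \<Rightarrow> (('e \<Rightarrow> 'e) \<Rightarrow> 'x \<Rightarrow> 'x) \<Rightarrow> bool" where
  "is_action Y act \<longleftrightarrow>
     (\<forall>g\<in>carrier G. \<forall>x\<in>Y. act g x \<in> Y) \<and> (\<forall>x\<in>Y. act \<one>\<^bsub>G\<^esub> x = x) \<and>
     (\<forall>g\<in>carrier G. \<forall>h\<in>carrier G. \<forall>x\<in>Y. act (g \<otimes>\<^bsub>G\<^esub> h) x = act g (act h x))"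

text \<open>Both objects of the descent have this form: \<open>E[N]\<^sup>G\<close> consists of the
  equivariant functions on \<open>N\<close> under conjugation, and \<open>L\<close> of those on the
  cosets, an element \<open>x\<close> giving the function \<open>s \<mapsto> s x\<close>.\<close>

definition equivariant :: "'x set \<Rightarrow> (('e \<Rightarrow> 'e) \<Rightarrow> 'x \<Rightarrow> 'x) \<Rightarrow> ('x \<Rightarrow> 'e) \<Rightarrow> bool" where
  "equivariant Y act u \<longleftrightarrow>
     (\<forall>x\<in>Y. u x \<in> carrier E) \<and> (\<forall>g\<in>carrier G. \<forall>x\<in>Y. u (act g x) = g (u x))"

lemma action_inj:
  assumes "is_action Y act" "g \<in> carrier G" "x \<in> Y" "y \<in> Y" "act g x = act g y"
  shows "x = y"
proof -
  have "act (inv\<^bsub>G\<^esub> g) (act g z) = z" if "z \<in> Y" for z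
  proof -
    have "act (inv\<^bsub>G\<^esub> g \<otimes>\<^bsub>G\<^esub> g) z = act (inv\<^bsub>G\<^esub> g) (act g z)"
      using assms(1,2) that G.inv_closed[OF assms(2)] unfolding is_action_def by blast
    thus ?thesis using assms(1,2) that by (simp add: is_action_def)
  qed
  thus ?thesis using assms(3-5) by metis
qed

text \<open>With \<open>ps\<close> as in \<open>coordinates\<close> and \<open>t\<close> of trace one, the function \<open>a\<close> attached to \<open>x\<close> and \<open>(e, f)\<close> is the orbit
  sum of \<open>f\<close> from \<open>x\<close>, and \<open>d\<close> is the orbit sum of \<open>t e\<close>.\<close>

theorem dual_frame:
  assumes act: "is_action (set xs) act" and xs: "distinct xs"
  shows "\<exists>F. (\<forall>(a, d)\<in>set F. equivariant (set xs) act a \<and> equivariant (set xs) act d) \<and>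
           (\<forall>m\<in>set xs. \<forall>n\<in>set xs. list_sum E (\<lambda>(a, d). d m \<otimes> a n) F = (if m = n then \<one> else \<zero>))"
proof -
  obtain gs where gs: "distinct gs" "set gs = carrier G"
    using finite_distinct_list[OF finite_G] by blast
  obtain t where t: "t \<in> carrier E" "list_sum E (\<lambda>g. g t) gs = \<one>" using trace_one[OF gs] by blast
  obtain ps where ps: "set ps \<subseteq> carrier E \<times> carrier E"
    "\<And>g. g \<in> carrier G \<Longrightarrow> list_sum E (\<lambda>(e, f). e \<otimes> g f) ps = (if g = \<one>\<^bsub>G\<^esub> then \<one> else \<zero>)"
    using coordinates by blast
  have pc: "fst x \<in> carrier E" "snd x \<in> carrier E" if "x \<in> set ps" for x using ps(1) that by auto
  \<comment> \<open>The coordinate identity at \<open>h\<^sup>-\<^sup>1 g\<close>, transported by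
    \<open>h\<close>.\<close>
  have ps2: "list_sum E (\<lambda>p. h (fst p) \<otimes> g (snd p)) ps = (if g = h then \<one> else \<zero>)"
    if g: "g \<in> carrier G" and h: "h \<in> carrier G" for g h
  proof -
    have ih: "inv\<^bsub>G\<^esub> h \<otimes>\<^bsub>G\<^esub> g \<in> carrier G" using g h by simp
    have "list_sum E (\<lambda>p. h (fst p) \<otimes> g (snd p)) ps =
      list_sum E (\<lambda>p. h (fst p \<otimes> (inv\<^bsub>G\<^esub> h \<otimes>\<^bsub>G\<^esub> g) (snd p))) ps"
    proof (intro list_sum_cong refl)
      fix p assume p: "p \<in> set ps"
      have "g (snd p) = (h \<otimes>\<^bsub>G\<^esub> (inv\<^bsub>G\<^esub> h \<otimes>\<^bsub>G\<^esub> g)) (snd p)"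
        using g h by (simp add: G.m_assoc[symmetric])
      also have "\<dots> = h ((inv\<^bsub>G\<^esub> h \<otimes>\<^bsub>G\<^esub> g) (snd p))"
        by (rule G_mult[OF h ih pc(2)[OF p]])
      finally show "h (fst p) \<otimes> g (snd p) = h (fst p \<otimes> (inv\<^bsub>G\<^esub> h \<otimes>\<^bsub>G\<^esub> g) (snd p))"
        using pc[OF p] h G_closed[OF ih pc(2)[OF p]] by simp
    qed
    also have "\<dots> = h (list_sum E (\<lambda>p. fst p \<otimes> (inv\<^bsub>G\<^esub> h \<otimes>\<^bsub>G\<^esub> g) (snd p)) ps)"
      by (rule G_list_sum[OF h, symmetric]) (use pc G_closed[OF ih] in auto)
    also have "\<dots> = h (if inv\<^bsub>G\<^esub> h \<otimes>\<^bsub>G\<^esub> g = \<one>\<^bsub>G\<^esub> then \<one> else \<zero>)"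
      using ps(2)[OF ih] by (simp add: split_def)
    also have "inv\<^bsub>G\<^esub> h \<otimes>\<^bsub>G\<^esub> g = \<one>\<^bsub>G\<^esub> \<longleftrightarrow> g = h"
      using g h by (metis G.inv_closed G.inv_equality G.inv_inv G.l_inv)
    finally show ?thesis using h by simp
  qed
  let ?O = "orbit_sum act gs"
  have Oc: "?O x c y \<in> carrier E" if "c \<in> carrier E" for x c y
    by (rule orbit_sum_closed[OF gs(2) that])
  define F where "F = concat (map (\<lambda>x. map (\<lambda>p. (?O x (snd p), ?O x (t \<otimes> fst p))) ps) xs)"
  note A = act[unfolded is_action_def]
  have eq: "equivariant (set xs) act (?O x c)" if "x \<in> set xs" "c \<in> carrier E" for x c
    unfolding equivariant_def
  proof (intro conjI ballI)
    show "?O x c y \<in> carrier E" for y by (rule orbit_sum_closed[OF gs(2) that(2)])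
    show "?O x c (act g y) = g (?O x c y)" if "g \<in> carrier G" "y \<in> set xs" for g y
      by (rule orbit_sum_equivariant[OF gs \<open>c \<in> carrier E\<close> \<open>x \<in> set xs\<close> that(2) _ _ _ that(1)])
         (use A in blast, use A in blast, rule action_inj[OF act])
  qed
  have "\<forall>(a, d)\<in>set F. equivariant (set xs) act a \<and> equivariant (set xs) act d"
    using eq pc t(1) by (auto simp: F_def)
  moreover have "list_sum E (\<lambda>(a, d). d m \<otimes> a n) F = (if m = n then \<one> else \<zero>)"
    if mn: "m \<in> set xs" "n \<in> set xs" for m n
  proof -
    have gc: "g c \<in> carrier E" if "g \<in> set gs" "c \<in> carrier E" for g c using that gs by auto
    have "list_sum E (\<lambda>(a, d). d m \<otimes> a n) F =
        list_sum E (\<lambda>x. list_sum E (\<lambda>p. ?O x (t \<otimes> fst p) m \<otimes> ?O x (snd p) n) ps) xs"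
      unfolding F_def
      by (subst list_sum_concat) (use pc t(1) Oc in auto)
    also have "\<dots> = list_sum E (\<lambda>x. list_sum E (\<lambda>h. if act h x = m \<and> m = n then h t else \<zero>) gs) xs"
    proof (intro list_sum_cong refl)
      fix x assume x: "x \<in> set xs"
      let ?f = "\<lambda>h g p. (if act h x = m then h (t \<otimes> fst p) else \<zero>) \<otimes> (if act g x = n then g (snd p) else \<zero>)"
      have fc: "?f h g p \<in> carrier E" if "h \<in> set gs" "g \<in> set gs" "p \<in> set ps" for h g p
        using that gs pc t(1) by auto
      have "list_sum E (\<lambda>p. ?O x (t \<otimes> fst p) m \<otimes> ?O x (snd p) n) ps =
          list_sum E (\<lambda>p. list_sum E (\<lambda>h. list_sum E (\<lambda>g. ?f h g p) gs) gs) ps"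
        unfolding orbit_sum_def
        by (intro list_sum_cong refl list_sum_product) (use gs pc t(1) in auto)
      also have "\<dots> = list_sum E (\<lambda>h. list_sum E (\<lambda>p. list_sum E (\<lambda>g. ?f h g p) gs) ps) gs"
        by (rule list_sum_swap) (use fc in blast)
      also have "\<dots> = list_sum E (\<lambda>h. list_sum E (\<lambda>g. list_sum E (\<lambda>p. ?f h g p) ps) gs) gs"
        by (intro list_sum_cong refl list_sum_swap) (use fc in blast)
      \<comment> \<open>By \<open>ps2\<close> only \<open>g = h\<close> contributes, which forces
        the two target points \<open>m\<close> and \<open>n\<close> to coincide.\<close>
      also have "\<dots> = list_sum E (\<lambda>h. list_sum E (\<lambda>g. if g = h then (if act h x = m \<and> act h x = n then h t else \<zero>) else \<zero>) gs) gs"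
      proof (intro list_sum_cong refl)
        fix h g assume "h \<in> set gs" "g \<in> set gs"
        hence hg: "h \<in> carrier G" "g \<in> carrier G" using gs by auto
        show "list_sum E (\<lambda>p. ?f h g p) ps = (if g = h then (if act h x = m \<and> act h x = n then h t else \<zero>) else \<zero>)"
        proof (cases "act h x = m \<and> act g x = n")
          case True
          have "list_sum E (\<lambda>p. ?f h g p) ps = list_sum E (\<lambda>p. h t \<otimes> (h (fst p) \<otimes> g (snd p))) ps"
            using True hg pc t(1) by (intro list_sum_cong refl) (simp add: m_assoc)
          also have "\<dots> = h t \<otimes> list_sum E (\<lambda>p. h (fst p) \<otimes> g (snd p)) ps"
            by (rule list_sum_rdistr[symmetric]) (use hg pc t(1) in auto)
          finally show ?thesis using ps2[OF hg(2,1)] True hg t(1) by auto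
        next
          case False
          have "list_sum E (\<lambda>p. ?f h g p) ps = \<zero>"
            by (rule list_sum_zero') (use False hg pc t(1) in auto)
          thus ?thesis using False by auto
        qed
      qed
      also have "\<dots> = list_sum E (\<lambda>h. if act h x = m \<and> act h x = n then h t else \<zero>) gs"
        by (intro list_sum_cong refl list_sum_delta(1)[OF gs(1)]) (use gs t(1) in auto)
      also have "\<dots> = list_sum E (\<lambda>h. if act h x = m \<and> m = n then h t else \<zero>) gs"
        by (intro list_sum_cong refl) auto
      finally show "list_sum E (\<lambda>p. ?O x (t \<otimes> fst p) m \<otimes> ?O x (snd p) n) ps = \<dots>" .
    qed
    also have "\<dots> = list_sum E (\<lambda>h. list_sum E (\<lambda>x. if act h x = m \<and> m = n then h t else \<zero>) xs) gs"
      by (rule list_sum_swap) (use gs t(1) in auto)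
    \<comment> \<open>Each \<open>h\<close> meets exactly one starting point,
      \<open>x = h\<^sup>-\<^sup>1 m\<close>, so what remains is the trace of
      \<open>t\<close>.\<close>
    also have "\<dots> = list_sum E (\<lambda>h. if m = n then h t else \<zero>) gs"
    proof (intro list_sum_cong refl)
      fix h assume "h \<in> set gs"
      hence h: "h \<in> carrier G" using gs by simp
      have *: "act h x = m \<longleftrightarrow> x = act (inv\<^bsub>G\<^esub> h) m" if "x \<in> set xs" for x
      proof -
        have "act (h \<otimes>\<^bsub>G\<^esub> inv\<^bsub>G\<^esub> h) m = act h (act (inv\<^bsub>G\<^esub> h) m)"
          using A h mn(1) G.inv_closed[OF h] by blast
        hence "act h (act (inv\<^bsub>G\<^esub> h) m) = m" using A h mn(1) by simp
        moreover have "act (inv\<^bsub>G\<^esub> h) m \<in> set xs" using A mn(1) G.inv_closed[OF h] by blast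
        ultimately show ?thesis using action_inj[OF act h that] by auto
      qed
      have "list_sum E (\<lambda>x. if act h x = m \<and> m = n then h t else \<zero>) xs =
          list_sum E (\<lambda>x. if x = act (inv\<^bsub>G\<^esub> h) m then (if m = n then h t else \<zero>) else \<zero>) xs"
        by (intro list_sum_cong refl) (use * in auto)
      also have "\<dots> = (if m = n then h t else \<zero>)"
        by (rule list_sum_delta(1)[OF xs]) (use A h mn(1) t(1) in auto)
      finally show "list_sum E (\<lambda>x. if act h x = m \<and> m = n then h t else \<zero>) xs = \<dots>" .
    qed
    also have "\<dots> = (if m = n then \<one> else \<zero>)" using t(2) by auto
    finally show ?thesis .
  qed
  ultimately show ?thesis by blast
qed

end


section \<open>Tensors and dual bases\<close>

text \<open>A frame need not be linearly independent, so no dimension theory enters.\<close>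

definition frame :: "('k, 'r) ring_scheme \<Rightarrow> ('k, 'a, 's) module_scheme \<Rightarrow> ('a \<times> ('a \<Rightarrow> 'k)) list \<Rightarrow> bool" where
  "frame R M F \<longleftrightarrow> (\<forall>(a, \<phi>)\<in>set F. a \<in> carrier M \<and> linear_form R M \<phi>) \<and>
     (\<forall>x\<in>carrier M. x = list_sum M (\<lambda>(a, \<phi>). \<phi> x \<odot>\<^bsub>M\<^esub> a) F)"

lemma frameD:
  assumes "frame R M F"
  shows "p \<in> set F \<Longrightarrow> fst p \<in> carrier M" "p \<in> set F \<Longrightarrow> linear_form R M (snd p)"
    "x \<in> carrier M \<Longrightarrow> x = list_sum M (\<lambda>p. snd p x \<odot>\<^bsub>M\<^esub> fst p) F"
  using assms unfolding frame_def split_def by auto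

lemma linear_formD:
  assumes "linear_form R M f"
  shows "x \<in> carrier M \<Longrightarrow> f x \<in> carrier R"
    "x \<in> carrier M \<Longrightarrow> y \<in> carrier M \<Longrightarrow> f (x \<oplus>\<^bsub>M\<^esub> y) = f x \<oplus>\<^bsub>R\<^esub> f y"
    "c \<in> carrier R \<Longrightarrow> x \<in> carrier M \<Longrightarrow> f (c \<odot>\<^bsub>M\<^esub> x) = c \<otimes>\<^bsub>R\<^esub> f x"
  using assms unfolding linear_form_def by auto

lemma (in module) linear_form_list_sum:
  assumes "linear_form R M f" "\<And>x. x \<in> set xs \<Longrightarrow> g x \<in> carrier M"
  shows "f (list_sum M g xs) = list_sum R (\<lambda>x. f (g x)) xs"
  using assms(2)
proof (induction xs)
  case Nil
  have "f (\<zero> \<odot>\<^bsub>M\<^esub> \<zero>\<^bsub>M\<^esub>) = \<zero> \<otimes> f \<zero>\<^bsub>M\<^esub>"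
    by (rule linear_formD(3)[OF assms(1)]) auto
  thus ?case using linear_formD(1)[OF assms(1), of "\<zero>\<^bsub>M\<^esub>"] by simp
next
  case (Cons x xs)
  thus ?case using linear_formD(2)[OF assms(1), of "g x" "list_sum M g xs"] M.list_sum_closed by simp
qed

lemma (in module) frame_expand:
  assumes "frame R M F" "linear_form R M f" "x \<in> carrier M"
  shows "f x = list_sum R (\<lambda>p. snd p x \<otimes> f (fst p)) F"
proof -
  note F = frameD[OF assms(1)]
  have "f x = f (list_sum M (\<lambda>p. snd p x \<odot>\<^bsub>M\<^esub> fst p) F)" using F(3)[OF assms(3)] by simp
  also have "\<dots> = list_sum R (\<lambda>p. f (snd p x \<odot>\<^bsub>M\<^esub> fst p)) F"
    by (rule linear_form_list_sum[OF assms(2)]) (use F linear_formD(1)[OF F(2) assms(3)] in auto)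
  also have "\<dots> = list_sum R (\<lambda>p. snd p x \<otimes> f (fst p)) F"
    by (intro list_sum_cong refl linear_formD(3)[OF assms(2)]) (use F linear_formD(1)[OF F(2) assms(3)] in auto)
  finally show ?thesis .
qed

text \<open>Expanding both arguments in the frames separates the coefficients, which depend on the
  list but not on \<beta>, from the values of \<beta>, taken only at frame vectors.\<close>

lemma bilinear_expand:
  assumes M: "module R M" "module R N" and F: "frame R M F" "frame R N F'"
    and \<beta>: "bilinear_form R M N \<beta>" and s: "set s \<subseteq> carrier M \<times> carrier N"
  shows "list_sum R (\<lambda>(x, y). \<beta> x y) s =
    list_sum R (\<lambda>p. list_sum R (\<lambda>q. list_sum R (\<lambda>(x, y). snd p x \<otimes>\<^bsub>R\<^esub> snd q y) s \<otimes>\<^bsub>R\<^esub> \<beta> (fst p) (fst q)) F') F"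
proof -
  interpret R: cring R by (rule module.axioms(1)) fact
  interpret M: module R M by fact
  interpret N: module R N by fact
  note F1 = frameD[OF F(1)] note F2 = frameD[OF F(2)]
  have b1: "linear_form R M (\<lambda>x. \<beta> x y)" if "y \<in> carrier N" for y using \<beta> that by (auto simp: bilinear_form_def)
  have b2: "linear_form R N (\<lambda>y. \<beta> x y)" if "x \<in> carrier M" for x using \<beta> that by (auto simp: bilinear_form_def)
  have sc: "fst z \<in> carrier M" "snd z \<in> carrier N" if "z \<in> set s" for z using s that by auto
  have bc: "\<beta> x y \<in> carrier R" if "x \<in> carrier M" "y \<in> carrier N" for x y
    using linear_formD(1)[OF b2] that by auto
  have fc: "snd p x \<in> carrier R" if "p \<in> set F" "x \<in> carrier M" for p x using linear_formD(1)[OF F1(2)] that by auto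
  have gc: "snd p x \<in> carrier R" if "p \<in> set F'" "x \<in> carrier N" for p x using linear_formD(1)[OF F2(2)] that by auto
  have "list_sum R (\<lambda>(x, y). \<beta> x y) s =
      list_sum R (\<lambda>z. list_sum R (\<lambda>p. list_sum R (\<lambda>q. (snd p (fst z) \<otimes>\<^bsub>R\<^esub> snd q (snd z)) \<otimes>\<^bsub>R\<^esub> \<beta> (fst p) (fst q)) F') F) s"
  proof (intro list_sum_cong refl)
    fix z assume z: "z \<in> set s"
    have "(case z of (x, y) \<Rightarrow> \<beta> x y) = list_sum R (\<lambda>p. snd p (fst z) \<otimes>\<^bsub>R\<^esub> \<beta> (fst p) (snd z)) F"
      using M.frame_expand[OF F(1) b1[OF sc(2)[OF z]] sc(1)[OF z]] by (simp add: split_def)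
    also have "\<dots> = list_sum R (\<lambda>p. list_sum R (\<lambda>q. (snd p (fst z) \<otimes>\<^bsub>R\<^esub> snd q (snd z)) \<otimes>\<^bsub>R\<^esub> \<beta> (fst p) (fst q)) F') F"
    proof (intro list_sum_cong refl)
      fix p assume p: "p \<in> set F"
      have "snd p (fst z) \<otimes>\<^bsub>R\<^esub> \<beta> (fst p) (snd z) =
          snd p (fst z) \<otimes>\<^bsub>R\<^esub> list_sum R (\<lambda>q. snd q (snd z) \<otimes>\<^bsub>R\<^esub> \<beta> (fst p) (fst q)) F'"
        using N.frame_expand[OF F(2) b2[OF F1(1)[OF p]] sc(2)[OF z]] by simp
      also have "\<dots> = list_sum R (\<lambda>q. snd p (fst z) \<otimes>\<^bsub>R\<^esub> (snd q (snd z) \<otimes>\<^bsub>R\<^esub> \<beta> (fst p) (fst q))) F'"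
        by (rule R.list_sum_rdistr) (use p z sc fc gc bc F1 F2 in auto)
      also have "\<dots> = list_sum R (\<lambda>q. (snd p (fst z) \<otimes>\<^bsub>R\<^esub> snd q (snd z)) \<otimes>\<^bsub>R\<^esub> \<beta> (fst p) (fst q)) F'"
        by (intro list_sum_cong refl R.m_assoc[symmetric]) (use p z sc fc gc bc F1 F2 in auto)
      finally show "snd p (fst z) \<otimes>\<^bsub>R\<^esub> \<beta> (fst p) (snd z) = \<dots>" .
    qed
    finally show "(case z of (x, y) \<Rightarrow> \<beta> x y) = \<dots>" .
  qed
  also have "\<dots> = list_sum R (\<lambda>p. list_sum R (\<lambda>z. list_sum R (\<lambda>q. (snd p (fst z) \<otimes>\<^bsub>R\<^esub> snd q (snd z)) \<otimes>\<^bsub>R\<^esub> \<beta> (fst p) (fst q)) F') s) F"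
    by (rule R.list_sum_swap) (use sc fc gc bc F1 F2 in auto)
  also have "\<dots> = list_sum R (\<lambda>p. list_sum R (\<lambda>q. list_sum R (\<lambda>z. (snd p (fst z) \<otimes>\<^bsub>R\<^esub> snd q (snd z)) \<otimes>\<^bsub>R\<^esub> \<beta> (fst p) (fst q)) s) F') F"
    by (intro list_sum_cong refl R.list_sum_swap) (use sc fc gc bc F1 F2 in auto)
  also have "\<dots> = list_sum R (\<lambda>p. list_sum R (\<lambda>q. list_sum R (\<lambda>z. snd p (fst z) \<otimes>\<^bsub>R\<^esub> snd q (snd z)) s \<otimes>\<^bsub>R\<^esub> \<beta> (fst p) (fst q)) F') F"
    by (intro list_sum_cong refl R.list_sum_ldistr[symmetric]) (use sc fc gc bc F1 F2 in auto)
  finally show ?thesis by (simp add: split_def)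
qed

text \<open>Reduces the quantifier over all bilinear forms to finitely many products of frame
  functionals.\<close>

lemma tensor_eqI:
  assumes M: "module R M" "module R N" and F: "frame R M F" "frame R N F'"
    and s: "set s \<subseteq> carrier M \<times> carrier N" "set t \<subseteq> carrier M \<times> carrier N"
    and eq: "\<And>p q. p \<in> set F \<Longrightarrow> q \<in> set F' \<Longrightarrow>
      list_sum R (\<lambda>(x, y). snd p x \<otimes>\<^bsub>R\<^esub> snd q y) s = list_sum R (\<lambda>(x, y). snd p x \<otimes>\<^bsub>R\<^esub> snd q y) t"
  shows "tensor_eq R M N s t"
  unfolding tensor_eq_def
  using bilinear_expand[OF M F _ s(1)] bilinear_expand[OF M F _ s(2)] eq
  by (simp cong: list_sum_cong)

text \<open>The same separation for three arguments: the list enters only through triple products of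
  frame functionals.\<close>

lemma trilinear_expand:
  assumes M: "module R M" and F: "frame R M F"
    and \<beta>: "trilinear_form R M \<beta>" and s: "set s \<subseteq> carrier M \<times> carrier M \<times> carrier M"
  shows "list_sum R (\<lambda>(x, y, z). \<beta> x y z) s =
    list_sum R (\<lambda>p. list_sum R (\<lambda>q. list_sum R (\<lambda>r.
      list_sum R (\<lambda>(x, y, z). snd p x \<otimes>\<^bsub>R\<^esub> (snd q y \<otimes>\<^bsub>R\<^esub> snd r z)) s \<otimes>\<^bsub>R\<^esub> \<beta> (fst p) (fst q) (fst r)) F) F) F"
proof -
  interpret R: cring R by (rule module.axioms(1)) fact
  interpret M: module R M by fact
  note F1 = frameD[OF F]
  have b: "linear_form R M (\<lambda>z. \<beta> z x y)" "linear_form R M (\<lambda>z. \<beta> x z y)" "linear_form R M (\<lambda>z. \<beta> x y z)"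
    if "x \<in> carrier M" "y \<in> carrier M" for x y using \<beta> that by (auto simp: trilinear_form_def)
  have sc: "fst z \<in> carrier M" "fst (snd z) \<in> carrier M" "snd (snd z) \<in> carrier M"
    if "z \<in> set s" for z using s that by auto
  have bc: "\<beta> x y z \<in> carrier R" if "x \<in> carrier M" "y \<in> carrier M" "z \<in> carrier M" for x y z
    using linear_formD(1)[OF b(1)] that by auto
  have fc: "snd p x \<in> carrier R" if "p \<in> set F" "x \<in> carrier M" for p x using linear_formD(1)[OF F1(2)] that by auto
  let ?c = "\<lambda>p q r z. (snd p (fst z) \<otimes>\<^bsub>R\<^esub> (snd q (fst (snd z)) \<otimes>\<^bsub>R\<^esub> snd r (snd (snd z)))) \<otimes>\<^bsub>R\<^esub> \<beta> (fst p) (fst q) (fst r)"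
  have cc: "?c p q r z \<in> carrier R" if "p \<in> set F" "q \<in> set F" "r \<in> set F" "z \<in> set s" for p q r z
    using that sc fc bc F1 by auto
  have "list_sum R (\<lambda>(x, y, z). \<beta> x y z) s =
      list_sum R (\<lambda>z. list_sum R (\<lambda>p. list_sum R (\<lambda>q. list_sum R (\<lambda>r. ?c p q r z) F) F) F) s"
  proof (intro list_sum_cong refl)
    fix z assume z: "z \<in> set s"
    note zc = sc[OF z]
    have "(case z of (x, y, z) \<Rightarrow> \<beta> x y z) = list_sum R (\<lambda>p. snd p (fst z) \<otimes>\<^bsub>R\<^esub> \<beta> (fst p) (fst (snd z)) (snd (snd z))) F"
      using M.frame_expand[OF F b(1)[OF zc(2,3)] zc(1)] by (simp add: split_def)
    also have "\<dots> = list_sum R (\<lambda>p. list_sum R (\<lambda>q. list_sum R (\<lambda>r. ?c p q r z) F) F) F"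
    proof (intro list_sum_cong refl)
      fix p assume p: "p \<in> set F"
      have "\<beta> (fst p) (fst (snd z)) (snd (snd z)) =
          list_sum R (\<lambda>q. snd q (fst (snd z)) \<otimes>\<^bsub>R\<^esub> \<beta> (fst p) (fst q) (snd (snd z))) F"
        using M.frame_expand[OF F b(2)[OF F1(1)[OF p] zc(3)] zc(2)] .
      also have "\<dots> = list_sum R (\<lambda>q. list_sum R (\<lambda>r. snd q (fst (snd z)) \<otimes>\<^bsub>R\<^esub> (snd r (snd (snd z)) \<otimes>\<^bsub>R\<^esub> \<beta> (fst p) (fst q) (fst r))) F) F"
      proof (intro list_sum_cong refl)
        fix q assume q: "q \<in> set F"
        have "\<beta> (fst p) (fst q) (snd (snd z)) = list_sum R (\<lambda>r. snd r (snd (snd z)) \<otimes>\<^bsub>R\<^esub> \<beta> (fst p) (fst q) (fst r)) F"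
          using M.frame_expand[OF F b(3)[OF F1(1)[OF p] F1(1)[OF q]] zc(3)] .
        thus "snd q (fst (snd z)) \<otimes>\<^bsub>R\<^esub> \<beta> (fst p) (fst q) (snd (snd z)) =
            list_sum R (\<lambda>r. snd q (fst (snd z)) \<otimes>\<^bsub>R\<^esub> (snd r (snd (snd z)) \<otimes>\<^bsub>R\<^esub> \<beta> (fst p) (fst q) (fst r))) F"
          using p q zc fc bc F1 by (simp add: R.list_sum_rdistr)
      qed
      finally have "snd p (fst z) \<otimes>\<^bsub>R\<^esub> \<beta> (fst p) (fst (snd z)) (snd (snd z)) =
          snd p (fst z) \<otimes>\<^bsub>R\<^esub> list_sum R (\<lambda>q. list_sum R (\<lambda>r. snd q (fst (snd z)) \<otimes>\<^bsub>R\<^esub> (snd r (snd (snd z)) \<otimes>\<^bsub>R\<^esub> \<beta> (fst p) (fst q) (fst r))) F) F"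
        by simp
      also have "\<dots> = list_sum R (\<lambda>q. list_sum R (\<lambda>r. snd p (fst z) \<otimes>\<^bsub>R\<^esub> (snd q (fst (snd z)) \<otimes>\<^bsub>R\<^esub> (snd r (snd (snd z)) \<otimes>\<^bsub>R\<^esub> \<beta> (fst p) (fst q) (fst r)))) F) F"
        using p zc fc bc F1 by (simp add: R.list_sum_rdistr cong: list_sum_cong)
      also have "\<dots> = list_sum R (\<lambda>q. list_sum R (\<lambda>r. ?c p q r z) F) F"
        by (intro list_sum_cong refl) (use p zc fc bc F1 in \<open>simp add: R.m_assoc\<close>)
      finally show "snd p (fst z) \<otimes>\<^bsub>R\<^esub> \<beta> (fst p) (fst (snd z)) (snd (snd z)) = \<dots>" .
    qed
    finally show "(case z of (x, y, z) \<Rightarrow> \<beta> x y z) = \<dots>" .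
  qed
  also have "\<dots> = list_sum R (\<lambda>p. list_sum R (\<lambda>z. list_sum R (\<lambda>q. list_sum R (\<lambda>r. ?c p q r z) F) F) s) F"
    by (rule R.list_sum_swap) (use cc in auto)
  also have "\<dots> = list_sum R (\<lambda>p. list_sum R (\<lambda>q. list_sum R (\<lambda>z. list_sum R (\<lambda>r. ?c p q r z) F) s) F) F"
    by (intro list_sum_cong refl R.list_sum_swap) (use cc in auto)
  also have "\<dots> = list_sum R (\<lambda>p. list_sum R (\<lambda>q. list_sum R (\<lambda>r. list_sum R (\<lambda>z. ?c p q r z) s) F) F) F"
    by (intro list_sum_cong refl R.list_sum_swap) (use cc in auto)
  also have "\<dots> = list_sum R (\<lambda>p. list_sum R (\<lambda>q. list_sum R (\<lambda>r. list_sum R (\<lambda>z. snd p (fst z) \<otimes>\<^bsub>R\<^esub> (snd q (fst (snd z)) \<otimes>\<^bsub>R\<^esub> snd r (snd (snd z)))) s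
       \<otimes>\<^bsub>R\<^esub> \<beta> (fst p) (fst q) (fst r)) F) F) F"
    by (intro list_sum_cong refl R.list_sum_ldistr[symmetric]) (use sc fc bc F1 in auto)
  finally show ?thesis by (simp add: split_def)
qed

lemma tensor3_eqI:
  assumes M: "module R M" and F: "frame R M F"
    and s: "set s \<subseteq> carrier M \<times> carrier M \<times> carrier M" "set t \<subseteq> carrier M \<times> carrier M \<times> carrier M"
    and eq: "\<And>p q r. p \<in> set F \<Longrightarrow> q \<in> set F \<Longrightarrow> r \<in> set F \<Longrightarrow>
      list_sum R (\<lambda>(x, y, z). snd p x \<otimes>\<^bsub>R\<^esub> (snd q y \<otimes>\<^bsub>R\<^esub> snd r z)) s = list_sum R (\<lambda>(x, y, z). snd p x \<otimes>\<^bsub>R\<^esub> (snd q y \<otimes>\<^bsub>R\<^esub> snd r z)) t"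
  shows "tensor3_eq R M s t"
  unfolding tensor3_eq_def
  using trilinear_expand[OF M F _ s(1)] trilinear_expand[OF M F _ s(2)] eq
  by (simp cong: list_sum_cong)


section \<open>The action on cosets\<close>

context galois_extension
begin

abbreviation "S \<equiv> galois_cosets E K L"
abbreviation "P \<equiv> BijGroup S"
abbreviation "lam \<equiv> left_translation E K L"

sublocale P: group P by (rule group_BijGroup)

lemma subgroup_B: "subgroup B G"
proof (rule G.subgroupI)
  have sub: "subgroup B (BijGroup (carrier E))" using subgroup_galois[OF field_axioms subfieldE(3)[OF L]] .
  have sub': "subgroup (carrier G) (BijGroup (carrier E))" using subgroup_galois[OF field_axioms subfieldE(3)[OF K]] .
  have Gm: "x \<otimes>\<^bsub>G\<^esub> y = x \<otimes>\<^bsub>BijGroup (carrier E)\<^esub> y" for x y by (simp add: galois_group_def)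
  show BG: "B \<subseteq> carrier G" using KL by (auto simp: galois_group_def)
  show "B \<noteq> {}" using subgroup.one_closed[OF sub] by auto
  fix a b assume ab: "a \<in> B" "b \<in> B"
  show "a \<otimes>\<^bsub>G\<^esub> b \<in> B" using subgroup.m_closed[OF sub ab] by (simp add: Gm)
  have "inv\<^bsub>G\<^esub> a = inv\<^bsub>BijGroup (carrier E)\<^esub> a"
    using group.m_inv_consistent[OF group_BijGroup sub', of a] ab(1) BG by (auto simp: galois_group_def)
  thus "inv\<^bsub>G\<^esub> a \<in> B" using subgroup.m_inv_closed[OF sub ab(1)] by simp
qed

lemma BG: "B \<subseteq> carrier G" using subgroup.subset[OF subgroup_B] .

lemma coset_iff: "s \<in> S \<longleftrightarrow> (\<exists>g\<in>carrier G. s = g <#\<^bsub>G\<^esub> B)"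
  by (auto simp: galois_cosets_def LCOSETS_def)

lemma B_coset: "B \<in> S"
  using coset_iff G.lcos_mult_one[OF BG] by (metis G.one_closed)

lemma finite_cosets: "finite S"
proof -
  have "S = (\<lambda>g. g <#\<^bsub>G\<^esub> B) ` carrier G" using coset_iff by auto
  thus ?thesis using finite_G by simp
qed

lemma lam_apply: "s \<in> S \<Longrightarrow> lam g s = g <#\<^bsub>G\<^esub> s"
  by (simp add: left_translation_def)

lemma lam_coset: "g \<in> carrier G \<Longrightarrow> h \<in> carrier G \<Longrightarrow> lam g (h <#\<^bsub>G\<^esub> B) = (g \<otimes>\<^bsub>G\<^esub> h) <#\<^bsub>G\<^esub> B"
  using lam_apply[of "h <#\<^bsub>G\<^esub> B" g] coset_iff G.lcos_m_assoc[OF BG] by auto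

lemma lam_B: "g \<in> carrier G \<Longrightarrow> lam g B = g <#\<^bsub>G\<^esub> B"
  using lam_apply[OF B_coset] .

lemma coset_lamE:
  assumes "s \<in> S" obtains g where "g \<in> carrier G" "s = lam g B"
  using assms coset_iff lam_B by metis

lemma lam_closed: "g \<in> carrier G \<Longrightarrow> s \<in> S \<Longrightarrow> lam g s \<in> S"
  using coset_iff lam_coset by (metis G.m_closed)

lemma lam_mult: "g \<in> carrier G \<Longrightarrow> h \<in> carrier G \<Longrightarrow> s \<in> S \<Longrightarrow> lam (g \<otimes>\<^bsub>G\<^esub> h) s = lam g (lam h s)"
  using coset_iff lam_coset by (metis G.m_closed G.m_assoc)

lemma lam_one: "s \<in> S \<Longrightarrow> lam \<one>\<^bsub>G\<^esub> s = s"
  using coset_iff lam_coset by (metis G.one_closed G.l_one)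

lemma action_lam: "is_action S lam"
  unfolding is_action_def using lam_closed lam_mult lam_one by auto

lemma lam_inv: "g \<in> carrier G \<Longrightarrow> s \<in> S \<Longrightarrow> lam (inv\<^bsub>G\<^esub> g) (lam g s) = s"
   "g \<in> carrier G \<Longrightarrow> s \<in> S \<Longrightarrow> lam g (lam (inv\<^bsub>G\<^esub> g) s) = s"
  using lam_mult[of "inv\<^bsub>G\<^esub> g" g s] lam_mult[of g "inv\<^bsub>G\<^esub> g" s] lam_one by auto

lemma lam_P: "g \<in> carrier G \<Longrightarrow> lam g \<in> carrier P"
proof -
  assume g: "g \<in> carrier G"
  have "bij_betw (lam g) S S"
    by (rule bij_betw_byWitness[of _ "lam (inv\<^bsub>G\<^esub> g)"]) (use g lam_inv lam_closed in auto)
  thus ?thesis by (simp add: BijGroup_def Bij_def left_translation_def)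
qed

lemma P_mult: "n \<in> carrier P \<Longrightarrow> m \<in> carrier P \<Longrightarrow> s \<in> S \<Longrightarrow> (n \<otimes>\<^bsub>P\<^esub> m) s = n (m s)"
  by (simp add: BijGroup_def compose_eq)

lemma P_one: "s \<in> S \<Longrightarrow> \<one>\<^bsub>P\<^esub> s = s" by (simp add: BijGroup_def)

lemma P_closed: "n \<in> carrier P \<Longrightarrow> s \<in> S \<Longrightarrow> n s \<in> S"
  by (auto simp: BijGroup_def Bij_def bij_betw_def)

lemma P_inv: "n \<in> carrier P \<Longrightarrow> s \<in> S \<Longrightarrow> (inv\<^bsub>P\<^esub> n) (n s) = s"
   "n \<in> carrier P \<Longrightarrow> s \<in> S \<Longrightarrow> n ((inv\<^bsub>P\<^esub> n) s) = s"
  using P_mult[of "inv\<^bsub>P\<^esub> n" n s] P_mult[of n "inv\<^bsub>P\<^esub> n" s] P_one by auto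

lemma P_eqI: "n \<in> carrier P \<Longrightarrow> m \<in> carrier P \<Longrightarrow> (\<And>s. s \<in> S \<Longrightarrow> n s = m s) \<Longrightarrow> n = m"
  by (rule extensionalityI[of _ S]) (auto simp: BijGroup_def Bij_def)

lemma lam_P_mult: "g \<in> carrier G \<Longrightarrow> h \<in> carrier G \<Longrightarrow> lam (g \<otimes>\<^bsub>G\<^esub> h) = lam g \<otimes>\<^bsub>P\<^esub> lam h"
  by (rule P_eqI) (auto simp: lam_P P_mult lam_mult)

lemma lam_P_one: "lam \<one>\<^bsub>G\<^esub> = \<one>\<^bsub>P\<^esub>"
  by (rule P_eqI) (auto simp: lam_P P_one lam_one)

lemma lam_P_inv: "g \<in> carrier G \<Longrightarrow> inv\<^bsub>P\<^esub> (lam g) = lam (inv\<^bsub>G\<^esub> g)"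
  by (rule P.inv_equality) (auto simp: lam_P lam_P_mult[symmetric] lam_P_one)

lemma conj_def': "g \<in> carrier G \<Longrightarrow> conj_translation E K L g n = lam g \<otimes>\<^bsub>P\<^esub> n \<otimes>\<^bsub>P\<^esub> lam (inv\<^bsub>G\<^esub> g)"
  by (simp add: conj_translation_def lam_P_inv)

lemma conj_apply:
  "g \<in> carrier G \<Longrightarrow> n \<in> carrier P \<Longrightarrow> s \<in> S \<Longrightarrow>
     conj_translation E K L g n s = lam g (n (lam (inv\<^bsub>G\<^esub> g) s))"
  by (simp add: conj_def' P_mult lam_P lam_closed)

text \<open>The embedding of \<open>L\<close> into \<open>E\<close> named by a coset. The choice of
  representative is harmless on \<open>L\<close>, and values at arguments outside \<open>L\<close>
  carry no meaning.\<close>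

definition coset_eval :: "('e \<Rightarrow> 'e) set \<Rightarrow> 'e \<Rightarrow> 'e" where
  "coset_eval s x = (SOME g. g \<in> s) x"

lemma coset_eval_eq:
  assumes "s \<in> S" "g \<in> s" "x \<in> L" shows "coset_eval s x = g x"
proof -
  obtain h where h: "h \<in> carrier G" "s = h <#\<^bsub>G\<^esub> B" using assms(1) coset_iff by blast
  have hx: "g' x = h x" if g': "g' \<in> s" for g'
  proof -
    obtain b where "b \<in> B" "g' = h \<otimes>\<^bsub>G\<^esub> b" using g' h by (auto simp: l_coset_def)
    thus ?thesis using G_mult[OF h(1), of b x] BG assms(3) galois_groupD(2)[of b E L x] by auto
  qed
  have "(SOME g. g \<in> s) \<in> s" by (rule someI[of "\<lambda>g. g \<in> s"]) (rule assms(2))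
  thus ?thesis using hx[of "SOME g. g \<in> s"] hx[OF assms(2)] by (simp add: coset_eval_def)
qed

lemma coset_eval_B: "x \<in> L \<Longrightarrow> coset_eval B x = x"
  using coset_eval_eq[OF B_coset subgroup.one_closed[OF subgroup_B]] G_one by simp

lemma coset_eval_coset: "g \<in> carrier G \<Longrightarrow> x \<in> L \<Longrightarrow> coset_eval (lam g B) x = g x"
  using coset_eval_eq[of "lam g B" g x] G.lcos_self[OF _ subgroup_B] lam_B lam_closed[OF _ B_coset] by simp

lemma coset_eval_lam:
  assumes "g \<in> carrier G" "s \<in> S" "x \<in> L" shows "coset_eval (lam g s) x = g (coset_eval s x)"
proof -
  obtain h where h: "h \<in> carrier G" "s = lam h B" using coset_lamE[OF assms(2)] .
  show ?thesis using assms h coset_eval_coset[of h x] coset_eval_coset[of "g \<otimes>\<^bsub>G\<^esub> h" x]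
      lam_mult[OF assms(1) h(1) B_coset] G_mult[OF assms(1) h(1), of x] by simp
qed

lemma coset_eval_closed [simp, intro]: "s \<in> S \<Longrightarrow> x \<in> L \<Longrightarrow> coset_eval s x \<in> carrier E"
  by (metis coset_lamE coset_eval_coset G_closed L_carrier)

lemma coset_eval_hom:
  assumes "s \<in> S" "x \<in> L" "y \<in> L"
  shows "coset_eval s (x \<otimes> y) = coset_eval s x \<otimes> coset_eval s y"
    "coset_eval s (x \<oplus> y) = coset_eval s x \<oplus> coset_eval s y"
    "coset_eval s \<one> = \<one>" "k \<in> K \<Longrightarrow> coset_eval s k = k"
proof -
  obtain g where g: "g \<in> carrier G" "s = lam g B" using coset_lamE[OF assms(1)] .
  note sL = subfieldE(1)[OF L]
  have L': "x \<otimes> y \<in> L" "x \<oplus> y \<in> L" "\<one> \<in> L" using subringE(3,6,7)[OF sL] assms by auto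
  show "coset_eval s (x \<otimes> y) = coset_eval s x \<otimes> coset_eval s y"
    "coset_eval s (x \<oplus> y) = coset_eval s x \<oplus> coset_eval s y" "coset_eval s \<one> = \<one>"
    using g L' assms(2,3) by (simp_all add: coset_eval_coset)
  show "k \<in> K \<Longrightarrow> coset_eval s k = k" using g KL by (auto simp: coset_eval_coset G_K)
qed

lemma fixed_B: "x \<in> carrier E \<Longrightarrow> (\<And>b. b \<in> B \<Longrightarrow> b x = x) \<Longrightarrow> x \<in> L"
  using fixed_L by blast

lemma lam_B_fix: "b \<in> B \<Longrightarrow> lam b B = B"
  using lam_B BG G.coset_join3[OF _ subgroup_B] by auto

text \<open>\<open>B\<close> fixes the trivial coset, so it fixes the value there. Together with
  \<open>coset_eval\<close> this identifies \<open>L\<close> with the equivariant functions on the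
  cosets.\<close>

lemma equivariant_B_in_L: "equivariant S lam u \<Longrightarrow> u B \<in> L"
  by (rule fixed_B) (use B_coset lam_B_fix BG in \<open>auto simp: equivariant_def, metis subsetD\<close>)

end


section \<open>The Hopf algebra of a regular subgroup\<close>

locale regular_normalized = galois_extension +
  fixes N :: "'a coset_perm set"
  assumes N: "N \<in> greither_pareigis E K L"
begin

abbreviation "cj \<equiv> conj_translation E K L"
abbreviation "A \<equiv> fixed_group_algebra E K L N"
abbreviation "H \<equiv> gp_hopf E K L N"
abbreviation "R0 \<equiv> E\<lparr>carrier := K\<rparr>"
abbreviation pm (infixl \<open>\<cdot>\<close> 70) where "m \<cdot> n \<equiv> m \<otimes>\<^bsub>P\<^esub> n"
abbreviation "iv \<equiv> m_inv P"

lemma N_subgroup: "subgroup N P"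
  using N by (simp add: greither_pareigis_def regular_subgroup_def)

lemma N_regular: "s \<in> S \<Longrightarrow> t \<in> S \<Longrightarrow> \<exists>!n. n \<in> N \<and> n s = t"
  using N by (simp add: greither_pareigis_def regular_subgroup_def)

lemma N_P: "n \<in> N \<Longrightarrow> n \<in> carrier P"
  using subgroup.subset[OF N_subgroup] by blast

lemma N_closed [simp]: "n \<in> N \<Longrightarrow> m \<in> N \<Longrightarrow> n \<cdot> m \<in> N" "n \<in> N \<Longrightarrow> iv n \<in> N" "\<one>\<^bsub>P\<^esub> \<in> N"
  using N_subgroup by (auto simp: subgroup.m_closed subgroup.m_inv_closed subgroup.one_closed)

lemma N_S [simp]: "n \<in> N \<Longrightarrow> s \<in> S \<Longrightarrow> n s \<in> S"
  using P_closed N_P by blast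

lemma N_simps:
  assumes "n \<in> N" "m \<in> N"
  shows "iv (n \<cdot> m) = iv m \<cdot> iv n" "iv (iv n) = n" "n \<cdot> (iv n \<cdot> m) = m" "iv n \<cdot> (n \<cdot> m) = m"
    "n \<cdot> \<one>\<^bsub>P\<^esub> = n" "\<one>\<^bsub>P\<^esub> \<cdot> n = n" "n \<cdot> iv n = \<one>\<^bsub>P\<^esub>" "iv n \<cdot> n = \<one>\<^bsub>P\<^esub>"
proof -
  note c = N_P[OF assms(1)] N_P[OF assms(2)]
  show "iv (n \<cdot> m) = iv m \<cdot> iv n" by (rule P.inv_mult_group[OF c])
  show "iv (iv n) = n" by (rule P.inv_inv[OF c(1)])
  show "n \<cdot> (iv n \<cdot> m) = m" "iv n \<cdot> (n \<cdot> m) = m" using c by (simp_all add: P.m_assoc[symmetric])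
  show "n \<cdot> \<one>\<^bsub>P\<^esub> = n" "\<one>\<^bsub>P\<^esub> \<cdot> n = n" "n \<cdot> iv n = \<one>\<^bsub>P\<^esub>" "iv n \<cdot> n = \<one>\<^bsub>P\<^esub>" using c by simp_all
qed

lemma N_assoc: "n \<in> N \<Longrightarrow> m \<in> N \<Longrightarrow> l \<in> N \<Longrightarrow> (n \<cdot> m) \<cdot> l = n \<cdot> (m \<cdot> l)"
  by (simp add: P.m_assoc N_P)

lemma N_cancel: "n \<in> N \<Longrightarrow> m \<in> N \<Longrightarrow> l \<in> N \<Longrightarrow> n \<cdot> m = n \<cdot> l \<longleftrightarrow> m = l"
  by (metis N_simps(4))

lemma cj_closed [simp]: "g \<in> carrier G \<Longrightarrow> n \<in> N \<Longrightarrow> cj g n \<in> N"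
  using N by (simp add: greither_pareigis_def)

lemma cj_mult: "g \<in> carrier G \<Longrightarrow> n \<in> N \<Longrightarrow> m \<in> N \<Longrightarrow> cj g (n \<cdot> m) = cj g n \<cdot> cj g m"
  by (rule P_eqI) (auto simp: N_P conj_apply P_mult N_P[OF cj_closed] lam_closed lam_inv)

lemma cj_one: "g \<in> carrier G \<Longrightarrow> cj g \<one>\<^bsub>P\<^esub> = \<one>\<^bsub>P\<^esub>"
  by (rule P_eqI) (auto simp: N_P conj_apply N_P[OF cj_closed] lam_closed lam_inv P_one)

lemma cj_inv: "g \<in> carrier G \<Longrightarrow> n \<in> N \<Longrightarrow> cj g (iv n) = iv (cj g n)"
  by (rule P.inv_equality[symmetric])
     (simp_all add: N_P cj_mult[symmetric] N_simps cj_one N_P[OF cj_closed])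

lemma action_cj: "is_action N cj"
  unfolding is_action_def
proof (intro conjI ballI)
  show "cj g n \<in> N" if "g \<in> carrier G" "n \<in> N" for g n using that by simp
  show "cj \<one>\<^bsub>G\<^esub> n = n" if "n \<in> N" for n
    by (rule P_eqI) (use that in \<open>auto simp: N_P conj_apply N_P[OF cj_closed] lam_one\<close>)
  show "cj (g \<otimes>\<^bsub>G\<^esub> h) n = cj g (cj h n)" if "g \<in> carrier G" "h \<in> carrier G" "n \<in> N" for g h n
    by (rule P_eqI)
       (use that in \<open>auto simp: N_P conj_apply N_P[OF cj_closed] lam_mult lam_closed G.inv_mult_group\<close>)
qed

lemma finite_N: "finite N"
proof (rule inj_on_finite[OF _ _ finite_cosets])
  show "inj_on (\<lambda>n. n B) N"
  proof (rule inj_onI)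
    fix n m assume "n \<in> N" "m \<in> N" "n B = m B"
    thus "n = m" using N_regular[OF B_coset, of "m B"] B_coset by auto
  qed
  show "(\<lambda>n. n B) ` N \<subseteq> S" using B_coset by auto
qed

text \<open>A fixed enumeration of \<open>N\<close>: sums over the group become list sums, the kind
  of sum that tensors use, so the two can be interchanged by one rule.\<close>

definition "ns = (SOME xs. distinct xs \<and> set xs = N)"

lemma ns: "distinct ns" "set ns = N"
  using someI_ex[of "\<lambda>xs. distinct xs \<and> set xs = N"] finite_distinct_list[OF finite_N]
  unfolding ns_def by blast+

abbreviation "SN f \<equiv> list_sum E f ns"

lemma SN_closed [simp]: "(\<And>n. n \<in> N \<Longrightarrow> f n \<in> carrier E) \<Longrightarrow> SN f \<in> carrier E"
  by (rule list_sum_closed) (simp add: ns)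

lemma SN_cong: "(\<And>n. n \<in> N \<Longrightarrow> f n = g n) \<Longrightarrow> SN f = SN g"
  by (rule list_sum_cong) (auto simp: ns)

lemma SN_finsum: "(\<And>n. n \<in> N \<Longrightarrow> f n \<in> carrier E) \<Longrightarrow> finsum E f N = SN f"
  using finsum_list_sum[OF ns(1), of f] by (simp add: ns)

lemma SN_delta:
  assumes "n \<in> N" "f n \<in> carrier E"
  shows "SN (\<lambda>m. if m = n then f m else \<zero>) = f n" "SN (\<lambda>m. if n = m then f m else \<zero>) = f n"
  using list_sum_delta[OF ns(1), of n f] assms by (simp_all add: ns)

lemma SN_swap: "(\<And>n m. n \<in> N \<Longrightarrow> m \<in> N \<Longrightarrow> f n m \<in> carrier E) \<Longrightarrow>
    SN (\<lambda>n. SN (f n)) = SN (\<lambda>m. SN (\<lambda>n. f n m))"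
  by (rule list_sum_swap) (simp add: ns)

lemma SN_swap_list: "(\<And>n x. n \<in> N \<Longrightarrow> x \<in> set xs \<Longrightarrow> f n x \<in> carrier E) \<Longrightarrow>
    SN (\<lambda>n. list_sum E (f n) xs) = list_sum E (\<lambda>x. SN (\<lambda>n. f n x)) xs"
  by (rule list_sum_swap) (simp add: ns)

lemma SN_l: "c \<in> carrier E \<Longrightarrow> (\<And>n. n \<in> N \<Longrightarrow> f n \<in> carrier E) \<Longrightarrow> c \<otimes> SN f = SN (\<lambda>n. c \<otimes> f n)"
  by (rule list_sum_rdistr) (auto simp: ns)

lemma SN_r: "c \<in> carrier E \<Longrightarrow> (\<And>n. n \<in> N \<Longrightarrow> f n \<in> carrier E) \<Longrightarrow> SN f \<otimes> c = SN (\<lambda>n. f n \<otimes> c)"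
  by (rule list_sum_ldistr) (auto simp: ns)

lemma SN_add: "(\<And>n. n \<in> N \<Longrightarrow> f n \<in> carrier E) \<Longrightarrow> (\<And>n. n \<in> N \<Longrightarrow> g n \<in> carrier E) \<Longrightarrow>
    SN (\<lambda>n. f n \<oplus> g n) = SN f \<oplus> SN g"
  by (rule list_sum_add) (auto simp: ns)

lemma SN_bij: "bij_betw h N N \<Longrightarrow> (\<And>n. n \<in> N \<Longrightarrow> f n \<in> carrier E) \<Longrightarrow> SN (\<lambda>n. f (h n)) = SN f"
  using list_sum_reindex[OF ns(1) ns(1), of h f] by (simp add: ns)

lemma SN_left: "m \<in> N \<Longrightarrow> (\<And>n. n \<in> N \<Longrightarrow> f n \<in> carrier E) \<Longrightarrow> SN (\<lambda>n. f (m \<cdot> n)) = SN f"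
  by (rule SN_bij, rule bij_betw_byWitness[of _ "\<lambda>n. iv m \<cdot> n"]) (auto simp: N_simps)

lemma SN_inv: "(\<And>n. n \<in> N \<Longrightarrow> f n \<in> carrier E) \<Longrightarrow> SN (\<lambda>n. f (iv n)) = SN f"
  by (rule SN_bij, rule bij_betw_byWitness[of _ "iv"]) (auto simp: N_simps)

lemma cj_cancel: "g \<in> carrier G \<Longrightarrow> n \<in> N \<Longrightarrow> cj (inv\<^bsub>G\<^esub> g) (cj g n) = n"
  "g \<in> carrier G \<Longrightarrow> n \<in> N \<Longrightarrow> cj g (cj (inv\<^bsub>G\<^esub> g) n) = n"
  by (rule P_eqI; auto simp: N_P conj_apply N_P[OF cj_closed] lam_closed lam_inv)+

lemma SN_cj: "g \<in> carrier G \<Longrightarrow> (\<And>n. n \<in> N \<Longrightarrow> f n \<in> carrier E) \<Longrightarrow> SN (\<lambda>n. f (cj g n)) = SN f"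
  by (rule SN_bij, rule bij_betw_byWitness[of _ "cj (inv\<^bsub>G\<^esub> g)"]) (auto simp: cj_cancel)

lemma G_SN: "g \<in> carrier G \<Longrightarrow> (\<And>n. n \<in> N \<Longrightarrow> f n \<in> carrier E) \<Longrightarrow> g (SN f) = SN (\<lambda>n. g (f n))"
  by (rule G_list_sum) (auto simp: ns)

text \<open>A Galois automorphism only permutes the terms.\<close>

lemma SN_K:
  assumes "\<And>n. n \<in> N \<Longrightarrow> f n \<in> carrier E" "\<And>g n. g \<in> carrier G \<Longrightarrow> n \<in> N \<Longrightarrow> f (cj g n) = g (f n)"
  shows "SN f \<in> K"
proof (rule fixed_K)
  show "SN f \<in> carrier E" using assms(1) by simp
  fix g assume g: "g \<in> carrier G"
  have "g (SN f) = SN (\<lambda>n. f (cj g n))"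
    using G_SN[OF g, of f] assms g by (simp cong: SN_cong)
  thus "g (SN f) = SN f" using SN_cj[OF g, of f] assms by simp
qed

lemma A_D:
  assumes "c \<in> A"
  shows "n \<in> N \<Longrightarrow> c n \<in> carrier E" "g \<in> carrier G \<Longrightarrow> n \<in> N \<Longrightarrow> c (cj g n) = g (c n)" "c \<in> extensional N"
  using assms by (auto simp: fixed_group_algebra_def PiE_def)

lemmas A_closed [simp] = A_D(1)

lemma A_I:
  assumes "\<And>n. n \<in> N \<Longrightarrow> f n \<in> carrier E" "\<And>g n. g \<in> carrier G \<Longrightarrow> n \<in> N \<Longrightarrow> f (cj g n) = g (f n)"
  shows "restrict f N \<in> A"
  using assms by (auto simp: fixed_group_algebra_def)

lemma A_eqI: "c \<in> A \<Longrightarrow> d \<in> A \<Longrightarrow> (\<And>n. n \<in> N \<Longrightarrow> c n = d n) \<Longrightarrow> c = d"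
  by (rule extensionalityI[of _ N]) (auto simp: A_D(3))

lemma H_carrier [simp]: "carrier H = A" by (simp add: gp_hopf_def)

lemma H_apply [simp]:
  assumes "n \<in> N"
  shows "(c \<oplus>\<^bsub>H\<^esub> d) n = c n \<oplus> d n" "(k \<odot>\<^bsub>H\<^esub> c) n = k \<otimes> c n" "\<zero>\<^bsub>H\<^esub> n = \<zero>"
    "\<one>\<^bsub>H\<^esub> n = (if n = \<one>\<^bsub>P\<^esub> then \<one> else \<zero>)" "antipode H c n = c (iv n)"
  using assms by (simp_all add: gp_hopf_def)

lemma H_mult [simp]:
  assumes "c \<in> A" "d \<in> A" "n \<in> N"
  shows "(c \<otimes>\<^bsub>H\<^esub> d) n = SN (\<lambda>m. c m \<otimes> d (iv m \<cdot> n))"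
  using assms SN_finsum[of "\<lambda>m. c m \<otimes> d (iv m \<cdot> n)"] by (simp add: gp_hopf_def)

lemma H_counit: "c \<in> A \<Longrightarrow> counit H c = SN c"
  using SN_finsum[of c] by (simp add: gp_hopf_def)

lemma H_closed [simp]:
  assumes "c \<in> A" "d \<in> A"
  shows "c \<oplus>\<^bsub>H\<^esub> d \<in> A" "k \<in> K \<Longrightarrow> k \<odot>\<^bsub>H\<^esub> c \<in> A" "\<zero>\<^bsub>H\<^esub> \<in> A" "\<one>\<^bsub>H\<^esub> \<in> A" "antipode H c \<in> A" "c \<otimes>\<^bsub>H\<^esub> d \<in> A"
proof -
  show "c \<oplus>\<^bsub>H\<^esub> d \<in> A" using A_I[of "\<lambda>n. c n \<oplus> d n"] assms by (simp add: gp_hopf_def A_D(2))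
  show "k \<in> K \<Longrightarrow> k \<odot>\<^bsub>H\<^esub> c \<in> A" using A_I[of "\<lambda>n. k \<otimes> c n"] assms by (simp add: gp_hopf_def A_D(2) G_K)
  show "\<zero>\<^bsub>H\<^esub> \<in> A" using A_I[of "\<lambda>n. \<zero>"] by (simp add: gp_hopf_def)
  have cj1: "cj g n = \<one>\<^bsub>P\<^esub> \<longleftrightarrow> n = \<one>\<^bsub>P\<^esub>" if "g \<in> carrier G" "n \<in> N" for g n
    using that cj_one cj_cancel(1) by (metis N_closed(3))
  show "\<one>\<^bsub>H\<^esub> \<in> A" using A_I[of "\<lambda>n. if n = \<one>\<^bsub>P\<^esub> then \<one> else \<zero>"] by (simp add: gp_hopf_def cj1)
  show "antipode H c \<in> A" using A_I[of "\<lambda>n. c (iv n)"] assms by (simp add: gp_hopf_def A_D(2) cj_inv[symmetric])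
  let ?f = "\<lambda>n. SN (\<lambda>m. c m \<otimes> d (iv m \<cdot> n))"
  have "restrict ?f N \<in> A"
  proof (rule A_I)
    show "?f n \<in> carrier E" if "n \<in> N" for n using that assms by simp
    fix g n assume g: "g \<in> carrier G" "n \<in> N"
    \<comment> \<open>The convolution is reindexed by conjugation, which is an automorphism of
      \<open>N\<close>.\<close>
    have "?f (cj g n) = SN (\<lambda>m. c (cj g m) \<otimes> d (iv (cj g m) \<cdot> cj g n))"
      using g assms by (intro SN_cj[symmetric]) simp_all
    also have "\<dots> = SN (\<lambda>m. g (c m \<otimes> d (iv m \<cdot> n)))"
      by (rule SN_cong) (use g assms in \<open>simp add: cj_inv[symmetric] cj_mult[symmetric] A_D(2)\<close>)
    also have "\<dots> = g (?f n)" using g assms by (intro G_SN[symmetric]) simp_all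
    finally show "?f (cj g n) = g (?f n)" .
  qed
  thus "c \<otimes>\<^bsub>H\<^esub> d \<in> A"
    using SN_finsum[of "\<lambda>m. c m \<otimes> d (iv m \<cdot> n)" for n] assms
    by (simp add: gp_hopf_def cong: restrict_cong)
qed

lemma field_R0: "field R0" using subfield_iff(2)[OF K] .

lemma abelian_H: "abelian_group H"
proof (rule abelian_groupI)
  fix c d e assume cde: "c \<in> carrier H" "d \<in> carrier H" "e \<in> carrier H"
  show "c \<oplus>\<^bsub>H\<^esub> d \<oplus>\<^bsub>H\<^esub> e = c \<oplus>\<^bsub>H\<^esub> (d \<oplus>\<^bsub>H\<^esub> e)" by (rule A_eqI) (use cde in \<open>simp_all add: a_assoc\<close>)
next
  fix c d assume cde: "c \<in> carrier H" "d \<in> carrier H"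
  show "c \<oplus>\<^bsub>H\<^esub> d = d \<oplus>\<^bsub>H\<^esub> c" by (rule A_eqI) (use cde in \<open>simp_all add: a_comm\<close>)
next
  fix c assume cde: "c \<in> carrier H"
  show "\<zero>\<^bsub>H\<^esub> \<oplus>\<^bsub>H\<^esub> c = c" by (rule A_eqI) (use cde H_closed(3)[of c c] in simp_all)
  let ?m = "restrict (\<lambda>n. \<ominus> c n) N"
  have "?m \<in> A"
  proof (rule A_I)
    fix g n assume g: "g \<in> carrier G" "n \<in> N"
    interpret h: ring_hom_ring E E g using G_ring_hom[OF g(1)] .
    show "\<ominus> c (cj g n) = g (\<ominus> c n)"
      using cde g by (simp add: A_D(2))
  qed (use cde in simp)
  moreover have "?m \<oplus>\<^bsub>H\<^esub> c = \<zero>\<^bsub>H\<^esub>"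
    by (rule A_eqI) (use cde \<open>?m \<in> A\<close> in \<open>simp_all add: l_neg\<close>)
  ultimately show "\<exists>m\<in>carrier H. m \<oplus>\<^bsub>H\<^esub> c = \<zero>\<^bsub>H\<^esub>" by auto
next
  have "restrict (\<lambda>n. \<zero>) N \<in> A" by (rule A_I) auto
  thus "\<zero>\<^bsub>H\<^esub> \<in> carrier H" by (simp add: gp_hopf_def)
qed simp_all

lemma module_H: "module R0 H"
proof (rule moduleI)
  show "cring R0" using field_R0 by (simp add: field_def domain_def)
  show "abelian_group H" by (rule abelian_H)
qed (auto intro!: A_eqI simp: l_distr r_distr m_assoc subringE[OF subfieldE(1)[OF K]])

lemma ring_H: "ring H"
proof (rule ringI)
  show "abelian_group H" by (rule abelian_H)
  show "monoid H"
  proof (rule monoidI)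
    fix c d e assume "c \<in> carrier H" "d \<in> carrier H" "e \<in> carrier H"
    hence c: "c \<in> A" "d \<in> A" "e \<in> A" by auto
    show "c \<otimes>\<^bsub>H\<^esub> d \<otimes>\<^bsub>H\<^esub> e = c \<otimes>\<^bsub>H\<^esub> (d \<otimes>\<^bsub>H\<^esub> e)"
    proof (rule A_eqI)
      fix n assume n: "n \<in> N"
      have "(c \<otimes>\<^bsub>H\<^esub> d \<otimes>\<^bsub>H\<^esub> e) n = SN (\<lambda>m. SN (\<lambda>l. c l \<otimes> d (iv l \<cdot> m)) \<otimes> e (iv m \<cdot> n))"
        using c n by (simp cong: SN_cong)
      also have "\<dots> = SN (\<lambda>m. SN (\<lambda>l. c l \<otimes> d (iv l \<cdot> m) \<otimes> e (iv m \<cdot> n)))"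
        using c n by (intro SN_cong SN_r) simp_all
      also have "\<dots> = SN (\<lambda>l. SN (\<lambda>m. c l \<otimes> d (iv l \<cdot> m) \<otimes> e (iv m \<cdot> n)))"
        using c n by (intro SN_swap) simp
      \<comment> \<open>Substituting \<open>m = l k\<close> turns the nested convolutions into one
        sum over factorizations of \<open>n\<close> into three factors.\<close>
      also have "\<dots> = SN (\<lambda>l. SN (\<lambda>k. c l \<otimes> d (iv l \<cdot> (l \<cdot> k)) \<otimes> e (iv (l \<cdot> k) \<cdot> n)))"
        using c n by (intro SN_cong SN_left[symmetric]) simp_all
      also have "\<dots> = SN (\<lambda>l. SN (\<lambda>k. c l \<otimes> (d k \<otimes> e (iv k \<cdot> (iv l \<cdot> n)))))"
        using c n by (intro SN_cong) (simp add: N_simps N_assoc m_assoc)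
      also have "\<dots> = SN (\<lambda>l. c l \<otimes> SN (\<lambda>k. d k \<otimes> e (iv k \<cdot> (iv l \<cdot> n))))"
        using c n by (intro SN_cong SN_l[symmetric]) simp_all
      also have "\<dots> = (c \<otimes>\<^bsub>H\<^esub> (d \<otimes>\<^bsub>H\<^esub> e)) n" using c n by (simp cong: SN_cong)
      finally show "(c \<otimes>\<^bsub>H\<^esub> d \<otimes>\<^bsub>H\<^esub> e) n = (c \<otimes>\<^bsub>H\<^esub> (d \<otimes>\<^bsub>H\<^esub> e)) n" .
    qed (use c in simp_all)
  next
    fix c assume "c \<in> carrier H"
    hence c: "c \<in> A" by simp
    have one: "\<one>\<^bsub>H\<^esub> \<in> A" using H_closed(4)[OF c c] .
    show "\<one>\<^bsub>H\<^esub> \<otimes>\<^bsub>H\<^esub> c = c"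
    proof (rule A_eqI)
      fix n assume n: "n \<in> N"
      have "(\<one>\<^bsub>H\<^esub> \<otimes>\<^bsub>H\<^esub> c) n = SN (\<lambda>m. if m = \<one>\<^bsub>P\<^esub> then c (iv m \<cdot> n) else \<zero>)"
        using c n one by (simp, intro SN_cong) simp
      also have "\<dots> = c n" using c n by (subst SN_delta) (simp_all add: N_simps)
      finally show "(\<one>\<^bsub>H\<^esub> \<otimes>\<^bsub>H\<^esub> c) n = c n" .
    qed (use c one in simp_all)
    show "c \<otimes>\<^bsub>H\<^esub> \<one>\<^bsub>H\<^esub> = c"
    proof (rule A_eqI)
      fix n assume n: "n \<in> N"
      have *: "iv m \<cdot> n = \<one>\<^bsub>P\<^esub> \<longleftrightarrow> m = n" if "m \<in> N" for m
        using that n by (metis N_closed N_simps(3,5,8))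
      have "(c \<otimes>\<^bsub>H\<^esub> \<one>\<^bsub>H\<^esub>) n = SN (\<lambda>m. if m = n then c m else \<zero>)"
        using c n one * by (simp, intro SN_cong) simp
      also have "\<dots> = c n" using c n by (subst SN_delta) simp_all
      finally show "(c \<otimes>\<^bsub>H\<^esub> \<one>\<^bsub>H\<^esub>) n = c n" .
    qed (use c one in simp_all)
  next
    have "restrict (\<lambda>n. \<zero>) N \<in> A" by (rule A_I) auto
    from H_closed(4)[OF this this] show "\<one>\<^bsub>H\<^esub> \<in> carrier H" by simp
  qed simp
next
  fix c d e assume "c \<in> carrier H" "d \<in> carrier H" "e \<in> carrier H"
  hence c: "c \<in> A" "d \<in> A" "e \<in> A" by auto
  show "(c \<oplus>\<^bsub>H\<^esub> d) \<otimes>\<^bsub>H\<^esub> e = c \<otimes>\<^bsub>H\<^esub> e \<oplus>\<^bsub>H\<^esub> d \<otimes>\<^bsub>H\<^esub> e"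
    by (rule A_eqI) (use c in \<open>simp_all add: l_distr SN_add[symmetric] cong: SN_cong\<close>)
  show "e \<otimes>\<^bsub>H\<^esub> (c \<oplus>\<^bsub>H\<^esub> d) = e \<otimes>\<^bsub>H\<^esub> c \<oplus>\<^bsub>H\<^esub> e \<otimes>\<^bsub>H\<^esub> d"
    by (rule A_eqI) (use c in \<open>simp_all add: r_distr SN_add[symmetric] cong: SN_cong\<close>)
qed

end


text \<open>The product functional built from \<open>d\<close> and \<open>d'\<close>, applied to a
  tensor, is a combination of the pointwise values of that tensor. Hence such functionals cannot
  tell apart two lists with the same values.\<close>

lemma (in cring) list_sum_pairing:
  assumes "\<And>m. m \<in> set xs \<Longrightarrow> d m \<in> carrier R" "\<And>n. n \<in> set ys \<Longrightarrow> d' n \<in> carrier R"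
    "\<And>m z. m \<in> set xs \<Longrightarrow> z \<in> set s \<Longrightarrow> f m z \<in> carrier R"
    "\<And>n z. n \<in> set ys \<Longrightarrow> z \<in> set s \<Longrightarrow> g n z \<in> carrier R"
  shows "list_sum R (\<lambda>z. list_sum R (\<lambda>m. d m \<otimes> f m z) xs \<otimes> list_sum R (\<lambda>n. d' n \<otimes> g n z) ys) s =
    list_sum R (\<lambda>m. list_sum R (\<lambda>n. (d m \<otimes> d' n) \<otimes> list_sum R (\<lambda>z. f m z \<otimes> g n z) s) ys) xs"
proof -
  have "list_sum R (\<lambda>z. list_sum R (\<lambda>m. d m \<otimes> f m z) xs \<otimes> list_sum R (\<lambda>n. d' n \<otimes> g n z) ys) s =
      list_sum R (\<lambda>z. list_sum R (\<lambda>m. list_sum R (\<lambda>n. (d m \<otimes> f m z) \<otimes> (d' n \<otimes> g n z)) ys) xs) s"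
    by (intro list_sum_cong refl list_sum_product) (use assms in auto)
  also have "\<dots> = list_sum R (\<lambda>z. list_sum R (\<lambda>m. list_sum R (\<lambda>n. (d m \<otimes> d' n) \<otimes> (f m z \<otimes> g n z)) ys) xs) s"
    by (intro list_sum_cong refl) (use assms in \<open>simp add: m_ac\<close>)
  also have "\<dots> = list_sum R (\<lambda>m. list_sum R (\<lambda>z. list_sum R (\<lambda>n. (d m \<otimes> d' n) \<otimes> (f m z \<otimes> g n z)) ys) s) xs"
    by (rule list_sum_swap) (use assms in auto)
  also have "\<dots> = list_sum R (\<lambda>m. list_sum R (\<lambda>n. list_sum R (\<lambda>z. (d m \<otimes> d' n) \<otimes> (f m z \<otimes> g n z)) s) ys) xs"
    by (intro list_sum_cong refl list_sum_swap) (use assms in auto)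
  also have "\<dots> = list_sum R (\<lambda>m. list_sum R (\<lambda>n. (d m \<otimes> d' n) \<otimes> list_sum R (\<lambda>z. f m z \<otimes> g n z) s) ys) xs"
    by (intro list_sum_cong refl list_sum_rdistr[symmetric]) (use assms in auto)
  finally show ?thesis .
qed

lemma (in cring) list_sum_product_list:
  assumes "\<And>x. x \<in> set xs \<Longrightarrow> f x \<in> carrier R" "\<And>y. y \<in> set ys \<Longrightarrow> g y \<in> carrier R"
  shows "list_sum R f xs \<otimes> list_sum R g ys = list_sum R (\<lambda>z. f (fst z) \<otimes> g (snd z)) (List.product xs ys)"
proof -
  have "list_sum R (\<lambda>z. f (fst z) \<otimes> g (snd z)) (List.product xs ys) =
      list_sum R (\<lambda>x. list_sum R (\<lambda>y. f x \<otimes> g y) ys) xs"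
    unfolding product_concat_map by (subst list_sum_concat) (use assms in auto)
  thus ?thesis using list_sum_product[of xs f ys g] assms by simp
qed

section \<open>The comultiplication and the Hopf algebra axioms\<close>

context regular_normalized
begin

definition "FN = (SOME F. (\<forall>(a, d)\<in>set F. equivariant N cj a \<and> equivariant N cj d) \<and>
           (\<forall>m\<in>N. \<forall>n\<in>N. list_sum E (\<lambda>(a, d). d m \<otimes> a n) F = (if m = n then \<one> else \<zero>)))"

lemma FN:
  shows "p \<in> set FN \<Longrightarrow> n \<in> N \<Longrightarrow> fst p n \<in> carrier E" "p \<in> set FN \<Longrightarrow> n \<in> N \<Longrightarrow> snd p n \<in> carrier E"
    "p \<in> set FN \<Longrightarrow> n \<in> N \<Longrightarrow> g \<in> carrier G \<Longrightarrow> fst p (cj g n) = g (fst p n)"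
    "p \<in> set FN \<Longrightarrow> n \<in> N \<Longrightarrow> g \<in> carrier G \<Longrightarrow> snd p (cj g n) = g (snd p n)"
    "m \<in> N \<Longrightarrow> n \<in> N \<Longrightarrow> list_sum E (\<lambda>p. snd p m \<otimes> fst p n) FN = (if m = n then \<one> else \<zero>)"
proof -
  have "\<exists>F. (\<forall>(a, d)\<in>set F. equivariant N cj a \<and> equivariant N cj d) \<and>
           (\<forall>m\<in>N. \<forall>n\<in>N. list_sum E (\<lambda>(a, d). d m \<otimes> a n) F = (if m = n then \<one> else \<zero>))"
    using dual_frame[of ns cj] action_cj by (simp add: ns)
  from someI_ex[OF this] have *: "(\<forall>(a, d)\<in>set FN. equivariant N cj a \<and> equivariant N cj d)"
     "(\<forall>m\<in>N. \<forall>n\<in>N. list_sum E (\<lambda>(a, d). d m \<otimes> a n) FN = (if m = n then \<one> else \<zero>))"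
    unfolding FN_def[symmetric] by auto
  have **: "equivariant N cj (fst p)" "equivariant N cj (snd p)" if "p \<in> set FN" for p
    using *(1) that by auto
  show "p \<in> set FN \<Longrightarrow> n \<in> N \<Longrightarrow> fst p n \<in> carrier E" "p \<in> set FN \<Longrightarrow> n \<in> N \<Longrightarrow> snd p n \<in> carrier E"
    "p \<in> set FN \<Longrightarrow> n \<in> N \<Longrightarrow> g \<in> carrier G \<Longrightarrow> fst p (cj g n) = g (fst p n)"
    "p \<in> set FN \<Longrightarrow> n \<in> N \<Longrightarrow> g \<in> carrier G \<Longrightarrow> snd p (cj g n) = g (snd p n)"
    using ** unfolding equivariant_def by blast+
  show "m \<in> N \<Longrightarrow> n \<in> N \<Longrightarrow> list_sum E (\<lambda>p. snd p m \<otimes> fst p n) FN = (if m = n then \<one> else \<zero>)"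
    using *(2) by (simp add: split_def)
qed

lemma FN_A: "p \<in> set FN \<Longrightarrow> restrict (fst p) N \<in> A"
  by (rule A_I) (auto simp: FN)

lemma A_conj_pairing: "p \<in> set FN \<Longrightarrow> c \<in> A \<Longrightarrow> SN (\<lambda>m. snd p m \<otimes> c m) \<in> K"
  by (rule SN_K) (auto simp: FN A_D(2))

text \<open>Pairing with an equivariant \<open>d\<close> is linear over \<open>K\<close> and lands
  in \<open>K\<close>, so the two halves of a dual frame become vectors and functionals.\<close>

definition "FH = map (\<lambda>p. (restrict (fst p) N, \<lambda>c. SN (\<lambda>m. snd p m \<otimes> c m))) FN"

lemma H_list_sum:
  assumes "\<And>x. x \<in> set xs \<Longrightarrow> g x \<in> A"
  shows "list_sum H g xs \<in> A" "n \<in> N \<Longrightarrow> list_sum H g xs n = list_sum E (\<lambda>x. g x n) xs"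
proof -
  interpret H: abelian_group H by (rule abelian_H)
  show "list_sum H g xs \<in> A" using H.list_sum_closed[of xs g] assms by simp
  show "n \<in> N \<Longrightarrow> list_sum H g xs n = list_sum E (\<lambda>x. g x n) xs"
    by (induction xs) simp_all
qed

text \<open>Interchanging the sums puts \<open>\<Sum> d(m) a(n)\<close> inside, which is 1 or 0 by
  duality, and only the term \<open>m = n\<close> survives.\<close>

lemma frame_H: "frame R0 H FH"
  unfolding frame_def
proof (intro conjI ballI)
  fix q assume "q \<in> set FH"
  then obtain p where p: "p \<in> set FN" "q = (restrict (fst p) N, \<lambda>c. SN (\<lambda>m. snd p m \<otimes> c m))"
    by (auto simp: FH_def)
  have "linear_form R0 H (\<lambda>c. SN (\<lambda>m. snd p m \<otimes> c m))"
    unfolding linear_form_def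
  proof (intro conjI ballI)
    show "(\<lambda>c. SN (\<lambda>m. snd p m \<otimes> c m)) \<in> carrier H \<rightarrow> carrier R0"
      using A_conj_pairing[OF p(1)] by simp
    fix x y assume "x \<in> carrier H" "y \<in> carrier H"
    hence xy: "x \<in> A" "y \<in> A" by auto
    have "SN (\<lambda>m. snd p m \<otimes> (x \<oplus>\<^bsub>H\<^esub> y) m) = SN (\<lambda>m. snd p m \<otimes> x m \<oplus> snd p m \<otimes> y m)"
      by (rule SN_cong) (use xy FN(2)[OF p(1)] in \<open>simp add: r_distr\<close>)
    also have "\<dots> = SN (\<lambda>m. snd p m \<otimes> x m) \<oplus> SN (\<lambda>m. snd p m \<otimes> y m)"
      by (rule SN_add) (use xy FN(2)[OF p(1)] in simp_all)
    finally show "SN (\<lambda>m. snd p m \<otimes> (x \<oplus>\<^bsub>H\<^esub> y) m) = SN (\<lambda>m. snd p m \<otimes> x m) \<oplus>\<^bsub>R0\<^esub> SN (\<lambda>m. snd p m \<otimes> y m)"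
      by simp
  next
    fix k x assume "k \<in> carrier R0" "x \<in> carrier H"
    hence kx: "k \<in> carrier E" "x \<in> A" by auto
    have "SN (\<lambda>m. snd p m \<otimes> (k \<odot>\<^bsub>H\<^esub> x) m) = SN (\<lambda>m. k \<otimes> (snd p m \<otimes> x m))"
      by (rule SN_cong) (use kx FN(2)[OF p(1)] in \<open>simp add: m_ac\<close>)
    also have "\<dots> = k \<otimes> SN (\<lambda>m. snd p m \<otimes> x m)"
      by (rule SN_l[symmetric]) (use kx FN(2)[OF p(1)] in simp_all)
    finally show "SN (\<lambda>m. snd p m \<otimes> (k \<odot>\<^bsub>H\<^esub> x) m) = k \<otimes>\<^bsub>R0\<^esub> SN (\<lambda>m. snd p m \<otimes> x m)"
      by simp
  qed
  thus "case q of (a, \<phi>) \<Rightarrow> a \<in> carrier H \<and> linear_form R0 H \<phi>"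
    using p FN_A by simp
next
  fix x assume "x \<in> carrier H"
  hence x: "x \<in> A" by simp
  let ?g = "\<lambda>p. SN (\<lambda>m. snd p m \<otimes> x m) \<odot>\<^bsub>H\<^esub> restrict (fst p) N"
  have gA: "?g p \<in> A" if "p \<in> set FN" for p
    using H_closed(2)[OF FN_A[OF that] FN_A[OF that] A_conj_pairing[OF that x]] .
  have "x = list_sum H ?g FN"
  proof (rule A_eqI[OF x H_list_sum(1)[OF gA]])
    fix n assume n: "n \<in> N"
    have "list_sum H ?g FN n = list_sum E (\<lambda>p. ?g p n) FN"
      by (rule H_list_sum(2)[OF gA n])
    also have "\<dots> = list_sum E (\<lambda>p. SN (\<lambda>m. x m \<otimes> (snd p m \<otimes> fst p n))) FN"
    proof (intro list_sum_cong refl)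
      fix p assume p: "p \<in> set FN"
      have "?g p n = SN (\<lambda>m. snd p m \<otimes> x m) \<otimes> fst p n" using n by simp
      also have "\<dots> = SN (\<lambda>m. (snd p m \<otimes> x m) \<otimes> fst p n)"
        by (rule SN_r) (use FN(1,2)[OF p] n x in simp_all)
      also have "\<dots> = SN (\<lambda>m. x m \<otimes> (snd p m \<otimes> fst p n))"
        by (rule SN_cong) (use FN(1,2)[OF p] n x in \<open>simp add: m_ac\<close>)
      finally show "?g p n = SN (\<lambda>m. x m \<otimes> (snd p m \<otimes> fst p n))" .
    qed
    also have "\<dots> = SN (\<lambda>m. list_sum E (\<lambda>p. x m \<otimes> (snd p m \<otimes> fst p n)) FN)"
      by (rule SN_swap_list[symmetric]) (use FN(1,2) n x in simp)
    also have "\<dots> = SN (\<lambda>m. x m \<otimes> list_sum E (\<lambda>p. snd p m \<otimes> fst p n) FN)"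
      by (intro SN_cong list_sum_rdistr[symmetric]) (use FN(1,2) n x in simp_all)
    also have "\<dots> = SN (\<lambda>m. if m = n then x m else \<zero>)"
      by (rule SN_cong) (use FN(5) n x in simp)
    also have "\<dots> = x n" by (rule SN_delta(1)[OF n]) (use n x in simp)
    finally show "x n = list_sum H ?g FN n" by simp
  qed simp
  thus "x = list_sum H (\<lambda>(a, \<phi>). \<phi> x \<odot>\<^bsub>H\<^esub> a) FH" by (simp add: FH_def split_def)
qed

lemma pairing_H:
  assumes "set s \<subseteq> A \<times> A" "p \<in> set FN" "q \<in> set FN"
  shows "list_sum E (\<lambda>z. SN (\<lambda>m. snd p m \<otimes> fst z m) \<otimes> SN (\<lambda>n. snd q n \<otimes> snd z n)) s =
    SN (\<lambda>m. SN (\<lambda>n. (snd p m \<otimes> snd q n) \<otimes> list_sum E (\<lambda>z. fst z m \<otimes> snd z n) s))"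
  by (rule list_sum_pairing) (use assms FN(2) in \<open>auto simp: ns\<close>)

text \<open>The functionals of \<open>FH\<close> are \<open>E\<close>-linear combinations of
  evaluations at points of \<open>N\<close>, so the coordinates of a tensor over \<open>K\<close>
  can be computed from its values on \<open>N \<times> N\<close>.\<close>

lemma H_tensor_eqI:
  assumes s: "set s \<subseteq> A \<times> A" and t: "set t \<subseteq> A \<times> A"
    and eq: "\<And>m n. m \<in> N \<Longrightarrow> n \<in> N \<Longrightarrow>
      list_sum E (\<lambda>z. fst z m \<otimes> snd z n) s = list_sum E (\<lambda>z. fst z m \<otimes> snd z n) t"
  shows "tensor_eq R0 H H s t"
proof (rule tensor_eqI[OF module_H module_H frame_H frame_H])
  show "set s \<subseteq> carrier H \<times> carrier H" "set t \<subseteq> carrier H \<times> carrier H" using s t by auto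
  fix p q assume "p \<in> set FH" "q \<in> set FH"
  then obtain p' q' where p': "p' \<in> set FN" "snd p = (\<lambda>c. SN (\<lambda>m. snd p' m \<otimes> c m))"
    and q': "q' \<in> set FN" "snd q = (\<lambda>c. SN (\<lambda>m. snd q' m \<otimes> c m))" by (auto simp: FH_def)
  show "list_sum R0 (\<lambda>(x, y). snd p x \<otimes>\<^bsub>R0\<^esub> snd q y) s = list_sum R0 (\<lambda>(x, y). snd p x \<otimes>\<^bsub>R0\<^esub> snd q y) t"
    using pairing_H[OF s p'(1) q'(1)] pairing_H[OF t p'(1) q'(1)] eq
    by (simp add: p'(2) q'(2) split_def cong: SN_cong)
qed

lemma H_tensor3_eqI:
  assumes s: "set s \<subseteq> A \<times> A \<times> A" and t: "set t \<subseteq> A \<times> A \<times> A"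
    and eq: "\<And>m n l. m \<in> N \<Longrightarrow> n \<in> N \<Longrightarrow> l \<in> N \<Longrightarrow>
      list_sum E (\<lambda>z. fst z m \<otimes> (fst (snd z) n \<otimes> snd (snd z) l)) s =
      list_sum E (\<lambda>z. fst z m \<otimes> (fst (snd z) n \<otimes> snd (snd z) l)) t"
  shows "tensor3_eq R0 H s t"
proof (rule tensor3_eqI[OF module_H frame_H])
  show "set s \<subseteq> carrier H \<times> carrier H \<times> carrier H" "set t \<subseteq> carrier H \<times> carrier H \<times> carrier H"
    using s t by auto
  fix p q r assume "p \<in> set FH" "q \<in> set FH" "r \<in> set FH"
  then obtain p' q' r' where p': "p' \<in> set FN" "snd p = (\<lambda>c. SN (\<lambda>m. snd p' m \<otimes> c m))"
    and q': "q' \<in> set FN" "snd q = (\<lambda>c. SN (\<lambda>m. snd q' m \<otimes> c m))"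
    and r': "r' \<in> set FN" "snd r = (\<lambda>c. SN (\<lambda>m. snd r' m \<otimes> c m))" by (auto simp: FH_def)
  \<comment> \<open>The last two arguments are merged into one that runs over pairs, so that the
    pairing for two factors applies again.\<close>
  let ?ps = "List.product ns ns"
  have *: "list_sum E (\<lambda>z. SN (\<lambda>m. snd p' m \<otimes> fst z m) \<otimes>
        (SN (\<lambda>m. snd q' m \<otimes> fst (snd z) m) \<otimes> SN (\<lambda>m. snd r' m \<otimes> snd (snd z) m))) s =
      list_sum E (\<lambda>m. list_sum E (\<lambda>w. (snd p' m \<otimes> (snd q' (fst w) \<otimes> snd r' (snd w))) \<otimes>
         list_sum E (\<lambda>z. fst z m \<otimes> (fst (snd z) (fst w) \<otimes> snd (snd z) (snd w))) s) ?ps) ns"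
    if s: "set s \<subseteq> A \<times> A \<times> A" for s
  proof -
    have zA: "fst z \<in> A" "fst (snd z) \<in> A" "snd (snd z) \<in> A" if "z \<in> set s" for z using s that by auto
    have "list_sum E (\<lambda>z. SN (\<lambda>m. snd p' m \<otimes> fst z m) \<otimes>
        (SN (\<lambda>m. snd q' m \<otimes> fst (snd z) m) \<otimes> SN (\<lambda>m. snd r' m \<otimes> snd (snd z) m))) s =
      list_sum E (\<lambda>z. SN (\<lambda>m. snd p' m \<otimes> fst z m) \<otimes>
        list_sum E (\<lambda>w. (snd q' (fst w) \<otimes> snd r' (snd w)) \<otimes> (fst (snd z) (fst w) \<otimes> snd (snd z) (snd w))) ?ps) s"
    proof (intro list_sum_cong refl arg_cong2[of _ _ _ _ "(\<otimes>)"])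
      fix z assume z: "z \<in> set s"
      have "SN (\<lambda>m. snd q' m \<otimes> fst (snd z) m) \<otimes> SN (\<lambda>m. snd r' m \<otimes> snd (snd z) m) =
        list_sum E (\<lambda>w. (snd q' (fst w) \<otimes> fst (snd z) (fst w)) \<otimes> (snd r' (snd w) \<otimes> snd (snd z) (snd w))) ?ps"
        by (rule list_sum_product_list) (use zA[OF z] FN(2) q'(1) r'(1) in \<open>auto simp: ns\<close>)
      also have "\<dots> = list_sum E (\<lambda>w. (snd q' (fst w) \<otimes> snd r' (snd w)) \<otimes> (fst (snd z) (fst w) \<otimes> snd (snd z) (snd w))) ?ps"
        by (intro list_sum_cong refl) (use zA[OF z] FN(2)[OF q'(1)] FN(2)[OF r'(1)] in \<open>auto simp: ns m_ac\<close>)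
      finally show "SN (\<lambda>m. snd q' m \<otimes> fst (snd z) m) \<otimes> SN (\<lambda>m. snd r' m \<otimes> snd (snd z) m) = \<dots>" .
    qed
    also have "\<dots> = list_sum E (\<lambda>m. list_sum E (\<lambda>w. (snd p' m \<otimes> (snd q' (fst w) \<otimes> snd r' (snd w))) \<otimes>
         list_sum E (\<lambda>z. fst z m \<otimes> (fst (snd z) (fst w) \<otimes> snd (snd z) (snd w))) s) ?ps) ns"
      by (rule list_sum_pairing) (use zA FN(2)[OF p'(1)] FN(2)[OF q'(1)] FN(2)[OF r'(1)] in \<open>auto simp: ns\<close>)
    finally show ?thesis .
  qed
  have "list_sum E (\<lambda>m. list_sum E (\<lambda>w. (snd p' m \<otimes> (snd q' (fst w) \<otimes> snd r' (snd w))) \<otimes>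
         list_sum E (\<lambda>z. fst z m \<otimes> (fst (snd z) (fst w) \<otimes> snd (snd z) (snd w))) s) ?ps) ns =
      list_sum E (\<lambda>m. list_sum E (\<lambda>w. (snd p' m \<otimes> (snd q' (fst w) \<otimes> snd r' (snd w))) \<otimes>
         list_sum E (\<lambda>z. fst z m \<otimes> (fst (snd z) (fst w) \<otimes> snd (snd z) (snd w))) t) ?ps) ns"
    by (intro list_sum_cong refl arg_cong2[of _ _ _ _ "(\<otimes>)"] eq) (auto simp: ns)
  thus "list_sum R0 (\<lambda>(x, y, z). snd p x \<otimes>\<^bsub>R0\<^esub> (snd q y \<otimes>\<^bsub>R0\<^esub> snd r z)) s =
      list_sum R0 (\<lambda>(x, y, z). snd p x \<otimes>\<^bsub>R0\<^esub> (snd q y \<otimes>\<^bsub>R0\<^esub> snd r z)) t"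
    using *[OF s] *[OF t] by (simp add: p'(2) q'(2) r'(2) split_def)
qed

text \<open>The function equal to \<open>c\<close> on the diagonal of \<open>N \<times> N\<close>
  and 0 elsewhere is expanded in products of frame functions. Its coefficients
  \<open>\<Sum> d(l) d'(l) c(l)\<close> lie in \<open>K\<close> by equivariance, so they may be
  absorbed into the first factor.\<close>

lemma comult_exists:
  assumes c: "c \<in> A"
  shows "\<exists>t. set t \<subseteq> A \<times> A \<and> (\<forall>m\<in>N. \<forall>n\<in>N. list_sum E (\<lambda>(u, v). u m \<otimes> v n) t = (if m = n then c n else \<zero>))"
proof -
  define k where "k = (\<lambda>(p :: ('a coset_perm \<Rightarrow> 'a) \<times> ('a coset_perm \<Rightarrow> 'a))
      (q :: ('a coset_perm \<Rightarrow> 'a) \<times> ('a coset_perm \<Rightarrow> 'a)). SN (\<lambda>l. (snd p l \<otimes> snd q l) \<otimes> c l))"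
  have kK: "k p q \<in> K" if "p \<in> set FN" "q \<in> set FN" for p q
    unfolding k_def by (rule SN_K) (use that c FN in \<open>auto simp: A_D(2)\<close>)
  define t where "t = concat (map (\<lambda>p. map (\<lambda>q. (k p q \<odot>\<^bsub>H\<^esub> restrict (fst p) N, restrict (fst q) N)) FN) FN)"
  have tA: "set t \<subseteq> A \<times> A"
    using FN_A kK H_closed(2)[OF FN_A FN_A] by (auto simp: t_def)
  have "list_sum E (\<lambda>(u, v). u m \<otimes> v n) t = (if m = n then c n else \<zero>)" if mn: "m \<in> N" "n \<in> N" for m n
  proof -
    have "list_sum E (\<lambda>(u, v). u m \<otimes> v n) t =
        list_sum E (\<lambda>p. list_sum E (\<lambda>q. k p q \<otimes> fst p m \<otimes> fst q n) FN) FN"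
      unfolding t_def
      by (subst list_sum_concat) (use mn FN(1) K_carrier[OF kK] in auto)
    also have "\<dots> = list_sum E (\<lambda>p. list_sum E (\<lambda>q. SN (\<lambda>l. c l \<otimes> ((snd p l \<otimes> fst p m) \<otimes> (snd q l \<otimes> fst q n)))) FN) FN"
    proof (intro list_sum_cong refl)
      fix p q assume pq: "p \<in> set FN" "q \<in> set FN"
      have "k p q \<otimes> fst p m \<otimes> fst q n = k p q \<otimes> (fst p m \<otimes> fst q n)"
        using K_carrier[OF kK[OF pq]] FN(1) pq mn by (simp add: m_assoc)
      also have "\<dots> = SN (\<lambda>l. ((snd p l \<otimes> snd q l) \<otimes> c l) \<otimes> (fst p m \<otimes> fst q n))"
        unfolding k_def by (rule SN_r) (use FN(1,2) pq mn c in simp_all)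
      also have "\<dots> = SN (\<lambda>l. c l \<otimes> ((snd p l \<otimes> fst p m) \<otimes> (snd q l \<otimes> fst q n)))"
        by (rule SN_cong) (use FN(1,2) pq mn c in \<open>simp add: m_ac\<close>)
      finally show "k p q \<otimes> fst p m \<otimes> fst q n = \<dots>" .
    qed
    also have "\<dots> = list_sum E (\<lambda>p. SN (\<lambda>l. list_sum E (\<lambda>q. c l \<otimes> ((snd p l \<otimes> fst p m) \<otimes> (snd q l \<otimes> fst q n))) FN)) FN"
      by (intro list_sum_cong refl SN_swap_list[symmetric]) (use FN(1,2) mn c in simp)
    also have "\<dots> = SN (\<lambda>l. list_sum E (\<lambda>p. list_sum E (\<lambda>q. c l \<otimes> ((snd p l \<otimes> fst p m) \<otimes> (snd q l \<otimes> fst q n))) FN) FN)"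
      by (rule SN_swap_list[symmetric]) (use FN(1,2) mn c in simp)
    also have "\<dots> = SN (\<lambda>l. if l = m then (if m = n then c l else \<zero>) else \<zero>)"
    proof (rule SN_cong)
      fix l assume l: "l \<in> N"
      let ?x = "list_sum E (\<lambda>p. snd p l \<otimes> fst p m) FN" and ?y = "list_sum E (\<lambda>q. snd q l \<otimes> fst q n) FN"
      have "list_sum E (\<lambda>p. list_sum E (\<lambda>q. c l \<otimes> ((snd p l \<otimes> fst p m) \<otimes> (snd q l \<otimes> fst q n))) FN) FN =
          list_sum E (\<lambda>p. c l \<otimes> list_sum E (\<lambda>q. (snd p l \<otimes> fst p m) \<otimes> (snd q l \<otimes> fst q n)) FN) FN"
        by (intro list_sum_cong refl list_sum_rdistr[symmetric]) (use FN(1,2) mn c l in simp_all)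
      also have "\<dots> = c l \<otimes> list_sum E (\<lambda>p. list_sum E (\<lambda>q. (snd p l \<otimes> fst p m) \<otimes> (snd q l \<otimes> fst q n)) FN) FN"
        by (intro list_sum_rdistr[symmetric]) (use FN(1,2) mn c l in simp_all)
      also have "\<dots> = c l \<otimes> (?x \<otimes> ?y)"
        by (subst list_sum_product) (use FN(1,2) mn c l in simp_all)
      finally show "list_sum E (\<lambda>p. list_sum E (\<lambda>q. c l \<otimes> ((snd p l \<otimes> fst p m) \<otimes> (snd q l \<otimes> fst q n))) FN) FN =
          (if l = m then (if m = n then c l else \<zero>) else \<zero>)"
        using FN(5) l mn c by auto
    qed
    also have "\<dots> = (if m = n then c n else \<zero>)"
      by (subst SN_delta(1)[OF mn(1)]) (use mn c in auto)
    finally show ?thesis .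
  qed
  thus ?thesis using tA by blast
qed

lemma comult_H:
  assumes "c \<in> A"
  shows "set (comult H c) \<subseteq> A \<times> A"
    "m \<in> N \<Longrightarrow> n \<in> N \<Longrightarrow> list_sum E (\<lambda>z. fst z m \<otimes> snd z n) (comult H c) = (if m = n then c n else \<zero>)"
    "z \<in> set (comult H c) \<Longrightarrow> fst z \<in> A" "z \<in> set (comult H c) \<Longrightarrow> snd z \<in> A"
proof -
  have eq: "comult H c = (SOME t. set t \<subseteq> A \<times> A \<and>
      (\<forall>m\<in>N. \<forall>n\<in>N. list_sum E (\<lambda>(u, v). u m \<otimes> v n) t = (if m = n then c n else \<zero>)))"
    by (simp add: gp_hopf_def)
  have *: "set (comult H c) \<subseteq> A \<times> A \<and>
      (\<forall>m\<in>N. \<forall>n\<in>N. list_sum E (\<lambda>(u, v). u m \<otimes> v n) (comult H c) = (if m = n then c n else \<zero>))"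
    unfolding eq by (rule someI_ex[OF comult_exists[OF assms]])
  thus "set (comult H c) \<subseteq> A \<times> A"
    "m \<in> N \<Longrightarrow> n \<in> N \<Longrightarrow> list_sum E (\<lambda>z. fst z m \<otimes> snd z n) (comult H c) = (if m = n then c n else \<zero>)"
    "z \<in> set (comult H c) \<Longrightarrow> fst z \<in> A" "z \<in> set (comult H c) \<Longrightarrow> snd z \<in> A"
    by (auto simp: split_def)
qed

lemma H_smult_A [simp]: "k \<in> K \<Longrightarrow> c \<in> A \<Longrightarrow> k \<odot>\<^bsub>H\<^esub> c \<in> A"
  using H_closed(2) by blast

lemma H_antipode_A [simp]: "c \<in> A \<Longrightarrow> antipode H c \<in> A"
  using H_closed(5) by blast

lemma H_zero_A [simp]: "\<zero>\<^bsub>H\<^esub> \<in> A" "\<one>\<^bsub>H\<^esub> \<in> A"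
proof -
  show "\<zero>\<^bsub>H\<^esub> \<in> A" using abelian_group.axioms(1)[OF abelian_H, THEN abelian_monoid.zero_closed] by simp
  thus "\<one>\<^bsub>H\<^esub> \<in> A" using H_closed(4) by blast
qed

text \<open>Every axiom about tensors is checked at points of \<open>N\<close>, where a sum over
  \<open>comult H x\<close> collapses to the diagonal values of \<open>x\<close>. What remains is
  the corresponding identity for group elements in \<open>E[N]\<close>.\<close>

lemma hopf_algebra_H: "hopf_algebra R0 H"
proof (intro hopf_algebra.intro hopf_algebra_axioms.intro)
  show "field R0" by (rule field_R0)
  show "module R0 H" by (rule module_H)
  show "ring H" by (rule ring_H)
next
  fix c x y assume "c \<in> carrier R0" "x \<in> carrier H" "y \<in> carrier H"
  hence c: "c \<in> K" "c \<in> carrier E" and x: "x \<in> A" "y \<in> A" by auto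
  have cx: "c \<odot>\<^bsub>H\<^esub> x \<in> A" "c \<odot>\<^bsub>H\<^esub> y \<in> A" using H_closed(2) x c by auto
  show "(c \<odot>\<^bsub>H\<^esub> x) \<otimes>\<^bsub>H\<^esub> y = c \<odot>\<^bsub>H\<^esub> (x \<otimes>\<^bsub>H\<^esub> y)"
    by (rule A_eqI) (use c x cx in \<open>simp_all add: SN_l m_assoc cong: SN_cong\<close>)
  show "x \<otimes>\<^bsub>H\<^esub> (c \<odot>\<^bsub>H\<^esub> y) = c \<odot>\<^bsub>H\<^esub> (x \<otimes>\<^bsub>H\<^esub> y)"
    by (rule A_eqI) (use c x cx in \<open>simp_all add: SN_l m_lcomm cong: SN_cong\<close>)
next
  fix x assume "x \<in> carrier H"
  thus "set (comult H x) \<subseteq> carrier H \<times> carrier H" using comult_H(1) by simp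
next
  fix x y assume "x \<in> carrier H" "y \<in> carrier H"
  hence x: "x \<in> A" "y \<in> A" by auto
  note cx = comult_H[OF x(1)] note cy = comult_H[OF x(2)]
  note cxy = comult_H[OF H_closed(1)[OF x]]
  show "tensor_eq R0 H H (comult H (x \<oplus>\<^bsub>H\<^esub> y)) (comult H x @ comult H y)"
  proof (rule H_tensor_eqI)
    fix m n assume mn: "m \<in> N" "n \<in> N"
    have "list_sum E (\<lambda>z. fst z m \<otimes> snd z n) (comult H x @ comult H y) =
       list_sum E (\<lambda>z. fst z m \<otimes> snd z n) (comult H x) \<oplus> list_sum E (\<lambda>z. fst z m \<otimes> snd z n) (comult H y)"
      by (rule list_sum_append) (use cx(3,4) cy(3,4) mn in auto)
    thus "list_sum E (\<lambda>z. fst z m \<otimes> snd z n) (comult H (x \<oplus>\<^bsub>H\<^esub> y)) =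
        list_sum E (\<lambda>z. fst z m \<otimes> snd z n) (comult H x @ comult H y)"
      using cx(2) cy(2) cxy(2) mn by simp
  qed (use cx(1) cy(1) cxy(1) in auto)
next
  fix c x assume "c \<in> carrier R0" "x \<in> carrier H"
  hence c: "c \<in> K" "c \<in> carrier E" and x: "x \<in> A" by auto
  have cA: "c \<odot>\<^bsub>H\<^esub> x \<in> A" using H_closed(2) x c by auto
  note cx = comult_H[OF x] note ccx = comult_H[OF cA]
  show "tensor_eq R0 H H (comult H (c \<odot>\<^bsub>H\<^esub> x)) [(c \<odot>\<^bsub>H\<^esub> u, v). (u, v) \<leftarrow> comult H x]"
  proof (rule H_tensor_eqI)
    show "set [(c \<odot>\<^bsub>H\<^esub> u, v). (u, v) \<leftarrow> comult H x] \<subseteq> A \<times> A"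
      using cx(3,4) c by (auto simp: split_def)
    fix m n assume mn: "m \<in> N" "n \<in> N"
    have "list_sum E (\<lambda>z. fst z m \<otimes> snd z n) [(c \<odot>\<^bsub>H\<^esub> u, v). (u, v) \<leftarrow> comult H x] =
        list_sum E (\<lambda>z. c \<otimes> (fst z m \<otimes> snd z n)) (comult H x)"
      unfolding list_sum_map by (intro list_sum_cong refl) (use cx(3,4) c mn in \<open>auto simp: split_def m_assoc\<close>)
    also have "\<dots> = c \<otimes> list_sum E (\<lambda>z. fst z m \<otimes> snd z n) (comult H x)"
      by (rule list_sum_rdistr[symmetric]) (use cx(3,4) c mn in auto)
    finally show "list_sum E (\<lambda>z. fst z m \<otimes> snd z n) (comult H (c \<odot>\<^bsub>H\<^esub> x)) =
        list_sum E (\<lambda>z. fst z m \<otimes> snd z n) [(c \<odot>\<^bsub>H\<^esub> u, v). (u, v) \<leftarrow> comult H x]"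
      using cx(2) ccx(2) c mn by simp
  qed (rule ccx(1))
next
  show "linear_form R0 H (counit H)"
    unfolding linear_form_def
  proof (intro conjI ballI)
    show "counit H \<in> carrier H \<rightarrow> carrier R0"
      using SN_K by (auto simp: H_counit A_D(2))
  qed (auto simp: H_counit SN_add SN_l cong: SN_cong)
next
  fix x assume "x \<in> carrier H"
  hence x: "x \<in> A" by simp
  note cx = comult_H[OF x]
  let ?s = "[(u1, u2, v). (u, v) \<leftarrow> comult H x, (u1, u2) \<leftarrow> comult H u]"
  let ?t = "[(u, v1, v2). (u, v) \<leftarrow> comult H x, (v1, v2) \<leftarrow> comult H v]"
  show "tensor3_eq R0 H ?s ?t"
  proof (rule H_tensor3_eqI)
    show "set ?s \<subseteq> A \<times> A \<times> A"
    proof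
      fix y assume "y \<in> set ?s"
      then obtain z w where "z \<in> set (comult H x)" "w \<in> set (comult H (fst z))" "y = (fst w, snd w, snd z)"
        by (auto simp: split_def)
      thus "y \<in> A \<times> A \<times> A"
        using cx(3,4)[of z] comult_H(3,4)[of "fst z" w] by (simp add: mem_Times_iff)
    qed
    show "set ?t \<subseteq> A \<times> A \<times> A"
    proof
      fix y assume "y \<in> set ?t"
      then obtain z w where "z \<in> set (comult H x)" "w \<in> set (comult H (snd z))" "y = (fst z, fst w, snd w)"
        by (auto simp: split_def)
      thus "y \<in> A \<times> A \<times> A"
        using cx(3,4)[of z] comult_H(3,4)[of "snd z" w] by (simp add: mem_Times_iff)
    qed
    fix m n l assume mn: "m \<in> N" "n \<in> N" "l \<in> N"
    let ?F = "\<lambda>z. fst z m \<otimes> (fst (snd z) n \<otimes> snd (snd z) l)"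
    have "list_sum E ?F ?s = list_sum E (\<lambda>z. list_sum E (\<lambda>w. fst w m \<otimes> (snd w n \<otimes> snd z l)) (comult H (fst z))) (comult H x)"
    proof (subst list_sum_concat, goal_cases)
      case (1 us y)
      then obtain z w where "z \<in> set (comult H x)" "w \<in> set (comult H (fst z))" "y = (fst w, snd w, snd z)"
        by (auto simp: split_def)
      thus ?case using cx(3,4)[of z] comult_H(3,4)[of "fst z" w] mn by simp
    qed (simp add: split_def)
    also have "\<dots> = list_sum E (\<lambda>z. list_sum E (\<lambda>w. fst w m \<otimes> snd w n) (comult H (fst z)) \<otimes> snd z l) (comult H x)"
    proof (intro list_sum_cong refl)
      fix z assume z: "z \<in> set (comult H x)"
      have "list_sum E (\<lambda>w. fst w m \<otimes> (snd w n \<otimes> snd z l)) (comult H (fst z)) =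
          list_sum E (\<lambda>w. (fst w m \<otimes> snd w n) \<otimes> snd z l) (comult H (fst z))"
        by (intro list_sum_cong refl) (use cx(3,4)[OF z] comult_H(3,4)[OF cx(3)[OF z]] mn in \<open>simp add: m_assoc\<close>)
      also have "\<dots> = list_sum E (\<lambda>w. fst w m \<otimes> snd w n) (comult H (fst z)) \<otimes> snd z l"
        by (rule list_sum_ldistr[symmetric]) (use cx(3,4)[OF z] comult_H(3,4)[OF cx(3)[OF z]] mn in simp_all)
      finally show "list_sum E (\<lambda>w. fst w m \<otimes> (snd w n \<otimes> snd z l)) (comult H (fst z)) = \<dots>" .
    qed
    also have "\<dots> = list_sum E (\<lambda>z. if m = n then fst z n \<otimes> snd z l else \<zero>) (comult H x)"
      by (intro list_sum_cong refl) (use comult_H(2)[OF cx(3)] cx(4) mn in auto)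
    also have "\<dots> = (if m = n \<and> n = l then x l else \<zero>)"
      using cx(2) mn by (cases "m = n") simp_all
    finally have s: "list_sum E ?F ?s = (if m = n \<and> n = l then x l else \<zero>)" .
    have "list_sum E ?F ?t = list_sum E (\<lambda>z. list_sum E (\<lambda>w. fst z m \<otimes> (fst w n \<otimes> snd w l)) (comult H (snd z))) (comult H x)"
    proof (subst list_sum_concat, goal_cases)
      case (1 us y)
      then obtain z w where "z \<in> set (comult H x)" "w \<in> set (comult H (snd z))" "y = (fst z, fst w, snd w)"
        by (auto simp: split_def)
      thus ?case using cx(3,4)[of z] comult_H(3,4)[of "snd z" w] mn by simp
    qed (simp add: split_def)
    also have "\<dots> = list_sum E (\<lambda>z. fst z m \<otimes> list_sum E (\<lambda>w. fst w n \<otimes> snd w l) (comult H (snd z))) (comult H x)"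
    proof (intro list_sum_cong refl)
      fix z assume z: "z \<in> set (comult H x)"
      show "list_sum E (\<lambda>w. fst z m \<otimes> (fst w n \<otimes> snd w l)) (comult H (snd z)) =
         fst z m \<otimes> list_sum E (\<lambda>w. fst w n \<otimes> snd w l) (comult H (snd z))"
        by (rule list_sum_rdistr[symmetric]) (use cx(3,4)[OF z] comult_H(3,4)[OF cx(4)[OF z]] mn in simp_all)
    qed
    also have "\<dots> = list_sum E (\<lambda>z. if n = l then fst z m \<otimes> snd z n else \<zero>) (comult H x)"
      by (intro list_sum_cong refl) (use comult_H(2)[OF cx(4)] cx(3) mn in auto)
    also have "\<dots> = (if m = n \<and> n = l then x l else \<zero>)"
      using cx(2) mn by (cases "n = l") simp_all
    finally show "list_sum E ?F ?s = list_sum E ?F ?t" using s by simp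
  qed
next
  fix x assume "x \<in> carrier H"
  hence x: "x \<in> A" by simp
  note cx = comult_H[OF x]
  have K: "counit H u \<in> K" if "u \<in> A" for u using that SN_K by (simp add: H_counit A_D(2))
  have c1: "(case z of (u, v) \<Rightarrow> counit H u \<odot>\<^bsub>H\<^esub> v) \<in> A" if "z \<in> set (comult H x)" for z
    using cx(3,4)[OF that] K H_closed(2) by (auto simp: split_def)
  have c2: "(case z of (u, v) \<Rightarrow> counit H v \<odot>\<^bsub>H\<^esub> u) \<in> A" if "z \<in> set (comult H x)" for z
    using cx(3,4)[OF that] K H_closed(2) by (auto simp: split_def)
  show "list_sum H (\<lambda>(u, v). counit H u \<odot>\<^bsub>H\<^esub> v) (comult H x) = x"
  proof (rule A_eqI[OF H_list_sum(1)[OF c1] x])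
    fix n assume n: "n \<in> N"
    have "list_sum H (\<lambda>(u, v). counit H u \<odot>\<^bsub>H\<^esub> v) (comult H x) n =
        list_sum E (\<lambda>z. (case z of (u, v) \<Rightarrow> counit H u \<odot>\<^bsub>H\<^esub> v) n) (comult H x)"
      by (rule H_list_sum(2)[OF c1 n])
    also have "\<dots> = list_sum E (\<lambda>z. SN (\<lambda>m. fst z m \<otimes> snd z n)) (comult H x)"
      by (intro list_sum_cong refl) (use cx(3,4) n in \<open>simp add: split_def H_counit SN_r\<close>)
    also have "\<dots> = SN (\<lambda>m. list_sum E (\<lambda>z. fst z m \<otimes> snd z n) (comult H x))"
      by (rule SN_swap_list[symmetric]) (use cx(3,4) n in simp)
    also have "\<dots> = SN (\<lambda>m. if m = n then x n else \<zero>)" by (rule SN_cong) (use cx(2) n in simp)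
    also have "\<dots> = x n" using SN_delta(1)[of n "\<lambda>_. x n"] n x by simp
    finally show "list_sum H (\<lambda>(u, v). counit H u \<odot>\<^bsub>H\<^esub> v) (comult H x) n = x n" .
  qed
  show "list_sum H (\<lambda>(u, v). counit H v \<odot>\<^bsub>H\<^esub> u) (comult H x) = x"
  proof (rule A_eqI[OF H_list_sum(1)[OF c2] x])
    fix n assume n: "n \<in> N"
    have "list_sum H (\<lambda>(u, v). counit H v \<odot>\<^bsub>H\<^esub> u) (comult H x) n =
        list_sum E (\<lambda>z. (case z of (u, v) \<Rightarrow> counit H v \<odot>\<^bsub>H\<^esub> u) n) (comult H x)"
      by (rule H_list_sum(2)[OF c2 n])
    also have "\<dots> = list_sum E (\<lambda>z. SN (\<lambda>m. fst z n \<otimes> snd z m)) (comult H x)"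
      by (intro list_sum_cong refl) (use cx(3,4) n in \<open>simp add: split_def H_counit SN_l m_comm[of "SN f" for f]\<close>)
    also have "\<dots> = SN (\<lambda>m. list_sum E (\<lambda>z. fst z n \<otimes> snd z m) (comult H x))"
      by (rule SN_swap_list[symmetric]) (use cx(3,4) n in simp)
    also have "\<dots> = SN (\<lambda>m. if n = m then x n else \<zero>)" by (rule SN_cong) (use cx(2) n in simp)
    also have "\<dots> = x n" using SN_delta(2)[of n "\<lambda>_. x n"] n x by simp
    finally show "list_sum H (\<lambda>(u, v). counit H v \<odot>\<^bsub>H\<^esub> u) (comult H x) n = x n" .
  qed
next
  fix x y assume "x \<in> carrier H" "y \<in> carrier H"
  hence x: "x \<in> A" "y \<in> A" by auto
  note cx = comult_H[OF x(1)] note cy = comult_H[OF x(2)]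
  have xyA: "x \<otimes>\<^bsub>H\<^esub> y \<in> A" using H_closed(6) x by simp
  note cxy = comult_H[OF xyA]
  let ?t = "[(u \<otimes>\<^bsub>H\<^esub> u', v \<otimes>\<^bsub>H\<^esub> v'). (u, v) \<leftarrow> comult H x, (u', v') \<leftarrow> comult H y]"
  show "tensor_eq R0 H H (comult H (x \<otimes>\<^bsub>H\<^esub> y)) ?t"
  proof (rule H_tensor_eqI[OF cxy(1)])
    show "set ?t \<subseteq> A \<times> A"
    proof
      fix w assume "w \<in> set ?t"
      then obtain z z' where "z \<in> set (comult H x)" "z' \<in> set (comult H y)"
        "w = (fst z \<otimes>\<^bsub>H\<^esub> fst z', snd z \<otimes>\<^bsub>H\<^esub> snd z')" by (auto simp: split_def)
      thus "w \<in> A \<times> A" using cx(3,4)[of z] cy(3,4)[of z'] H_closed(6) by simp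
    qed
    fix m n assume mn: "m \<in> N" "n \<in> N"
    have cancel: "iv k \<cdot> m = iv k \<cdot> n \<longleftrightarrow> m = n" if "k \<in> N" for k
      using that mn N_cancel by simp
    have "list_sum E (\<lambda>z. fst z m \<otimes> snd z n) ?t =
        list_sum E (\<lambda>z. list_sum E (\<lambda>w. (fst z \<otimes>\<^bsub>H\<^esub> fst w) m \<otimes> (snd z \<otimes>\<^bsub>H\<^esub> snd w) n) (comult H y)) (comult H x)"
    proof (subst list_sum_concat, goal_cases)
      case (1 us w)
      then obtain z z' where "z \<in> set (comult H x)" "z' \<in> set (comult H y)"
        "w = (fst z \<otimes>\<^bsub>H\<^esub> fst z', snd z \<otimes>\<^bsub>H\<^esub> snd z')" by (auto simp: split_def)
      thus ?case using cx(3,4)[of z] cy(3,4)[of z'] H_closed(6) mn by (simp del: H_mult)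
    qed (simp add: split_def del: H_mult)
    also have "\<dots> = list_sum E (\<lambda>z. list_sum E (\<lambda>w.
        SN (\<lambda>k. fst z k \<otimes> fst w (iv k \<cdot> m)) \<otimes> SN (\<lambda>l. snd z l \<otimes> snd w (iv l \<cdot> n))) (comult H y)) (comult H x)"
      by (intro list_sum_cong refl) (use cx(3,4) cy(3,4) mn in simp)
    also have "\<dots> = list_sum E (\<lambda>z. SN (\<lambda>k. SN (\<lambda>l. (fst z k \<otimes> snd z l) \<otimes>
        list_sum E (\<lambda>w. fst w (iv k \<cdot> m) \<otimes> snd w (iv l \<cdot> n)) (comult H y)))) (comult H x)"
      by (intro list_sum_cong refl list_sum_pairing) (use cx(3,4) cy(3,4) mn in \<open>auto simp: ns\<close>)
    also have "\<dots> = list_sum E (\<lambda>z. SN (\<lambda>k. SN (\<lambda>l. (fst z k \<otimes> snd z l) \<otimes>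
        (if iv k \<cdot> m = iv l \<cdot> n then y (iv k \<cdot> m) else \<zero>)))) (comult H x)"
      by (intro list_sum_cong refl SN_cong arg_cong2[of _ _ _ _ "(\<otimes>)"]) (use cy(2) mn in auto)
    also have "\<dots> = SN (\<lambda>k. list_sum E (\<lambda>z. SN (\<lambda>l. (fst z k \<otimes> snd z l) \<otimes>
        (if iv k \<cdot> m = iv l \<cdot> n then y (iv k \<cdot> m) else \<zero>))) (comult H x))"
      by (rule SN_swap_list[symmetric]) (use cx(3,4) x mn in simp)
    also have "\<dots> = SN (\<lambda>k. SN (\<lambda>l. list_sum E (\<lambda>z. (fst z k \<otimes> snd z l) \<otimes>
        (if iv k \<cdot> m = iv l \<cdot> n then y (iv k \<cdot> m) else \<zero>)) (comult H x)))"
      by (intro SN_cong SN_swap_list[symmetric]) (use cx(3,4) x mn in simp)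
    also have "\<dots> = SN (\<lambda>k. SN (\<lambda>l. list_sum E (\<lambda>z. fst z k \<otimes> snd z l) (comult H x) \<otimes>
        (if iv k \<cdot> m = iv l \<cdot> n then y (iv k \<cdot> m) else \<zero>)))"
      by (intro SN_cong list_sum_ldistr[symmetric]) (use cx(3,4) x mn in simp_all)
    \<comment> \<open>Diagonality of \<open>x\<close> forces \<open>k = l\<close>; diagonality of
      \<open>y\<close> then forces \<open>m = n\<close> by cancellation.\<close>
    also have "\<dots> = SN (\<lambda>k. SN (\<lambda>l. if k = l then (if m = n then x k \<otimes> y (iv k \<cdot> m) else \<zero>) else \<zero>))"
      by (intro SN_cong) (use cx(2) x mn cancel in simp)
    also have "\<dots> = SN (\<lambda>k. if m = n then x k \<otimes> y (iv k \<cdot> m) else \<zero>)"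
      by (intro SN_cong SN_delta(2)) (use x mn in simp_all)
    also have "\<dots> = (if m = n then (x \<otimes>\<^bsub>H\<^esub> y) n else \<zero>)" using x mn by simp
    finally show "list_sum E (\<lambda>z. fst z m \<otimes> snd z n) (comult H (x \<otimes>\<^bsub>H\<^esub> y)) =
       list_sum E (\<lambda>z. fst z m \<otimes> snd z n) ?t"
      using cxy(2) mn by simp
  qed
  have "SN (x \<otimes>\<^bsub>H\<^esub> y) = SN (\<lambda>n. SN (\<lambda>m. x m \<otimes> y (iv m \<cdot> n)))" using x by (simp cong: SN_cong)
  also have "\<dots> = SN (\<lambda>m. SN (\<lambda>n. x m \<otimes> y (iv m \<cdot> n)))" by (rule SN_swap) (use x in simp)
  also have "\<dots> = SN (\<lambda>m. SN (\<lambda>n. x m \<otimes> y n))"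
  proof (rule SN_cong)
    fix m assume "m \<in> N"
    thus "SN (\<lambda>n. x m \<otimes> y (iv m \<cdot> n)) = SN (\<lambda>n. x m \<otimes> y n)"
      using SN_left[of "iv m" "\<lambda>n. x m \<otimes> y n"] x by simp
  qed
  also have "\<dots> = SN x \<otimes> SN y" using list_sum_product[of ns x ns y] x by (simp add: ns)
  finally show "counit H (x \<otimes>\<^bsub>H\<^esub> y) = counit H x \<otimes>\<^bsub>R0\<^esub> counit H y"
    using xyA x by (simp add: H_counit)
  have an: "antipode H x \<in> A" "antipode H y \<in> A" "antipode H (x \<oplus>\<^bsub>H\<^esub> y) \<in> A" using H_closed(5) H_closed(1) x by auto
  show "antipode H (x \<oplus>\<^bsub>H\<^esub> y) = antipode H x \<oplus>\<^bsub>H\<^esub> antipode H y"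
    by (rule A_eqI) (use an x H_closed(1) in simp_all)
next
  fix x assume "x \<in> carrier H"
  thus "antipode H x \<in> carrier H" using H_closed(5) by simp
next
  have z: "\<zero>\<^bsub>H\<^esub> \<in> A" using abelian_group.axioms(1)[OF abelian_H, THEN abelian_monoid.zero_closed] by simp
  have one: "\<one>\<^bsub>H\<^esub> \<in> A" using H_closed(4)[OF z z] .
  note c1 = comult_H[OF one]
  show "tensor_eq R0 H H (comult H \<one>\<^bsub>H\<^esub>) [(\<one>\<^bsub>H\<^esub>, \<one>\<^bsub>H\<^esub>)]"
    by (rule H_tensor_eqI[OF c1(1)]) (use one c1(2) in auto)
  have "SN (\<one>\<^bsub>H\<^esub>) = SN (\<lambda>n. if n = \<one>\<^bsub>P\<^esub> then \<one> else \<zero>)" by (rule SN_cong) simp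
  also have "\<dots> = \<one>" using SN_delta(1)[of "\<one>\<^bsub>P\<^esub>" "\<lambda>_. \<one>"] by simp
  finally show "counit H \<one>\<^bsub>H\<^esub> = \<one>\<^bsub>R0\<^esub>" using one by (simp add: H_counit)
next
  fix c x assume "c \<in> carrier R0" "x \<in> carrier H"
  hence c: "c \<in> K" and x: "x \<in> A" by auto
  have cx: "c \<odot>\<^bsub>H\<^esub> x \<in> A" using H_closed(2) x c by auto
  show "antipode H (c \<odot>\<^bsub>H\<^esub> x) = c \<odot>\<^bsub>H\<^esub> antipode H x"
    by (rule A_eqI) (use cx x c H_closed(5)[OF cx cx] H_closed(2)[OF H_closed(5)[OF x x] x] in simp_all)
next
  fix x assume "x \<in> carrier H"
  hence x: "x \<in> A" by simp
  note cx = comult_H[OF x]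
  have an: "antipode H u \<in> A" if "u \<in> A" for u using H_closed(5) that by blast
  have one: "\<one>\<^bsub>H\<^esub> \<in> A" using H_closed(4)[OF x x] .
  have K: "counit H x \<in> K" using x SN_K by (simp add: H_counit A_D(2))
  have c1: "(case z of (u, v) \<Rightarrow> antipode H u \<otimes>\<^bsub>H\<^esub> v) \<in> A" if "z \<in> set (comult H x)" for z
    using cx(3,4)[OF that] an H_closed(6) by (auto simp: split_def)
  have c2: "(case z of (u, v) \<Rightarrow> u \<otimes>\<^bsub>H\<^esub> antipode H v) \<in> A" if "z \<in> set (comult H x)" for z
    using cx(3,4)[OF that] an H_closed(6) by (auto simp: split_def)
  have eA: "counit H x \<odot>\<^bsub>H\<^esub> \<one>\<^bsub>H\<^esub> \<in> A" using H_closed(2)[OF one one K] .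
  have 1: "SN (\<lambda>m. if n = \<one>\<^bsub>P\<^esub> then x m else \<zero>) = (counit H x \<odot>\<^bsub>H\<^esub> \<one>\<^bsub>H\<^esub>) n" if n: "n \<in> N" for n
    using n x by (simp add: H_counit)
  have eq1: "m = m \<cdot> n \<longleftrightarrow> n = \<one>\<^bsub>P\<^esub>" if "m \<in> N" "n \<in> N" for m n
    using that N_simps(4,5,8) by metis
  show "list_sum H (\<lambda>(u, v). antipode H u \<otimes>\<^bsub>H\<^esub> v) (comult H x) = counit H x \<odot>\<^bsub>H\<^esub> \<one>\<^bsub>H\<^esub>"
  proof (rule A_eqI[OF H_list_sum(1)[OF c1] eA])
    fix n assume n: "n \<in> N"
    have "list_sum H (\<lambda>(u, v). antipode H u \<otimes>\<^bsub>H\<^esub> v) (comult H x) n =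
        list_sum E (\<lambda>z. (case z of (u, v) \<Rightarrow> antipode H u \<otimes>\<^bsub>H\<^esub> v) n) (comult H x)"
      by (rule H_list_sum(2)[OF c1 n])
    also have "\<dots> = list_sum E (\<lambda>z. SN (\<lambda>m. fst z (iv m) \<otimes> snd z (iv m \<cdot> n))) (comult H x)"
      by (intro list_sum_cong refl) (use cx(3,4) n an in \<open>simp add: split_def cong: SN_cong\<close>)
    \<comment> \<open>Replacing \<open>m\<close> by its inverse undoes the antipode and leaves the
      points \<open>m\<close> and \<open>m n\<close>, which agree only for
      \<open>n = 1\<close>.\<close>
    also have "\<dots> = list_sum E (\<lambda>z. SN (\<lambda>m. fst z m \<otimes> snd z (m \<cdot> n))) (comult H x)"
    proof (rule list_sum_cong[OF refl])
      fix z assume "z \<in> set (comult H x)"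
      thus "SN (\<lambda>m. fst z (iv m) \<otimes> snd z (iv m \<cdot> n)) = SN (\<lambda>m. fst z m \<otimes> snd z (m \<cdot> n))"
        using SN_inv[of "\<lambda>m. fst z m \<otimes> snd z (m \<cdot> n)"] cx(3,4) n by simp
    qed
    also have "\<dots> = SN (\<lambda>m. list_sum E (\<lambda>z. fst z m \<otimes> snd z (m \<cdot> n)) (comult H x))"
      by (rule SN_swap_list[symmetric]) (use cx(3,4) n in simp)
    also have "\<dots> = SN (\<lambda>m. if n = \<one>\<^bsub>P\<^esub> then x m else \<zero>)"
      by (rule SN_cong) (use cx(2) n eq1 in \<open>auto simp: N_simps\<close>)
    finally show "list_sum H (\<lambda>(u, v). antipode H u \<otimes>\<^bsub>H\<^esub> v) (comult H x) n = (counit H x \<odot>\<^bsub>H\<^esub> \<one>\<^bsub>H\<^esub>) n"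
      using 1[OF n] by simp
  qed
  show "list_sum H (\<lambda>(u, v). u \<otimes>\<^bsub>H\<^esub> antipode H v) (comult H x) = counit H x \<odot>\<^bsub>H\<^esub> \<one>\<^bsub>H\<^esub>"
  proof (rule A_eqI[OF H_list_sum(1)[OF c2] eA])
    fix n assume n: "n \<in> N"
    \<comment> \<open>With the antipode in the second factor, the coincidence to be solved is
      \<open>m = n\<^sup>-\<^sup>1 m\<close>.\<close>
    have eq2: "m = iv (iv m \<cdot> n) \<longleftrightarrow> n = \<one>\<^bsub>P\<^esub>" if m: "m \<in> N" for m
    proof -
      have "iv (iv m \<cdot> n) = iv n \<cdot> m" using m n by (simp add: N_simps)
      moreover have "m = iv n \<cdot> m \<longleftrightarrow> iv n = \<one>\<^bsub>P\<^esub>"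
        using m n N_P P.l_cancel_one' by simp
      ultimately show ?thesis using n N_P by (metis N_simps(2) P.inv_one)
    qed
    have "list_sum H (\<lambda>(u, v). u \<otimes>\<^bsub>H\<^esub> antipode H v) (comult H x) n =
        list_sum E (\<lambda>z. (case z of (u, v) \<Rightarrow> u \<otimes>\<^bsub>H\<^esub> antipode H v) n) (comult H x)"
      by (rule H_list_sum(2)[OF c2 n])
    also have "\<dots> = list_sum E (\<lambda>z. SN (\<lambda>m. fst z m \<otimes> snd z (iv (iv m \<cdot> n)))) (comult H x)"
      by (intro list_sum_cong refl) (use cx(3,4) n an in \<open>simp add: split_def cong: SN_cong\<close>)
    also have "\<dots> = SN (\<lambda>m. list_sum E (\<lambda>z. fst z m \<otimes> snd z (iv (iv m \<cdot> n))) (comult H x))"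
      by (rule SN_swap_list[symmetric]) (use cx(3,4) n in simp)
    also have "\<dots> = SN (\<lambda>m. if n = \<one>\<^bsub>P\<^esub> then x m else \<zero>)"
      by (rule SN_cong) (use cx(2) n eq2 in \<open>auto simp: N_simps\<close>)
    finally show "list_sum H (\<lambda>(u, v). u \<otimes>\<^bsub>H\<^esub> antipode H v) (comult H x) n = (counit H x \<odot>\<^bsub>H\<^esub> \<one>\<^bsub>H\<^esub>) n"
      using 1[OF n] by simp
  qed
qed

end


text \<open>A frame may list the same vector twice, while finite dimensionality asks for one
  coefficient per element of a set; coefficients of repeated vectors are added.\<close>

lemma (in module) list_sum_as_finsum:
  assumes B: "finite B" "B \<subseteq> carrier M"
    and ps: "\<And>p. p \<in> set ps \<Longrightarrow> k p \<in> carrier R" "\<And>p. p \<in> set ps \<Longrightarrow> a p \<in> B"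
  shows "\<exists>c\<in>B \<rightarrow> carrier R. list_sum M (\<lambda>p. k p \<odot>\<^bsub>M\<^esub> a p) ps = finsum M (\<lambda>b. c b \<odot>\<^bsub>M\<^esub> b) B"
  using ps
proof (induction ps)
  case Nil
  have "finsum M (\<lambda>b. \<zero> \<odot>\<^bsub>M\<^esub> b) B = \<zero>\<^bsub>M\<^esub>"
    using B by (intro M.add.finprod_one_eqI) auto
  thus ?case by (intro bexI[of _ "\<lambda>_. \<zero>"]) auto
next
  case (Cons p ps)
  then obtain c where c: "c \<in> B \<rightarrow> carrier R"
    "list_sum M (\<lambda>p. k p \<odot>\<^bsub>M\<^esub> a p) ps = finsum M (\<lambda>b. c b \<odot>\<^bsub>M\<^esub> b) B" by auto
  have kp: "k p \<in> carrier R" "a p \<in> B" "a p \<in> carrier M" using Cons B by auto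
  define c' where "c' = (\<lambda>b. (if a p = b then k p else \<zero>) \<oplus> c b)"
  have "finsum M (\<lambda>b. c' b \<odot>\<^bsub>M\<^esub> b) B = finsum M (\<lambda>b. (if a p = b then k p \<odot>\<^bsub>M\<^esub> b else \<zero>\<^bsub>M\<^esub>) \<oplus>\<^bsub>M\<^esub> c b \<odot>\<^bsub>M\<^esub> b) B"
    using B c kp by (intro M.finsum_cong') (auto simp: c'_def smult_l_distr Pi_def subset_iff)
  also have "\<dots> = finsum M (\<lambda>b. if a p = b then k p \<odot>\<^bsub>M\<^esub> b else \<zero>\<^bsub>M\<^esub>) B \<oplus>\<^bsub>M\<^esub> finsum M (\<lambda>b. c b \<odot>\<^bsub>M\<^esub> b) B"
    using B c kp by (intro M.finsum_addf) (auto simp: Pi_def subset_iff)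
  also have "finsum M (\<lambda>b. if a p = b then k p \<odot>\<^bsub>M\<^esub> b else \<zero>\<^bsub>M\<^esub>) B = k p \<odot>\<^bsub>M\<^esub> a p"
    using B kp by (intro M.finsum_singleton) (auto simp: Pi_def subset_iff)
  finally show ?case
    using c kp by (intro bexI[of _ c']) (auto simp: c'_def)
qed

section \<open>The field \<open>L\<close> as functions on the cosets, and independence of its
  embeddings\<close>

context galois_extension
begin

abbreviation "Lv \<equiv> vector_space_of E L"

lemma Lv_simps [simp]: "carrier Lv = L" "x \<oplus>\<^bsub>Lv\<^esub> y = x \<oplus> y" "k \<odot>\<^bsub>Lv\<^esub> x = k \<otimes> x" "\<zero>\<^bsub>Lv\<^esub> = \<zero>"
  by (simp_all add: vector_space_of_def)

lemma L_closed [simp]: "x \<in> L \<Longrightarrow> y \<in> L \<Longrightarrow> x \<oplus> y \<in> L" "x \<in> L \<Longrightarrow> y \<in> L \<Longrightarrow> x \<otimes> y \<in> L"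
    "\<one> \<in> L" "\<zero> \<in> L" "k \<in> K \<Longrightarrow> k \<in> L" "x \<in> L \<Longrightarrow> \<ominus> x \<in> L"
  using subringE[OF subfieldE(1)[OF L]] KL by auto

lemma module_Lv: "module (E\<lparr>carrier := K\<rparr>) Lv"
proof (rule moduleI)
  have "field (E\<lparr>carrier := K\<rparr>)" using subfield_iff(2)[OF K] .
  thus "cring (E\<lparr>carrier := K\<rparr>)" by (simp add: field_def domain_def)
  show "abelian_group Lv"
  proof (rule abelian_groupI)
    show "\<exists>y\<in>carrier Lv. y \<oplus>\<^bsub>Lv\<^esub> x = \<zero>\<^bsub>Lv\<^esub>" if "x \<in> carrier Lv" for x
      using that by (intro bexI[of _ "\<ominus> x"]) (auto simp: l_neg)
  qed (simp_all add: a_ac)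
qed (simp_all add: l_distr r_distr m_assoc)

lemma Lv_list_sum: "list_sum Lv f xs = list_sum E f xs"
  by (induction xs) simp_all

lemma L_list_sum: "(\<And>x. x \<in> set xs \<Longrightarrow> f x \<in> L) \<Longrightarrow> list_sum E f xs \<in> L"
  by (induction xs) simp_all

definition "ss = (SOME xs. distinct xs \<and> set xs = S)"

lemma ss: "distinct ss" "set ss = S"
  using someI_ex[of "\<lambda>xs. distinct xs \<and> set xs = S"] finite_distinct_list[OF finite_cosets]
  unfolding ss_def by blast+

abbreviation "SS f \<equiv> list_sum E f ss"

lemma SS_closed [simp]: "(\<And>s. s \<in> S \<Longrightarrow> f s \<in> carrier E) \<Longrightarrow> SS f \<in> carrier E"
  by (rule list_sum_closed) (simp add: ss)

lemma SS_cong: "(\<And>s. s \<in> S \<Longrightarrow> f s = g s) \<Longrightarrow> SS f = SS g"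
  by (rule list_sum_cong) (auto simp: ss)

lemma SS_delta:
  assumes "n \<in> S" "f n \<in> carrier E"
  shows "SS (\<lambda>m. if m = n then f m else \<zero>) = f n" "SS (\<lambda>m. if n = m then f m else \<zero>) = f n"
  using list_sum_delta[OF ss(1), of n f] assms by (simp_all add: ss)

lemma SS_l: "c \<in> carrier E \<Longrightarrow> (\<And>n. n \<in> S \<Longrightarrow> f n \<in> carrier E) \<Longrightarrow> c \<otimes> SS f = SS (\<lambda>n. c \<otimes> f n)"
  by (rule list_sum_rdistr) (auto simp: ss)

lemma SS_r: "c \<in> carrier E \<Longrightarrow> (\<And>n. n \<in> S \<Longrightarrow> f n \<in> carrier E) \<Longrightarrow> SS f \<otimes> c = SS (\<lambda>n. f n \<otimes> c)"
  by (rule list_sum_ldistr) (auto simp: ss)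

lemma SS_swap_list: "(\<And>n x. n \<in> S \<Longrightarrow> x \<in> set xs \<Longrightarrow> f n x \<in> carrier E) \<Longrightarrow>
    SS (\<lambda>n. list_sum E (f n) xs) = list_sum E (\<lambda>x. SS (\<lambda>n. f n x)) xs"
  by (rule list_sum_swap) (simp add: ss)

lemma SS_K:
  assumes "\<And>n. n \<in> S \<Longrightarrow> f n \<in> carrier E" "\<And>g n. g \<in> carrier G \<Longrightarrow> n \<in> S \<Longrightarrow> f (lam g n) = g (f n)"
  shows "SS f \<in> K"
proof (rule fixed_K)
  show "SS f \<in> carrier E" using assms(1) by simp
  fix g assume g: "g \<in> carrier G"
  have "g (SS f) = SS (\<lambda>n. g (f n))" by (rule G_list_sum[OF g]) (use assms ss in auto)
  also have "\<dots> = SS (\<lambda>n. f (lam g n))" by (rule SS_cong) (use assms g in simp)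
  also have "\<dots> = SS f"
  proof (rule list_sum_reindex[OF ss(1) ss(1), symmetric])
    show "bij_betw (lam g) (set ss) (set ss)"
      using lam_P[OF g] by (simp add: ss BijGroup_def Bij_def)
  qed (use assms ss in auto)
  finally show "g (SS f) = SS f" .
qed

definition "FS = (SOME F. (\<forall>(a, d)\<in>set F. equivariant S lam a \<and> equivariant S lam d) \<and>
           (\<forall>m\<in>S. \<forall>n\<in>S. list_sum E (\<lambda>(a, d). d m \<otimes> a n) F = (if m = n then \<one> else \<zero>)))"

lemma FS:
  shows "p \<in> set FS \<Longrightarrow> n \<in> S \<Longrightarrow> fst p n \<in> carrier E" "p \<in> set FS \<Longrightarrow> n \<in> S \<Longrightarrow> snd p n \<in> carrier E"
    "p \<in> set FS \<Longrightarrow> n \<in> S \<Longrightarrow> g \<in> carrier G \<Longrightarrow> fst p (lam g n) = g (fst p n)"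
    "p \<in> set FS \<Longrightarrow> n \<in> S \<Longrightarrow> g \<in> carrier G \<Longrightarrow> snd p (lam g n) = g (snd p n)"
    "m \<in> S \<Longrightarrow> n \<in> S \<Longrightarrow> list_sum E (\<lambda>p. snd p m \<otimes> fst p n) FS = (if m = n then \<one> else \<zero>)"
    "p \<in> set FS \<Longrightarrow> fst p B \<in> L"
proof -
  have "\<exists>F. (\<forall>(a, d)\<in>set F. equivariant S lam a \<and> equivariant S lam d) \<and>
           (\<forall>m\<in>S. \<forall>n\<in>S. list_sum E (\<lambda>(a, d). d m \<otimes> a n) F = (if m = n then \<one> else \<zero>))"
    using dual_frame[of ss lam] action_lam by (simp add: ss)
  from someI_ex[OF this] have *: "(\<forall>(a, d)\<in>set FS. equivariant S lam a \<and> equivariant S lam d)"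
     "(\<forall>m\<in>S. \<forall>n\<in>S. list_sum E (\<lambda>(a, d). d m \<otimes> a n) FS = (if m = n then \<one> else \<zero>))"
    unfolding FS_def[symmetric] by auto
  have **: "equivariant S lam (fst p)" "equivariant S lam (snd p)" if "p \<in> set FS" for p
    using *(1) that by auto
  show "p \<in> set FS \<Longrightarrow> n \<in> S \<Longrightarrow> fst p n \<in> carrier E" "p \<in> set FS \<Longrightarrow> n \<in> S \<Longrightarrow> snd p n \<in> carrier E"
    "p \<in> set FS \<Longrightarrow> n \<in> S \<Longrightarrow> g \<in> carrier G \<Longrightarrow> fst p (lam g n) = g (fst p n)"
    "p \<in> set FS \<Longrightarrow> n \<in> S \<Longrightarrow> g \<in> carrier G \<Longrightarrow> snd p (lam g n) = g (snd p n)"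
    using ** unfolding equivariant_def by blast+
  show "m \<in> S \<Longrightarrow> n \<in> S \<Longrightarrow> list_sum E (\<lambda>p. snd p m \<otimes> fst p n) FS = (if m = n then \<one> else \<zero>)"
    using *(2) by (simp add: split_def)
  show "p \<in> set FS \<Longrightarrow> fst p B \<in> L" using equivariant_B_in_L[OF **(1)] .
qed

lemma coset_eval_FS: "p \<in> set FS \<Longrightarrow> s \<in> S \<Longrightarrow> coset_eval s (fst p B) = fst p s"
  by (metis coset_lamE coset_eval_coset FS(3,6) B_coset)

text \<open>The functional paired with the vector \<open>fst p B\<close> in the frame of
  \<open>L\<close>: a weighted trace, \<open>\<Sum> d(s) s(x)\<close> over the embeddings
  \<open>s\<close>.\<close>

definition "phi p x = SS (\<lambda>s. snd p s \<otimes> coset_eval s x)"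

lemma phi_K: "p \<in> set FS \<Longrightarrow> x \<in> L \<Longrightarrow> phi p x \<in> K"
  unfolding phi_def by (rule SS_K) (auto simp: FS coset_eval_lam)

text \<open>The equivariant function \<open>s \<mapsto> s x\<close> attached to \<open>x\<close> is
  expanded in the dual frame on the cosets; its value at the trivial coset is \<open>x\<close>
  itself.\<close>

lemma phi_expand:
  assumes "x \<in> L" "s \<in> S"
  shows "coset_eval s x = list_sum E (\<lambda>p. phi p x \<otimes> fst p s) FS"
proof -
  have "list_sum E (\<lambda>p. phi p x \<otimes> fst p s) FS = list_sum E (\<lambda>p. SS (\<lambda>m. coset_eval m x \<otimes> (snd p m \<otimes> fst p s))) FS"
  proof (rule list_sum_cong[OF refl])
    fix p assume p: "p \<in> set FS"
    have "phi p x \<otimes> fst p s = SS (\<lambda>m. (snd p m \<otimes> coset_eval m x) \<otimes> fst p s)"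
      unfolding phi_def by (rule SS_r) (use FS(1,2)[OF p] assms in simp_all)
    also have "\<dots> = SS (\<lambda>m. coset_eval m x \<otimes> (snd p m \<otimes> fst p s))"
      by (rule SS_cong) (use FS(1,2)[OF p] assms in \<open>simp add: m_ac\<close>)
    finally show "phi p x \<otimes> fst p s = \<dots>" .
  qed
  also have "\<dots> = SS (\<lambda>m. list_sum E (\<lambda>p. coset_eval m x \<otimes> (snd p m \<otimes> fst p s)) FS)"
    by (rule SS_swap_list[symmetric]) (use FS(1,2) assms in simp)
  also have "\<dots> = SS (\<lambda>m. coset_eval m x \<otimes> list_sum E (\<lambda>p. snd p m \<otimes> fst p s) FS)"
    by (intro SS_cong list_sum_rdistr[symmetric]) (use FS(1,2) assms in simp_all)
  also have "\<dots> = SS (\<lambda>m. if m = s then coset_eval m x else \<zero>)"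
    by (rule SS_cong) (use FS(5) assms in simp)
  also have "\<dots> = coset_eval s x" by (rule SS_delta(1)) (use assms in auto)
  finally show ?thesis by simp
qed

lemma phi_expand_L: "x \<in> L \<Longrightarrow> x = list_sum E (\<lambda>p. phi p x \<otimes> fst p B) FS"
  using phi_expand[of x B] B_coset coset_eval_B by simp

definition "FL = map (\<lambda>p. (fst p B, phi p)) FS"

lemma frame_L: "frame (E\<lparr>carrier := K\<rparr>) Lv FL"
  unfolding frame_def
proof (intro conjI ballI)
  fix q assume "q \<in> set FL"
  then obtain p where p: "p \<in> set FS" "q = (fst p B, phi p)" by (auto simp: FL_def)
  have "linear_form (E\<lparr>carrier := K\<rparr>) Lv (phi p)"
    unfolding linear_form_def
  proof (intro conjI ballI)
    show "phi p \<in> carrier Lv \<rightarrow> carrier (E\<lparr>carrier := K\<rparr>)" using phi_K[OF p(1)] by simp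
    fix x y assume "x \<in> carrier Lv" "y \<in> carrier Lv"
    hence xy: "x \<in> L" "y \<in> L" by auto
    have "phi p (x \<oplus> y) = SS (\<lambda>s. snd p s \<otimes> coset_eval s x \<oplus> snd p s \<otimes> coset_eval s y)"
      unfolding phi_def by (rule SS_cong) (use xy FS(2)[OF p(1)] in \<open>simp add: coset_eval_hom r_distr\<close>)
    also have "\<dots> = phi p x \<oplus> phi p y"
      unfolding phi_def by (rule list_sum_add) (use xy FS(2)[OF p(1)] ss in auto)
    finally show "phi p (x \<oplus>\<^bsub>Lv\<^esub> y) = phi p x \<oplus>\<^bsub>E\<lparr>carrier := K\<rparr>\<^esub> phi p y" by simp
  next
    fix k x assume "k \<in> carrier (E\<lparr>carrier := K\<rparr>)" "x \<in> carrier Lv"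
    hence kx: "k \<in> K" "k \<in> carrier E" "k \<in> L" "x \<in> L" by auto
    have "phi p (k \<otimes> x) = SS (\<lambda>s. k \<otimes> (snd p s \<otimes> coset_eval s x))"
      unfolding phi_def by (rule SS_cong) (use kx FS(2)[OF p(1)] in \<open>simp add: coset_eval_hom m_ac\<close>)
    also have "\<dots> = k \<otimes> phi p x"
      unfolding phi_def by (rule SS_l[symmetric]) (use kx FS(2)[OF p(1)] in simp_all)
    finally show "phi p (k \<odot>\<^bsub>Lv\<^esub> x) = k \<otimes>\<^bsub>E\<lparr>carrier := K\<rparr>\<^esub> phi p x" by simp
  qed
  thus "case q of (a, \<phi>) \<Rightarrow> a \<in> carrier Lv \<and> linear_form (E\<lparr>carrier := K\<rparr>) Lv \<phi>"
    using p FS(6) by simp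
next
  fix x assume "x \<in> carrier Lv"
  thus "x = list_sum Lv (\<lambda>(a, \<phi>). \<phi> x \<odot>\<^bsub>Lv\<^esub> a) FL"
    using phi_expand_L[of x] by (simp add: Lv_list_sum FL_def)
qed

text \<open>The frame vectors \<open>fst p B\<close> suffice as test elements: weighted by
  \<open>snd p s\<close> and summed over \<open>p\<close>, their images under the embeddings become
  a delta at \<open>s\<close>.\<close>

lemma coset_independent:
  assumes w: "\<And>s. s \<in> S \<Longrightarrow> w s \<in> carrier E"
    and 0: "\<And>y. y \<in> L \<Longrightarrow> SS (\<lambda>s. w s \<otimes> coset_eval s y) = \<zero>" and s: "s \<in> S"
  shows "w s = \<zero>"
proof -
  have "\<zero> = list_sum E (\<lambda>p. snd p s \<otimes> SS (\<lambda>m. w m \<otimes> coset_eval m (fst p B))) FS"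
    using 0 FS(2,6) s by (intro list_sum_zero'[symmetric]) simp
  also have "\<dots> = list_sum E (\<lambda>p. SS (\<lambda>m. w m \<otimes> (snd p s \<otimes> fst p m))) FS"
  proof (rule list_sum_cong[OF refl])
    fix p assume p: "p \<in> set FS"
    have "snd p s \<otimes> SS (\<lambda>m. w m \<otimes> coset_eval m (fst p B)) = SS (\<lambda>m. snd p s \<otimes> (w m \<otimes> coset_eval m (fst p B)))"
      by (rule SS_l) (use FS(2,6)[OF p] w s in simp_all)
    also have "\<dots> = SS (\<lambda>m. w m \<otimes> (snd p s \<otimes> fst p m))"
      by (rule SS_cong) (use FS(1,2)[OF p] w s in \<open>simp add: coset_eval_FS[OF p] m_ac\<close>)
    finally show "snd p s \<otimes> SS (\<lambda>m. w m \<otimes> coset_eval m (fst p B)) = \<dots>" .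
  qed
  also have "\<dots> = SS (\<lambda>m. list_sum E (\<lambda>p. w m \<otimes> (snd p s \<otimes> fst p m)) FS)"
    by (rule SS_swap_list[symmetric]) (use FS(1,2) s w in simp)
  also have "\<dots> = SS (\<lambda>m. w m \<otimes> list_sum E (\<lambda>p. snd p s \<otimes> fst p m) FS)"
    by (intro SS_cong list_sum_rdistr[symmetric]) (use FS(1,2) s w in simp_all)
  also have "\<dots> = SS (\<lambda>m. if s = m then w m else \<zero>)"
    by (rule SS_cong) (use FS(5) s w in simp)
  also have "\<dots> = w s" by (rule SS_delta(2)) (use s w in auto)
  finally show ?thesis by simp
qed

lemma linear_endos_list_sum:
  assumes f: "f \<in> linear_endos E K L" and "\<And>p. p \<in> set ps \<Longrightarrow> k p \<in> K" "\<And>p. p \<in> set ps \<Longrightarrow> a p \<in> L"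
  shows "f (list_sum E (\<lambda>p. k p \<otimes> a p) ps) = list_sum E (\<lambda>p. k p \<otimes> f (a p)) ps"
  using assms(2,3)
proof (induction ps)
  case Nil
  have K0: "\<zero> \<in> K" using subringE(2)[OF subfieldE(1)[OF K]] .
  have "f (\<zero> \<otimes> \<zero>) = \<zero> \<otimes> f \<zero>" using f K0 by (simp add: linear_endos_def del: l_null r_null)
  moreover have "f \<zero> \<in> L" using f by (auto simp: linear_endos_def)
  ultimately show ?case by simp
next
  case (Cons p ps)
  have "list_sum E (\<lambda>p. k p \<otimes> a p) ps \<in> L" using Cons.prems by (intro L_list_sum) auto
  moreover have "k p \<otimes> a p \<in> L" using Cons.prems by simp
  ultimately show ?case using Cons f by (simp add: linear_endos_def)
qed

end


section \<open>The action on \<open>L\<close> and the bijectivity of its Galois map\<close>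

context regular_normalized
begin

lemma finite_cocommutative_H: "finite_cocommutative_hopf_algebra R0 H"
proof (intro finite_cocommutative_hopf_algebra.intro finite_cocommutative_hopf_algebra_axioms.intro)
  show "hopf_algebra R0 H" by (rule hopf_algebra_H)
  interpret module R0 H by (rule module_H)
  let ?B = "(\<lambda>p. restrict (fst p) N) ` set FN"
  show "\<exists>B. finite B \<and> B \<subseteq> carrier H \<and>
         (\<forall>x\<in>carrier H. \<exists>c\<in>B \<rightarrow> carrier R0. x = finsum H (\<lambda>b. c b \<odot>\<^bsub>H\<^esub> b) B)"
  proof (intro exI[of _ ?B] conjI ballI)
    show B: "?B \<subseteq> carrier H" using FN_A by auto
    fix x assume x: "x \<in> carrier H"
    have "x = list_sum H (\<lambda>p. SN (\<lambda>m. snd p m \<otimes> x m) \<odot>\<^bsub>H\<^esub> restrict (fst p) N) FN"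
      using frameD(3)[OF frame_H x] by (simp add: FH_def)
    moreover have "\<exists>c\<in>?B \<rightarrow> carrier R0. list_sum H (\<lambda>p. SN (\<lambda>m. snd p m \<otimes> x m) \<odot>\<^bsub>H\<^esub> restrict (fst p) N) FN
        = finsum H (\<lambda>b. c b \<odot>\<^bsub>H\<^esub> b) ?B"
      by (rule list_sum_as_finsum[OF _ B]) (use x A_conj_pairing in auto)
    ultimately show "\<exists>c\<in>?B \<rightarrow> carrier R0. x = finsum H (\<lambda>b. c b \<odot>\<^bsub>H\<^esub> b) ?B" by simp
  qed simp
next
  fix x assume "x \<in> carrier H"
  hence x: "x \<in> A" by simp
  note cx = comult_H[OF x]
  show "tensor_eq R0 H H (comult H x) [(v, u). (u, v) \<leftarrow> comult H x]"
  proof (rule H_tensor_eqI[OF cx(1)])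
    show "set [(v, u). (u, v) \<leftarrow> comult H x] \<subseteq> A \<times> A" using cx(1) by auto
    fix m n assume mn: "m \<in> N" "n \<in> N"
    have "list_sum E (\<lambda>z. fst z m \<otimes> snd z n) [(v, u). (u, v) \<leftarrow> comult H x] =
       list_sum E (\<lambda>z. fst z n \<otimes> snd z m) (comult H x)"
      unfolding list_sum_map
      by (intro list_sum_cong refl) (use cx(3,4) mn in \<open>simp add: split_def m_comm\<close>)
    thus "list_sum E (\<lambda>z. fst z m \<otimes> snd z n) (comult H x) =
       list_sum E (\<lambda>z. fst z m \<otimes> snd z n) [(v, u). (u, v) \<leftarrow> comult H x]"
      using cx(2) mn by auto
  qed
qed

abbreviation "act \<equiv> gp_action E K L N"

lemma act_eq:
  assumes "c \<in> A" "x \<in> L"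
  shows "act c x = SN (\<lambda>n. c n \<otimes> coset_eval (iv n B) x)"
proof -
  have "act c x = finsum E (\<lambda>n. c n \<otimes> coset_eval (iv n B) x) N"
    unfolding gp_action_def coset_eval_def ..
  also have "\<dots> = SN (\<lambda>n. c n \<otimes> coset_eval (iv n B) x)"
    by (rule SN_finsum) (use assms B_coset in simp)
  finally show ?thesis .
qed

lemma lam_iv:
  assumes "g \<in> carrier G" "n \<in> N" "s \<in> S"
  shows "lam g (iv n s) = iv (cj g n) (lam g s)"
  using assms by (simp add: cj_inv[symmetric] conj_apply N_P lam_closed lam_inv)

text \<open>Moving \<open>g\<close> past \<open>n\<^sup>-\<^sup>1\<close> replaces \<open>n\<close>
  by its conjugate, and equivariance of \<open>c\<close> lets the sum be reindexed. For
  \<open>g\<close> in \<open>B\<close> this shows that the action preserves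
  \<open>L\<close>.\<close>

lemma G_act:
  assumes c: "c \<in> A" and x: "x \<in> L" and g: "g \<in> carrier G"
  shows "g (act c x) = SN (\<lambda>n. c n \<otimes> coset_eval (iv n (lam g B)) x)"
proof -
  have "g (act c x) = SN (\<lambda>n. g (c n \<otimes> coset_eval (iv n B) x))"
    unfolding act_eq[OF c x] by (rule G_SN[OF g]) (use c x B_coset in simp)
  also have "\<dots> = SN (\<lambda>n. c (cj g n) \<otimes> coset_eval (iv (cj g n) (lam g B)) x)"
    by (rule SN_cong) (use c x g B_coset in \<open>simp add: A_D(2) coset_eval_lam[symmetric] lam_iv\<close>)
  also have "\<dots> = SN (\<lambda>n. c n \<otimes> coset_eval (iv n (lam g B)) x)"
    by (rule SN_cj[OF g]) (use c x g B_coset lam_closed in simp)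
  finally show ?thesis .
qed

lemma act_L [simp]:
  assumes c: "c \<in> A" and x: "x \<in> L" shows "act c x \<in> L"
proof (rule fixed_B)
  show "act c x \<in> carrier E" unfolding act_eq[OF c x] using c x B_coset by simp
  fix b assume b: "b \<in> B"
  hence bG: "b \<in> carrier G" using BG by blast
  show "b (act c x) = act c x" using G_act[OF c x bG] lam_B_fix[OF b] act_eq[OF c x] by simp
qed

text \<open>In coset coordinates the base point \<open>B\<close> of the action becomes an arbitrary
  coset; composing two actions and comparing two subgroups both rest on this form.\<close>

lemma coset_eval_act:
  assumes c: "c \<in> A" and x: "x \<in> L" and s: "s \<in> S"
  shows "coset_eval s (act c x) = SN (\<lambda>n. c n \<otimes> coset_eval (iv n s) x)"
proof -
  obtain g where g: "g \<in> carrier G" "s = lam g B" using coset_lamE[OF s] .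
  show ?thesis using coset_eval_coset[OF g(1) act_L[OF c x]] G_act[OF c x g(1)] g(2) by simp
qed

lemma iv_B_inj: "n \<in> N \<Longrightarrow> m \<in> N \<Longrightarrow> iv n B = iv m B \<longleftrightarrow> n = m"
  using N_regular[OF B_coset, of "iv n B"] N_S[OF _ B_coset] N_simps(2) by (metis N_closed(2))

lemma bij_iv_B: "bij_betw (\<lambda>n. iv n B) N S"
proof (rule bij_betwI')
  show "\<exists>n\<in>N. s = iv n B" if s: "s \<in> S" for s
  proof -
    obtain m where "m \<in> N" "m B = s" using N_regular[OF B_coset s] by blast
    thus ?thesis by (intro bexI[of _ "iv m"]) (auto simp: N_simps)
  qed
qed (use iv_B_inj N_S[OF _ B_coset] in auto)

lemma SS_SN: "(\<And>s. s \<in> S \<Longrightarrow> f s \<in> carrier E) \<Longrightarrow> SS f = SN (\<lambda>n. f (iv n B))"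
  by (rule list_sum_reindex[OF ns(1) ss(1)]) (use bij_iv_B in \<open>auto simp: ns ss\<close>)

lemma N_independent:
  assumes w: "\<And>n. n \<in> N \<Longrightarrow> w n \<in> carrier E"
    and 0: "\<And>y. y \<in> L \<Longrightarrow> SN (\<lambda>n. w n \<otimes> coset_eval (iv n B) y) = \<zero>" and n: "n \<in> N"
  shows "w n = \<zero>"
proof -
  define i where "i = inv_into N (\<lambda>n. iv n B)"
  have i: "i (iv n B) = n" if "n \<in> N" for n
    using bij_iv_B that inv_into_f_f[of "\<lambda>n. iv n B" N n] by (simp add: i_def bij_betw_def)
  have iN: "i s \<in> N" if "s \<in> S" for s
    using bij_iv_B that by (metis bij_betw_def i_def inv_into_into)
  have "w (i (iv n B)) = \<zero>"
  proof (rule coset_independent)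
    fix y assume y: "y \<in> L"
    have "SS (\<lambda>s. w (i s) \<otimes> coset_eval s y) = SN (\<lambda>n. w (i (iv n B)) \<otimes> coset_eval (iv n B) y)"
      by (rule SS_SN) (use w iN y in simp)
    also have "\<dots> = SN (\<lambda>n. w n \<otimes> coset_eval (iv n B) y)" by (rule SN_cong) (simp add: i)
    finally show "SS (\<lambda>s. w (i s) \<otimes> coset_eval s y) = \<zero>" using 0[OF y] by simp
  qed (use w iN n B_coset in simp_all)
  thus ?thesis using i n by simp
qed

text \<open>Independence of the embeddings gives \<open>\<Sum> x h(n) = 0\<close> for each
  \<open>n\<close>. Galois automorphisms turn this into vanishing at every pair of a coset and an
  element of \<open>N\<close>, and those values determine a tensor in
  \<open>L \<otimes> H\<close>.\<close>

lemma galois_map_inj_H: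
  assumes t: "set t \<subseteq> L \<times> carrier H"
    and 0: "\<And>y. y \<in> L \<Longrightarrow> list_sum E (\<lambda>(x, h). x \<otimes> act h y) t = \<zero>"
  shows "tensor_eq R0 Lv H t []"
proof (rule tensor_eqI[OF module_Lv module_H frame_L frame_H])
  show "set t \<subseteq> carrier Lv \<times> carrier H" using t by simp
  show "set [] \<subseteq> carrier Lv \<times> carrier H" by simp
  have tc: "fst z \<in> L" "snd z \<in> A" if "z \<in> set t" for z using t that by auto
  have w: "list_sum E (\<lambda>z. fst z \<otimes> snd z n) t = \<zero>" if n: "n \<in> N" for n
  proof (rule N_independent[OF _ _ n])
    show "list_sum E (\<lambda>z. fst z \<otimes> snd z n) t \<in> carrier E" if "n \<in> N" for n
      using tc that by (intro list_sum_closed) simp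
    fix y assume y: "y \<in> L"
    have "\<zero> = list_sum E (\<lambda>z. fst z \<otimes> act (snd z) y) t" using 0[OF y] by (simp add: split_def)
    also have "\<dots> = list_sum E (\<lambda>z. SN (\<lambda>n. (fst z \<otimes> snd z n) \<otimes> coset_eval (iv n B) y)) t"
    proof (rule list_sum_cong[OF refl])
      fix z assume z: "z \<in> set t"
      have "fst z \<otimes> act (snd z) y = SN (\<lambda>n. fst z \<otimes> (snd z n \<otimes> coset_eval (iv n B) y))"
        unfolding act_eq[OF tc(2)[OF z] y] by (rule SN_l) (use tc[OF z] y B_coset in simp_all)
      also have "\<dots> = SN (\<lambda>n. (fst z \<otimes> snd z n) \<otimes> coset_eval (iv n B) y)"
        by (rule SN_cong) (use tc[OF z] y B_coset in \<open>simp add: m_assoc\<close>)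
      finally show "fst z \<otimes> act (snd z) y = \<dots>" .
    qed
    also have "\<dots> = SN (\<lambda>n. list_sum E (\<lambda>z. (fst z \<otimes> snd z n) \<otimes> coset_eval (iv n B) y) t)"
      by (rule SN_swap_list[symmetric]) (use tc y B_coset in simp)
    also have "\<dots> = SN (\<lambda>n. list_sum E (\<lambda>z. fst z \<otimes> snd z n) t \<otimes> coset_eval (iv n B) y)"
      by (intro SN_cong list_sum_ldistr[symmetric]) (use tc y B_coset in simp_all)
    finally show "SN (\<lambda>n. list_sum E (\<lambda>z. fst z \<otimes> snd z n) t \<otimes> coset_eval (iv n B) y) = \<zero>" by simp
  qed
  have w2: "list_sum E (\<lambda>z. coset_eval s (fst z) \<otimes> snd z n) t = \<zero>" if s: "s \<in> S" and n: "n \<in> N" for s n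
  proof -
    obtain g where g: "g \<in> carrier G" "s = lam g B" using coset_lamE[OF s] .
    \<comment> \<open>Chosen so that conjugation by \<open>g\<close> takes it to \<open>n\<close>,
      since \<open>g\<close> moves both arguments at once.\<close>
    define m where "m = cj (inv\<^bsub>G\<^esub> g) n"
    have m: "m \<in> N" "n = cj g m" using g n by (simp_all add: m_def cj_cancel)
    have "list_sum E (\<lambda>z. coset_eval s (fst z) \<otimes> snd z n) t = list_sum E (\<lambda>z. g (fst z \<otimes> snd z m)) t"
      by (rule list_sum_cong[OF refl]) (use tc g m in \<open>simp add: coset_eval_coset A_D(2)\<close>)
    also have "\<dots> = g (list_sum E (\<lambda>z. fst z \<otimes> snd z m) t)"
      by (rule G_list_sum[OF g(1), symmetric]) (use tc m in simp)
    finally show ?thesis using w[OF m(1)] g(1) by simp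
  qed
  fix p q assume "p \<in> set FL" "q \<in> set FH"
  then obtain p' q' where p': "p' \<in> set FS" "snd p = phi p'"
    and q': "q' \<in> set FN" "snd q = (\<lambda>c. SN (\<lambda>m. snd q' m \<otimes> c m))" by (auto simp: FL_def FH_def)
  have "list_sum E (\<lambda>z. SS (\<lambda>s. snd p' s \<otimes> coset_eval s (fst z)) \<otimes> SN (\<lambda>m. snd q' m \<otimes> snd z m)) t =
    SS (\<lambda>s. SN (\<lambda>n. (snd p' s \<otimes> snd q' n) \<otimes> list_sum E (\<lambda>z. coset_eval s (fst z) \<otimes> snd z n) t))"
    by (rule list_sum_pairing) (use tc FS(2)[OF p'(1)] FN(2)[OF q'(1)] in \<open>auto simp: ns ss\<close>)
  also have "\<dots> = SS (\<lambda>s. SN (\<lambda>n. \<zero>))"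
    by (intro SS_cong SN_cong) (use w2 FS(2)[OF p'(1)] FN(2)[OF q'(1)] in simp)
  finally show "list_sum R0 (\<lambda>(x, y). snd p x \<otimes>\<^bsub>R0\<^esub> snd q y) t = list_sum R0 (\<lambda>(x, y). snd p x \<otimes>\<^bsub>R0\<^esub> snd q y) []"
    by (simp add: p'(2) q'(2) phi_def split_def)
qed

text \<open>An endomorphism of \<open>L\<close> over \<open>K\<close> is
  \<open>\<Sum> w(s) s\<close> over the embeddings, with coefficients in \<open>E\<close>. Since
  \<open>f\<close> has values in \<open>L\<close>, the function \<open>w\<close> is compatible with
  \<open>B\<close>, so pairing \<open>n \<mapsto> w (n\<^sup>-\<^sup>1 B)\<close> with the dual
  frame of \<open>N\<close> gives coefficients \<open>c q\<close> in \<open>L\<close>.\<close>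

lemma galois_map_surj_H:
  assumes f: "f \<in> linear_endos E K L"
  shows "\<exists>t. set t \<subseteq> L \<times> carrier H \<and> (\<forall>y\<in>L. f y = list_sum E (\<lambda>(x, h). x \<otimes> act h y) t)"
proof -
  have fL: "f x \<in> L" if "x \<in> L" for x using f that by (auto simp: linear_endos_def)
  define w where "w = (\<lambda>s. list_sum E (\<lambda>p. snd p s \<otimes> f (fst p B)) FS)"
  have wc: "w s \<in> carrier E" if "s \<in> S" for s
    unfolding w_def using that FS(2,6) fL by (intro list_sum_closed) simp
  have fy: "f y = SN (\<lambda>n. w (iv n B) \<otimes> coset_eval (iv n B) y)" if y: "y \<in> L" for y
  proof -
    have "f y = list_sum E (\<lambda>p. phi p y \<otimes> f (fst p B)) FS"
      using linear_endos_list_sum[OF f, of FS "\<lambda>p. phi p y" "\<lambda>p. fst p B"] phi_K FS(6) y phi_expand_L[OF y]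
      by simp
    also have "\<dots> = list_sum E (\<lambda>p. SS (\<lambda>s. (snd p s \<otimes> f (fst p B)) \<otimes> coset_eval s y)) FS"
    proof (rule list_sum_cong[OF refl])
      fix p assume p: "p \<in> set FS"
      have "phi p y \<otimes> f (fst p B) = SS (\<lambda>s. (snd p s \<otimes> coset_eval s y) \<otimes> f (fst p B))"
        unfolding phi_def by (rule SS_r) (use FS(2,6)[OF p] fL y in simp_all)
      also have "\<dots> = SS (\<lambda>s. (snd p s \<otimes> f (fst p B)) \<otimes> coset_eval s y)"
        by (rule SS_cong) (use FS(2,6)[OF p] fL y in \<open>simp add: m_ac\<close>)
      finally show "phi p y \<otimes> f (fst p B) = \<dots>" .
    qed
    also have "\<dots> = SS (\<lambda>s. list_sum E (\<lambda>p. (snd p s \<otimes> f (fst p B)) \<otimes> coset_eval s y) FS)"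
      by (rule SS_swap_list[symmetric]) (use FS(2,6) fL y in simp)
    also have "\<dots> = SS (\<lambda>s. w s \<otimes> coset_eval s y)"
      unfolding w_def by (intro SS_cong list_sum_ldistr[symmetric]) (use FS(2,6) fL y in simp_all)
    also have "\<dots> = SN (\<lambda>n. w (iv n B) \<otimes> coset_eval (iv n B) y)"
      by (rule SS_SN) (use wc y in simp)
    finally show ?thesis .
  qed
  define c where "c = (\<lambda>q :: ('a coset_perm \<Rightarrow> 'a) \<times> ('a coset_perm \<Rightarrow> 'a). SN (\<lambda>m. snd q m \<otimes> w (iv m B)))"
  have cL: "c q \<in> L" if q: "q \<in> set FN" for q
  proof (rule fixed_B)
    show "c q \<in> carrier E" unfolding c_def using FN(2)[OF q] wc B_coset by simp
    fix b assume b: "b \<in> B"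
    hence bG: "b \<in> carrier G" using BG by blast
    have bw: "b (w s) = w (lam b s)" if s: "s \<in> S" for s
    proof -
      have "b (w s) = list_sum E (\<lambda>p. b (snd p s \<otimes> f (fst p B))) FS"
        unfolding w_def by (rule G_list_sum[OF bG]) (use FS(2,6) fL s in simp)
      also have "\<dots> = w (lam b s)" unfolding w_def
        by (rule list_sum_cong[OF refl])
           (use FS(2,4,6) fL s bG galois_groupD(2)[OF b fL] in simp)
      finally show ?thesis .
    qed
    have "b (c q) = SN (\<lambda>m. b (snd q m \<otimes> w (iv m B)))"
      unfolding c_def by (rule G_SN[OF bG]) (use FN(2)[OF q] wc B_coset in simp)
    also have "\<dots> = SN (\<lambda>m. snd q (cj b m) \<otimes> w (iv (cj b m) B))"
      by (rule SN_cong)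
         (use FN(2,4)[OF q] wc B_coset bG bw lam_iv[OF bG _ B_coset] lam_B_fix[OF b] in simp)
    also have "\<dots> = c q" unfolding c_def
      by (rule SN_cj[OF bG]) (use FN(2)[OF q] wc B_coset in simp)
    finally show "b (c q) = c q" .
  qed
  let ?t = "map (\<lambda>q. (c q, restrict (fst q) N)) FN"
  have "set ?t \<subseteq> L \<times> carrier H" using cL FN_A by auto
  moreover have "f y = list_sum E (\<lambda>(x, h). x \<otimes> act h y) ?t" if y: "y \<in> L" for y
  proof -
    let ?e = "\<lambda>n. coset_eval (iv n B) y"
    have e: "?e n \<in> carrier E" if "n \<in> N" for n using that y B_coset by simp
    have "list_sum E (\<lambda>(x, h). x \<otimes> act h y) ?t = list_sum E (\<lambda>q. c q \<otimes> SN (\<lambda>n. fst q n \<otimes> ?e n)) FN"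
      unfolding list_sum_map
      by (rule list_sum_cong[OF refl]) (use FN_A y in \<open>simp add: act_eq cong: SN_cong\<close>)
    also have "\<dots> = list_sum E (\<lambda>q. SN (\<lambda>m. w (iv m B) \<otimes> snd q m) \<otimes> SN (\<lambda>n. ?e n \<otimes> fst q n)) FN"
    proof (rule list_sum_cong[OF refl])
      fix q assume q: "q \<in> set FN"
      have "c q = SN (\<lambda>m. w (iv m B) \<otimes> snd q m)" unfolding c_def
        by (rule SN_cong) (use FN(2)[OF q] wc B_coset in \<open>simp add: m_comm\<close>)
      moreover have "SN (\<lambda>n. fst q n \<otimes> ?e n) = SN (\<lambda>n. ?e n \<otimes> fst q n)"
        by (rule SN_cong) (use FN(1)[OF q] e in \<open>simp add: m_comm\<close>)
      ultimately show "c q \<otimes> SN (\<lambda>n. fst q n \<otimes> ?e n) =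
          SN (\<lambda>m. w (iv m B) \<otimes> snd q m) \<otimes> SN (\<lambda>n. ?e n \<otimes> fst q n)" by simp
    qed
    also have "\<dots> = SN (\<lambda>m. SN (\<lambda>n. (w (iv m B) \<otimes> ?e n) \<otimes> list_sum E (\<lambda>q. snd q m \<otimes> fst q n) FN))"
      by (rule list_sum_pairing) (use FN(1,2) wc e B_coset ns in auto)
    also have "\<dots> = SN (\<lambda>m. SN (\<lambda>n. if m = n then w (iv m B) \<otimes> ?e n else \<zero>))"
      by (intro SN_cong) (use FN(5) wc e B_coset in simp)
    also have "\<dots> = SN (\<lambda>m. w (iv m B) \<otimes> ?e m)"
      by (intro SN_cong SN_delta(2)) (use wc e B_coset in simp_all)
    finally show ?thesis using fy[OF y] by simp
  qed
  ultimately show ?thesis by blast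
qed

theorem hopf_galois_structure_H: "hopf_galois_structure E K L H act"
proof (intro hopf_galois_structure.intro hopf_galois_structure_axioms.intro)
  show "finite_cocommutative_hopf_algebra R0 H" by (rule finite_cocommutative_H)
next
  fix h assume "h \<in> carrier H"
  hence h: "h \<in> A" by simp
  have "act h (x \<oplus> y) = act h x \<oplus> act h y" if "x \<in> L" "y \<in> L" for x y
    using that h B_coset by (simp add: act_eq coset_eval_hom r_distr SN_add cong: SN_cong)
  moreover have "act h (k \<otimes> x) = k \<otimes> act h x" if "k \<in> K" "x \<in> L" for k x
    using that h B_coset by (simp add: act_eq coset_eval_hom m_lcomm SN_l cong: SN_cong)
  ultimately show "act h \<in> linear_endos E K L" using h by (auto simp: linear_endos_def)
next
  fix h h' x assume "h \<in> carrier H" "h' \<in> carrier H" and x: "x \<in> L"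
  hence h: "h \<in> A" "h' \<in> A" by auto
  show "act (h \<oplus>\<^bsub>H\<^esub> h') x = act h x \<oplus> act h' x"
    using h x B_coset by (simp add: act_eq l_distr SN_add cong: SN_cong)
  have hh: "h \<otimes>\<^bsub>H\<^esub> h' \<in> A" using h H_closed(6) by simp
  have "act h (act h' x) = SN (\<lambda>m. h m \<otimes> SN (\<lambda>n. h' n \<otimes> coset_eval (iv n (iv m B)) x))"
    using h x B_coset by (simp add: act_eq[of h "act h' x"] coset_eval_act cong: SN_cong)
  also have "\<dots> = SN (\<lambda>m. h m \<otimes> SN (\<lambda>n. h' (iv m \<cdot> n) \<otimes> coset_eval (iv n B) x))"
  proof (rule SN_cong)
    fix m assume m: "m \<in> N"
    have "SN (\<lambda>n. h' n \<otimes> coset_eval (iv n (iv m B)) x) = SN (\<lambda>n. h' (iv m \<cdot> n) \<otimes> coset_eval (iv (iv m \<cdot> n) (iv m B)) x)"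
      by (rule SN_left[symmetric, of "iv m" "\<lambda>n. h' n \<otimes> coset_eval (iv n (iv m B)) x"]) (use m h x B_coset in simp_all)
    also have "\<dots> = SN (\<lambda>n. h' (iv m \<cdot> n) \<otimes> coset_eval (iv n B) x)"
    proof (rule SN_cong)
      fix n assume n: "n \<in> N"
      \<comment> \<open>Inverting \<open>m\<^sup>-\<^sup>1 n\<close> produces a factor
        \<open>m\<close>, which cancels against \<open>m\<^sup>-\<^sup>1 B\<close>.\<close>
      have "iv (iv m \<cdot> n) (iv m B) = (iv n \<cdot> m) (iv m B)" using m n by (simp add: N_simps)
      also have "\<dots> = iv n (m (iv m B))" using m n B_coset by (intro P_mult) (simp_all add: N_P)
      also have "\<dots> = iv n B" using m B_coset by (simp add: P_inv N_P)
      finally show "h' (iv m \<cdot> n) \<otimes> coset_eval (iv (iv m \<cdot> n) (iv m B)) x = h' (iv m \<cdot> n) \<otimes> coset_eval (iv n B) x"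
        by simp
    qed
    finally show "h m \<otimes> SN (\<lambda>n. h' n \<otimes> coset_eval (iv n (iv m B)) x) =
        h m \<otimes> SN (\<lambda>n. h' (iv m \<cdot> n) \<otimes> coset_eval (iv n B) x)" by simp
  qed
  also have "\<dots> = SN (\<lambda>m. SN (\<lambda>n. (h m \<otimes> h' (iv m \<cdot> n)) \<otimes> coset_eval (iv n B) x))"
    using h x B_coset by (simp add: SN_l m_assoc cong: SN_cong)
  also have "\<dots> = SN (\<lambda>n. SN (\<lambda>m. (h m \<otimes> h' (iv m \<cdot> n)) \<otimes> coset_eval (iv n B) x))"
    by (rule SN_swap) (use h x B_coset in simp)
  also have "\<dots> = SN (\<lambda>n. SN (\<lambda>m. h m \<otimes> h' (iv m \<cdot> n)) \<otimes> coset_eval (iv n B) x)"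
    by (rule SN_cong, rule SN_r[symmetric]) (use h x B_coset in simp_all)
  also have "\<dots> = act (h \<otimes>\<^bsub>H\<^esub> h') x"
    using h x hh by (simp add: act_eq[OF hh x] cong: SN_cong)
  finally show "act (h \<otimes>\<^bsub>H\<^esub> h') x = act h (act h' x)" by simp
next
  fix c h x assume c: "c \<in> K" and "h \<in> carrier H" and x: "x \<in> L"
  hence h: "h \<in> A" by simp
  show "act (c \<odot>\<^bsub>H\<^esub> h) x = c \<otimes> act h x"
    using h x c B_coset by (simp add: act_eq m_assoc SN_l cong: SN_cong)
next
  fix x assume x: "x \<in> L"
  have "act \<one>\<^bsub>H\<^esub> x = SN (\<lambda>n. if n = \<one>\<^bsub>P\<^esub> then coset_eval (iv n B) x else \<zero>)"
    unfolding act_eq[OF H_zero_A(2) x] by (rule SN_cong) (use x B_coset in simp)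
  also have "\<dots> = coset_eval (iv \<one>\<^bsub>P\<^esub> B) x" by (rule SN_delta(1)) (use x B_coset in simp_all)
  also have "\<dots> = x" using x B_coset by (simp add: P_one coset_eval_B)
  finally show "act \<one>\<^bsub>H\<^esub> x = x" .
next
  fix h x y assume "h \<in> carrier H" and x: "x \<in> L" "y \<in> L"
  hence h: "h \<in> A" by simp
  note ch = comult_H[OF h]
  let ?e = "\<lambda>n. coset_eval (iv n B)"
  have e: "?e n z \<in> carrier E" if "n \<in> N" "z \<in> L" for n z using that B_coset by simp
  have "list_sum E (\<lambda>(u, v). act u x \<otimes> act v y) (comult H h) =
      list_sum E (\<lambda>z. SN (\<lambda>m. ?e m x \<otimes> fst z m) \<otimes> SN (\<lambda>n. ?e n y \<otimes> snd z n)) (comult H h)"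
  proof (rule list_sum_cong[OF refl])
    fix z assume z: "z \<in> set (comult H h)"
    have "act (fst z) x = SN (\<lambda>m. ?e m x \<otimes> fst z m)" "act (snd z) y = SN (\<lambda>m. ?e m y \<otimes> snd z m)"
      using ch(3,4)[OF z] x e by (simp_all add: act_eq m_comm cong: SN_cong)
    thus "(case z of (u, v) \<Rightarrow> act u x \<otimes> act v y) =
        SN (\<lambda>m. ?e m x \<otimes> fst z m) \<otimes> SN (\<lambda>n. ?e n y \<otimes> snd z n)" by (simp add: split_def)
  qed
  also have "\<dots> = SN (\<lambda>m. SN (\<lambda>n. (?e m x \<otimes> ?e n y) \<otimes> list_sum E (\<lambda>z. fst z m \<otimes> snd z n) (comult H h)))"
    by (rule list_sum_pairing) (use ch(3,4) x e in \<open>auto simp: ns\<close>)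
  also have "\<dots> = SN (\<lambda>m. SN (\<lambda>n. if m = n then (?e m x \<otimes> ?e n y) \<otimes> h n else \<zero>))"
    by (intro SN_cong) (use ch(2) x e in simp)
  also have "\<dots> = SN (\<lambda>m. (?e m x \<otimes> ?e m y) \<otimes> h m)"
    by (intro SN_cong SN_delta(2)) (use x e h in simp_all)
  also have "\<dots> = act h (x \<otimes> y)"
    using x e h B_coset by (simp add: act_eq coset_eval_hom m_comm cong: SN_cong)
  finally show "act h (x \<otimes> y) = list_sum E (\<lambda>(u, v). act u x \<otimes> act v y) (comult H h)" by simp
next
  fix h assume "h \<in> carrier H"
  thus "act h \<one> = counit H h"
    using coset_eval_hom(3)[OF N_S[OF _ B_coset], of _ \<one> \<one>]
    by (simp add: act_eq H_counit cong: SN_cong)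
qed (rule galois_map_inj_H galois_map_surj_H; assumption)+

end


section \<open>Isomorphism classes\<close>

lemma tensor_eq_sym: "tensor_eq R M N s t \<Longrightarrow> tensor_eq R M N t s"
  by (simp add: tensor_eq_def)

lemma tensor_eq_trans: "tensor_eq R M N s t \<Longrightarrow> tensor_eq R M N t u \<Longrightarrow> tensor_eq R M N s u"
  by (simp add: tensor_eq_def)

text \<open>Bilinear forms on the target pull back along \<open>f\<close>.\<close>

lemma tensor_eq_map:
  assumes f: "f \<in> carrier M \<rightarrow> carrier M'"
    "\<And>x y. x \<in> carrier M \<Longrightarrow> y \<in> carrier M \<Longrightarrow> f (x \<oplus>\<^bsub>M\<^esub> y) = f x \<oplus>\<^bsub>M'\<^esub> f y"
    "\<And>c x. c \<in> carrier R \<Longrightarrow> x \<in> carrier M \<Longrightarrow> f (c \<odot>\<^bsub>M\<^esub> x) = c \<odot>\<^bsub>M'\<^esub> f x"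
    and eq: "tensor_eq R M M s t"
  shows "tensor_eq R M' M' [(f u, f v). (u, v) \<leftarrow> s] [(f u, f v). (u, v) \<leftarrow> t]"
  unfolding tensor_eq_def
proof (intro allI impI)
  fix \<beta> assume \<beta>: "bilinear_form R M' M' \<beta>"
  have "bilinear_form R M M (\<lambda>x y. \<beta> (f x) (f y))"
    using \<beta> f unfolding bilinear_form_def linear_form_def by (fastforce simp: Pi_def)
  hence "list_sum R (\<lambda>(x, y). \<beta> (f x) (f y)) s = list_sum R (\<lambda>(x, y). \<beta> (f x) (f y)) t"
    using eq unfolding tensor_eq_def by blast
  thus "list_sum R (\<lambda>(x, y). \<beta> x y) [(f u, f v). (u, v) \<leftarrow> s] = list_sum R (\<lambda>(x, y). \<beta> x y) [(f u, f v). (u, v) \<leftarrow> t]"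
    by (simp add: split_def)
qed

lemma hopf_galois_structure_closed:
  assumes "hopf_galois_structure E K L H \<mu>"
  shows "ring H" "module (E\<lparr>carrier := K\<rparr>) H" "h \<in> carrier H \<Longrightarrow> set (comult H h) \<subseteq> carrier H \<times> carrier H"
    "h \<in> carrier H \<Longrightarrow> antipode H h \<in> carrier H"
proof -
  interpret hopf_galois_structure E K L H \<mu> by fact
  show "ring H" "module (E\<lparr>carrier := K\<rparr>) H" by unfold_locales
  show "h \<in> carrier H \<Longrightarrow> set (comult H h) \<subseteq> carrier H \<times> carrier H"
    "h \<in> carrier H \<Longrightarrow> antipode H h \<in> carrier H" using comult_closed antipode_closed by auto
qed

lemma hopf_galois_iso_refl: "hopf_galois_iso E K L (H, \<mu>) (H, \<mu>)"
  unfolding hopf_galois_iso_def split_def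
proof (simp, intro bexI[of _ "\<lambda>x. x"] conjI ballI)
  show "(\<lambda>x. x) \<in> ring_iso H H"
    by (auto simp: ring_iso_def ring_hom_def bij_betw_def)
qed (auto simp: tensor_eq_def split_def)

lemma hopf_galois_iso_sym:
  assumes H: "hopf_galois_structure E K L H \<mu>" and H': "hopf_galois_structure E K L H' \<mu>'"
    and iso: "hopf_galois_iso E K L (H, \<mu>) (H', \<mu>')"
  shows "hopf_galois_iso E K L (H', \<mu>') (H, \<mu>)"
proof -
  note c = hopf_galois_structure_closed[OF H] note c' = hopf_galois_structure_closed[OF H']
  interpret M: module "E\<lparr>carrier := K\<rparr>" H by (rule c(2))
  obtain \<phi> where \<phi>: "\<phi> \<in> ring_iso H H'"
       "\<And>k h. k \<in> K \<Longrightarrow> h \<in> carrier H \<Longrightarrow> \<phi> (k \<odot>\<^bsub>H\<^esub> h) = k \<odot>\<^bsub>H'\<^esub> \<phi> h"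
       "\<And>h. h \<in> carrier H \<Longrightarrow> counit H' (\<phi> h) = counit H h"
       "\<And>h. h \<in> carrier H \<Longrightarrow> tensor_eq (E\<lparr>carrier := K\<rparr>) H' H' (comult H' (\<phi> h)) [(\<phi> u, \<phi> v). (u, v) \<leftarrow> comult H h]"
       "\<And>h. h \<in> carrier H \<Longrightarrow> antipode H' (\<phi> h) = \<phi> (antipode H h)"
       "\<And>h x. h \<in> carrier H \<Longrightarrow> x \<in> L \<Longrightarrow> \<mu>' (\<phi> h) x = \<mu> h x"
    using iso unfolding hopf_galois_iso_def by auto
  define \<psi> where "\<psi> = inv_into (carrier H) \<phi>"
  have \<psi>: "\<psi> \<in> ring_iso H' H" unfolding \<psi>_def using ring_iso_set_sym[OF c(1) \<phi>(1)] .
  have bij: "bij_betw \<phi> (carrier H) (carrier H')" using \<phi>(1) by (simp add: ring_iso_def)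
  have \<psi>\<phi>: "\<psi> (\<phi> h) = h" if "h \<in> carrier H" for h
    using bij that by (simp add: \<psi>_def bij_betw_def)
  have ex: "\<exists>h\<in>carrier H. h' = \<phi> h" if "h' \<in> carrier H'" for h'
    using bij that by (auto simp: bij_betw_def)
  have \<phi>c: "\<phi> h \<in> carrier H'" if "h \<in> carrier H" for h using bij that by (auto simp: bij_betw_def)
  have smult: "\<psi> (k \<odot>\<^bsub>H'\<^esub> h') = k \<odot>\<^bsub>H\<^esub> \<psi> h'" if "k \<in> K" "h' \<in> carrier H'" for k h'
    using ex[OF that(2)] \<phi>(2)[OF that(1), symmetric] \<psi>\<phi> M.smult_closed that(1) by auto
  have "tensor_eq (E\<lparr>carrier := K\<rparr>) H H (comult H (\<psi> h')) [(\<psi> u, \<psi> v). (u, v) \<leftarrow> comult H' h']"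
    if h': "h' \<in> carrier H'" for h'
  proof -
    obtain h where h: "h \<in> carrier H" "h' = \<phi> h" using ex[OF h'] by blast
    have "tensor_eq (E\<lparr>carrier := K\<rparr>) H H [(\<psi> u, \<psi> v). (u, v) \<leftarrow> comult H' (\<phi> h)]
        [(\<psi> u, \<psi> v). (u, v) \<leftarrow> [(\<phi> u, \<phi> v). (u, v) \<leftarrow> comult H h]]"
      by (rule tensor_eq_map[OF _ _ _ \<phi>(4)[OF h(1)]])
         (use ring_hom_memE[of \<psi> H' H] \<psi> smult in \<open>auto simp: ring_iso_def\<close>)
    moreover have "[(\<psi> u, \<psi> v). (u, v) \<leftarrow> [(\<phi> u, \<phi> v). (u, v) \<leftarrow> comult H h]] = comult H h"
      unfolding map_map by (rule map_idI) (use c(3)[OF h(1)] \<psi>\<phi> in auto)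
    ultimately show ?thesis using h \<psi>\<phi> tensor_eq_sym by metis
  qed
  moreover have "counit H (\<psi> h') = counit H' h'" if "h' \<in> carrier H'" for h'
    using ex[OF that] \<phi>(3) \<psi>\<phi> by auto
  moreover have "antipode H (\<psi> h') = \<psi> (antipode H' h')" if "h' \<in> carrier H'" for h'
    using ex[OF that] \<phi>(5) \<psi>\<phi> c(4) by auto
  moreover have "\<mu> (\<psi> h') x = \<mu>' h' x" if "h' \<in> carrier H'" "x \<in> L" for h' x
    using ex[OF that(1)] \<phi>(6) that(2) \<psi>\<phi> by auto
  ultimately show ?thesis
    unfolding hopf_galois_iso_def split_conv using \<psi> smult by (intro bexI[of _ \<psi>]) auto
qed

lemma hopf_galois_iso_trans:
  assumes H: "hopf_galois_structure E K L H \<mu>" and H': "hopf_galois_structure E K L H' \<mu>'"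
    and H'': "hopf_galois_structure E K L H'' \<mu>''"
    and iso: "hopf_galois_iso E K L (H, \<mu>) (H', \<mu>')" "hopf_galois_iso E K L (H', \<mu>') (H'', \<mu>'')"
  shows "hopf_galois_iso E K L (H, \<mu>) (H'', \<mu>'')"
proof -
  note c = hopf_galois_structure_closed[OF H] note c' = hopf_galois_structure_closed[OF H']
  obtain \<phi> where \<phi>: "\<phi> \<in> ring_iso H H'"
       "\<And>k h. k \<in> K \<Longrightarrow> h \<in> carrier H \<Longrightarrow> \<phi> (k \<odot>\<^bsub>H\<^esub> h) = k \<odot>\<^bsub>H'\<^esub> \<phi> h"
       "\<And>h. h \<in> carrier H \<Longrightarrow> counit H' (\<phi> h) = counit H h"
       "\<And>h. h \<in> carrier H \<Longrightarrow> tensor_eq (E\<lparr>carrier := K\<rparr>) H' H' (comult H' (\<phi> h)) [(\<phi> u, \<phi> v). (u, v) \<leftarrow> comult H h]"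
       "\<And>h. h \<in> carrier H \<Longrightarrow> antipode H' (\<phi> h) = \<phi> (antipode H h)"
       "\<And>h x. h \<in> carrier H \<Longrightarrow> x \<in> L \<Longrightarrow> \<mu>' (\<phi> h) x = \<mu> h x"
    using iso(1) unfolding hopf_galois_iso_def by auto
  obtain \<psi> where \<psi>: "\<psi> \<in> ring_iso H' H''"
       "\<And>k h. k \<in> K \<Longrightarrow> h \<in> carrier H' \<Longrightarrow> \<psi> (k \<odot>\<^bsub>H'\<^esub> h) = k \<odot>\<^bsub>H''\<^esub> \<psi> h"
       "\<And>h. h \<in> carrier H' \<Longrightarrow> counit H'' (\<psi> h) = counit H' h"
       "\<And>h. h \<in> carrier H' \<Longrightarrow> tensor_eq (E\<lparr>carrier := K\<rparr>) H'' H'' (comult H'' (\<psi> h)) [(\<psi> u, \<psi> v). (u, v) \<leftarrow> comult H' h]"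
       "\<And>h. h \<in> carrier H' \<Longrightarrow> antipode H'' (\<psi> h) = \<psi> (antipode H' h)"
       "\<And>h x. h \<in> carrier H' \<Longrightarrow> x \<in> L \<Longrightarrow> \<mu>'' (\<psi> h) x = \<mu>' h x"
    using iso(2) unfolding hopf_galois_iso_def by auto
  have \<phi>c: "\<phi> h \<in> carrier H'" if "h \<in> carrier H" for h
    using \<phi>(1) that by (auto simp: ring_iso_def ring_hom_def)
  have "tensor_eq (E\<lparr>carrier := K\<rparr>) H'' H'' (comult H'' (\<psi> (\<phi> h))) [(\<psi> (\<phi> u), \<psi> (\<phi> v)). (u, v) \<leftarrow> comult H h]"
    if h: "h \<in> carrier H" for h
  proof -
    have 1: "tensor_eq (E\<lparr>carrier := K\<rparr>) H'' H'' [(\<psi> u, \<psi> v). (u, v) \<leftarrow> comult H' (\<phi> h)]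
        [(\<psi> u, \<psi> v). (u, v) \<leftarrow> [(\<phi> u, \<phi> v). (u, v) \<leftarrow> comult H h]]"
      by (rule tensor_eq_map[OF _ _ _ \<phi>(4)[OF h]])
         (use ring_hom_memE[of \<psi> H' H''] \<psi>(1,2) in \<open>auto simp: ring_iso_def\<close>)
    have 2: "[(\<psi> u, \<psi> v). (u, v) \<leftarrow> [(\<phi> u, \<phi> v). (u, v) \<leftarrow> comult H h]] =
        [(\<psi> (\<phi> u), \<psi> (\<phi> v)). (u, v) \<leftarrow> comult H h]" by (simp add: split_def)
    show ?thesis using tensor_eq_trans[OF \<psi>(4)[OF \<phi>c[OF h]] 1] unfolding 2 .
  qed
  thus ?thesis
    unfolding hopf_galois_iso_def split_conv
    using ring_iso_set_trans[OF \<phi>(1) \<psi>(1)] \<phi>(2,3,5,6) \<psi>(2,3,5,6) \<phi>c c(4)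
    by (intro bexI[of _ "\<psi> \<circ> \<phi>"]) auto
qed

context galois_extension
begin

lemma coset_independent_eq:
  assumes w: "\<And>s. s \<in> S \<Longrightarrow> w s \<in> carrier E" "\<And>s. s \<in> S \<Longrightarrow> w' s \<in> carrier E"
    and eq: "\<And>y. y \<in> L \<Longrightarrow> SS (\<lambda>s. w s \<otimes> coset_eval s y) = SS (\<lambda>s. w' s \<otimes> coset_eval s y)" and s: "s \<in> S"
  shows "w s = w' s"
proof -
  have "w s \<ominus> w' s = \<zero>"
  proof (rule coset_independent[of "\<lambda>s. w s \<ominus> w' s"])
    fix y assume y: "y \<in> L"
    have m: "SS (\<lambda>s. (\<ominus> \<one>) \<otimes> (w' s \<otimes> coset_eval s y)) = (\<ominus> \<one>) \<otimes> SS (\<lambda>s. w' s \<otimes> coset_eval s y)"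
      by (rule SS_l[symmetric]) (use w y in simp_all)
    have "SS (\<lambda>s. (w s \<ominus> w' s) \<otimes> coset_eval s y) =
        SS (\<lambda>s. w s \<otimes> coset_eval s y \<oplus> (\<ominus> \<one>) \<otimes> (w' s \<otimes> coset_eval s y))"
    proof (rule SS_cong)
      fix s assume "s \<in> S"
      hence "w s \<in> carrier E" "w' s \<in> carrier E" "coset_eval s y \<in> carrier E" using w y by auto
      thus "(w s \<ominus> w' s) \<otimes> coset_eval s y = w s \<otimes> coset_eval s y \<oplus> (\<ominus> \<one>) \<otimes> (w' s \<otimes> coset_eval s y)"
        by algebra
    qed
    also have "\<dots> = SS (\<lambda>s. w s \<otimes> coset_eval s y) \<oplus> (\<ominus> \<one>) \<otimes> SS (\<lambda>s. w' s \<otimes> coset_eval s y)"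
      unfolding m[symmetric] by (rule list_sum_add) (use w y ss in auto)
    also have "\<dots> = \<zero>" unfolding eq[OF y] using w(2) y by (simp add: l_minus r_neg)
    finally show "SS (\<lambda>s. (w s \<ominus> w' s) \<otimes> coset_eval s y) = \<zero>" .
  qed (use w s in simp_all)
  thus ?thesis using w s by simp
qed

end

section \<open>Recovering the subgroup from its Hopf Galois structure\<close>

context regular_normalized
begin

text \<open>The index of a matrix entry: in coset coordinates \<open>c\<close> acts on
  \<open>L\<close> by the matrix with entry \<open>c (elt s t)\<close> in row \<open>s\<close> and
  column \<open>t\<close>.\<close>

definition "elt s t = (THE n. n \<in> N \<and> n t = s)"

lemma elt:
  assumes "s \<in> S" "t \<in> S" shows "elt s t \<in> N" "elt s t t = s" "iv (elt s t) s = t"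
proof -
  have "elt s t \<in> N \<and> elt s t t = s"
    unfolding elt_def by (rule theI'[OF N_regular[OF assms(2,1)]])
  thus "elt s t \<in> N" "elt s t t = s" by auto
  thus "iv (elt s t) s = t" using P_inv(1)[of "elt s t" t] N_P assms by metis
qed

lemma elt_eqI: "s \<in> S \<Longrightarrow> n \<in> N \<Longrightarrow> elt s (iv n s) = n"
  using N_regular[of "iv n s" s] elt[of s "iv n s"] P_inv(2)[of n s] N_P by (metis N_S N_closed(2))

lemma coset_eval_act_SS:
  assumes c: "c \<in> A" and x: "x \<in> L" and s: "s \<in> S"
  shows "coset_eval s (act c x) = SS (\<lambda>t. c (elt s t) \<otimes> coset_eval t x)"
proof -
  have "SS (\<lambda>t. c (elt s t) \<otimes> coset_eval t x) = SN (\<lambda>n. c (elt s (iv n s)) \<otimes> coset_eval (iv n s) x)"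
  proof (rule list_sum_reindex[OF ns(1) ss(1)])
    show "bij_betw (\<lambda>n. iv n s) (set ns) (set ss)" unfolding ns ss
      by (rule bij_betw_byWitness[of _ "elt s"]) (use s elt elt_eqI in auto)
    show "c (elt s t) \<otimes> coset_eval t x \<in> carrier E" if "t \<in> set ss" for t
      using that ss c x s elt(1) by simp
  qed
  also have "\<dots> = coset_eval s (act c x)"
    unfolding coset_eval_act[OF c x s] by (rule SN_cong) (use s in \<open>simp add: elt_eqI\<close>)
  finally show ?thesis by simp
qed

text \<open>The first halves of the dual frame are fixed elements; if they all agreed at
  \<open>n\<close> and \<open>m\<close>, the duality relation would give the same value, 1 and 0, at
  \<open>(n, n)\<close> and \<open>(n, m)\<close>.\<close>

lemma A_separates:
  assumes "n \<in> N" "m \<in> N" "\<And>c. c \<in> A \<Longrightarrow> c n = c m" shows "n = m"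
proof (rule ccontr)
  assume "n \<noteq> m"
  have "list_sum E (\<lambda>p. snd p n \<otimes> fst p n) FN = list_sum E (\<lambda>p. snd p n \<otimes> fst p m) FN"
    by (rule list_sum_cong[OF refl]) (use assms(3)[OF FN_A] assms(1,2) in simp)
  thus False using FN(5) assms(1,2) \<open>n \<noteq> m\<close> by simp
qed

end

context galois_extension
begin

text \<open>An isomorphism respects the action, so the two matrices agree:
  \<open>h (a.elt s t) = \<phi> h (b.elt s t)\<close>. For fixed \<open>n\<close> in
  \<open>N\<close>, the elements of \<open>N'\<close> taking \<open>s\<close> to \<open>n s\<close>,
  for varying \<open>s\<close>, therefore look the same to every element of the second fixed
  algebra, hence are one element \<open>m\<close> of \<open>N'\<close>, and \<open>m\<close> acts as
  \<open>n\<close>.\<close>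

lemma gp_iso_imp_subset:
  assumes N: "N \<in> greither_pareigis E K L" and N': "N' \<in> greither_pareigis E K L"
    and iso: "hopf_galois_iso E K L (gp_hopf E K L N, gp_action E K L N) (gp_hopf E K L N', gp_action E K L N')"
  shows "N \<subseteq> N'"
proof
  interpret a: regular_normalized E K L N by unfold_locales (rule N)
  interpret b: regular_normalized E K L N' by unfold_locales (rule N')
  obtain \<phi> where \<phi>: "\<phi> \<in> ring_iso a.H b.H" "\<And>h x. h \<in> a.A \<Longrightarrow> x \<in> L \<Longrightarrow> b.act (\<phi> h) x = a.act h x"
    using iso unfolding hopf_galois_iso_def by auto
  have bij: "bij_betw \<phi> a.A b.A" using \<phi>(1) by (simp add: ring_iso_def)
  hence \<phi>c: "\<phi> h \<in> b.A" if "h \<in> a.A" for h using that by (auto simp: bij_betw_def)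
  have eq: "h (a.elt s t) = \<phi> h (b.elt s t)" if h: "h \<in> a.A" and s: "s \<in> S" and t: "t \<in> S" for h s t
  proof (rule coset_independent_eq[of "\<lambda>t. h (a.elt s t)" "\<lambda>t. \<phi> h (b.elt s t)", OF _ _ _ t])
    show "h (a.elt s t) \<in> carrier E" "\<phi> h (b.elt s t) \<in> carrier E" if "t \<in> S" for t
      using a.elt(1)[OF s that] b.elt(1)[OF s that] a.A_closed[OF h] b.A_closed[OF \<phi>c[OF h]] by auto
    fix y assume y: "y \<in> L"
    show "SS (\<lambda>t. h (a.elt s t) \<otimes> coset_eval t y) = SS (\<lambda>t. \<phi> h (b.elt s t) \<otimes> coset_eval t y)"
      using a.coset_eval_act_SS[OF h y s] b.coset_eval_act_SS[OF \<phi>c[OF h] y s] \<phi>(2)[OF h y] by simp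
  qed
  fix n assume n: "n \<in> N"
  \<comment> \<open>The common element, read off at the cosets \<open>B\<close> and
    \<open>n\<^sup>-\<^sup>1 B\<close>.\<close>
  define m where "m = b.elt B (a.iv n B)"
  have m: "m \<in> N'" using b.elt(1) a.N_S[of "a.iv n"] n B_coset by (simp add: m_def)
  have "n = m"
  proof (rule P_eqI)
    fix s assume s: "s \<in> S"
    define k where "k = b.elt (n s) s"
    have k: "k \<in> N'" "k s = n s" using b.elt a.N_S[OF n s] s by (auto simp: k_def)
    have iv: "a.iv n (n s) = s" using P_inv(1) a.N_P[OF n] s by blast
    have "m = k"
    proof (rule b.A_separates[OF m k(1)])
      fix c assume "c \<in> b.A"
      then obtain h where h: "h \<in> a.A" "c = \<phi> h" using bij by (auto simp: bij_betw_def)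
      have "h n = c m"
        using eq[OF h(1) B_coset, of "a.iv n B"] a.elt_eqI[OF B_coset n] a.N_S[of "a.iv n"] n B_coset h(2)
        by (simp add: m_def)
      moreover have "h n = c k"
        using eq[OF h(1) a.N_S[OF n s] s] a.elt_eqI[OF a.N_S[OF n s] n] iv h(2) by (simp add: k_def)
      ultimately show "c m = c k" by simp
    qed
    thus "n s = m s" using k by simp
  qed (use n m a.N_P b.N_P in auto)
  thus "n \<in> N'" using m by simp
qed

definition "gp_of_type T = {N \<in> greither_pareigis E K L. P\<lparr>carrier := N\<rparr> \<cong> T}"

lemma gp_structure:
  assumes "N \<in> greither_pareigis E K L"
  shows "hopf_galois_structure E K L (gp_hopf E K L N) (gp_action E K L N)"
proof -
  interpret regular_normalized E K L N by unfold_locales (rule assms)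
  show ?thesis by (rule hopf_galois_structure_H)
qed

lemma gp_iso_imp_eq:
  assumes N: "N \<in> greither_pareigis E K L" and N': "N' \<in> greither_pareigis E K L"
    and iso: "hopf_galois_iso E K L (gp_hopf E K L N, gp_action E K L N) (gp_hopf E K L N', gp_action E K L N')"
  shows "N = N'"
  using gp_iso_imp_subset[OF N N' iso]
    gp_iso_imp_subset[OF N' N hopf_galois_iso_sym[OF gp_structure[OF N] gp_structure[OF N'] iso]] by blast

lemma gp_mem_of_type: "N \<in> gp_of_type T \<Longrightarrow> (gp_hopf E K L N, gp_action E K L N) \<in> hopf_galois_of_type E K L T"
  unfolding hopf_galois_of_type_def gp_of_type_def using gp_structure hopf_galois_iso_refl by blast

theorem hopf_galois_of_type_empty_iff: "hopf_galois_of_type E K L T \<noteq> {} \<longleftrightarrow> gp_of_type T \<noteq> {}"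
proof
  show "hopf_galois_of_type E K L T \<noteq> {} \<Longrightarrow> gp_of_type T \<noteq> {}"
    unfolding hopf_galois_of_type_def gp_of_type_def by blast
  show "gp_of_type T \<noteq> {} \<Longrightarrow> hopf_galois_of_type E K L T \<noteq> {}"
    using gp_mem_of_type[of _ T] by blast
qed

text \<open>Every class contains some \<open>gp_hopf E K L N\<close> by the definition of the type,
  and only one by \<open>gp_iso_imp_eq\<close>.\<close>

theorem num_hopf_galois_eq: "num_hopf_galois_of_type E K L T = card (gp_of_type T)"
proof -
  let ?X = "hopf_galois_of_type E K L T"
  let ?r = "{(Z, Z'). Z \<in> ?X \<and> Z' \<in> ?X \<and> hopf_galois_iso E K L Z Z'}"
  let ?g = "\<lambda>N. (gp_hopf E K L N, gp_action E K L N)"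
  have struct: "hopf_galois_structure E K L (fst Z) (snd Z)" if "Z \<in> ?X" for Z
    using that by (auto simp: hopf_galois_of_type_def)
  have sym: "hopf_galois_iso E K L Z' Z" if "hopf_galois_iso E K L Z Z'" "Z \<in> ?X" "Z' \<in> ?X" for Z Z'
    using hopf_galois_iso_sym[OF struct[OF that(2)] struct[OF that(3)]] that(1) by simp
  have trans: "hopf_galois_iso E K L Z Z''"
    if "hopf_galois_iso E K L Z Z'" "hopf_galois_iso E K L Z' Z''" "Z \<in> ?X" "Z' \<in> ?X" "Z'' \<in> ?X" for Z Z' Z''
    using hopf_galois_iso_trans[OF struct[OF that(3)] struct[OF that(4)] struct[OF that(5)]] that(1,2) by simp
  have "bij_betw (\<lambda>N. ?r `` {?g N}) (gp_of_type T) (?X // ?r)"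
  proof (rule bij_betwI')
    fix N N' assume N: "N \<in> gp_of_type T" "N' \<in> gp_of_type T"
    show "?r `` {?g N} = ?r `` {?g N'} \<longleftrightarrow> N = N'"
    proof
      assume "?r `` {?g N} = ?r `` {?g N'}"
      moreover have "?g N' \<in> ?r `` {?g N'}"
        using gp_mem_of_type[OF N(2)] hopf_galois_iso_refl by blast
      ultimately have "?g N' \<in> ?r `` {?g N}" by (simp only:)
      hence "hopf_galois_iso E K L (?g N) (?g N')" by blast
      thus "N = N'" using gp_iso_imp_eq N by (simp add: gp_of_type_def)
    qed simp
  next
    fix N assume "N \<in> gp_of_type T"
    thus "?r `` {?g N} \<in> ?X // ?r" using gp_mem_of_type by (intro quotientI)
  next
    fix C assume "C \<in> ?X // ?r"
    then obtain Z where Z: "Z \<in> ?X" "C = ?r `` {Z}" by (auto elim: quotientE)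
    then obtain N where N: "N \<in> gp_of_type T" "hopf_galois_iso E K L Z (?g N)"
      by (auto simp: hopf_galois_of_type_def gp_of_type_def)
    have gN: "?g N \<in> ?X" using gp_mem_of_type[OF N(1)] .
    have "?r `` {Z} = ?r `` {?g N}"
      using trans[OF N(2) _ Z(1) gN] trans[OF sym[OF N(2) Z(1) gN] _ gN Z(1)] Z(1) gN by blast
    thus "\<exists>N\<in>gp_of_type T. C = ?r `` {?g N}" using N(1) Z(2) by blast
  qed
  thus ?thesis unfolding num_hopf_galois_of_type_def by (simp add: bij_betw_same_card)
qed

end

section \<open>The degree\<close>

text \<open>Gaussian elimination, one equation at a time. A nonzero entry of the equation serves as
  pivot: the unknown in its column is expressed through the others and substituted.\<close>

lemma (in field) homogeneous_system:
  assumes "finite I"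
  shows "finite J \<Longrightarrow> card I < card J \<Longrightarrow> (\<And>i j. i \<in> I \<Longrightarrow> j \<in> J \<Longrightarrow> a i j \<in> carrier R) \<Longrightarrow>
    \<exists>x. (\<forall>j\<in>J. x j \<in> carrier R) \<and> (\<exists>j\<in>J. x j \<noteq> \<zero>) \<and> (\<forall>i\<in>I. finsum R (\<lambda>j. a i j \<otimes> x j) J = \<zero>)"
  using assms
proof (induction I arbitrary: J a rule: finite_induct)
  case empty
  hence "J \<noteq> {}" by auto
  thus ?case by (intro exI[of _ "\<lambda>_. \<one>"]) auto
next
  case (insert r I)
  show ?case
  proof (cases "\<forall>j\<in>J. a r j = \<zero>")
    case True
    obtain x where x: "\<forall>j\<in>J. x j \<in> carrier R" "\<exists>j\<in>J. x j \<noteq> \<zero>" "\<forall>i\<in>I. finsum R (\<lambda>j. a i j \<otimes> x j) J = \<zero>"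
      using insert.IH[of J a] insert.prems insert.hyps by auto
    have "finsum R (\<lambda>j. a r j \<otimes> x j) J = \<zero>"
      using x(1) True by (intro add.finprod_one_eqI) auto
    thus ?thesis using x by (intro exI[of _ x]) auto
  next
    case False
    then obtain l where l: "l \<in> J" "a r l \<noteq> \<zero>" by blast
    have alc: "a r l \<in> carrier R" using insert.prems(3) l by auto
    define v where "v = inv (a r l)"
    have v: "v \<in> carrier R" "v \<otimes> a r l = \<one>" using alc l field_Units by (auto simp: v_def)
    define J' where "J' = J - {l}"
    have J': "finite J'" "card I < card J'" "J = insert l J'" "l \<notin> J'"
      using insert.prems insert.hyps l by (auto simp: J'_def)
    have ac: "a i j \<in> carrier R" if "i \<in> insert r I" "j \<in> J" for i j using insert.prems(3) that by blast
    \<comment> \<open>Row \<open>i\<close> after subtracting the multiple of the pivot row that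
      clears column \<open>l\<close>.\<close>
    define b where "b = (\<lambda>i j. a i j \<ominus> a i l \<otimes> v \<otimes> a r j)"
    have bc: "b i j \<in> carrier R" if "i \<in> I" "j \<in> J'" for i j
      using that ac v J' by (auto simp: b_def)
    have "\<exists>x. (\<forall>j\<in>J'. x j \<in> carrier R) \<and> (\<exists>j\<in>J'. x j \<noteq> \<zero>) \<and> (\<forall>i\<in>I. finsum R (\<lambda>j. b i j \<otimes> x j) J' = \<zero>)"
      by (rule insert.IH[OF J'(1,2)]) (rule bc)
    then obtain x where x: "\<forall>j\<in>J'. x j \<in> carrier R" "\<exists>j\<in>J'. x j \<noteq> \<zero>" "\<forall>i\<in>I. finsum R (\<lambda>j. b i j \<otimes> x j) J' = \<zero>"
      by (elim exE conjE)
    define s where "s = (\<lambda>i. finsum R (\<lambda>j. a i j \<otimes> x j) J')"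
    have sc: "s i \<in> carrier R" if "i \<in> insert r I" for i
      unfolding s_def using that ac x J' by (intro finsum_closed) auto
    \<comment> \<open>The pivot equation determines the removed unknown.\<close>
    define y where "y = x(l := \<ominus> (v \<otimes> s r))"
    have yl: "y l \<in> carrier R" using v sc by (simp add: y_def)
    have sum: "finsum R (\<lambda>j. a i j \<otimes> y j) J = a i l \<otimes> y l \<oplus> s i" if "i \<in> insert r I" for i
    proof -
      have "finsum R (\<lambda>j. a i j \<otimes> y j) J = a i l \<otimes> y l \<oplus> finsum R (\<lambda>j. a i j \<otimes> y j) J'"
        unfolding J'(3) using J' that ac x yl by (intro finsum_insert) (auto simp: y_def)
      also have "finsum R (\<lambda>j. a i j \<otimes> y j) J' = s i"
        unfolding s_def using J' that ac x by (intro finsum_cong') (auto simp: y_def)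
      finally show ?thesis .
    qed
    have "finsum R (\<lambda>j. a i j \<otimes> y j) J = \<zero>" if i: "i \<in> insert r I" for i
    proof (cases "i = r")
      case True
      have "a r l \<otimes> y l \<oplus> s r = \<ominus> (v \<otimes> a r l \<otimes> s r) \<oplus> s r"
        using v(1) alc sc[of r] by (simp add: y_def, algebra)
      thus ?thesis using sum[OF i] True v(2) sc[of r] by (simp add: l_neg)
    next
      case False
      hence iI: "i \<in> I" using i by simp
      have il: "a i l \<in> carrier R" using ac i l by auto
      have "\<zero> = finsum R (\<lambda>j. a i j \<otimes> x j \<oplus> \<ominus> (a i l \<otimes> v) \<otimes> (a r j \<otimes> x j)) J'"
      proof -
        have "finsum R (\<lambda>j. b i j \<otimes> x j) J' = finsum R (\<lambda>j. a i j \<otimes> x j \<oplus> \<ominus> (a i l \<otimes> v) \<otimes> (a r j \<otimes> x j)) J'"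
        proof (rule finsum_cong'[OF refl])
          show "(\<lambda>j. a i j \<otimes> x j \<oplus> \<ominus> (a i l \<otimes> v) \<otimes> (a r j \<otimes> x j)) \<in> J' \<rightarrow> carrier R"
            using ac i x v il J' by auto
          fix j assume j: "j \<in> J'"
          have "a i j \<in> carrier R" "a r j \<in> carrier R" "x j \<in> carrier R" using ac i x j J' by auto
          thus "b i j \<otimes> x j = a i j \<otimes> x j \<oplus> \<ominus> (a i l \<otimes> v) \<otimes> (a r j \<otimes> x j)"
            unfolding b_def using il v(1) by algebra
        qed
        thus ?thesis using x(3) iI by simp
      qed
      also have "\<dots> = s i \<oplus> finsum R (\<lambda>j. \<ominus> (a i l \<otimes> v) \<otimes> (a r j \<otimes> x j)) J'"
        unfolding s_def using ac i x v il J' by (intro finsum_addf) auto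
      also have "finsum R (\<lambda>j. \<ominus> (a i l \<otimes> v) \<otimes> (a r j \<otimes> x j)) J' = \<ominus> (a i l \<otimes> v) \<otimes> s r"
        unfolding s_def using ac x v il J' by (intro finsum_rdistr[symmetric]) auto
      finally have "s i \<oplus> \<ominus> (a i l \<otimes> v) \<otimes> s r = \<zero>" by simp
      moreover have "a i l \<otimes> y l \<oplus> s i = s i \<oplus> \<ominus> (a i l \<otimes> v) \<otimes> s r"
        using il v(1) sc[of r] sc[OF i] by (simp add: y_def, algebra)
      ultimately show ?thesis using sum[OF i] by simp
    qed
    moreover have "\<exists>j\<in>J. y j \<noteq> \<zero>"
    proof -
      obtain j where "j \<in> J'" "x j \<noteq> \<zero>" using x(2) by blast
      thus ?thesis using J'(3,4) by (intro bexI[of _ j]) (auto simp: y_def)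
    qed
    moreover have "\<forall>j\<in>J. y j \<in> carrier R" using x(1) yl J'(3) by (auto simp: y_def)
    ultimately show ?thesis by blast
  qed
qed


lemma (in ring) combine_list_sum:
  "length Ks = length Us \<Longrightarrow> combine Ks Us = list_sum R (\<lambda>k. Ks ! k \<otimes> Us ! k) [0..<length Us]"
proof (induction Ks Us rule: list_induct2)
  case (Cons k Ks u Us)
  have "[0..<length (u # Us)] = 0 # map Suc [0..<length Us]"
    by (simp add: map_Suc_upt upt_conv_Cons del: upt_Suc)
  thus ?case using Cons by (simp del: upt_Suc)
qed simp

text \<open>For a basis \<open>us\<close> of \<open>L\<close> over \<open>K\<close>, the matrices
  \<open>D k s\<close> and \<open>coset_eval s (us ! k)\<close> are inverse to each other on both
  sides. A matrix with a left inverse has trivial kernel, so it cannot have more columns than rows;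
  this is applied to both.\<close>

theorem (in galois_extension) card_cosets:
  assumes dim: "dimension n K L"
  shows "card S = n"
proof -
  obtain us where us: "set us \<subseteq> carrier E" "independent K us" "length us = n" "Span K us = L"
    using exists_base[OF K dim] by blast
  let ?ks = "[0..<n]"
  have usL: "us ! k \<in> L" if "k < n" for k
    using that Span_base_incl[OF K us(1)] us(3,4) nth_mem by (metis subsetD)
  have "\<exists>Ks. set Ks \<subseteq> K \<and> length Ks = n \<and> fst p B = combine Ks us" if "p \<in> set FS" for p
    using unique_decomposition[OF K us(2), of "fst p B"] FS(6)[OF that] us(3,4) by auto
  then obtain \<alpha> where \<alpha>: "\<And>p. p \<in> set FS \<Longrightarrow> set (\<alpha> p) \<subseteq> K \<and> length (\<alpha> p) = n \<and> fst p B = combine (\<alpha> p) us"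
    by metis
  have \<alpha>K: "\<alpha> p ! k \<in> K" if "p \<in> set FS" "k < n" for p k using \<alpha>[OF that(1)] that(2) nth_mem by blast
  have \<alpha>B: "fst p B = list_sum E (\<lambda>k. \<alpha> p ! k \<otimes> us ! k) ?ks" if "p \<in> set FS" for p
    using \<alpha>[OF that] combine_list_sum[of "\<alpha> p" us] us(3) by simp
  \<comment> \<open>The dual functions on the cosets, combined with the coordinates
    \<open>\<alpha> p\<close> of the frame vectors in the basis \<open>us\<close>.\<close>
  define D where "D = (\<lambda>k s. list_sum E (\<lambda>p. snd p s \<otimes> \<alpha> p ! k) FS)"
  have Dc: "D k s \<in> carrier E" if "k < n" "s \<in> S" for k s
    unfolding D_def using that FS(2) \<alpha>K by (intro list_sum_closed) simp
  have ceS: "coset_eval s (list_sum E f xs) = list_sum E (\<lambda>x. coset_eval s (f x)) xs"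
    if "s \<in> S" "\<And>x. x \<in> set xs \<Longrightarrow> f x \<in> L" for s f and xs :: "nat list"
    using that(2)
  proof (induction xs)
    case Nil
    show ?case using coset_eval_hom(4)[OF that(1), of \<one> \<one> \<zero>] subringE(2)[OF subfieldE(1)[OF K]] by simp
  next
    case (Cons x xs)
    have "list_sum E f xs \<in> L" using Cons.prems by (intro L_list_sum) auto
    thus ?case using Cons coset_eval_hom(2)[OF that(1)] by simp
  qed
  have fstp: "fst p s = list_sum E (\<lambda>k. \<alpha> p ! k \<otimes> coset_eval s (us ! k)) ?ks" if p: "p \<in> set FS" and s: "s \<in> S" for p s
  proof -
    have "fst p s = coset_eval s (list_sum E (\<lambda>k. \<alpha> p ! k \<otimes> us ! k) ?ks)"
      using coset_eval_FS[OF p s] \<alpha>B[OF p] by simp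
    also have "\<dots> = list_sum E (\<lambda>k. coset_eval s (\<alpha> p ! k \<otimes> us ! k)) ?ks"
      by (rule ceS[OF s]) (use \<alpha>K[OF p] usL in simp)
    also have "\<dots> = list_sum E (\<lambda>k. \<alpha> p ! k \<otimes> coset_eval s (us ! k)) ?ks"
    proof (rule list_sum_cong[OF refl])
      fix k assume "k \<in> set ?ks"
      hence k: "\<alpha> p ! k \<in> K" "us ! k \<in> L" using \<alpha>K[OF p] usL by auto
      show "coset_eval s (\<alpha> p ! k \<otimes> us ! k) = \<alpha> p ! k \<otimes> coset_eval s (us ! k)"
        using coset_eval_hom(1)[OF s L_closed(5)[OF k(1)] k(2)] coset_eval_hom(4)[OF s k(2) k(2) k(1)] by simp
    qed
    finally show ?thesis .
  qed
  have DB: "list_sum E (\<lambda>k. D k m \<otimes> coset_eval s (us ! k)) ?ks = (if m = s then \<one> else \<zero>)"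
    if m: "m \<in> S" and s: "s \<in> S" for m s
  proof -
    have uc: "coset_eval s (us ! k) \<in> carrier E" if "k < n" for k using usL[OF that] s by simp
    have "list_sum E (\<lambda>k. D k m \<otimes> coset_eval s (us ! k)) ?ks =
        list_sum E (\<lambda>k. list_sum E (\<lambda>p. (snd p m \<otimes> \<alpha> p ! k) \<otimes> coset_eval s (us ! k)) FS) ?ks"
      unfolding D_def
      by (rule list_sum_cong[OF refl], rule list_sum_ldistr) (use uc FS(2) \<alpha>K m in simp_all)
    also have "\<dots> = list_sum E (\<lambda>p. list_sum E (\<lambda>k. (snd p m \<otimes> \<alpha> p ! k) \<otimes> coset_eval s (us ! k)) ?ks) FS"
      by (rule list_sum_swap) (use uc FS(2) \<alpha>K m in simp)
    also have "\<dots> = list_sum E (\<lambda>p. snd p m \<otimes> fst p s) FS"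
    proof (rule list_sum_cong[OF refl])
      fix p assume p: "p \<in> set FS"
      have "list_sum E (\<lambda>k. (snd p m \<otimes> \<alpha> p ! k) \<otimes> coset_eval s (us ! k)) ?ks =
          list_sum E (\<lambda>k. snd p m \<otimes> (\<alpha> p ! k \<otimes> coset_eval s (us ! k))) ?ks"
        by (rule list_sum_cong[OF refl]) (use uc FS(2)[OF p m] \<alpha>K[OF p] in \<open>simp add: m_assoc\<close>)
      also have "\<dots> = snd p m \<otimes> fst p s" unfolding fstp[OF p s]
        by (rule list_sum_rdistr[symmetric]) (use uc FS(2)[OF p m] \<alpha>K[OF p] in simp_all)
      finally show "list_sum E (\<lambda>k. (snd p m \<otimes> \<alpha> p ! k) \<otimes> coset_eval s (us ! k)) ?ks = snd p m \<otimes> fst p s" .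
    qed
    finally show ?thesis using FS(5)[OF m s] by simp
  qed
  have BD: "SS (\<lambda>s. D k s \<otimes> coset_eval s (us ! l)) = (if k = l then \<one> else \<zero>)" if kl: "k < n" "l < n" for k l
  proof -
    have lL: "us ! l \<in> L" using usL kl by simp
    define c where "c = (\<lambda>k. list_sum E (\<lambda>p. phi p (us ! l) \<otimes> \<alpha> p ! k) FS)"
    have cK: "c k \<in> K" if "k < n" for k
    proof -
      have clos: "(\<And>p. p \<in> set xs \<Longrightarrow> f p \<in> K) \<Longrightarrow> list_sum E f xs \<in> K" for f
        and xs :: "((('a \<Rightarrow> 'a) set \<Rightarrow> 'a) \<times> (('a \<Rightarrow> 'a) set \<Rightarrow> 'a)) list"
        by (induction xs) (use subringE(2,7)[OF subfieldE(1)[OF K]] in auto)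
      show ?thesis unfolding c_def
      proof (rule clos)
        fix p assume "p \<in> set FS"
        thus "phi p (us ! l) \<otimes> \<alpha> p ! k \<in> K"
          using subringE(6)[OF subfieldE(1)[OF K] phi_K[OF _ lL] \<alpha>K[OF _ that]] by simp
      qed
    qed
    have "us ! l = list_sum E (\<lambda>p. phi p (us ! l) \<otimes> fst p B) FS" by (rule phi_expand_L[OF lL])
    also have "\<dots> = list_sum E (\<lambda>p. list_sum E (\<lambda>k. (phi p (us ! l) \<otimes> \<alpha> p ! k) \<otimes> us ! k) ?ks) FS"
    proof (rule list_sum_cong[OF refl])
      fix p assume p: "p \<in> set FS"
      have "phi p (us ! l) \<otimes> fst p B = list_sum E (\<lambda>k. phi p (us ! l) \<otimes> (\<alpha> p ! k \<otimes> us ! k)) ?ks"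
        unfolding \<alpha>B[OF p] by (rule list_sum_rdistr) (use phi_K[OF p lL] \<alpha>K[OF p] usL in simp_all)
      also have "\<dots> = list_sum E (\<lambda>k. (phi p (us ! l) \<otimes> \<alpha> p ! k) \<otimes> us ! k) ?ks"
        by (rule list_sum_cong[OF refl]) (use phi_K[OF p lL] \<alpha>K[OF p] usL in \<open>simp add: m_assoc\<close>)
      finally show "phi p (us ! l) \<otimes> fst p B = \<dots>" .
    qed
    also have "\<dots> = list_sum E (\<lambda>k. list_sum E (\<lambda>p. (phi p (us ! l) \<otimes> \<alpha> p ! k) \<otimes> us ! k) FS) ?ks"
      by (rule list_sum_swap) (use phi_K[OF _ lL] \<alpha>K usL in simp)
    also have "\<dots> = list_sum E (\<lambda>k. c k \<otimes> us ! k) ?ks"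
      unfolding c_def
      by (rule list_sum_cong[OF refl], rule list_sum_ldistr[symmetric]) (use phi_K[OF _ lL] \<alpha>K usL in simp_all)
    finally have c: "us ! l = list_sum E (\<lambda>k. c k \<otimes> us ! k) ?ks" .
    have d: "us ! l = list_sum E (\<lambda>k. (if k = l then \<one> else \<zero>) \<otimes> us ! k) ?ks"
    proof -
      have "list_sum E (\<lambda>k. (if k = l then \<one> else \<zero>) \<otimes> us ! k) ?ks = list_sum E (\<lambda>k. if k = l then us ! k else \<zero>) ?ks"
        by (rule list_sum_cong[OF refl]) (use usL in simp)
      also have "\<dots> = us ! l" by (rule list_sum_delta(1)) (use kl lL in simp_all)
      finally show ?thesis by simp
    qed
    have comb: "us ! l = combine (map f ?ks) us" if "us ! l = list_sum E (\<lambda>k. f k \<otimes> us ! k) ?ks" for f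
    proof -
      have "combine (map f ?ks) us = list_sum E (\<lambda>k. map f ?ks ! k \<otimes> us ! k) ?ks"
        using combine_list_sum[of "map f ?ks" us] us(3) by simp
      also have "\<dots> = list_sum E (\<lambda>k. f k \<otimes> us ! k) ?ks" by (rule list_sum_cong[OF refl]) simp
      finally show ?thesis using that by simp
    qed
    \<comment> \<open>Uniqueness of coordinates turns the expansion of \<open>us ! l\<close> by the
      frame of \<open>L\<close> into a unit vector.\<close>
    have uniq: "\<exists>!Ks. set Ks \<subseteq> K \<and> length Ks = length us \<and> us ! l = combine Ks us"
      by (rule unique_decomposition[OF K us(2)]) (use lL us(4) in simp)
    have 1: "set (map c ?ks) \<subseteq> K \<and> length (map c ?ks) = length us \<and> us ! l = combine (map c ?ks) us"
      using cK comb[OF c] us(3) by auto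
    have 2: "set (map (\<lambda>k. if k = l then \<one> else \<zero>) ?ks) \<subseteq> K \<and>
        length (map (\<lambda>k. if k = l then \<one> else \<zero>) ?ks) = length us \<and>
        us ! l = combine (map (\<lambda>k. if k = l then \<one> else \<zero>) ?ks) us"
      using comb[OF d] us(3) subringE(2,3)[OF subfieldE(1)[OF K]] by auto
    have "map c ?ks = map (\<lambda>k. if k = l then \<one> else \<zero>) ?ks"
    proof -
      from uniq obtain Ks where Ks: "\<And>Ks'. set Ks' \<subseteq> K \<and> length Ks' = length us \<and> us ! l = combine Ks' us \<Longrightarrow> Ks' = Ks"
        by (elim ex1E) blast
      show ?thesis using Ks[OF 1] Ks[OF 2] by simp
    qed
    hence ck: "c k = (if k = l then \<one> else \<zero>)" using kl by (auto simp: map_eq_conv)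
    have "SS (\<lambda>s. D k s \<otimes> coset_eval s (us ! l)) =
        SS (\<lambda>s. list_sum E (\<lambda>p. (snd p s \<otimes> coset_eval s (us ! l)) \<otimes> \<alpha> p ! k) FS)"
    proof (rule SS_cong)
      fix s assume s: "s \<in> S"
      have "D k s \<otimes> coset_eval s (us ! l) = list_sum E (\<lambda>p. (snd p s \<otimes> \<alpha> p ! k) \<otimes> coset_eval s (us ! l)) FS"
        unfolding D_def by (rule list_sum_ldistr) (use s lL FS(2) \<alpha>K kl in simp_all)
      also have "\<dots> = list_sum E (\<lambda>p. (snd p s \<otimes> coset_eval s (us ! l)) \<otimes> \<alpha> p ! k) FS"
      proof (rule list_sum_cong[OF refl])
        fix p assume p: "p \<in> set FS"
        have "snd p s \<in> carrier E" "\<alpha> p ! k \<in> carrier E" "coset_eval s (us ! l) \<in> carrier E"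
          using FS(2)[OF p s] \<alpha>K[OF p kl(1)] s lL by auto
        thus "(snd p s \<otimes> \<alpha> p ! k) \<otimes> coset_eval s (us ! l) = (snd p s \<otimes> coset_eval s (us ! l)) \<otimes> \<alpha> p ! k"
          by (simp add: m_ac)
      qed
      finally show "D k s \<otimes> coset_eval s (us ! l) = \<dots>" .
    qed
    also have "\<dots> = list_sum E (\<lambda>p. SS (\<lambda>s. (snd p s \<otimes> coset_eval s (us ! l)) \<otimes> \<alpha> p ! k)) FS"
      by (rule SS_swap_list) (use lL FS(2) \<alpha>K kl in simp)
    also have "\<dots> = c k" unfolding c_def phi_def
      by (rule list_sum_cong[OF refl], rule SS_r[symmetric]) (use lL FS(2) \<alpha>K kl in simp_all)
    finally show ?thesis using ck by simp
  qed
  have fk: "finsum E f {..<n} = list_sum E f ?ks" if "\<And>k. k < n \<Longrightarrow> f k \<in> carrier E" for f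
    using finsum_list_sum[of ?ks f] that by (simp add: lessThan_atLeast0)
  have fS: "finsum E f S = SS f" if "\<And>s. s \<in> S \<Longrightarrow> f s \<in> carrier E" for f
    using finsum_list_sum[OF ss(1), of f] that by (simp add: ss)
  have uc: "coset_eval s (us ! k) \<in> carrier E" if "k < n" "s \<in> S" for k s using usL that by simp
  show ?thesis
  proof (rule antisym)
    show "card S \<le> n"
    proof (rule ccontr)
      assume "\<not> card S \<le> n"
      then obtain x where x: "\<forall>s\<in>S. x s \<in> carrier E" "\<exists>s\<in>S. x s \<noteq> \<zero>"
          "\<forall>k\<in>{..<n}. finsum E (\<lambda>s. D k s \<otimes> x s) S = \<zero>"
        using homogeneous_system[of "{..<n}" S D] finite_cosets Dc by auto
      have z: "SS (\<lambda>s. D k s \<otimes> x s) = \<zero>" if "k < n" for k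
        using x(3) fS[of "\<lambda>s. D k s \<otimes> x s"] Dc[OF that] x(1) that by simp
      have "x m = \<zero>" if m: "m \<in> S" for m
      proof -
        have "x m = SS (\<lambda>s. if s = m then x s else \<zero>)" using SS_delta(1)[OF m, of x] x(1) m by simp
        also have "\<dots> = SS (\<lambda>s. x s \<otimes> list_sum E (\<lambda>k. D k s \<otimes> coset_eval m (us ! k)) ?ks)"
          by (rule SS_cong) (use DB m x(1) in simp)
        also have "\<dots> = SS (\<lambda>s. list_sum E (\<lambda>k. x s \<otimes> (D k s \<otimes> coset_eval m (us ! k))) ?ks)"
          by (rule SS_cong, rule list_sum_rdistr) (use Dc uc m x(1) in simp_all)
        also have "\<dots> = list_sum E (\<lambda>k. SS (\<lambda>s. x s \<otimes> (D k s \<otimes> coset_eval m (us ! k)))) ?ks"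
          by (rule SS_swap_list) (use Dc uc m x(1) in simp)
        also have "\<dots> = \<zero>"
        proof (rule list_sum_zero')
          fix k assume "k \<in> set ?ks"
          hence k: "k < n" by simp
          have "SS (\<lambda>s. x s \<otimes> (D k s \<otimes> coset_eval m (us ! k))) = SS (\<lambda>s. (D k s \<otimes> x s) \<otimes> coset_eval m (us ! k))"
            by (rule SS_cong) (use Dc[OF k] uc[OF k] m x(1) in \<open>simp add: m_ac\<close>)
          also have "\<dots> = SS (\<lambda>s. D k s \<otimes> x s) \<otimes> coset_eval m (us ! k)"
            by (rule SS_r[symmetric]) (use Dc[OF k] uc[OF k] m x(1) in simp_all)
          finally show "SS (\<lambda>s. x s \<otimes> (D k s \<otimes> coset_eval m (us ! k))) = \<zero>" using z[OF k] uc[OF k m] by simp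
        qed
        finally show ?thesis .
      qed
      thus False using x(2) by blast
    qed
    show "n \<le> card S"
    proof (rule ccontr)
      assume "\<not> n \<le> card S"
      then obtain x where x: "\<forall>k\<in>{..<n}. x k \<in> carrier E" "\<exists>k\<in>{..<n}. x k \<noteq> \<zero>"
          "\<forall>s\<in>S. finsum E (\<lambda>k. coset_eval s (us ! k) \<otimes> x k) {..<n} = \<zero>"
        using homogeneous_system[of S "{..<n}" "\<lambda>s k. coset_eval s (us ! k)"] finite_cosets uc by auto
      have z: "list_sum E (\<lambda>k. coset_eval s (us ! k) \<otimes> x k) ?ks = \<zero>" if "s \<in> S" for s
        using x(3) fk[of "\<lambda>k. coset_eval s (us ! k) \<otimes> x k"] uc[OF _ that] x(1) that by simp
      have "x l = \<zero>" if l: "l < n" for l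
      proof -
        have "x l = list_sum E (\<lambda>k. if l = k then x k else \<zero>) ?ks"
          using list_sum_delta(2)[of ?ks l x] x(1) l by simp
        also have "\<dots> = list_sum E (\<lambda>k. SS (\<lambda>s. D l s \<otimes> coset_eval s (us ! k)) \<otimes> x k) ?ks"
          by (rule list_sum_cong[OF refl]) (use BD l x(1) in simp)
        also have "\<dots> = list_sum E (\<lambda>k. SS (\<lambda>s. (D l s \<otimes> coset_eval s (us ! k)) \<otimes> x k)) ?ks"
          by (rule list_sum_cong[OF refl], rule SS_r) (use Dc uc l x(1) in simp_all)
        also have "\<dots> = SS (\<lambda>s. list_sum E (\<lambda>k. (D l s \<otimes> coset_eval s (us ! k)) \<otimes> x k) ?ks)"
          by (rule SS_swap_list[symmetric]) (use Dc uc l x(1) in simp)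
        also have "\<dots> = SS (\<lambda>s. \<zero>)"
        proof (rule SS_cong)
          fix s assume s: "s \<in> S"
          have "list_sum E (\<lambda>k. (D l s \<otimes> coset_eval s (us ! k)) \<otimes> x k) ?ks =
              list_sum E (\<lambda>k. D l s \<otimes> (coset_eval s (us ! k) \<otimes> x k)) ?ks"
            by (rule list_sum_cong[OF refl]) (use Dc[OF l s] uc[OF _ s] x(1) in \<open>simp add: m_assoc\<close>)
          also have "\<dots> = D l s \<otimes> list_sum E (\<lambda>k. coset_eval s (us ! k) \<otimes> x k) ?ks"
            by (rule list_sum_rdistr[symmetric]) (use Dc[OF l s] uc[OF _ s] x(1) in simp_all)
          finally show "list_sum E (\<lambda>k. (D l s \<otimes> coset_eval s (us ! k)) \<otimes> x k) ?ks = \<zero>"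
            using z[OF s] Dc[OF l s] by simp
        qed
        finally show ?thesis by simp
      qed
      thus False using x(2) by blast
    qed
  qed
qed


section \<open>Geometric sums modulo prime powers\<close>

definition geom_sum :: "int \<Rightarrow> nat \<Rightarrow> int" where
  "geom_sum c k = (\<Sum>i<k. c ^ i)"

lemma geom_sum_simps [simp]: "geom_sum c 0 = 0" "geom_sum c (Suc 0) = 1"
  by (simp_all add: geom_sum_def)

lemma geom_sum_Suc: "geom_sum c (Suc k) = geom_sum c k + c ^ k"
  by (simp add: geom_sum_def)

lemma geom_sum_Suc': "geom_sum c (Suc k) = 1 + c * geom_sum c k"
  unfolding geom_sum_def sum.lessThan_Suc_shift by (simp add: sum_distrib_left)

lemma geom_sum_add: "geom_sum c (j + k) = geom_sum c j + c ^ j * geom_sum c k"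
  by (induction k) (simp_all add: geom_sum_Suc power_add algebra_simps)

text \<open>The terms are grouped into \<open>k\<close> blocks of length \<open>j\<close>.\<close>

lemma geom_sum_mult: "geom_sum c (j * k) = geom_sum c j * geom_sum (c ^ j) k"
  by (induction k) (simp_all add: geom_sum_Suc' geom_sum_add algebra_simps)

lemma geom_sum_closed_form: "(c - 1) * geom_sum c k = c ^ k - 1"
  by (induction k) (simp_all add: geom_sum_Suc algebra_simps)

lemma geom_sum_cong: "[c = d] (mod m) \<Longrightarrow> [geom_sum c k = geom_sum d k] (mod m)"
  unfolding geom_sum_def by (intro cong_sum cong_pow)

lemma power_one_plus_cong: "[(1 + m * t) ^ i = 1 + int i * m * t] (mod m ^ 2)" for m t :: int
proof (induction i)
  case (Suc i)
  have "[(1 + m * t) ^ Suc i = (1 + m * t) * (1 + int i * m * t)] (mod m ^ 2)"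
    using cong_mult[OF cong_refl Suc] by simp
  also have "(1 + m * t) * (1 + int i * m * t) = 1 + int (Suc i) * m * t + m ^ 2 * (int i * t * t)"
    by (simp add: algebra_simps power2_eq_square)
  also have "[\<dots> = 1 + int (Suc i) * m * t] (mod m ^ 2)"
    by (simp add: cong_iff_dvd_diff)
  finally show ?case .
qed simp

context
  fixes p :: nat
  assumes p: "Factorial_Ring.prime p" and odd: "odd p"
begin

lemma prime_int_p: "Factorial_Ring.prime (int p)"
  using p by simp

lemma geom_sum_cong_p:
  assumes "int p dvd c - 1" shows "[geom_sum c k = int k] (mod int p)"
proof -
  have "[c = 1] (mod int p)" using assms by (simp add: cong_iff_dvd_diff)
  hence "[geom_sum c k = geom_sum 1 k] (mod int p)" by (rule geom_sum_cong)
  thus ?thesis by (simp add: geom_sum_def)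
qed

text \<open>With \<open>c = 1 + p t\<close>, the sum is \<open>p + p t (0 + ... + (p - 1))\<close>
  modulo \<open>p\<^sup>2\<close>, and for odd \<open>p\<close> the triangular number is again a
  multiple of \<open>p\<close>. For \<open>p = 2\<close> and \<open>c = 3\<close> the sum is 4, so
  oddness matters.\<close>

lemma geom_sum_p:
  assumes "int p dvd c - 1" shows "\<exists>w. geom_sum c p = int p * w \<and> \<not> int p dvd w"
proof -
  obtain t where t: "c = 1 + int p * t" using assms by (metis add.commute diff_add_cancel dvdE)
  obtain r where r: "p = 2 * r + 1" using odd by (rule oddE)
  have "[geom_sum c p = (\<Sum>i<p. 1 + int i * int p * t)] (mod int p ^ 2)"
    unfolding geom_sum_def t by (intro cong_sum power_one_plus_cong)
  also have "(\<Sum>i<p. 1 + int i * int p * t) = int p + int p * t * (\<Sum>i<p. int i)"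
    by (simp add: sum.distrib sum_distrib_left algebra_simps)
  also have "(\<Sum>i<p. int i) = int p * int r"
  proof -
    have "2 * (\<Sum>i<n. int i) = int n * (int n - 1)" for n
      by (induction n) (simp_all add: algebra_simps)
    from this[of p] have "2 * (\<Sum>i<p. int i) = int p * (2 * int r)" by (simp add: r)
    thus ?thesis by simp
  qed
  also have "int p + int p * t * (int p * int r) = int p + int p ^ 2 * (t * int r)"
    by (simp add: power2_eq_square algebra_simps)
  also have "[\<dots> = int p] (mod int p ^ 2)" by (simp add: cong_iff_dvd_diff)
  finally obtain s where s: "geom_sum c p - int p = int p ^ 2 * s"
    by (auto simp: cong_iff_dvd_diff)
  hence "geom_sum c p = int p * (1 + int p * s)" by (simp add: algebra_simps power2_eq_square)
  moreover have "\<not> int p dvd 1 + int p * s"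
    using dvd_add_left_iff[of "int p" "int p * s" 1] prime_int_p by (auto simp: not_prime_unit)
  ultimately show ?thesis by blast
qed

text \<open>Split off one factor \<open>p\<close> of \<open>k\<close>: by
  \<open>geom_sum_mult\<close> the sum is \<open>geom_sum c p\<close>, exactly divisible by
  \<open>p\<close>, times a sum of length \<open>k / p\<close> with ratio \<open>c\<^sup>p\<close>,
  which is again 1 modulo \<open>p\<close>.\<close>

lemma geom_sum_dvd_iff:
  assumes "int p dvd c - 1"
  shows "int p ^ e dvd geom_sum c k \<longleftrightarrow> p ^ e dvd k"
  using assms
proof (induction e arbitrary: c k)
  case (Suc e)
  have ppos: "int p \<noteq> 0" using p by (auto simp: prime_gt_0_nat)
  have base: "int p dvd geom_sum c k \<longleftrightarrow> p dvd k"
    using cong_dvd_iff[OF geom_sum_cong_p[OF Suc.prems, of k]] by simp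
  show ?case
  proof (cases "p dvd k")
    case False
    thus ?thesis using base by (metis dvd_mult_left power_Suc)
  next
    case True
    then obtain m where m: "k = p * m" ..
    obtain w where w: "geom_sum c p = int p * w" "\<not> int p dvd w" using geom_sum_p[OF Suc.prems] by blast
    have cp: "int p dvd c ^ p - 1"
      using Suc.prems geom_sum_closed_form[of c p] by (metis dvd_mult2)
    have cop: "coprime (int p ^ e) w"
      using w(2) prime_int_p by (simp add: prime_imp_coprime)
    have "int p ^ Suc e dvd geom_sum c k \<longleftrightarrow> int p * int p ^ e dvd int p * (w * geom_sum (c ^ p) m)"
      unfolding m geom_sum_mult w(1) by (simp add: mult.assoc)
    also have "\<dots> \<longleftrightarrow> int p ^ e dvd w * geom_sum (c ^ p) m" using ppos by simp
    also have "\<dots> \<longleftrightarrow> int p ^ e dvd geom_sum (c ^ p) m" using cop by (simp add: coprime_dvd_mult_right_iff)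
    also have "\<dots> \<longleftrightarrow> p ^ e dvd m" by (rule Suc.IH[OF cp])
    also have "\<dots> \<longleftrightarrow> p ^ Suc e dvd k" using ppos by (simp add: m)
    finally show ?thesis .
  qed
qed simp

lemma not_dvd_of_cong_one: "int p dvd c - 1 \<Longrightarrow> \<not> int p dvd c"
proof
  assume "int p dvd c - 1" "int p dvd c"
  hence "int p dvd c - (c - 1)" by (rule dvd_diff[rotated])
  thus False using prime_int_p by (simp add: not_prime_unit)
qed

lemma coprime_p_power: "\<not> int p dvd c \<Longrightarrow> coprime c (int p ^ e)"
  using prime_imp_coprime[OF prime_int_p] by (simp add: coprime_commute)

text \<open>The difference of two such sums is a power of the unit \<open>c\<close> times a sum
  whose length is the difference of lengths. So \<open>z \<mapsto> c z + 1\<close> is a cycle of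
  full length modulo \<open>p\<^sup>e\<close>.\<close>

lemma geom_sum_cong_iff:
  assumes "int p dvd c - 1"
  shows "[geom_sum c j = geom_sum c k] (mod int p ^ e) \<longleftrightarrow> [j = k] (mod p ^ e)"
proof -
  have *: "[geom_sum c (j + k) = geom_sum c j] (mod int p ^ e) \<longleftrightarrow> [j + k = j] (mod p ^ e)" for j k
  proof -
    have "coprime (int p ^ e) (c ^ j)"
      using coprime_p_power[OF not_dvd_of_cong_one[OF assms], of e] by (auto simp: coprime_commute)
    hence "[geom_sum c (j + k) = geom_sum c j] (mod int p ^ e) \<longleftrightarrow> int p ^ e dvd geom_sum c k"
      by (simp add: cong_iff_dvd_diff geom_sum_add coprime_dvd_mult_right_iff)
    also have "\<dots> \<longleftrightarrow> p ^ e dvd k" by (rule geom_sum_dvd_iff[OF assms])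
    also have "\<dots> \<longleftrightarrow> [j + k = j] (mod p ^ e)" by (simp add: cong_add_lcancel_0_nat cong_0_iff)
    finally show ?thesis .
  qed
  show ?thesis
  proof (cases "j \<le> k")
    case True
    then obtain m where "k = j + m" using le_Suc_ex by blast
    thus ?thesis using *[of j m] by (simp add: cong_sym_eq)
  next
    case False
    then obtain m where "j = k + m" using le_Suc_ex by (metis nat_le_linear)
    thus ?thesis using *[of k m] by simp
  qed
qed

text \<open>Lifting the exponent: \<open>c\<^sup>k - 1\<close> is \<open>c - 1\<close> times a
  geometric sum, and that sum is the \<open>p\<close>-part of \<open>k\<close> times a factor prime
  to \<open>p\<close>.\<close>

lemma power_minus_one_dvd_iff:
  assumes "int p dvd c - 1"
  shows "int p ^ e dvd c ^ k - 1 \<longleftrightarrow> int p ^ e dvd (c - 1) * int k"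
proof (cases "k = 0")
  case False
  obtain m where m: "k = p ^ multiplicity p k * m" "\<not> p dvd m"
    by (rule multiplicity_decompose'[of k p]) (use False p in \<open>auto simp: not_prime_unit\<close>)
  define v where "v = multiplicity p k"
  have ppos: "p > 0" using p by (simp add: prime_gt_0_nat)
  have k: "k = p ^ v * m" using m(1) by (simp add: v_def)
  have "int p ^ v dvd geom_sum c k" using geom_sum_dvd_iff[OF assms] k by simp
  then obtain w where w: "geom_sum c k = int p ^ v * w" ..
  have "\<not> p ^ Suc v dvd k" using m(2) ppos by (simp add: k mult.commute[of p])
  hence "\<not> int p ^ Suc v dvd geom_sum c k" using geom_sum_dvd_iff[OF assms] by blast
  hence "\<not> int p dvd w" using ppos by (auto simp: w mult.commute[of "int p"])
  hence cw: "coprime (int p ^ e) w" using coprime_p_power by (simp add: coprime_commute)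
  have cm: "coprime (int p ^ e) (int m)" using coprime_p_power[of "int m" e] m(2) by (simp add: coprime_commute)
  have "int p ^ e dvd c ^ k - 1 \<longleftrightarrow> int p ^ e dvd ((c - 1) * int p ^ v) * w"
    unfolding geom_sum_closed_form[symmetric] w by (simp add: mult.assoc)
  also have "\<dots> \<longleftrightarrow> int p ^ e dvd (c - 1) * int p ^ v" using cw by (simp add: coprime_dvd_mult_left_iff)
  also have "\<dots> \<longleftrightarrow> int p ^ e dvd ((c - 1) * int p ^ v) * int m" using cm by (simp add: coprime_dvd_mult_left_iff)
  also have "((c - 1) * int p ^ v) * int m = (c - 1) * int k" by (simp add: k)
  finally show ?thesis .
qed simp

lemma card_cong_one:
  assumes "1 \<le> e" "e \<le> n"
  shows "card {c \<in> {0..<int p ^ n}. int p ^ e dvd c - 1} = p ^ (n - e)"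
proof -
  have ppos: "int p > 0" using p by (simp add: prime_gt_0_nat)
  have p1: "int p > 1" using p prime_gt_1_nat by auto
  have pn: "int p ^ n = int p ^ e * int p ^ (n - e)" using assms(2) by (simp add: power_add[symmetric])
  have pe: "int p ^ e > 1" using p1 assms(1) by simp
  have "{c \<in> {0..<int p ^ n}. int p ^ e dvd c - 1} = (\<lambda>m. 1 + int p ^ e * m) ` {0..<int p ^ (n - e)}"
  proof (intro equalityI subsetI)
    fix c assume c: "c \<in> {c \<in> {0..<int p ^ n}. int p ^ e dvd c - 1}"
    then obtain m where m: "c - 1 = int p ^ e * m" by (auto elim: dvdE)
    have "c \<noteq> 0"
    proof
      assume "c = 0"
      hence "int p ^ e dvd 1" using c by simp
      thus False using pe by (simp add: zdvd1_eq)
    qed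
    hence "0 \<le> int p ^ e * m" "int p ^ e * m < int p ^ e * int p ^ (n - e)" using c m pn by auto
    hence "0 \<le> m" "m < int p ^ (n - e)"
      using ppos pe by (simp_all add: zero_le_mult_iff)
    thus "c \<in> (\<lambda>m. 1 + int p ^ e * m) ` {0..<int p ^ (n - e)}"
      using m by (intro image_eqI[of _ _ m]) auto
  next
    fix c assume "c \<in> (\<lambda>m. 1 + int p ^ e * m) ` {0..<int p ^ (n - e)}"
    then obtain m where m: "c = 1 + int p ^ e * m" "0 \<le> m" "m + 1 \<le> int p ^ (n - e)" using ppos by fastforce
    have "int p ^ e * (m + 1) \<le> int p ^ n" using mult_left_mono[OF m(3), of "int p ^ e"] pn pe by simp
    hence "c < int p ^ n" using pe m(1) by (simp add: algebra_simps)
    moreover have "0 \<le> c" using m pe by simp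
    ultimately show "c \<in> {c \<in> {0..<int p ^ n}. int p ^ e dvd c - 1}" using m by simp
  qed
  moreover have "inj_on (\<lambda>m. 1 + int p ^ e * m) {0..<int p ^ (n - e)}" using ppos by (auto simp: inj_on_def)
  ultimately show ?thesis by (simp add: card_image nat_power_eq)
qed

text \<open>The residues modulo \<open>p\<^sup>3\<close> that are 1 modulo \<open>p\<close> number
  \<open>p\<^sup>2\<close>, and the first \<open>p\<^sup>2\<close> powers of \<open>u\<close> are
  distinct by lifting the exponent, so they exhaust these residues; one of them is the inverse of
  \<open>c\<close>.\<close>

lemma power_surj_cong_one:
  assumes u: "int p dvd u - 1" "\<not> int p ^ 2 dvd u - 1" and c: "int p dvd c - 1"
  shows "\<exists>j. [c * u ^ j = 1] (mod int p ^ 3)"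
proof -
  let ?q = "int p ^ 3"
  let ?W = "{w \<in> {0..<?q}. int p ^ 1 dvd w - 1}"
  have qpos: "?q > 0" using p by (simp add: prime_gt_0_nat)
  have pq: "int p dvd ?q" by simp
  have mod1: "int p dvd x mod ?q - 1 \<longleftrightarrow> int p dvd x - 1" for x
  proof -
    have "[x mod ?q = x] (mod int p)"
      using cong_dvd_modulus[OF _ pq, of "x mod ?q" x] by (simp add: cong_def)
    hence "[x mod ?q - 1 = x - 1] (mod int p)" by (intro cong_diff cong_refl)
    thus ?thesis by (rule cong_dvd_iff)
  qed
  have upow: "int p dvd u ^ j - 1" for j
    using u(1) geom_sum_closed_form[of u j] by (metis dvd_mult2)
  have "inj_on (\<lambda>j. u ^ j mod ?q) {..<p ^ 2}"
  proof (rule linorder_inj_onI')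
    fix i j assume ij: "i \<in> {..<p ^ 2}" "j \<in> {..<p ^ 2}" "i < j"
    show "u ^ i mod ?q \<noteq> u ^ j mod ?q"
    proof
      assume "u ^ i mod ?q = u ^ j mod ?q"
      hence "[u ^ j = u ^ i] (mod ?q)" by (simp add: cong_def)
      hence "?q dvd u ^ j - u ^ i" by (simp add: cong_iff_dvd_diff)
      moreover have "u ^ j - u ^ i = u ^ i * (u ^ (j - i) - 1)"
        using ij(3) by (simp add: algebra_simps power_add[symmetric])
      moreover have "coprime ?q (u ^ i)"
        using coprime_p_power[OF not_dvd_of_cong_one[OF u(1)], of 3] by (auto simp: coprime_commute)
      ultimately have "?q dvd u ^ (j - i) - 1" by (simp add: coprime_dvd_mult_right_iff)
      hence "?q dvd (u - 1) * int (j - i)" using power_minus_one_dvd_iff[OF u(1)] by blast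
      moreover obtain w where w: "u - 1 = int p * w" using u(1) ..
      moreover have "\<not> int p dvd w"
        using u(2) w by (auto simp: power2_eq_square)
      moreover have "int p \<noteq> 0" using p by auto
      ultimately have "int p ^ 2 dvd w * int (j - i)"
        by (simp add: power3_eq_cube power2_eq_square mult.assoc)
      hence "int p ^ 2 dvd int (j - i)"
        using coprime_p_power[OF \<open>\<not> int p dvd w\<close>, of 2] by (simp add: coprime_dvd_mult_right_iff coprime_commute)
      hence "p ^ 2 dvd j - i" by (metis int_dvd_int_iff of_nat_power)
      thus False using ij by (auto dest: dvd_imp_le)
    qed
  qed
  hence "card ((\<lambda>j. u ^ j mod ?q) ` {..<p ^ 2}) = p ^ 2" by (simp add: card_image)
  moreover have "(\<lambda>j. u ^ j mod ?q) ` {..<p ^ 2} \<subseteq> ?W"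
    using mod1 upow qpos by auto
  moreover have "card ?W = p ^ 2" using card_cong_one[of 1 3] by simp
  ultimately have eq: "(\<lambda>j. u ^ j mod ?q) ` {..<p ^ 2} = ?W"
    by (intro card_subset_eq finite_subset[of ?W "{0..<?q}"]) auto
  obtain w where w: "[c * w = 1] (mod ?q)"
    using cong_solve_coprime_int[OF coprime_p_power[OF not_dvd_of_cong_one[OF c]]] by blast
  have "[c * w = 1] (mod int p)" using cong_dvd_modulus[OF w pq] .
  moreover have "[c = 1] (mod int p)" using c by (simp add: cong_iff_dvd_diff)
  ultimately have "[w = 1] (mod int p)"
    by (metis cong_scalar_right cong_sym cong_trans mult_1)
  hence "int p dvd w - 1" by (simp add: cong_iff_dvd_diff)
  hence "w mod ?q \<in> ?W" using mod1 qpos by simp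
  then obtain j where "w mod ?q = u ^ j mod ?q" using eq by (metis (no_types, lifting) imageE)
  hence "[u ^ j = w] (mod ?q)" by (simp add: cong_def)
  hence "[c * u ^ j = c * w] (mod ?q)" by (rule cong_scalar_left)
  thus ?thesis using w cong_trans by blast
qed

end


section \<open>Cyclic regular subgroups and coordinates\<close>

definition transl :: "nat \<Rightarrow> 'x set \<Rightarrow> ('x \<Rightarrow> int) \<Rightarrow> int \<Rightarrow> 'x \<Rightarrow> 'x" where
  "transl q S g j = (\<lambda>x\<in>S. inv_into S g ((g x + j) mod int q))"

definition transl_group :: "nat \<Rightarrow> 'x set \<Rightarrow> ('x \<Rightarrow> int) \<Rightarrow> ('x \<Rightarrow> 'x) set" where
  "transl_group q S g = range (transl q S g)"

definition affine_in :: "nat \<Rightarrow> 'x set \<Rightarrow> ('x \<Rightarrow> int) \<Rightarrow> ('x \<Rightarrow> 'x) \<Rightarrow> bool" where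
  "affine_in q S g \<pi> \<longleftrightarrow> (\<exists>u b. \<forall>x\<in>S. [g (\<pi> x) = u * g x + b] (mod int q))"

text \<open>The inclusion of \<open>\<pi> N\<close> in \<open>N \<pi>\<close>, stated pointwise;
  this avoids inverses and the extensional composition of \<open>BijGroup\<close>.\<close>

definition normalizes :: "'x set \<Rightarrow> ('x \<Rightarrow> 'x) \<Rightarrow> ('x \<Rightarrow> 'x) set \<Rightarrow> bool" where
  "normalizes S \<pi> N \<longleftrightarrow> (\<forall>n\<in>N. \<exists>m\<in>N. \<forall>x\<in>S. \<pi> (n x) = m (\<pi> x))"

locale coordinate =
  fixes q :: nat and S :: "'x set" and g :: "'x \<Rightarrow> int"
  assumes q: "q > 1" and bij: "bij_betw g S {0..<int q}"
begin

lemma range_g: "x \<in> S \<Longrightarrow> 0 \<le> g x" "x \<in> S \<Longrightarrow> g x < int q"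
  using bij by (auto simp: bij_betw_def)

lemma g_inj: "x \<in> S \<Longrightarrow> y \<in> S \<Longrightarrow> [g x = g y] (mod int q) \<longleftrightarrow> x = y"
  using bij range_g by (auto simp: cong_def bij_betw_def inj_on_def)

lemma g_surj: "\<exists>x\<in>S. [g x = k] (mod int q)"
proof -
  have "k mod int q \<in> g ` S" using bij q by (simp add: bij_betw_def)
  thus ?thesis by (auto simp: cong_def) (metis mod_mod_trivial)
qed

lemma transl:
  assumes "x \<in> S"
  shows "transl q S g j x \<in> S" "[g (transl q S g j x) = g x + j] (mod int q)"
proof -
  have m: "(g x + j) mod int q \<in> g ` S" using bij q by (simp add: bij_betw_def)
  show "transl q S g j x \<in> S" using inv_into_into[OF m] assms by (simp add: transl_def)
  show "[g (transl q S g j x) = g x + j] (mod int q)"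
    using f_inv_into_f[OF m] assms by (simp add: transl_def cong_def)
qed

lemma transl_eqI:
  assumes "\<pi> \<in> extensional S" "\<And>x. x \<in> S \<Longrightarrow> \<pi> x \<in> S" "\<And>x. x \<in> S \<Longrightarrow> [g (\<pi> x) = g x + j] (mod int q)"
  shows "\<pi> = transl q S g j"
proof (rule extensionalityI[OF assms(1)])
  fix x assume x: "x \<in> S"
  show "\<pi> x = transl q S g j x"
    using g_inj[OF assms(2)[OF x] transl(1)[OF x]] assms(3)[OF x] transl(2)[OF x] cong_sym cong_trans by blast
qed (simp add: transl_def)

lemma transl_Bij: "transl q S g j \<in> Bij S"
proof -
  have "transl q S g i (transl q S g (- i) x) = x" if x: "x \<in> S" for i x
  proof -
    have "[g (transl q S g i (transl q S g (- i) x)) = g (transl q S g (- i) x) + i] (mod int q)"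
      by (rule transl(2)[OF transl(1)[OF x]])
    also have "[g (transl q S g (- i) x) + i = g x + (- i) + i] (mod int q)"
      by (rule cong_add[OF transl(2)[OF x] cong_refl])
    finally show ?thesis using g_inj[OF transl(1)[OF transl(1)[OF x]] x] by simp
  qed
  from this[of _ j] this[of _ "- j"] have "bij_betw (transl q S g j) S S"
    by (intro bij_betw_byWitness[of _ "transl q S g (- j)"]) (use transl(1) in auto)
  thus ?thesis by (simp add: Bij_def transl_def)
qed

lemma transl_mult: "transl q S g i \<otimes>\<^bsub>BijGroup S\<^esub> transl q S g j = transl q S g (i + j)"
proof -
  have "compose S (transl q S g i) (transl q S g j) = transl q S g (i + j)"
  proof (rule transl_eqI)
    fix x assume x: "x \<in> S"
    show "compose S (transl q S g i) (transl q S g j) x \<in> S" using transl(1) x by (simp add: compose_eq)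
    have "[g (transl q S g i (transl q S g j x)) = g (transl q S g j x) + i] (mod int q)"
      by (rule transl(2)[OF transl(1)[OF x]])
    also have "[g (transl q S g j x) + i = g x + j + i] (mod int q)"
      by (rule cong_add[OF transl(2)[OF x] cong_refl])
    finally show "[g (compose S (transl q S g i) (transl q S g j) x) = g x + (i + j)] (mod int q)"
      using x by (simp add: compose_eq algebra_simps)
  qed simp
  thus ?thesis by (simp add: BijGroup_def transl_Bij)
qed

lemma transl_cong: "[i = j] (mod int q) \<Longrightarrow> transl q S g i = transl q S g j"
  by (auto simp: transl_def fun_eq_iff cong_def) (metis mod_add_cong)

lemma transl_inj:
  assumes "x \<in> S" "transl q S g i x = transl q S g j x" shows "[i = j] (mod int q)"
proof -
  have "[g x + i = g x + j] (mod int q)"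
    using transl(2)[OF assms(1), of i] transl(2)[OF assms(1), of j] assms(2) cong_sym cong_trans by metis
  thus ?thesis by (simp add: cong_add_lcancel)
qed

lemma transl_zero: "transl q S g 0 = \<one>\<^bsub>BijGroup S\<^esub>"
  using transl_eqI[of "\<lambda>x\<in>S. x" 0] by (simp add: BijGroup_def)

lemma S_nonempty: "S \<noteq> {}"
  using g_surj by blast

lemma transl_group_subgroup: "subgroup (transl_group q S g) (BijGroup S)"
proof -
  interpret P: group "BijGroup S" by (rule group_BijGroup)
  show ?thesis
  proof (rule P.subgroupI)
    show "transl_group q S g \<subseteq> carrier (BijGroup S)"
      using transl_Bij by (auto simp: transl_group_def BijGroup_def)
    show "transl_group q S g \<noteq> {}" by (simp add: transl_group_def)
    fix a b assume "a \<in> transl_group q S g" "b \<in> transl_group q S g"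
    then obtain i j where ij: "a = transl q S g i" "b = transl q S g j" by (auto simp: transl_group_def)
    show "a \<otimes>\<^bsub>BijGroup S\<^esub> b \<in> transl_group q S g"
      using ij transl_mult by (simp add: transl_group_def)
    have "inv\<^bsub>BijGroup S\<^esub> a = transl q S g (- i)"
      by (rule P.inv_equality) (use ij transl_mult transl_Bij in \<open>simp_all add: transl_zero BijGroup_def\<close>)
    thus "inv\<^bsub>BijGroup S\<^esub> a \<in> transl_group q S g" by (simp add: transl_group_def)
  qed
qed

lemma transl_group_regular: "regular_subgroup S (transl_group q S g)"
  unfolding regular_subgroup_def
proof (intro conjI ballI transl_group_subgroup)
  fix x y assume xy: "x \<in> S" "y \<in> S"
  show "\<exists>!n. n \<in> transl_group q S g \<and> n x = y"
  proof (rule ex1I[of _ "transl q S g (g y - g x)"])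
    have "[g (transl q S g (g y - g x) x) = g y] (mod int q)"
      using transl(2)[OF xy(1), of "g y - g x"] by simp
    thus "transl q S g (g y - g x) \<in> transl_group q S g \<and> transl q S g (g y - g x) x = y"
      using g_inj[OF transl(1)[OF xy(1)] xy(2)] by (simp add: transl_group_def)
    fix n assume "n \<in> transl_group q S g \<and> n x = y"
    then obtain j where j: "n = transl q S g j" "transl q S g j x = y" by (auto simp: transl_group_def)
    thus "n = transl q S g (g y - g x)"
      using \<open>_ \<and> transl q S g (g y - g x) x = y\<close> transl_inj[OF xy(1), of j "g y - g x"] transl_cong by simp
  qed
qed

lemma transl_group_iso: "(BijGroup S)\<lparr>carrier := transl_group q S g\<rparr> \<cong> integer_mod_group q"
proof -
  let ?N = "(BijGroup S)\<lparr>carrier := transl_group q S g\<rparr>"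
  interpret Z: group "integer_mod_group q" by simp
  have car: "carrier (integer_mod_group q) = {0..<int q}" using q by (simp add: carrier_integer_mod_group)
  have "transl q S g \<in> iso (integer_mod_group q) ?N"
  proof (rule isoI)
    show "transl q S g \<in> hom (integer_mod_group q) ?N"
      unfolding hom_def
    proof (clarsimp, intro conjI ballI)
      show "transl q S g \<in> carrier (integer_mod_group q) \<rightarrow> transl_group q S g"
        by (auto simp: transl_group_def)
      show "transl q S g ((i + j) mod int q) = transl q S g i \<otimes>\<^bsub>BijGroup S\<^esub> transl q S g j" for i j
        unfolding transl_mult by (rule transl_cong) (simp add: cong_def)
    qed
    obtain x where x: "x \<in> S" using S_nonempty by blast
    show "bij_betw (transl q S g) (carrier (integer_mod_group q)) (carrier ?N)"
    proof (rule bij_betw_imageI)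
      show "inj_on (transl q S g) (carrier (integer_mod_group q))"
        unfolding car
      proof (rule inj_onI)
        fix i j assume "i \<in> {0..<int q}" "j \<in> {0..<int q}" "transl q S g i = transl q S g j"
        thus "i = j" using transl_inj[OF x, of i j] by (simp add: cong_def)
      qed
      show "transl q S g ` carrier (integer_mod_group q) = carrier ?N"
        unfolding car
      proof (simp, intro equalityI subsetI)
        fix n assume "n \<in> transl_group q S g"
        then obtain j where "n = transl q S g j" by (auto simp: transl_group_def)
        moreover have "transl q S g j = transl q S g (j mod int q)" by (rule transl_cong) (simp add: cong_def)
        ultimately show "n \<in> transl q S g ` {0..<int q}" using q by (intro image_eqI[of _ _ "j mod int q"]) auto
      qed (auto simp: transl_group_def)
    qed
  qed
  thus ?thesis using Z.iso_sym is_isoI by blast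
qed

text \<open>Conjugation turns the translation by 1 into a translation by some \<open>u\<close>, so
  each step of 1 in \<open>g x\<close> changes \<open>g (\<pi> x)\<close> by
  \<open>u\<close>.\<close>

lemma affine_if_normalizes:
  assumes \<pi>: "\<pi> \<in> Bij S"
    and n: "\<And>n. n \<in> transl_group q S g \<Longrightarrow> \<exists>m\<in>transl_group q S g. \<forall>x\<in>S. \<pi> (n x) = m (\<pi> x)"
  shows "affine_in q S g \<pi>"
proof -
  have \<pi>S: "\<pi> x \<in> S" if "x \<in> S" for x using \<pi> that by (auto simp: Bij_def bij_betw_def)
  obtain u where u: "\<And>x. x \<in> S \<Longrightarrow> \<pi> (transl q S g 1 x) = transl q S g u (\<pi> x)"
    using n[of "transl q S g 1"] by (auto simp: transl_group_def)
  obtain x0 where x0: "x0 \<in> S" "[g x0 = 0] (mod int q)" using g_surj by blast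
  have *: "\<forall>x\<in>S. [g x = int k] (mod int q) \<longrightarrow> [g (\<pi> x) = u * int k + g (\<pi> x0)] (mod int q)" for k
  proof (induction k)
    case 0
    show ?case
    proof (intro ballI impI)
      fix x assume "x \<in> S" "[g x = int 0] (mod int q)"
      hence "x = x0" using g_inj x0 by (metis cong_sym cong_trans of_nat_0)
      thus "[g (\<pi> x) = u * int 0 + g (\<pi> x0)] (mod int q)" by simp
    qed
  next
    case (Suc k)
    show ?case
    proof (intro ballI impI)
      fix x assume x: "x \<in> S" "[g x = int (Suc k)] (mod int q)"
      let ?y = "transl q S g (- 1) x"
      have y: "?y \<in> S" "[g ?y = g x + - 1] (mod int q)" using transl[OF x(1)] by blast+
      have "[g x + - 1 = int (Suc k) + - 1] (mod int q)" using cong_add[OF x(2) cong_refl] .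
      hence "[g ?y = int k] (mod int q)" using cong_trans[OF y(2)] by simp
      hence IH: "[g (\<pi> ?y) = u * int k + g (\<pi> x0)] (mod int q)" using Suc y(1) by blast
      have "transl q S g 1 ?y = x"
      proof -
        have "[g (transl q S g 1 ?y) = g ?y + 1] (mod int q)" using transl(2)[OF y(1)] .
        also have "[g ?y + 1 = g x + - 1 + 1] (mod int q)" using cong_add[OF y(2) cong_refl] .
        finally show ?thesis using g_inj[OF transl(1)[OF y(1)] x(1)] by simp
      qed
      hence "\<pi> x = transl q S g u (\<pi> ?y)" using u[OF y(1)] by simp
      hence "[g (\<pi> x) = g (\<pi> ?y) + u] (mod int q)" using transl(2)[OF \<pi>S[OF y(1)]] by simp
      also have "[g (\<pi> ?y) + u = u * int k + g (\<pi> x0) + u] (mod int q)" using cong_add[OF IH cong_refl] .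
      finally show "[g (\<pi> x) = u * int (Suc k) + g (\<pi> x0)] (mod int q)" by (simp add: algebra_simps)
    qed
  qed
  have "[g (\<pi> x) = u * g x + g (\<pi> x0)] (mod int q)" if "x \<in> S" for x
    using *[of "nat (g x)"] range_g[OF that] that by simp
  thus ?thesis unfolding affine_in_def by blast
qed

lemma normalizes_if_affine:
  assumes \<pi>: "\<pi> \<in> Bij S" and a: "affine_in q S g \<pi>" and n: "n \<in> transl_group q S g"
  shows "\<exists>m\<in>transl_group q S g. \<forall>x\<in>S. \<pi> (n x) = m (\<pi> x)"
proof -
  have \<pi>S: "\<pi> x \<in> S" if "x \<in> S" for x using \<pi> that by (auto simp: Bij_def bij_betw_def)
  obtain u b where ub: "\<And>x. x \<in> S \<Longrightarrow> [g (\<pi> x) = u * g x + b] (mod int q)"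
    using a unfolding affine_in_def by blast
  obtain j where j: "n = transl q S g j" using n by (auto simp: transl_group_def)
  have "\<pi> (n x) = transl q S g (u * j) (\<pi> x)" if x: "x \<in> S" for x
  proof -
    note t = transl[OF x, of j]
    have "[g (\<pi> (n x)) = u * g (n x) + b] (mod int q)" using ub[OF t(1)] j by simp
    also have "[u * g (n x) + b = u * (g x + j) + b] (mod int q)"
      unfolding j by (intro cong_add cong_mult cong_refl t(2))
    also have "u * (g x + j) + b = (u * g x + b) + u * j" by (simp add: algebra_simps)
    also have "[(u * g x + b) + u * j = g (\<pi> x) + u * j] (mod int q)"
      by (intro cong_add cong_refl cong_sym[OF ub[OF x]])
    also have "[g (\<pi> x) + u * j = g (transl q S g (u * j) (\<pi> x))] (mod int q)"
      by (rule cong_sym[OF transl(2)[OF \<pi>S[OF x]]])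
    finally show ?thesis using g_inj[OF \<pi>S[OF t(1)] transl(1)[OF \<pi>S[OF x]]] j by simp
  qed
  thus ?thesis by (auto simp: transl_group_def)
qed

lemma normalizes_iff_affine:
  "\<pi> \<in> Bij S \<Longrightarrow> normalizes S \<pi> (transl_group q S g) \<longleftrightarrow> affine_in q S g \<pi>"
  using affine_if_normalizes normalizes_if_affine unfolding normalizes_def by blast

text \<open>Under an affine change of coordinate with unit slope \<open>u\<close>, translation by
  \<open>j\<close> becomes translation by \<open>u j\<close>, which only renames the members of the
  group.\<close>

lemma rescale:
  assumes u: "coprime u (int q)" and h: "\<And>x. x \<in> S \<Longrightarrow> h x = (u * g x + b) mod int q"
  shows "bij_betw h S {0..<int q}" "transl_group q S h = transl_group q S g"
proof -
  have inj: "inj_on h S"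
  proof (rule inj_onI)
    fix x y assume xy: "x \<in> S" "y \<in> S" "h x = h y"
    hence "[u * g x + b = u * g y + b] (mod int q)" by (simp add: h cong_def)
    hence "[g x = g y] (mod int q)" using u by (simp add: cong_add_rcancel cong_mult_lcancel)
    thus "x = y" using g_inj xy by simp
  qed
  have "card S = q" using bij by (simp add: bij_betw_same_card[OF bij])
  hence "card (h ` S) = q" using inj by (simp add: card_image)
  moreover have "h ` S \<subseteq> {0..<int q}" using h q by auto
  ultimately have "h ` S = {0..<int q}" by (intro card_subset_eq) auto
  thus b: "bij_betw h S {0..<int q}" using inj by (simp add: bij_betw_def)
  interpret h: coordinate q S h by unfold_locales (use q b in auto)
  have t: "transl q S g j = transl q S h (u * j)" for j
  proof (rule h.transl_eqI)
    fix x assume x: "x \<in> S"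
    note tj = transl[OF x, of j]
    show "transl q S g j x \<in> S" by (rule tj(1))
    have "[h (transl q S g j x) = u * g (transl q S g j x) + b] (mod int q)" by (simp add: h[OF tj(1)] cong_def)
    also have "[u * g (transl q S g j x) + b = u * (g x + j) + b] (mod int q)"
      by (intro cong_add cong_mult cong_refl tj(2))
    also have "u * (g x + j) + b = (u * g x + b) + u * j" by (simp add: algebra_simps)
    also have "[(u * g x + b) + u * j = h x + u * j] (mod int q)" by (simp add: h[OF x] cong_def mod_simps)
    finally show "[h (transl q S g j x) = h x + u * j] (mod int q)" .
  qed (simp add: transl_def)
  obtain w where w: "[u * w = 1] (mod int q)" using cong_solve_coprime_int[OF u] by blast
  have "transl q S h j = transl q S g (w * j)" for j
  proof -
    have "[u * w * j = 1 * j] (mod int q)" using cong_mult[OF w cong_refl] .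
    hence "transl q S h j = transl q S h (u * (w * j))" by (intro h.transl_cong) (simp add: cong_sym mult.assoc)
    thus ?thesis by (simp add: t)
  qed
  thus "transl_group q S h = transl_group q S g" using t by (auto simp: transl_group_def)
qed

text \<open>The translation by 1 in \<open>g\<close> is some translation in \<open>h\<close>; the
  points labelled 0 and 1 show that it is the translation by 1 there too, and iterating it from
  \<open>x0\<close> reaches every point. This makes \<open>c\<close> recoverable from the
  subgroup.\<close>

lemma coordinate_unique:
  assumes h: "bij_betw h S {0..<int q}" and eq: "transl_group q S h = transl_group q S g"
    and x: "x0 \<in> S" "x1 \<in> S" "g x0 = 0" "h x0 = 0" "g x1 = 1" "h x1 = 1" and y: "y \<in> S"
  shows "h y = g y"
proof -
  interpret h: coordinate q S h by unfold_locales (use q h in auto)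
  have "transl q S g 1 \<in> transl_group q S h" using eq by (auto simp: transl_group_def)
  then obtain j where j: "transl q S g 1 = transl q S h j" by (auto simp: transl_group_def)
  have "transl q S g 1 x0 = x1"
    using g_inj[OF transl(1)[OF x(1)] x(2), of 1] transl(2)[OF x(1), of 1] x by simp
  hence "[h x1 = h x0 + j] (mod int q)" using h.transl(2)[OF x(1), of j] j by simp
  hence "[j = 1] (mod int q)" using x by (simp add: cong_sym)
  hence eq1: "transl q S g 1 = transl q S h 1" using j h.transl_cong by simp
  have *: "\<forall>y\<in>S. [g y = int k] (mod int q) \<longrightarrow> [h y = int k] (mod int q)" for k
  proof (induction k)
    case 0
    show ?case
    proof (intro ballI impI)
      fix y assume "y \<in> S" "[g y = int 0] (mod int q)"
      hence "y = x0" using g_inj[OF _ x(1)] x(3) by simp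
      thus "[h y = int 0] (mod int q)" using x by simp
    qed
  next
    case (Suc k)
    show ?case
    proof (intro ballI impI)
      fix y assume y: "y \<in> S" "[g y = int (Suc k)] (mod int q)"
      let ?z = "transl q S g (- 1) y"
      have z: "?z \<in> S" "[g ?z = g y + - 1] (mod int q)" using transl[OF y(1)] by blast+
      have "[g y + - 1 = int (Suc k) + - 1] (mod int q)" using cong_add[OF y(2) cong_refl] .
      hence "[g ?z = int k] (mod int q)" using cong_trans[OF z(2)] by simp
      hence IH: "[h ?z = int k] (mod int q)" using Suc z(1) by blast
      have "transl q S g 1 ?z = y"
      proof -
        have "[g (transl q S g 1 ?z) = g ?z + 1] (mod int q)" using transl(2)[OF z(1)] .
        also have "[g ?z + 1 = g y + - 1 + 1] (mod int q)" using cong_add[OF z(2) cong_refl] .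
        finally show ?thesis using g_inj[OF transl(1)[OF z(1)] y(1)] by simp
      qed
      hence "[h y = h ?z + 1] (mod int q)" using h.transl(2)[OF z(1), of 1] eq1 by simp
      also have "[h ?z + 1 = int k + 1] (mod int q)" using cong_add[OF IH cong_refl] .
      finally show "[h y = int (Suc k)] (mod int q)" by (simp add: algebra_simps)
    qed
  qed
  have "[h y = g y] (mod int q)" using *[of "nat (g y)"] range_g[OF y] y by simp
  thus ?thesis using range_g[OF y] h.range_g[OF y] by (simp add: cong_def)
qed

end

text \<open>Label the point \<open>n x0\<close> by the residue that an isomorphism assigns to
  \<open>n\<close>; regularity makes this a bijection and turns \<open>N\<close> into the
  translations.\<close>

lemma regular_cyclic_coordinate:
  assumes q: "q > 1" and N: "regular_subgroup S N" and iso: "(BijGroup S)\<lparr>carrier := N\<rparr> \<cong> integer_mod_group q"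
    and x0: "x0 \<in> S"
  shows "\<exists>g. bij_betw g S {0..<int q} \<and> g x0 = 0 \<and> transl_group q S g = N"
proof -
  interpret P: group "BijGroup S" by (rule group_BijGroup)
  have sub: "subgroup N (BijGroup S)" using N by (simp add: regular_subgroup_def)
  have reg: "\<exists>!n. n \<in> N \<and> n x = y" if "x \<in> S" "y \<in> S" for x y using N that by (simp add: regular_subgroup_def)
  have car: "carrier (integer_mod_group q) = {0..<int q}" using q by (simp add: carrier_integer_mod_group)
  have "group ((BijGroup S)\<lparr>carrier := N\<rparr>)" using subgroup.subgroup_is_group[OF sub P.group_axioms] .
  then obtain f where f: "f \<in> iso (integer_mod_group q) ((BijGroup S)\<lparr>carrier := N\<rparr>)"
    using group.iso_sym[OF _ iso] by (auto simp: is_iso_def)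
  have fbij: "bij_betw f {0..<int q} N" using f car by (simp add: iso_def)
  have fN: "f i \<in> N" if "i \<in> {0..<int q}" for i using fbij that by (auto simp: bij_betw_def)
  have NB: "n \<in> Bij S" if "n \<in> N" for n using subgroup.subset[OF sub] that by (auto simp: BijGroup_def)
  have NX: "n x \<in> S" if "n \<in> N" "x \<in> S" for n x using NB[OF that(1)] that(2) by (auto simp: Bij_def bij_betw_def)
  have fadd: "f ((i + j) mod int q) x = f i (f j x)" if "i \<in> {0..<int q}" "j \<in> {0..<int q}" "x \<in> S" for i j x
  proof -
    have "f ((i + j) mod int q) = f i \<otimes>\<^bsub>BijGroup S\<^esub> f j"
      using f that car by (auto simp: iso_def hom_def)
    thus ?thesis using NB[OF fN] that by (simp add: BijGroup_def compose_eq)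
  qed
  have b: "bij_betw (\<lambda>i. f i x0) {0..<int q} S"
  proof (rule bij_betwI')
    fix i j assume ij: "i \<in> {0..<int q}" "j \<in> {0..<int q}"
    show "f i x0 = f j x0 \<longleftrightarrow> i = j"
    proof
      assume "f i x0 = f j x0"
      hence "f i = f j" using reg[OF x0 NX[OF fN[OF ij(2)] x0]] fN[OF ij(1)] fN[OF ij(2)] by metis
      thus "i = j" using inj_onD[OF bij_betw_imp_inj_on[OF fbij] _ ij] by blast
    qed simp
  next
    fix y assume "y \<in> S"
    then obtain n where "n \<in> N" "n x0 = y" using reg[OF x0] by blast
    thus "\<exists>i\<in>{0..<int q}. y = f i x0" using fbij by (auto simp: bij_betw_def)
  qed (use NX fN x0 in auto)
  define g where "g = inv_into {0..<int q} (\<lambda>i. f i x0)"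
  have gb: "bij_betw g S {0..<int q}" unfolding g_def by (rule bij_betw_inv_into[OF b])
  have gf: "g (f i x0) = i" if "i \<in> {0..<int q}" for i
    unfolding g_def by (rule inv_into_f_f[OF bij_betw_imp_inj_on[OF b] that])
  have fg: "f (g x) x0 = x" "g x \<in> {0..<int q}" if "x \<in> S" for x
    using f_inv_into_f[of x "\<lambda>i. f i x0" "{0..<int q}"] bij_betw_imp_surj_on[OF b] bij_betwE[OF gb] that
    by (simp_all add: g_def)
  interpret g: coordinate q S g by unfold_locales (use q gb in auto)
  have ft: "f i = transl q S g i" if i: "i \<in> {0..<int q}" for i
  proof (rule g.transl_eqI)
    show "f i \<in> extensional S" using NB[OF fN[OF i]] by (simp add: Bij_def)
    fix x assume x: "x \<in> S"
    show "f i x \<in> S" using NX fN i x by blast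
    have "f i x = f ((i + g x) mod int q) x0" using fadd[OF i fg(2)[OF x] x0] fg(1)[OF x] by simp
    hence "g (f i x) = (i + g x) mod int q" using gf q by simp
    thus "[g (f i x) = g x + i] (mod int q)" by (simp add: cong_def add.commute)
  qed
  have "transl_group q S g = N"
  proof (intro equalityI subsetI)
    fix n assume "n \<in> N"
    then obtain i where "i \<in> {0..<int q}" "n = f i" using fbij by (auto simp: bij_betw_def)
    thus "n \<in> transl_group q S g" using ft by (auto simp: transl_group_def)
  next
    fix n assume "n \<in> transl_group q S g"
    then obtain j where "n = transl q S g j" by (auto simp: transl_group_def)
    also have "transl q S g j = transl q S g (j mod int q)" by (rule g.transl_cong) (simp add: cong_def)
    also have "\<dots> = f (j mod int q)" using ft q by simp
    finally show "n \<in> N" using fN q by simp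
  qed
  moreover have "g x0 = 0"
  proof -
    have "f (g x0) x0 = x0" "g x0 \<in> {0..<int q}" using fg x0 by auto
    moreover have "f 0 x0 = x0"
    proof -
      have "f 0 (f 0 x0) = f 0 x0" using fadd[of 0 0 x0] q x0 by simp
      thus ?thesis using NB[OF fN[of 0]] q x0 NX[OF fN[of 0] x0]
        by (simp add: Bij_def bij_betw_def inj_on_def)
    qed
    ultimately show ?thesis using gf[of 0] q by simp
  qed
  ultimately show ?thesis using gb by blast
qed


section \<open>Counting normalized cyclic regular subgroups\<close>

lemma power_prime_power_cong:
  fixes m p :: nat
  assumes p: "Factorial_Ring.prime p" shows "[m ^ (p ^ i) = m] (mod p)"
proof -
  have mp: "[m ^ p = m] (mod p)"
  proof (cases "p dvd m")
    case True
    thus ?thesis using p by (metis cong_0_iff cong_sym cong_trans dvd_power_le dvd_power dvd_trans prime_gt_0_nat)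
  next
    case False
    hence "[m ^ (p - 1) * m = 1 * m] (mod p)" using fermat_theorem[OF p] by (intro cong_mult cong_refl)
    thus ?thesis using p by (metis mult_1 power_minus_mult prime_gt_0_nat)
  qed
  show ?thesis
  proof (induction i)
    case (Suc i)
    have "[(m ^ (p ^ i)) ^ p = m ^ p] (mod p)" using Suc by (rule cong_pow)
    thus ?case using mp cong_trans by (simp add: power_mult[symmetric] mult.commute)
  qed simp
qed

text \<open>What is left of the Galois group for the count: a cycle \<tau>, with \<open>pt k\<close>
  the \<open>k\<close>-th point of its orbit, and a map \<upsilon> that fixes \<open>pt 0\<close>
  and multiplies positions by \<open>u\<close>. Positions are natural numbers read modulo
  \<open>p\<^sup>n\<close>, so that \<open>u * k\<close> requires no reduction.\<close>

locale cycle_with_power =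
  fixes p n :: nat and S :: "'x set" and \<tau> \<upsilon> :: "'x \<Rightarrow> 'x" and pt :: "nat \<Rightarrow> 'x" and u :: nat
  assumes p: "Factorial_Ring.prime p" and odd: "odd p" and n: "n \<ge> 1"
    and \<tau>: "\<tau> \<in> Bij S" and \<upsilon>: "\<upsilon> \<in> Bij S"
    and pt_S: "pt k \<in> S" and pt_surj: "x \<in> S \<Longrightarrow> \<exists>k. x = pt k"
    and pt_eq: "pt j = pt k \<longleftrightarrow> [j = k] (mod p ^ n)"
    and \<tau>_pt: "\<tau> (pt k) = pt (Suc k)" and \<upsilon>_pt: "\<upsilon> (pt k) = pt (u * k)"
    and u: "\<not> p dvd u"
begin

abbreviation "q \<equiv> p ^ n"

lemma q1: "q > 1"
  using p n prime_gt_1_nat by (metis One_nat_def one_less_power le_eq_less_or_eq less_le_trans zero_less_Suc)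

lemma q1_int: "int p ^ n > 1"
  using q1 by (metis of_nat_1 of_nat_less_iff of_nat_power)

lemma p_pos: "p > 0"
  using p by (simp add: prime_gt_0_nat)

lemma geom_sum_two: "geom_sum d 2 = 1 + d"
  by (simp add: numeral_2_eq_2 geom_sum_Suc geom_sum_simps)

lemma u_pos: "u \<ge> 1"
  using u by (cases u) auto

lemma p_dvd_q: "int p dvd int q"
  using n by simp

lemma card_S: "card S = q"
proof -
  have "bij_betw pt {..<q} S"
  proof (rule bij_betwI')
    fix y assume "y \<in> S"
    then obtain k where "y = pt k" using pt_surj by blast
    moreover have "pt k = pt (k mod q)" by (simp add: pt_eq cong_def)
    ultimately have "y = pt (k mod q)" by simp
    moreover have "k mod q < q" using p_pos by simp
    ultimately show "\<exists>k\<in>{..<q}. y = pt k" by blast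
  qed (auto simp: pt_eq pt_S cong_def)
  thus ?thesis using bij_betw_same_card by force
qed

text \<open>The coordinate with \<open>pt 0 \<mapsto> 0\<close> in which \<open>\<tau>\<close> is \<open>z \<mapsto> c z + 1\<close>.\<close>

definition coord :: "int \<Rightarrow> 'x \<Rightarrow> int" where
  "coord c x = geom_sum c (SOME k. pt k = x) mod int q"

lemma coord_pt:
  assumes "int p dvd c - 1" shows "coord c (pt k) = geom_sum c k mod int q"
proof -
  have "pt (SOME j. pt j = pt k) = pt k" by (rule someI[of _ k]) simp
  hence "[(SOME j. pt j = pt k) = k] (mod p ^ n)" by (simp add: pt_eq)
  thus ?thesis using geom_sum_cong_iff[OF p odd assms, of _ k n] by (simp add: coord_def cong_def)
qed

lemma coord_cong: "int p dvd c - 1 \<Longrightarrow> [coord c (pt k) = geom_sum c k] (mod int q)"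
  by (simp add: coord_pt)

lemma coord_bij:
  assumes "int p dvd c - 1" shows "bij_betw (coord c) S {0..<int q}"
proof -
  have "inj_on (coord c) S"
  proof (rule inj_onI)
    fix x y assume xy: "x \<in> S" "y \<in> S" "coord c x = coord c y"
    obtain j k where jk: "x = pt j" "y = pt k" using pt_surj xy by blast
    hence "[geom_sum c j = geom_sum c k] (mod int p ^ n)"
      using xy(3) by (simp add: coord_pt[OF assms] cong_def)
    thus "x = y" using geom_sum_cong_iff[OF p odd assms] jk by (simp add: pt_eq)
  qed
  moreover have "coord c ` S \<subseteq> {0..<int q}" using p_pos by (auto simp: coord_def)
  ultimately show ?thesis
    using card_subset_eq[of "{0..<int q}" "coord c ` S"]
    by (simp add: bij_betw_def card_image card_S nat_power_eq)
qed

lemma coord_coordinate: "int p dvd c - 1 \<Longrightarrow> coordinate q S (coord c)"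
  using q1 coord_bij by (simp add: coordinate_def)

lemma coord_affine_\<tau>:
  assumes "int p dvd c - 1" shows "affine_in q S (coord c) \<tau>"
proof -
  have "[coord c (\<tau> x) = c * coord c x + 1] (mod int q)" if x: "x \<in> S" for x
  proof -
    obtain k where k: "x = pt k" using pt_surj x by blast
    have "[coord c (\<tau> x) = c * geom_sum c k + 1] (mod int q)"
      using coord_cong[OF assms, of "Suc k"] by (simp add: k \<tau>_pt geom_sum_Suc' add.commute)
    also have "[c * geom_sum c k + 1 = c * coord c x + 1] (mod int q)"
      unfolding k by (intro cong_add cong_mult cong_refl cong_sym[OF coord_cong[OF assms]])
    finally show ?thesis .
  qed
  thus ?thesis unfolding affine_in_def by blast
qed

text \<open>If \<upsilon> is affine with slope \<open>A\<close>, position 0 kills the constant term,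
  position 1 gives \<open>A = geom_sum c u\<close>, and position 2 compares \<open>1 + c ^ u\<close>
  with \<open>1 + c\<close>, both multiplied by that sum. The sum is a unit since \<open>p\<close>
  does not divide \<open>u\<close>, so \<open>c ^ u = c\<close> modulo \<open>q\<close>. Conversely
  \<open>geom_sum_mult\<close> then makes \<upsilon> multiplication by the same sum. Lifting the
  exponent removes the power.\<close>

lemma coord_affine_\<upsilon>_iff:
  assumes c: "int p dvd c - 1"
  shows "affine_in q S (coord c) \<upsilon> \<longleftrightarrow> int q dvd (c - 1) * (int u - 1)"
proof -
  have "affine_in q S (coord c) \<upsilon> \<longleftrightarrow> [c ^ u = c] (mod int q)"
  proof
    assume "affine_in q S (coord c) \<upsilon>"
    then obtain A b where "\<And>x. x \<in> S \<Longrightarrow> [coord c (\<upsilon> x) = A * coord c x + b] (mod int q)"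
      unfolding affine_in_def by blast
    note A0 = this
    have Ab: "[geom_sum c (u * k) = A * geom_sum c k + b] (mod int q)" for k
    proof -
      have "[geom_sum c (u * k) = coord c (\<upsilon> (pt k))] (mod int q)"
        unfolding \<upsilon>_pt by (rule cong_sym[OF coord_cong[OF c]])
      also have "[coord c (\<upsilon> (pt k)) = A * coord c (pt k) + b] (mod int q)" by (rule A0[OF pt_S])
      also have "[A * coord c (pt k) + b = A * geom_sum c k + b] (mod int q)"
        by (intro cong_add cong_mult cong_refl coord_cong[OF c])
      finally show ?thesis .
    qed
    have b: "[b = 0] (mod int q)" using Ab[of 0] by (simp add: cong_sym_eq geom_sum_simps)
    have "[geom_sum c u = A + b] (mod int q)" using Ab[of 1] by (simp add: geom_sum_simps)
    also have "[A + b = A + 0] (mod int q)" by (intro cong_add cong_refl b)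
    finally have A: "[geom_sum c u = A] (mod int q)" by simp
    have "geom_sum c (u * 2) = geom_sum c u * (1 + c ^ u)" "geom_sum c 2 = 1 + c"
      by (simp_all only: geom_sum_mult geom_sum_two)
    hence "[geom_sum c u * (1 + c ^ u) = A * (1 + c) + b] (mod int q)" using Ab[of 2] by metis
    also have "[A * (1 + c) + b = geom_sum c u * (1 + c) + 0] (mod int q)"
      by (intro cong_add cong_mult cong_refl b cong_sym[OF A])
    finally have "[geom_sum c u * (1 + c ^ u) = geom_sum c u * (1 + c)] (mod int q)" by simp
    moreover have "coprime (geom_sum c u) (int q)"
      using coprime_p_power[OF p odd, of "geom_sum c u" n] geom_sum_dvd_iff[OF p odd c, of 1 u] u by simp
    ultimately show "[c ^ u = c] (mod int q)" by (simp add: cong_mult_lcancel cong_add_lcancel)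
  next
    assume cu: "[c ^ u = c] (mod int q)"
    have "[coord c (\<upsilon> x) = geom_sum c u * coord c x + 0] (mod int q)" if x: "x \<in> S" for x
    proof -
      obtain k where k: "x = pt k" using pt_surj x by blast
      have "[geom_sum c (u * k) = geom_sum c u * geom_sum c k] (mod int q)"
        unfolding geom_sum_mult by (intro cong_mult cong_refl geom_sum_cong cu)
      thus ?thesis by (simp add: coord_pt[OF c] \<upsilon>_pt k cong_def mod_simps)
    qed
    thus "affine_in q S (coord c) \<upsilon>" unfolding affine_in_def by blast
  qed
  also have "\<dots> \<longleftrightarrow> int q dvd c ^ u - c" by (simp add: cong_iff_dvd_diff)
  also have "c ^ u - c = c * (c ^ (u - 1) - 1)"
    using u_pos by (cases u) (simp_all add: algebra_simps)
  also have "int q dvd c * (c ^ (u - 1) - 1) \<longleftrightarrow> int q dvd c ^ (u - 1) - 1"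
    using coprime_p_power[OF p odd not_dvd_of_cong_one[OF p odd c], of n]
    by (simp add: coprime_dvd_mult_right_iff coprime_commute)
  also have "\<dots> \<longleftrightarrow> int q dvd (c - 1) * (int u - 1)"
    using power_minus_one_dvd_iff[OF p odd c, of n "u - 1"] u_pos by (simp add: of_nat_diff)
  finally show ?thesis .
qed

definition normalized :: "('x \<Rightarrow> 'x) set set" where
  "normalized = {N. regular_subgroup S N \<and> (BijGroup S)\<lparr>carrier := N\<rparr> \<cong> integer_mod_group q \<and>
     normalizes S \<tau> N \<and> normalizes S \<upsilon> N}"

text \<open>In a coordinate sending \<open>pt 0\<close> to 0 the cycle reads
  \<open>z \<mapsto> c z + e\<close>. Every value is a multiple of \<open>e\<close> and 1 is
  attained, so \<open>e\<close> is a unit and can be scaled to 1. Returning to \<open>pt 0\<close>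
  after \<open>q\<close> steps gives \<open>c ^ q = 1\<close> modulo \<open>p\<close>, while Fermat
  gives \<open>c ^ q = c\<close>, whence \<open>c = 1\<close> modulo \<open>p\<close>.\<close>

lemma normalized_coord:
  assumes N: "N \<in> normalized"
  shows "\<exists>c\<in>{0..<int q}. int p dvd c - 1 \<and> transl_group q S (coord c) = N"
proof -
  have N': "regular_subgroup S N" "(BijGroup S)\<lparr>carrier := N\<rparr> \<cong> integer_mod_group q" "normalizes S \<tau> N"
    using N by (auto simp: normalized_def)
  obtain g where g: "bij_betw g S {0..<int q}" "g (pt 0) = 0" "transl_group q S g = N"
    using regular_cyclic_coordinate[OF q1 N'(1,2) pt_S] by blast
  interpret g: coordinate q S g by unfold_locales (use q1 g in auto)
  obtain c0 e where c0: "\<And>x. x \<in> S \<Longrightarrow> [g (\<tau> x) = c0 * g x + e] (mod int q)"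
    using g.normalizes_iff_affine[OF \<tau>] N'(3) g(3) unfolding affine_in_def by blast
  define c where "c = c0 mod int q"
  have crange: "c \<in> {0..<int q}" using p_pos by (simp add: c_def)
  have ck: "[g (pt k) = e * geom_sum c k] (mod int q)" for k
  proof (induction k)
    case (Suc k)
    have "[g (pt (Suc k)) = c0 * g (pt k) + e] (mod int q)" using c0[OF pt_S[of k]] by (simp add: \<tau>_pt)
    also have "[c0 * g (pt k) + e = c * (e * geom_sum c k) + e] (mod int q)"
      by (intro cong_add cong_mult cong_refl Suc) (simp add: c_def cong_def)
    also have "c * (e * geom_sum c k) + e = e * geom_sum c (Suc k)" by (simp add: geom_sum_Suc' algebra_simps)
    finally show ?case .
  qed (simp add: g(2) geom_sum_simps)
  have cop: "coprime e (int q)"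
  proof -
    obtain x where x: "x \<in> S" "[g x = 1] (mod int q)" using g.g_surj by blast
    obtain k where "x = pt k" using pt_surj x by blast
    hence "[e * geom_sum c k = 1] (mod int q)" using ck[of k] x(2) cong_sym cong_trans by blast
    thus ?thesis using coprime_iff_invertible_int by blast
  qed
  have "pt q = pt 0" by (simp add: pt_eq cong_def)
  hence "[e * geom_sum c q = e * 0] (mod int q)"
    using ck[of q] g(2) by (simp add: cong_sym_eq)
  hence "[geom_sum c q = 0] (mod int q)" using cong_mult_lcancel[OF cop] by blast
  hence "int p dvd geom_sum c q" using p_dvd_q by (metis cong_0_iff dvd_trans)
  hence "int p dvd c ^ q - 1" using geom_sum_closed_form[of c q] by (metis dvd_mult)
  moreover have "[c ^ q = c] (mod int p)"
  proof -
    define m where "m = nat c"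
    have m: "c = int m" using crange by (simp add: m_def)
    show ?thesis using power_prime_power_cong[OF p, of m n] unfolding m by (metis cong_int_iff of_nat_power)
  qed
  ultimately have pc: "int p dvd c - 1"
    by (metis cong_iff_dvd_diff cong_sym cong_trans)
  obtain w where w: "[e * w = 1] (mod int q)" using cong_solve_coprime_int[OF cop] by blast
  have "coprime w (int q)" using w coprime_iff_invertible_int by (metis mult.commute)
  moreover have "coord c x = (w * g x + 0) mod int q" if x: "x \<in> S" for x
  proof -
    obtain k where k: "x = pt k" using pt_surj x by blast
    have "[w * g x = w * (e * geom_sum c k)] (mod int q)" unfolding k by (intro cong_mult cong_refl ck)
    also have "w * (e * geom_sum c k) = e * w * geom_sum c k" by simp
    also have "[e * w * geom_sum c k = 1 * geom_sum c k] (mod int q)" by (intro cong_mult cong_refl w)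
    finally show ?thesis by (simp add: k coord_pt[OF pc] cong_def)
  qed
  ultimately have "transl_group q S (coord c) = transl_group q S g" by (rule g.rescale(2))
  thus ?thesis using crange pc g(3) by blast
qed

lemma card_normalized:
  "card normalized = card {c \<in> {0..<int q}. int p dvd c - 1 \<and> int q dvd (c - 1) * (int u - 1)}"
    (is "_ = card ?C")
proof -
  have inj: "inj_on (\<lambda>c. transl_group q S (coord c)) ?C"
  proof (rule inj_onI)
    fix c d assume c: "c \<in> ?C" and d: "d \<in> ?C" and eq: "transl_group q S (coord c) = transl_group q S (coord d)"
    have pc: "int p dvd c - 1" and pd: "int p dvd d - 1" using c d by auto
    interpret d: coordinate q S "coord d" by (rule coord_coordinate[OF pd])
    \<comment> \<open>Both coordinates put \<open>pt 0\<close> at 0 and \<open>pt 1\<close> at 1, so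
      they coincide; at \<open>pt 2\<close> they read \<open>1 + c\<close> and
      \<open>1 + d\<close>.\<close>
    have "coord c (pt 2) = coord d (pt 2)"
      by (rule d.coordinate_unique[OF coord_bij[OF pc] eq pt_S[of 0] pt_S[of 1] _ _ _ _ pt_S])
         (use q1_int in \<open>simp_all add: coord_pt[OF pc] coord_pt[OF pd] geom_sum_simps\<close>)
    hence "[1 + c = 1 + d] (mod int q)"
      by (simp add: coord_pt[OF pc] coord_pt[OF pd] numeral_2_eq_2 geom_sum_Suc geom_sum_simps cong_def)
    hence "[c = d] (mod int q)" by (simp add: cong_add_lcancel)
    thus "c = d" using c d by (simp add: cong_def)
  qed
  have img: "(\<lambda>c. transl_group q S (coord c)) ` ?C = normalized"
  proof (intro equalityI subsetI)
    fix N assume "N \<in> (\<lambda>c. transl_group q S (coord c)) ` ?C"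
    then obtain c where c: "c \<in> ?C" "N = transl_group q S (coord c)" by blast
    have pc: "int p dvd c - 1" using c by auto
    interpret c: coordinate q S "coord c" by (rule coord_coordinate[OF pc])
    have "normalizes S \<tau> N" "normalizes S \<upsilon> N"
      using c coord_affine_\<tau>[OF pc] coord_affine_\<upsilon>_iff[OF pc]
      by (simp_all add: c.normalizes_iff_affine[OF \<tau>] c.normalizes_iff_affine[OF \<upsilon>])
    thus "N \<in> normalized"
      using c.transl_group_regular c.transl_group_iso by (simp add: normalized_def c(2))
  next
    fix N assume N: "N \<in> normalized"
    then obtain c where c: "c \<in> {0..<int q}" "int p dvd c - 1" "transl_group q S (coord c) = N"
      using normalized_coord by blast
    interpret c: coordinate q S "coord c" by (rule coord_coordinate[OF c(2)])
    have "affine_in q S (coord c) \<upsilon>"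
      unfolding c.normalizes_iff_affine[OF \<upsilon>, symmetric] c(3) using N by (simp add: normalized_def)
    hence "c \<in> ?C" using c(1,2) coord_affine_\<upsilon>_iff[OF c(2)] by blast
    thus "N \<in> (\<lambda>c. transl_group q S (coord c)) ` ?C" by (rule image_eqI[rotated]) (simp add: c(3))
  qed
  show ?thesis using card_image[OF inj] unfolding img .
qed

end


text \<open>The order of \<open>u\<close> modulo \<open>p\<^sup>3\<close> controls the divisibility
  of \<open>u - 1\<close> by lifting the exponent. If \<open>d > 1\<close>, then
  \<open>u - 1\<close> is prime to \<open>p\<close> and \<open>c = 1\<close> is forced. If
  \<open>d = 1\<close> and \<open>a = 0\<close>, then \<open>u = 1\<close> modulo
  \<open>p\<^sup>3\<close> and only \<open>c = 1\<close> modulo \<open>p\<close> is asked. If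
  \<open>d = 1\<close> and \<open>a > 0\<close>, the exact power of \<open>p\<close> in
  \<open>u - 1\<close> is \<open>p ^ (3 - a)\<close>, which leaves \<open>c = 1\<close> modulo
  \<open>p ^ a\<close>.\<close>

lemma card_cong_one_solutions:
  fixes p a d u :: nat
  assumes p: "Factorial_Ring.prime p" and odd: "odd p" and a: "a \<le> 2" and d: "d dvd p - 1"
    and ord_u: "\<And>j. [u ^ j = 1] (mod p ^ 3) \<longleftrightarrow> p ^ a * d dvd j"
  shows "card {c \<in> {0..<int p ^ 3}. int p dvd c - 1 \<and> int p ^ 3 dvd (c - 1) * (int u - 1)} =
    (if d > 1 then 1 else if a = 0 then p ^ 2 else p ^ (3 - a))"
proof -
  let ?C = "\<lambda>e. {c \<in> {0..<int p ^ 3}. int p ^ e dvd c - 1}"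
  let ?D = "{c \<in> {0..<int p ^ 3}. int p dvd c - 1 \<and> int p ^ 3 dvd (c - 1) * (int u - 1)}"
  have p1: "p > 1" using prime_gt_1_nat[OF p] .
  have d0: "d > 0" using d p1 by (intro Nat.gr0I) auto
  have int_u: "int p ^ 3 dvd int u ^ j - 1 \<longleftrightarrow> p ^ a * d dvd j" for j
  proof -
    have "int p ^ 3 dvd int u ^ j - 1 \<longleftrightarrow> [int (u ^ j) = int 1] (mod int (p ^ 3))"
      by (simp add: cong_iff_dvd_diff)
    thus ?thesis unfolding cong_int_iff ord_u .
  qed
  have pdvd: "int p dvd x" if "int p ^ e dvd x" "e > 0" for e x
    using that dvd_trans[OF dvd_power[of e "int p"]] by blast
  have pow_p: "int p ^ 3 dvd (int u - 1) * int (p ^ j) \<longleftrightarrow> p ^ a * d dvd p ^ j" if "int p dvd int u - 1" for j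
    using power_minus_one_dvd_iff[OF p odd that, of 3 "p ^ j"] int_u[of "p ^ j"] by blast
  show ?thesis
  proof (cases "d > 1")
    case True
    have "\<not> int p dvd int u - 1"
    proof
      assume "int p dvd int u - 1"
      \<comment> \<open>Otherwise the \<open>p\<^sup>2\<close>-th power of \<open>u\<close> would be
        1 modulo \<open>p\<^sup>3\<close>, so \<open>d\<close>, which is prime to \<open>p\<close>,
        would divide \<open>p\<^sup>2\<close>.\<close>
      from pow_p[OF this, of 2] \<open>int p dvd int u - 1\<close> have "p ^ a * d dvd p ^ 2"
        using mult_dvd_mono[of "int p" "int u - 1" "int p ^ 2" "int p ^ 2"]
        by (simp add: power3_eq_cube power2_eq_square mult.assoc)
      hence "d dvd p ^ 2" by (rule dvd_mult_right)
      moreover have "coprime d (p ^ 2)"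
      proof -
        have "coprime d p" using d p1 by (meson coprime_commute coprime_divisors dvd_refl coprime_diff_one_right_nat less_trans zero_less_one)
        thus ?thesis by simp
      qed
      ultimately have "d = 1" using coprime_common_divisor_nat[of d "p ^ 2" d] by simp
      thus False using True by simp
    qed
    hence "coprime (int p ^ 3) (int u - 1)" using coprime_p_power[OF p odd, of "int u - 1" 3] by (simp add: coprime_commute)
    hence "?D = ?C 3" using pdvd[of 3] by (auto simp: coprime_dvd_mult_left_iff)
    thus ?thesis using True card_cong_one[OF p odd, of 3 3] by simp
  next
    case False
    hence d1: "d = 1" using d0 by simp
    show ?thesis
    proof (cases "a = 0")
      case True
      hence "int p ^ 3 dvd int u - 1" using int_u[of 1] d1 by simp
      hence "?D = ?C 1" by auto
      thus ?thesis using d1 True card_cong_one[OF p odd, of 1 3] by simp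
    next
      case a0: False
      have "int p ^ 3 dvd int u ^ (p ^ a) - 1" using int_u[of "p ^ a"] d1 by simp
      hence "int p dvd int (u ^ (p ^ a)) - int 1" using pdvd[of 3] by simp
      hence "[int (u ^ (p ^ a)) = int 1] (mod int p)" by (simp only: cong_iff_dvd_diff)
      hence "[u ^ (p ^ a) = 1] (mod p)" by (simp only: cong_int_iff)
      hence "[u = 1] (mod p)" using cong_trans[OF cong_sym[OF power_prime_power_cong[OF p]]] by blast
      hence "[int u = int 1] (mod int p)" by (simp only: cong_int_iff)
      hence pu: "int p dvd int u - 1" by (simp add: cong_iff_dvd_diff)
      have split: "int p ^ 3 = int p ^ a * int p ^ (3 - a)" using a by (simp add: power_add[symmetric])
      have pn0: "int p \<noteq> 0" using p1 by simp
      have "int p ^ a * int p ^ (3 - a) dvd int p ^ a * (int u - 1)"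
        using pow_p[OF pu, of a] d1 split by (simp add: mult.commute)
      hence "int p ^ (3 - a) dvd int u - 1" using pn0 by simp
      then obtain w where w: "int u - 1 = int p ^ (3 - a) * w" ..
      have "\<not> int p dvd w"
      proof
        \<comment> \<open>One more factor \<open>p\<close> in \<open>u - 1\<close> would make the
          order of \<open>u\<close> a divisor of \<open>p ^ (a - 1)\<close>.\<close>
        assume "int p dvd w"
        then obtain v where v: "w = int p * v" ..
        have "(int u - 1) * int (p ^ (a - 1)) = int p ^ (3 - a) * (int p * int p ^ (a - 1)) * v"
          by (simp add: w v)
        also have "int p * int p ^ (a - 1) = int p ^ a" using a0 by (simp flip: power_Suc)
        finally have "int p ^ 3 dvd (int u - 1) * int (p ^ (a - 1))" by (simp add: split mult.commute)
        hence "p ^ a dvd p ^ (a - 1)" using pow_p[OF pu] d1 by simp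
        hence "a \<le> a - 1" using p1 by (simp add: power_dvd_imp_le)
        thus False using a0 by simp
      qed
      hence cw: "coprime (int p ^ a) w" using coprime_p_power[OF p odd, of w a] by (simp add: coprime_commute)
      have "int p ^ 3 dvd (c - 1) * (int u - 1) \<longleftrightarrow> int p ^ a dvd c - 1" for c
      proof -
        have "int p ^ 3 dvd (c - 1) * (int u - 1) \<longleftrightarrow> int p ^ a * int p ^ (3 - a) dvd ((c - 1) * w) * int p ^ (3 - a)"
          by (simp add: split w mult_ac)
        also have "\<dots> \<longleftrightarrow> int p ^ a dvd (c - 1) * w" using pn0 by simp
        finally show ?thesis using cw by (simp add: coprime_dvd_mult_left_iff)
      qed
      hence "?D = ?C a" using pdvd[of a] a0 by auto
      thus ?thesis using d1 a0 a card_cong_one[OF p odd, of a 3] by simp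
    qed
  qed
qed


section \<open>Semidirect products of cyclic groups\<close>

lemma (in group) pow_commute_relation:
  fixes i j u :: nat
  assumes "a \<in> carrier G" "h \<in> carrier G" "h \<otimes> a = a [^] u \<otimes> h"
  shows "h [^] j \<otimes> a [^] i = a [^] (u ^ j * i) \<otimes> h [^] j"
proof -
  have step: "h \<otimes> a [^] i = a [^] (u * i) \<otimes> h" for i :: nat
  proof (induction i)
    case (Suc i)
    have "h \<otimes> a [^] Suc i = (h \<otimes> a [^] i) \<otimes> a" using assms(1,2) by (simp add: m_assoc)
    also have "\<dots> = a [^] (u * i) \<otimes> (h \<otimes> a)" using assms(1,2) Suc by (simp add: m_assoc)
    also have "\<dots> = (a [^] (u * i) \<otimes> a [^] u) \<otimes> h" using assms by (simp add: m_assoc)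
    also have "a [^] (u * i) \<otimes> a [^] u = a [^] (u * Suc i)"
      using assms(1) by (simp add: nat_pow_mult add.commute)
    finally show ?case .
  qed (use assms in simp)
  show ?thesis
  proof (induction j arbitrary: i)
    case (Suc j)
    have "h [^] Suc j \<otimes> a [^] i = h [^] j \<otimes> (h \<otimes> a [^] i)" using assms(1,2) by (simp add: m_assoc)
    also have "\<dots> = (h [^] j \<otimes> a [^] (u * i)) \<otimes> h" using assms(1,2) by (simp add: step m_assoc)
    also have "\<dots> = a [^] (u ^ j * (u * i)) \<otimes> h [^] Suc j" using assms(1,2) Suc by (simp add: m_assoc)
    finally show ?case by (simp add: mult.assoc mult.left_commute)
  qed (use assms in simp)
qed

lemma cong_self_add_iff: "[i = i + k] (mod m) \<longleftrightarrow> m dvd k" for i k m :: nat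
  using cong_add_lcancel_0_nat[of i k m] by (simp add: cong_0_iff cong_sym_eq[of i])

lemma (in group) pow_eq_iff_cong:
  fixes i j q :: nat
  assumes a: "a \<in> carrier G" and q: "\<And>i::nat. a [^] i = \<one> \<longleftrightarrow> q dvd i"
  shows "a [^] i = a [^] j \<longleftrightarrow> [i = j] (mod q)"
proof (induction i j rule: linorder_wlog)
  case (le i j)
  then obtain k where "j = i + k" using le_Suc_ex by blast
  thus ?case using a q[of k] by (simp add: nat_pow_mult[symmetric] cong_self_add_iff)
qed (metis cong_sym)

lemma integer_mod_group_carrier: "n > 0 \<Longrightarrow> carrier (integer_mod_group n) = {0..<int n}"
  by (simp add: carrier_integer_mod_group)

text \<open>An automorphism of the integers modulo \<open>q\<close> is multiplication by its value
  at 1. For the generator of the acting group that value is \<open>u\<close>, and faithfulness of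
  \<theta> says that \<open>u\<close> has order exactly \<open>D\<close>. The elements
  \<open>a\<close> and \<open>h\<close> are the preimages of the two standard generators.\<close>

lemma (in group) cyclic_semidirect_generators:
  assumes q: "q > 1" and D: "D > 0" and sd: "is_cyclic_semidirect G q D"
  obtains a h u where "a \<in> carrier G" "h \<in> carrier G" "h \<otimes> a = a [^] u \<otimes> h"
    "\<And>i::nat. a [^] i = \<one> \<longleftrightarrow> q dvd i" "\<And>j. [u ^ j = 1] (mod q) \<longleftrightarrow> D dvd j"
    "\<And>x. x \<in> carrier G \<Longrightarrow> \<exists>(i::nat) (j::nat). x = a [^] i \<otimes> h [^] j"
proof -
  obtain \<theta> \<phi> where \<theta>: "\<theta> \<in> hom (integer_mod_group D) (AutoGroup (integer_mod_group q))"
    and inj: "inj_on \<theta> (carrier (integer_mod_group D))"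
    and \<phi>: "\<phi> \<in> iso G (semidirect_product (integer_mod_group q) (integer_mod_group D) \<theta>)"
    using sd by (auto simp: is_cyclic_semidirect_def is_iso_def)
  have q0: "q > 0" using q by simp
  note car = integer_mod_group_carrier[OF D] integer_mod_group_carrier[OF q0]
  interpret Zq: group "integer_mod_group q" by simp
  interpret A: group "AutoGroup (integer_mod_group q)" by (rule Zq.AutoGroup)
  interpret ZD: group "integer_mod_group D" by simp
  interpret h\<theta>: group_hom "integer_mod_group D" "AutoGroup (integer_mod_group q)" \<theta>
    using \<theta> by unfold_locales
  have \<theta>auto: "\<theta> b \<in> auto (integer_mod_group q)" if "b \<in> {0..<int D}" for b
    using h\<theta>.hom_closed[of b] that by (simp add: car AutoGroup_def)
  have \<theta>B: "\<theta> b \<in> Bij {0..<int q}" if "b \<in> {0..<int D}" for b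
    using \<theta>auto[OF that] by (simp add: auto_def car)
  have \<theta>r: "\<theta> b x \<in> {0..<int q}" if "b \<in> {0..<int D}" "x \<in> {0..<int q}" for b x
    using \<theta>B[OF that(1)] that(2) bij_betwE by (fastforce simp: Bij_def)
  have \<theta>add: "\<theta> b ((x + y) mod int q) = (\<theta> b x + \<theta> b y) mod int q"
    if "b \<in> {0..<int D}" "x \<in> {0..<int q}" "y \<in> {0..<int q}" for b x y
    using \<theta>auto[OF that(1)] that(2,3) by (simp add: auto_def hom_def car)
  have \<theta>mult: "\<theta> ((b + c) mod int D) x = \<theta> b (\<theta> c x)"
    if "b \<in> {0..<int D}" "c \<in> {0..<int D}" "x \<in> {0..<int q}" for b c x
  proof -
    have "\<theta> ((b + c) mod int D) = \<theta> b \<otimes>\<^bsub>AutoGroup (integer_mod_group q)\<^esub> \<theta> c"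
      using h\<theta>.hom_mult[of b c] that by (simp add: car)
    thus ?thesis using \<theta>B that by (simp add: AutoGroup_def BijGroup_def car compose_eq)
  qed
  have \<theta>0: "\<theta> 0 x = x" if "x \<in> {0..<int q}" for x
    using h\<theta>.hom_one that by (simp add: AutoGroup_def BijGroup_def car)
  \<comment> \<open>Not simply 1: for \<open>D = 1\<close> the only element is 0.\<close>
  let ?b = "1 mod int D"
  have b: "?b \<in> {0..<int D}" using D by simp
  define u where "u = nat (\<theta> ?b 1)"
  have one: "1 \<in> {0..<int q}" using q by simp
  have u: "\<theta> ?b 1 = int u" using \<theta>r[OF b one] by (simp add: u_def)
  have \<theta>x: "\<theta> b x = (\<theta> b 1 * x) mod int q" if "b \<in> {0..<int D}" "x \<in> {0..<int q}" for b x
  proof -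
    have "\<theta> b (int k mod int q) = (\<theta> b 1 * int k) mod int q" for k
    proof (induction k)
      case 0
      have "\<theta> b 0 = (\<theta> b 0 + \<theta> b 0) mod int q" using \<theta>add[OF that(1), of 0 0] q by simp
      hence "int q dvd \<theta> b 0" using \<theta>r[OF that(1), of 0] q
        by (metis add_diff_cancel_left' minus_mod_eq_mult_div dvd_triv_left dvd_minus_iff minus_diff_eq diff_add_cancel)
      thus ?case using \<theta>r[OF that(1), of 0] q zdvd_imp_le by force
    next
      case (Suc k)
      have "\<theta> b (int (Suc k) mod int q) = \<theta> b ((int k mod int q + 1) mod int q)"
        by (simp add: mod_simps add.commute)
      also have "\<dots> = (\<theta> b (int k mod int q) + \<theta> b 1) mod int q"
        using \<theta>add[OF that(1), of "int k mod int q" 1] q by simp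
      finally show ?case using Suc by (simp add: mod_simps algebra_simps)
    qed
    from this[of "nat x"] show ?thesis using that by simp
  qed
  have \<theta>j: "\<theta> (int j mod int D) 1 = int (u ^ j) mod int q" for j
  proof (induction j)
    case 0
    thus ?case using \<theta>0[OF one] q by simp
  next
    case (Suc j)
    have r: "int j mod int D \<in> {0..<int D}" using D by simp
    have "\<theta> (int (Suc j) mod int D) 1 = \<theta> ((?b + int j mod int D) mod int D) 1" by (simp add: mod_simps)
    also have "\<dots> = \<theta> ?b (\<theta> (int j mod int D) 1)" by (rule \<theta>mult[OF b r one])
    also have "\<dots> = (int u * \<theta> (int j mod int D) 1) mod int q" using \<theta>x[OF b \<theta>r[OF r one]] u by simp
    finally show ?case using Suc by (simp add: mod_simps)
  qed
  have ord_u: "[u ^ j = 1] (mod q) \<longleftrightarrow> D dvd j" for j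
  proof
    have r: "int j mod int D \<in> {0..<int D}" using D by simp
    assume "[u ^ j = 1] (mod q)"
    hence "[int (u ^ j) = int 1] (mod int q)" by (simp only: cong_int_iff)
    hence j1: "\<theta> (int j mod int D) 1 = 1" using \<theta>j[of j] q by (simp add: cong_def)
    have "\<theta> (int j mod int D) = \<theta> 0"
    proof (rule extensionalityI[of _ "{0..<int q}"])
      show "\<theta> (int j mod int D) \<in> extensional {0..<int q}" "\<theta> 0 \<in> extensional {0..<int q}"
        using \<theta>B[OF r] \<theta>B[of 0] D by (auto simp: Bij_def)
      show "\<theta> (int j mod int D) x = \<theta> 0 x" if x: "x \<in> {0..<int q}" for x
        using \<theta>x[OF r x] j1 \<theta>0[OF x] x by simp
    qed
    hence "int j mod int D = 0" using inj_onD[OF inj, of "int j mod int D" 0] r D by (simp add: car)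
    thus "D dvd j" by (simp add: mod_eq_0_iff_dvd)
  next
    assume "D dvd j"
    hence "int j mod int D = 0" by simp
    hence "int (u ^ j) mod int q = 1" using \<theta>j[of j] \<theta>0[OF one] by simp
    hence "[int (u ^ j) = int 1] (mod int q)" using q by (simp add: cong_def)
    thus "[u ^ j = 1] (mod q)" by (simp only: cong_int_iff)
  qed
  let ?SD = "semidirect_product (integer_mod_group q) (integer_mod_group D) \<theta>"
  have \<phi>b: "bij_betw \<phi> (carrier G) ({0..<int q} \<times> {0..<int D})"
    using \<phi> by (simp add: iso_def semidirect_product_def car)
  have \<phi>mult: "\<phi> (x \<otimes> y) = (case \<phi> x of (v, b) \<Rightarrow> case \<phi> y of (w, c) \<Rightarrow> ((v + \<theta> b w) mod int q, (b + c) mod int D))"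
    if "x \<in> carrier G" "y \<in> carrier G" for x y
    using \<phi> that by (simp add: iso_def hom_def semidirect_product_def split: prod.splits)
  have ex: "\<exists>x\<in>carrier G. \<phi> x = y" if "y \<in> {0..<int q} \<times> {0..<int D}" for y
    using bij_betw_imp_surj_on[OF \<phi>b] that by (metis imageE)
  obtain a where a: "a \<in> carrier G" "\<phi> a = (1, 0)" using ex[of "(1, 0)"] q D by auto
  obtain h where h: "h \<in> carrier G" "\<phi> h = (0, ?b)" using ex[of "(0, ?b)"] q D by auto
  obtain e where e: "e \<in> carrier G" "\<phi> e = (0, 0)" using ex[of "(0, 0)"] q D by auto
  have \<phi>inj: "\<phi> x = \<phi> y \<longleftrightarrow> x = y" if "x \<in> carrier G" "y \<in> carrier G" for x y
    using bij_betw_imp_inj_on[OF \<phi>b] that by (auto dest: inj_onD)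
  \<comment> \<open>The element over \<open>(0, 0)\<close> is idempotent, hence the identity; this
    locates the identity without the group laws of the semidirect product.\<close>
  have "\<phi> (e \<otimes> e) = \<phi> e" using \<phi>mult[OF e(1) e(1)] e(2) \<theta>0[of 0] q by simp
  hence "e \<otimes> e = e" using \<phi>inj e(1) by simp
  hence "e = \<one>" using e(1) by simp
  hence \<phi>1: "\<phi> \<one> = (0, 0)" using e(2) by simp
  have \<phi>a: "\<phi> (a [^] i) = (int i mod int q, 0)" for i :: nat
  proof (induction i)
    case (Suc i)
    thus ?case using \<phi>mult[of "a [^] i" a] a \<theta>0[OF one] by (simp add: mod_simps add.commute)
  qed (simp add: \<phi>1)
  have \<phi>h: "\<phi> (h [^] j) = (0, int j mod int D)" for j :: nat
  proof (induction j)
    case (Suc j)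
    have r: "int j mod int D \<in> {0..<int D}" using D by simp
    show ?case using Suc \<phi>mult[of "h [^] j" h] h \<theta>x[OF r, of 0] q by (simp add: mod_simps add.commute)
  qed (simp add: \<phi>1)
  have \<phi>ah: "\<phi> (a [^] i \<otimes> h [^] j) = (int i mod int q, int j mod int D)" for i j :: nat
    using \<phi>mult[of "a [^] i" "h [^] j"] a h \<phi>a \<phi>h \<theta>0[of 0] q by simp
  show thesis
  proof (rule that[OF a(1) h(1)])
    have "\<phi> (h \<otimes> a) = (int u mod int q, ?b)" using \<phi>mult[OF h(1) a(1)] a h u by simp
    also have "\<dots> = \<phi> (a [^] u \<otimes> h [^] (1::nat))" using \<phi>ah[of u 1] by simp
    finally show "h \<otimes> a = a [^] u \<otimes> h" using \<phi>inj[of "h \<otimes> a" "a [^] u \<otimes> h"] a h by simp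
    show "a [^] i = \<one> \<longleftrightarrow> q dvd i" for i :: nat
      using \<phi>inj[of "a [^] i" \<one>] a \<phi>a[of i] \<phi>1 by (auto simp: mod_eq_0_iff_dvd)
    show "[u ^ j = 1] (mod q) \<longleftrightarrow> D dvd j" for j by (rule ord_u)
    fix x assume x: "x \<in> carrier G"
    obtain i j where ij: "\<phi> x = (i, j)" by (cases "\<phi> x")
    have "(i, j) \<in> {0..<int q} \<times> {0..<int D}" using bij_betwE[OF \<phi>b] x ij by metis
    hence "\<phi> x = \<phi> (a [^] nat i \<otimes> h [^] nat j)" using ij \<phi>ah[of "nat i" "nat j"] by simp
    hence "x = a [^] nat i \<otimes> h [^] nat j" using \<phi>inj x a h by simp
    thus "\<exists>(i::nat) (j::nat). x = a [^] i \<otimes> h [^] j" by blast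
  qed
qed

text \<open>Multiplication by powers of \<open>u\<close> defines the action, and
  \<open>(v, b) \<mapsto> a\<^sup>v h\<^sup>b\<close> is multiplicative by the commutation rule.
  Uniqueness of this normal form follows from \<open>trivial\<close>, its existence is
  \<open>gen\<close>.\<close>

lemma (in group) cyclic_semidirectI:
  assumes q: "q > 1" and D: "D > 0" and a: "a \<in> carrier G" and h: "h \<in> carrier G"
    and rel: "h \<otimes> a = a [^] u \<otimes> h"
    and trivial: "\<And>(i::nat) (j::nat). a [^] i \<otimes> h [^] j = \<one> \<longleftrightarrow> q dvd i \<and> D dvd j"
    and faithful: "\<And>j. [u ^ j = 1] (mod q) \<Longrightarrow> D dvd j"
    and gen: "\<And>x. x \<in> carrier G \<Longrightarrow> \<exists>(i::nat) (j::nat). x = a [^] i \<otimes> h [^] j"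
  shows "is_cyclic_semidirect G q D"
proof -
  have q0: "q > 0" using q by simp
  note car = integer_mod_group_carrier[OF D] integer_mod_group_carrier[OF q0]
  have aq: "a [^] i = \<one> \<longleftrightarrow> q dvd i" for i :: nat using trivial[of i 0] a by simp
  have hD: "h [^] j = \<one> \<longleftrightarrow> D dvd j" for j :: nat using trivial[of 0 j] h by simp
  note a_cong = pow_eq_iff_cong[OF a aq]
  note h_cong = pow_eq_iff_cong[OF h hD, THEN iffD2]
  note comm = pow_commute_relation[OF a h rel]
  have uD: "[u ^ D = 1] (mod q)"
  proof -
    have "a [^] (u ^ D) = a [^] (1::nat)" using comm[of D 1] hD[of D] a by simp
    thus ?thesis using a_cong by blast
  qed
  have upow: "[int u ^ i = int u ^ j] (mod int q)" if "[i = j] (mod D)" for i j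
  proof -
    have le: "[int u ^ i = int u ^ (i + D * k)] (mod int q)" for i k
    proof -
      have "[u ^ D ^ 1 = 1] (mod q)" using uD by simp
      hence "[int (u ^ D) = int 1] (mod int q)" by (simp only: cong_int_iff power_one_right)
      hence "[int u ^ i * (int u ^ D) ^ k = int u ^ i * 1 ^ k] (mod int q)"
        by (intro cong_mult cong_refl cong_pow) simp
      thus ?thesis by (simp add: power_add power_mult cong_sym_eq)
    qed
    show ?thesis using that le unfolding cong_iff_lin_nat
      by (metis cong_sym cong_trans mult.commute)
  qed
  define \<theta> where "\<theta> = (\<lambda>b. \<lambda>x\<in>{0..<int q}. (int u ^ nat b * x) mod int q)"
  have \<theta>: "\<theta> b x = (int u ^ nat b * x) mod int q" if "x \<in> {0..<int q}" for b x
    using that by (simp add: \<theta>_def)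
  have \<theta>r: "\<theta> b x \<in> {0..<int q}" if "x \<in> {0..<int q}" for b x using that q by (simp add: \<theta>)
  have \<theta>mult: "\<theta> ((b + c) mod int D) x = \<theta> b (\<theta> c x)"
    if "b \<in> {0..<int D}" "c \<in> {0..<int D}" "x \<in> {0..<int q}" for b c x
  proof -
    have "[nat ((b + c) mod int D) = nat b + nat c] (mod D)"
      using that by (simp add: cong_def nat_mod_distrib nat_add_distrib)
    hence "[int u ^ nat ((b + c) mod int D) * x = int u ^ (nat b + nat c) * x] (mod int q)"
      by (intro cong_mult cong_refl upow)
    thus ?thesis using \<theta>[OF that(3)] \<theta>[OF \<theta>r[OF that(3)], of b c]
      by (simp add: cong_def power_add mod_simps mult.assoc)
  qed
  have \<theta>0: "\<theta> 0 x = x" if "x \<in> {0..<int q}" for x using that by (simp add: \<theta>)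
  have \<theta>auto: "\<theta> b \<in> auto (integer_mod_group q)" if b: "b \<in> {0..<int D}" for b
  proof -
    have c: "(- b) mod int D \<in> {0..<int D}" using D by simp
    have "\<theta> b (\<theta> ((- b) mod int D) x) = x" "\<theta> ((- b) mod int D) (\<theta> b x) = x" if "x \<in> {0..<int q}" for x
      using \<theta>mult[OF b c that] \<theta>mult[OF c b that] \<theta>0[OF that] by (simp_all add: mod_simps)
    hence "bij_betw (\<theta> b) {0..<int q} {0..<int q}"
      by (intro bij_betw_byWitness[of _ "\<theta> ((- b) mod int D)"]) (use \<theta>r in auto)
    hence "\<theta> b \<in> Bij {0..<int q}" by (simp add: Bij_def \<theta>_def)
    moreover have "\<theta> b \<in> hom (integer_mod_group q) (integer_mod_group q)"
      unfolding hom_def using \<theta>r q by (auto simp: car \<theta> mod_simps distrib_left)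
    ultimately show ?thesis by (simp add: auto_def car)
  qed
  have \<theta>hom: "\<theta> \<in> hom (integer_mod_group D) (AutoGroup (integer_mod_group q))"
    unfolding hom_def
  proof (clarsimp simp: car AutoGroup_def, intro conjI ballI)
    show "\<theta> \<in> {0..<int D} \<rightarrow> auto (integer_mod_group q)" using \<theta>auto by blast
    fix b c assume bc: "b \<in> {0..<int D}" "c \<in> {0..<int D}"
    have B: "\<theta> d \<in> Bij {0..<int q}" if "d \<in> {0..<int D}" for d using \<theta>auto[OF that] by (simp add: auto_def car)
    have "\<theta> ((b + c) mod int D) = compose {0..<int q} (\<theta> b) (\<theta> c)"
      by (rule extensionalityI[of _ "{0..<int q}"]) (use \<theta>mult[OF bc] in \<open>auto simp: \<theta>_def compose_eq\<close>)
    thus "\<theta> ((b + c) mod int D) = \<theta> b \<otimes>\<^bsub>BijGroup {0..<int q}\<^esub> \<theta> c"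
      using B bc by (simp add: BijGroup_def)
  qed
  have \<theta>inj: "inj_on \<theta> (carrier (integer_mod_group D))"
    unfolding car
  proof (rule inj_onI)
    fix b c assume bc: "b \<in> {0..<int D}" "c \<in> {0..<int D}" "\<theta> b = \<theta> c"
    have d: "(- c) mod int D \<in> {0..<int D}" using D by simp
    have one: "1 \<in> {0..<int q}" using q by simp
    let ?e = "(- c + b) mod int D"
    have "\<theta> ((- c) mod int D) (\<theta> b 1) = \<theta> ((- c) mod int D) (\<theta> c 1)" using bc(3) by simp
    hence "\<theta> ?e 1 = 1"
      using \<theta>mult[OF d bc(1) one] \<theta>mult[OF d bc(2) one] \<theta>0[OF one] by (simp add: mod_simps)
    hence "int u ^ nat ?e mod int q = 1" using \<theta>[OF one] by simp
    hence "[int (u ^ nat ?e) = int 1] (mod int q)" using q by (simp add: cong_def)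
    hence "[u ^ nat ?e = 1] (mod q)" by (simp only: cong_int_iff)
    hence "D dvd nat ?e" by (rule faithful)
    moreover have "nat ?e < D" using D by (simp add: nat_less_iff)
    ultimately have "nat ?e = 0" using nat_dvd_not_less by blast
    hence "?e = 0" using D by (metis int_nat_eq of_nat_0 pos_mod_sign of_nat_0_less_iff)
    hence "int D dvd b - c" by (simp add: mod_eq_0_iff_dvd)
    hence "[b = c] (mod int D)" by (simp add: cong_iff_dvd_diff)
    thus "b = c" using bc by (simp add: cong_def)
  qed
  let ?SD = "semidirect_product (integer_mod_group q) (integer_mod_group D) \<theta>"
  define \<psi> where "\<psi> = (\<lambda>(v, b). a [^] nat v \<otimes> h [^] nat b)"
  let ?C = "{0..<int q} \<times> {0..<int D}"
  have \<psi>G: "\<psi> x \<in> carrier G" for x using a h by (simp add: \<psi>_def split: prod.splits)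
  have \<psi>mult: "\<psi> ((v + \<theta> b w) mod int q, (b + c) mod int D) = \<psi> (v, b) \<otimes> \<psi> (w, c)"
    if "v \<in> {0..<int q}" "b \<in> {0..<int D}" "w \<in> {0..<int q}" "c \<in> {0..<int D}" for v b w c
  proof -
    have "\<psi> (v, b) \<otimes> \<psi> (w, c) = a [^] nat v \<otimes> (h [^] nat b \<otimes> a [^] nat w) \<otimes> h [^] nat c"
      using a h by (simp add: \<psi>_def m_assoc)
    also have "\<dots> = a [^] (nat v + u ^ nat b * nat w) \<otimes> h [^] (nat b + nat c)"
      using a h by (simp add: comm m_assoc nat_pow_mult[symmetric])
    also have "a [^] (nat v + u ^ nat b * nat w) = a [^] nat ((v + \<theta> b w) mod int q)"
    proof -
      have "int (nat ((v + \<theta> b w) mod int q)) = (v + int u ^ nat b * w) mod int q"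
        using q that by (simp add: \<theta> mod_simps)
      also have "\<dots> = int (nat v + u ^ nat b * nat w) mod int q" using that by simp
      finally have "[int (nat v + u ^ nat b * nat w) = int (nat ((v + \<theta> b w) mod int q))] (mod int q)"
        by (simp add: cong_def)
      thus ?thesis using a_cong by (simp only: cong_int_iff)
    qed
    also have "h [^] (nat b + nat c) = h [^] nat ((b + c) mod int D)"
      using that by (intro h_cong) (simp add: cong_def nat_mod_distrib nat_add_distrib)
    finally show ?thesis by (simp add: \<psi>_def)
  qed
  have \<psi>inj: "inj_on \<psi> ?C"
  proof (rule inj_onI)
    fix x y assume xy: "x \<in> ?C" "y \<in> ?C" "\<psi> x = \<psi> y"
    obtain v b w c where vb: "x = (v, b)" "y = (w, c)" by (metis surj_pair)
    \<comment> \<open>A natural exponent inverse to \<open>b\<close>, so that negative powers are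
      avoided; \<open>w'\<close> below does the same for \<open>v\<close>.\<close>
    define b' where "b' = D - nat b"
    have r: "v \<in> {0..<int q}" "b \<in> {0..<int D}" "w \<in> {0..<int q}" "c \<in> {0..<int D}" using xy vb by auto
    have bb: "[nat b + b' = 0] (mod D)"
    proof -
      have "nat b + b' = D" using r by (simp add: b'_def nat_le_iff)
      thus ?thesis by (simp add: cong_0_iff)
    qed
    have "a [^] nat v = a [^] nat v \<otimes> h [^] (nat b + b')" using h_cong[OF bb] a by simp
    also have "\<dots> = (a [^] nat v \<otimes> h [^] nat b) \<otimes> h [^] b'" using a h by (simp add: nat_pow_mult[symmetric] m_assoc)
    also have "a [^] nat v \<otimes> h [^] nat b = a [^] nat w \<otimes> h [^] nat c" using xy(3) by (simp add: vb \<psi>_def)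
    also have "(a [^] nat w \<otimes> h [^] nat c) \<otimes> h [^] b' = a [^] nat w \<otimes> h [^] (nat c + b')"
      using a h by (simp add: nat_pow_mult[symmetric] m_assoc)
    finally have eq: "a [^] nat v = a [^] nat w \<otimes> h [^] (nat c + b')" .
    define w' where "w' = (q - 1) * nat v"
    have "a [^] w' \<otimes> a [^] nat v = \<one>"
    proof -
      have "w' + nat v = q * nat v" using q by (simp add: w'_def algebra_simps)
      thus ?thesis using a aq[of "w' + nat v"] by (simp add: nat_pow_mult)
    qed
    hence "a [^] (w' + nat w) \<otimes> h [^] (nat c + b') = \<one>"
      unfolding eq using a h by (simp add: nat_pow_mult[symmetric] m_assoc)
    hence d: "q dvd w' + nat w" "D dvd nat c + b'" using trivial by blast+
    have "[nat c + b' = nat b + b'] (mod D)" using d(2) bb by (metis cong_0_iff cong_sym cong_trans)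
    hence "[nat c = nat b] (mod D)" by (simp add: cong_add_rcancel_nat)
    hence "nat c = nat b" using r by (simp add: cong_def nat_less_iff)
    moreover have "[w' + nat w = w' + nat v] (mod q)"
    proof -
      have "q dvd w' + nat v" using q by (simp add: w'_def algebra_simps)
      thus ?thesis using d(1) by (metis cong_0_iff cong_sym cong_trans)
    qed
    hence "[nat w = nat v] (mod q)" by (simp add: cong_add_lcancel_nat)
    hence "nat w = nat v" using r by (simp add: cong_def nat_less_iff)
    ultimately show "x = y" using r vb eq_nat_nat_iff[of w v] eq_nat_nat_iff[of c b] by simp
  qed
  have \<psi>surj: "\<psi> ` ?C = carrier G"
  proof (intro equalityI subsetI)
    fix x assume "x \<in> carrier G"
    then obtain i j :: nat where "x = a [^] i \<otimes> h [^] j" using gen by blast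
    also have "\<dots> = a [^] (i mod q) \<otimes> h [^] (j mod D)"
      using a_cong[of i "i mod q"] h_cong[of j "j mod D"] by (simp add: cong_def)
    also have "\<dots> = \<psi> (int (i mod q), int (j mod D))" by (simp add: \<psi>_def del: of_nat_mod)
    finally show "x \<in> \<psi> ` ?C" using q D by (intro image_eqI[of x]) auto
  qed (use \<psi>G in auto)
  define F where "F = inv_into ?C \<psi>"
  have b: "bij_betw \<psi> ?C (carrier G)" using \<psi>inj \<psi>surj by (simp add: bij_betw_def)
  have Fb: "bij_betw F (carrier G) ?C" unfolding F_def by (rule bij_betw_inv_into[OF b])
  have F\<psi>: "F (\<psi> y) = y" if "y \<in> ?C" for y unfolding F_def by (rule inv_into_f_f[OF \<psi>inj that])
  have "F \<in> hom G ?SD"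
    unfolding hom_def
  proof (clarsimp, intro conjI ballI)
    show "F \<in> carrier G \<rightarrow> carrier ?SD" using bij_betwE[OF Fb] by (auto simp: semidirect_product_def car)
    fix x y assume "x \<in> carrier G" "y \<in> carrier G"
    then obtain v b w c where vb: "(v, b) \<in> ?C" "(w, c) \<in> ?C" "x = \<psi> (v, b)" "y = \<psi> (w, c)"
      unfolding \<psi>surj[symmetric] by auto
    have "x \<otimes> y = \<psi> ((v + \<theta> b w) mod int q, (b + c) mod int D)" using \<psi>mult vb by simp
    moreover have "((v + \<theta> b w) mod int q, (b + c) mod int D) \<in> ?C" using q D by simp
    ultimately have "F (x \<otimes> y) = ((v + \<theta> b w) mod int q, (b + c) mod int D)" using F\<psi> by simp
    thus "F (x \<otimes> y) = F x \<otimes>\<^bsub>?SD\<^esub> F y" using vb F\<psi> by (simp add: semidirect_product_def)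
  qed
  hence "F \<in> iso G ?SD" using Fb by (simp add: iso_def semidirect_product_def car)
  hence "G \<cong> ?SD" by (rule is_isoI)
  thus ?thesis unfolding is_cyclic_semidirect_def using \<theta>hom \<theta>inj by blast
qed


section \<open>Transitive groups of affine maps\<close>

text \<open>Meant for the Galois group acting on the cosets, with \<open>x0\<close> the trivial
  coset and \<open>g\<close> the coordinate of a given cyclic regular subgroup.\<close>

locale affine_action = group \<Gamma> + coordinate "p ^ 3" S g
  for \<Gamma> :: "('a, 'm) monoid_scheme" (structure) and p :: nat and S :: "'x set" and g :: "'x \<Rightarrow> int" +
  fixes act :: "'a \<Rightarrow> 'x \<Rightarrow> 'x" and x0 :: 'x
  assumes p: "Factorial_Ring.prime p" and odd: "odd p"
    and act_S: "\<sigma> \<in> carrier \<Gamma> \<Longrightarrow> x \<in> S \<Longrightarrow> act \<sigma> x \<in> S"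
    and act_mult: "\<sigma> \<in> carrier \<Gamma> \<Longrightarrow> \<rho> \<in> carrier \<Gamma> \<Longrightarrow> x \<in> S \<Longrightarrow> act (\<sigma> \<otimes> \<rho>) x = act \<sigma> (act \<rho> x)"
    and act_one: "x \<in> S \<Longrightarrow> act \<one> x = x"
    and faithful: "\<sigma> \<in> carrier \<Gamma> \<Longrightarrow> (\<And>x. x \<in> S \<Longrightarrow> act \<sigma> x = x) \<Longrightarrow> \<sigma> = \<one>"
    and transitive: "x \<in> S \<Longrightarrow> y \<in> S \<Longrightarrow> \<exists>\<sigma>\<in>carrier \<Gamma>. act \<sigma> x = y"
    and affine: "\<sigma> \<in> carrier \<Gamma> \<Longrightarrow> affine_in (p ^ 3) S g (act \<sigma>)"
    and x0: "x0 \<in> S" "g x0 = 0"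
begin

abbreviation "q \<equiv> p ^ 3"

text \<open>Slope and constant term are determined only modulo \<open>q\<close>; one choice of
  representatives is fixed, and all rules for them are congruences.\<close>

definition coeffs :: "'a \<Rightarrow> int \<times> int" where
  "coeffs \<sigma> = (SOME (u, b). \<forall>x\<in>S. [g (act \<sigma> x) = u * g x + b] (mod int q))"

definition lin :: "'a \<Rightarrow> int" where "lin \<sigma> = fst (coeffs \<sigma>)"
definition tr :: "'a \<Rightarrow> int" where "tr \<sigma> = snd (coeffs \<sigma>)"

lemma act_cong:
  assumes "\<sigma> \<in> carrier \<Gamma>" "x \<in> S" shows "[g (act \<sigma> x) = lin \<sigma> * g x + tr \<sigma>] (mod int q)"
proof -
  obtain u b where "\<forall>x\<in>S. [g (act \<sigma> x) = u * g x + b] (mod int q)"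
    using affine[OF assms(1)] unfolding affine_in_def by blast
  hence "case (u, b) of (u, b) \<Rightarrow> \<forall>x\<in>S. [g (act \<sigma> x) = u * g x + b] (mod int q)" by simp
  hence "case coeffs \<sigma> of (u, b) \<Rightarrow> \<forall>x\<in>S. [g (act \<sigma> x) = u * g x + b] (mod int q)"
    unfolding coeffs_def by (rule someI)
  thus ?thesis using assms(2) by (simp add: lin_def tr_def split: prod.splits)
qed

lemma coeffs_unique:
  assumes "\<sigma> \<in> carrier \<Gamma>" "\<And>x. x \<in> S \<Longrightarrow> [g (act \<sigma> x) = u * g x + b] (mod int q)"
  shows "[tr \<sigma> = b] (mod int q)" "[lin \<sigma> = u] (mod int q)"
proof -
  have *: "[lin \<sigma> * g x + tr \<sigma> = u * g x + b] (mod int q)" if "x \<in> S" for x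
    using act_cong[OF assms(1) that] assms(2)[OF that] cong_sym cong_trans by blast
  show t: "[tr \<sigma> = b] (mod int q)" using *[OF x0(1)] by (simp add: x0(2))
  obtain x1 where x1: "x1 \<in> S" "[g x1 = 1] (mod int q)" using g_surj by blast
  have "[lin \<sigma> * 1 + tr \<sigma> = lin \<sigma> * g x1 + tr \<sigma>] (mod int q)"
    by (intro cong_add cong_mult cong_refl cong_sym[OF x1(2)])
  also have "[lin \<sigma> * g x1 + tr \<sigma> = u * g x1 + b] (mod int q)" by (rule *[OF x1(1)])
  also have "[u * g x1 + b = u * 1 + tr \<sigma>] (mod int q)"
    by (intro cong_add cong_mult cong_refl x1(2) cong_sym[OF t])
  finally show "[lin \<sigma> = u] (mod int q)" by (simp add: cong_add_rcancel)
qed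

lemma coeffs_mult:
  assumes "\<sigma> \<in> carrier \<Gamma>" "\<rho> \<in> carrier \<Gamma>"
  shows "[lin (\<sigma> \<otimes> \<rho>) = lin \<sigma> * lin \<rho>] (mod int q)" "[tr (\<sigma> \<otimes> \<rho>) = lin \<sigma> * tr \<rho> + tr \<sigma>] (mod int q)"
proof -
  have *: "[g (act (\<sigma> \<otimes> \<rho>) x) = lin \<sigma> * lin \<rho> * g x + (lin \<sigma> * tr \<rho> + tr \<sigma>)] (mod int q)" if x: "x \<in> S" for x
  proof -
    have "[g (act (\<sigma> \<otimes> \<rho>) x) = lin \<sigma> * g (act \<rho> x) + tr \<sigma>] (mod int q)"
      using act_cong[OF assms(1) act_S[OF assms(2) x]] assms x by (simp add: act_mult)
    also have "[lin \<sigma> * g (act \<rho> x) + tr \<sigma> = lin \<sigma> * (lin \<rho> * g x + tr \<rho>) + tr \<sigma>] (mod int q)"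
      by (intro cong_add cong_mult cong_refl act_cong assms x)
    finally show ?thesis by (simp add: algebra_simps)
  qed
  show "[lin (\<sigma> \<otimes> \<rho>) = lin \<sigma> * lin \<rho>] (mod int q)" "[tr (\<sigma> \<otimes> \<rho>) = lin \<sigma> * tr \<rho> + tr \<sigma>] (mod int q)"
    using coeffs_unique[OF _ *] assms by simp_all
qed

lemma coeffs_one: "[lin \<one> = 1] (mod int q)" "[tr \<one> = 0] (mod int q)"
  using coeffs_unique[of \<one> 1 0] by (simp_all add: act_one)

lemma eq_if_coeffs:
  assumes "\<sigma> \<in> carrier \<Gamma>" "\<rho> \<in> carrier \<Gamma>" "[lin \<sigma> = lin \<rho>] (mod int q)" "[tr \<sigma> = tr \<rho>] (mod int q)"
  shows "\<sigma> = \<rho>"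
proof -
  have eq: "act \<sigma> x = act \<rho> x" if x: "x \<in> S" for x
  proof -
    have "[g (act \<sigma> x) = lin \<sigma> * g x + tr \<sigma>] (mod int q)" by (rule act_cong[OF assms(1) x])
    also have "[lin \<sigma> * g x + tr \<sigma> = lin \<rho> * g x + tr \<rho>] (mod int q)"
      by (intro cong_add cong_mult cong_refl assms)
    also have "[lin \<rho> * g x + tr \<rho> = g (act \<rho> x)] (mod int q)" by (rule cong_sym[OF act_cong[OF assms(2) x]])
    finally show ?thesis using g_inj act_S assms(1,2) x by simp
  qed
  have "inv \<rho> \<otimes> \<sigma> = \<one>"
  proof (rule faithful)
    fix x assume x: "x \<in> S"
    have "act (inv \<rho> \<otimes> \<sigma>) x = act (inv \<rho>) (act \<rho> x)" using assms(1,2) x by (simp add: act_mult eq)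
    also have "\<dots> = act (inv \<rho> \<otimes> \<rho>) x" using assms(2) x by (simp only: act_mult inv_closed)
    finally show "act (inv \<rho> \<otimes> \<sigma>) x = x" using assms(2) x by (simp add: act_one)
  qed (use assms in simp)
  hence "\<rho> \<otimes> (inv \<rho> \<otimes> \<sigma>) = \<rho>" using assms(2) by simp
  thus ?thesis using assms(1,2) by (simp add: m_assoc[symmetric])
qed

lemma coprime_lin: "\<sigma> \<in> carrier \<Gamma> \<Longrightarrow> coprime (lin \<sigma>) (int q)"
proof -
  assume \<sigma>: "\<sigma> \<in> carrier \<Gamma>"
  have "[lin \<sigma> * lin (inv \<sigma>) = 1] (mod int q)"
    using coeffs_mult(1)[OF \<sigma> inv_closed[OF \<sigma>]] coeffs_one(1) \<sigma> by (simp add: cong_sym_eq) (metis cong_sym cong_trans)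
  thus ?thesis using coprime_iff_invertible_int by blast
qed

lemma p_dvd_q: "int p dvd int q"
  by simp

lemma lin_pow: "\<sigma> \<in> carrier \<Gamma> \<Longrightarrow> [lin (\<sigma> [^] k) = lin \<sigma> ^ k] (mod int q)" for k :: nat
proof (induction k)
  case (Suc k)
  have "[lin (\<sigma> [^] Suc k) = lin (\<sigma> [^] k) * lin \<sigma>] (mod int q)" using coeffs_mult(1)[of "\<sigma> [^] k" \<sigma>] Suc.prems by simp
  also have "[lin (\<sigma> [^] k) * lin \<sigma> = lin \<sigma> ^ k * lin \<sigma>] (mod int q)" using Suc by (intro cong_mult cong_refl) simp
  finally show ?case by (simp add: mult.commute)
qed (use coeffs_one in simp)

lemma tr_pow: "\<sigma> \<in> carrier \<Gamma> \<Longrightarrow> [tr (\<sigma> [^] k) = tr \<sigma> * geom_sum (lin \<sigma>) k] (mod int q)" for k :: nat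
proof (induction k)
  case (Suc k)
  have "[tr (\<sigma> [^] Suc k) = lin (\<sigma> [^] k) * tr \<sigma> + tr (\<sigma> [^] k)] (mod int q)" using coeffs_mult(2)[of "\<sigma> [^] k" \<sigma>] Suc.prems by simp
  also have "[lin (\<sigma> [^] k) * tr \<sigma> + tr (\<sigma> [^] k) = lin \<sigma> ^ k * tr \<sigma> + tr \<sigma> * geom_sum (lin \<sigma>) k] (mod int q)"
    using Suc by (intro cong_add cong_mult cong_refl lin_pow) simp_all
  finally show ?case by (simp add: geom_sum_Suc algebra_simps)
qed (use coeffs_one in \<open>simp add: geom_sum_simps\<close>)

lemma fixes_iff: "\<upsilon> \<in> carrier \<Gamma> \<Longrightarrow> act \<upsilon> x0 = x0 \<longleftrightarrow> [tr \<upsilon> = 0] (mod int q)"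
proof -
  assume \<upsilon>: "\<upsilon> \<in> carrier \<Gamma>"
  have "[g (act \<upsilon> x0) = tr \<upsilon>] (mod int q)" using act_cong[OF \<upsilon> x0(1)] by (simp add: x0(2))
  moreover have "act \<upsilon> x0 = x0 \<longleftrightarrow> [g (act \<upsilon> x0) = 0] (mod int q)"
    using g_inj[OF act_S[OF \<upsilon> x0(1)] x0(1)] by (simp add: x0(2))
  ultimately show ?thesis by (metis cong_sym cong_trans)
qed

text \<open>A map with linear part not congruent to \<open>1\<close> has a fixed point \<open>y\<close>; its commutator with a map
  moving \<open>y\<close> by one unit is a translation.\<close>

lemma unit_translation_if_not_cong_one:
  assumes \<sigma>: "\<sigma> \<in> carrier \<Gamma>" and np: "\<not> int p dvd lin \<sigma> - 1"
  shows "\<exists>\<rho>\<in>carrier \<Gamma>. [lin \<rho> = 1] (mod int q) \<and> \<not> int p dvd tr \<rho>"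
proof -
  have "coprime (lin \<sigma> - 1) (int q)" using coprime_p_power[OF p odd np, of 3] by simp
  then obtain z where z: "[(lin \<sigma> - 1) * z = 1] (mod int q)" using cong_solve_coprime_int by blast
  obtain y where y: "y \<in> S" "[g y = z * (- tr \<sigma>)] (mod int q)" using g_surj by blast
  have fixp: "[lin \<sigma> * g y + tr \<sigma> = g y] (mod int q)"
  proof -
    have "[(lin \<sigma> - 1) * g y = (lin \<sigma> - 1) * (z * (- tr \<sigma>))] (mod int q)" by (intro cong_mult cong_refl y)
    also have "(lin \<sigma> - 1) * (z * (- tr \<sigma>)) = (lin \<sigma> - 1) * z * (- tr \<sigma>)" by (simp add: mult.assoc)
    also have "[(lin \<sigma> - 1) * z * (- tr \<sigma>) = 1 * (- tr \<sigma>)] (mod int q)" by (intro cong_mult cong_refl z)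
    finally have "[(lin \<sigma> - 1) * g y + (tr \<sigma> + g y) = 1 * (- tr \<sigma>) + (tr \<sigma> + g y)] (mod int q)"
      by (intro cong_add cong_refl)
    thus ?thesis by (simp add: algebra_simps)
  qed
  have \<sigma>y: "act \<sigma> y = y"
    using cong_trans[OF act_cong[OF \<sigma> y(1)] fixp] g_inj[OF act_S[OF \<sigma> y(1)] y(1)] by blast
  obtain y' where y': "y' \<in> S" "[g y' = g y + 1] (mod int q)" using g_surj by blast
  obtain \<eta> where \<eta>: "\<eta> \<in> carrier \<Gamma>" "act \<eta> y = y'" using transitive[OF y(1) y'(1)] by blast
  \<comment> \<open>As \<sigma> fixes \<open>y\<close>, this commutator takes \<open>y'\<close> to
    \<open>act \<sigma> y'\<close>, whose label differs from that of \<open>y'\<close> by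
    \<open>lin \<sigma> - 1\<close>.\<close>
  define \<rho> where "\<rho> = (\<sigma> \<otimes> \<eta>) \<otimes> inv (\<eta> \<otimes> \<sigma>)"
  have \<rho>: "\<rho> \<in> carrier \<Gamma>" using \<sigma> \<eta> by (simp add: \<rho>_def)
  have eq: "\<rho> \<otimes> (\<eta> \<otimes> \<sigma>) = \<sigma> \<otimes> \<eta>"
    using \<sigma> \<eta>(1) by (simp only: \<rho>_def m_assoc[of "\<sigma> \<otimes> \<eta>"] m_closed inv_closed l_inv r_one)
  have l: "[lin \<rho> = 1] (mod int q)"
  proof -
    have "[lin \<rho> * (lin \<eta> * lin \<sigma>) = lin \<rho> * lin (\<eta> \<otimes> \<sigma>)] (mod int q)"
      by (intro cong_mult cong_refl cong_sym[OF coeffs_mult(1)] \<sigma> \<eta>(1))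
    also have "[lin \<rho> * lin (\<eta> \<otimes> \<sigma>) = lin (\<sigma> \<otimes> \<eta>)] (mod int q)"
      using coeffs_mult(1)[OF \<rho>, of "\<eta> \<otimes> \<sigma>"] eq \<sigma> \<eta>(1) by (simp add: cong_sym_eq)
    also have "[lin (\<sigma> \<otimes> \<eta>) = lin \<sigma> * lin \<eta>] (mod int q)" by (rule coeffs_mult(1)[OF \<sigma> \<eta>(1)])
    finally have "[lin \<rho> * (lin \<eta> * lin \<sigma>) = 1 * (lin \<eta> * lin \<sigma>)] (mod int q)" by (simp add: mult.commute)
    moreover have "coprime (lin \<eta> * lin \<sigma>) (int q)" using coprime_lin \<sigma> \<eta>(1) by simp
    ultimately show ?thesis using cong_mult_rcancel by blast
  qed
  have "act \<rho> y' = act (\<rho> \<otimes> (\<eta> \<otimes> \<sigma>)) y" using \<rho> \<sigma> \<eta> y(1) by (simp add: act_mult act_S \<sigma>y)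
  also have "\<dots> = act \<sigma> y'" using \<sigma> \<eta> y(1) by (simp add: eq act_mult)
  finally have \<rho>y: "act \<rho> y' = act \<sigma> y'" .
  have "[1 * (g y + 1) + tr \<rho> = lin \<rho> * g y' + tr \<rho>] (mod int q)"
    by (intro cong_add cong_mult cong_refl cong_sym[OF y'(2)] cong_sym[OF l])
  also have "[lin \<rho> * g y' + tr \<rho> = g (act \<sigma> y')] (mod int q)"
    using cong_sym[OF act_cong[OF \<rho> y'(1)]] by (simp only: \<rho>y)
  also have "[g (act \<sigma> y') = lin \<sigma> * g y' + tr \<sigma>] (mod int q)" by (rule act_cong[OF \<sigma> y'(1)])
  also have "[lin \<sigma> * g y' + tr \<sigma> = lin \<sigma> * (g y + 1) + tr \<sigma>] (mod int q)"
    by (intro cong_add cong_mult cong_refl y'(2))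
  also have "[lin \<sigma> * (g y + 1) + tr \<sigma> = g y + lin \<sigma>] (mod int q)"
    using cong_add[OF fixp cong_refl[of "lin \<sigma>"]] by (simp add: algebra_simps)
  finally have "[1 * (g y + 1) + tr \<rho> = g y + lin \<sigma>] (mod int q)" .
  hence "[(g y + 1) + tr \<rho> - (g y + 1) = g y + lin \<sigma> - (g y + 1)] (mod int q)"
    by (intro cong_diff cong_refl) simp
  hence "[tr \<rho> = lin \<sigma> - 1] (mod int q)" by (simp add: algebra_simps)
  hence "int p dvd tr \<rho> \<longleftrightarrow> int p dvd lin \<sigma> - 1" by (intro cong_dvd_iff cong_dvd_modulus[OF _ p_dvd_q])
  thus ?thesis using \<rho> l np by blast
qed

text \<open>The conditions on slope and constant term make \<tau> run through all of
  \<open>S\<close> in one cycle; the last clause says that the stabilizer of \<open>x0\<close>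
  normalizes the group generated by \<tau>.\<close>

definition normalized_cycle :: "'a \<Rightarrow> bool" where
  "normalized_cycle \<tau> \<longleftrightarrow> \<tau> \<in> carrier \<Gamma> \<and> int p dvd lin \<tau> - 1 \<and> \<not> int p dvd tr \<tau> \<and>
     (\<forall>\<upsilon>\<in>carrier \<Gamma>. act \<upsilon> x0 = x0 \<longrightarrow> (\<exists>k::nat. \<upsilon> \<otimes> \<tau> = \<tau> [^] k \<otimes> \<upsilon>))"

text \<open>Conjugating a translation by a map fixing \<open>x0\<close> multiplies its length by the
  slope of that map, and a power of the translation has that length.\<close>

lemma normalized_cycle_translation:
  assumes \<tau>: "\<tau> \<in> carrier \<Gamma>" "[lin \<tau> = 1] (mod int q)" "\<not> int p dvd tr \<tau>"
  shows "normalized_cycle \<tau>"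
  unfolding normalized_cycle_def
proof (intro conjI ballI impI \<tau>)
  have "[lin \<tau> = 1] (mod int p)" using cong_dvd_modulus[OF \<tau>(2) p_dvd_q] .
  thus "int p dvd lin \<tau> - 1" by (simp add: cong_iff_dvd_diff)
  fix \<upsilon> assume \<upsilon>: "\<upsilon> \<in> carrier \<Gamma>" "act \<upsilon> x0 = x0"
  have t0: "[tr \<upsilon> = 0] (mod int q)" using fixes_iff \<upsilon> by blast
  define k where "k = nat (lin \<upsilon> mod int q)"
  have k: "[int k = lin \<upsilon>] (mod int q)" using p by (simp add: k_def cong_def prime_gt_0_nat)
  have lk: "[lin (\<tau> [^] k) = 1] (mod int q)"
    using cong_trans[OF lin_pow[OF \<tau>(1)] cong_pow[OF \<tau>(2)]] by simp
  have gk: "[geom_sum (lin \<tau>) k = int k] (mod int q)"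
    using geom_sum_cong[OF \<tau>(2), of k] by (simp add: geom_sum_def)
  have "\<upsilon> \<otimes> \<tau> = \<tau> [^] k \<otimes> \<upsilon>"
  proof (rule eq_if_coeffs)
    have "[lin (\<upsilon> \<otimes> \<tau>) = lin \<upsilon> * lin \<tau>] (mod int q)" by (rule coeffs_mult(1)[OF \<upsilon>(1) \<tau>(1)])
    also have "[lin \<upsilon> * lin \<tau> = lin \<upsilon> * 1] (mod int q)" by (intro cong_mult cong_refl \<tau>(2))
    also have "lin \<upsilon> * 1 = 1 * lin \<upsilon>" by simp
    also have "[1 * lin \<upsilon> = lin (\<tau> [^] k) * lin \<upsilon>] (mod int q)" by (intro cong_mult cong_refl cong_sym[OF lk])
    also have "[lin (\<tau> [^] k) * lin \<upsilon> = lin (\<tau> [^] k \<otimes> \<upsilon>)] (mod int q)"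
      by (rule cong_sym[OF coeffs_mult(1)]) (use \<tau> \<upsilon> in simp_all)
    finally show "[lin (\<upsilon> \<otimes> \<tau>) = lin (\<tau> [^] k \<otimes> \<upsilon>)] (mod int q)" .
    have "[tr (\<upsilon> \<otimes> \<tau>) = lin \<upsilon> * tr \<tau> + tr \<upsilon>] (mod int q)" by (rule coeffs_mult(2)[OF \<upsilon>(1) \<tau>(1)])
    also have "[lin \<upsilon> * tr \<tau> + tr \<upsilon> = int k * tr \<tau> + 0] (mod int q)"
      by (intro cong_add cong_mult cong_refl cong_sym[OF k] t0)
    also have "int k * tr \<tau> + 0 = 1 * 0 + tr \<tau> * int k" by simp
    also have "[1 * 0 + tr \<tau> * int k = lin (\<tau> [^] k) * tr \<upsilon> + tr \<tau> * geom_sum (lin \<tau>) k] (mod int q)"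
      by (intro cong_add cong_mult cong_refl cong_sym[OF lk] cong_sym[OF t0] cong_sym[OF gk])
    also have "[lin (\<tau> [^] k) * tr \<upsilon> + tr \<tau> * geom_sum (lin \<tau>) k = lin (\<tau> [^] k) * tr \<upsilon> + tr (\<tau> [^] k)] (mod int q)"
      by (intro cong_add cong_refl cong_sym[OF tr_pow] \<tau>(1))
    also have "[lin (\<tau> [^] k) * tr \<upsilon> + tr (\<tau> [^] k) = tr (\<tau> [^] k \<otimes> \<upsilon>)] (mod int q)"
      by (rule cong_sym[OF coeffs_mult(2)]) (use \<tau> \<upsilon> in simp_all)
    finally show "[tr (\<upsilon> \<otimes> \<tau>) = tr (\<tau> [^] k \<otimes> \<upsilon>)] (mod int q)" .
  qed (use \<tau> \<upsilon> in simp_all)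
  thus "\<exists>k::nat. \<upsilon> \<otimes> \<tau> = \<tau> [^] k \<otimes> \<upsilon>" by blast
qed

text \<open>For \<open>\<upsilon>\<close> fixing \<open>x0\<close>, let \<open>\<tau>\<^sup>k\<close> agree with \<open>\<upsilon> \<tau> \<upsilon>\<^sup>-\<^sup>1\<close> at \<open>x0\<close>. If their linear parts \<open>c\<^sup>k\<close> and \<open>c\<close> differ, then
  \<open>c - 1\<close> and \<open>lin \<upsilon> - 1\<close> are both exactly divisible by \<open>p\<close>, so that \<open>\<tau> \<upsilon>\<^sup>j\<close> is a translation for some \<open>j\<close>.\<close>

lemma normalized_cycle_no_translation:
  assumes none: "\<And>\<rho>. \<rho> \<in> carrier \<Gamma> \<Longrightarrow> [lin \<rho> = 1] (mod int q) \<Longrightarrow> int p dvd tr \<rho>"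
    and \<tau>: "\<tau> \<in> carrier \<Gamma>" "[tr \<tau> = 1] (mod int q)"
  shows "normalized_cycle \<tau>"
  unfolding normalized_cycle_def
proof (intro conjI ballI impI \<tau>)
  \<comment> \<open>A slope different from 1 modulo \<open>p\<close> would produce a translation
    that \<open>none\<close> excludes.\<close>
  have lin1: "int p dvd lin \<sigma> - 1" if "\<sigma> \<in> carrier \<Gamma>" for \<sigma>
    using unit_translation_if_not_cong_one[OF that] none by blast
  let ?c = "lin \<tau>"
  have c: "int p dvd ?c - 1" by (rule lin1[OF \<tau>(1)])
  show "int p dvd ?c - 1" by (rule c)
  have np1: "\<not> int p dvd 1" using p by (auto simp: prime_nat_iff)
  show "\<not> int p dvd tr \<tau>" using cong_dvd_iff[OF cong_dvd_modulus[OF \<tau>(2) p_dvd_q]] np1 by simp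
  fix \<upsilon> assume \<upsilon>: "\<upsilon> \<in> carrier \<Gamma>" "act \<upsilon> x0 = x0"
  let ?u = "lin \<upsilon>"
  have u: "int p dvd ?u - 1" by (rule lin1[OF \<upsilon>(1)])
  have t0: "[tr \<upsilon> = 0] (mod int q)" using fixes_iff \<upsilon> by blast
  have trk: "[tr (\<tau> [^] j) = geom_sum ?c j] (mod int q)" for j :: nat
    using cong_trans[OF tr_pow[OF \<tau>(1)] cong_mult[OF \<tau>(2) cong_refl]] by simp
  \<comment> \<open>\<open>\<tau>\<^sup>k\<close> and \<open>\<upsilon> \<tau>\<close> must agree at
    \<open>x0\<close>, whose images are labelled by the two sides. The geometric sums take every
    value modulo \<open>q\<close> because the first \<open>q\<close> of them are distinct.\<close>
  have "\<exists>k. [geom_sum ?c k = ?u] (mod int q)"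
  proof -
    have inj: "inj_on (\<lambda>k. geom_sum ?c k mod int q) {..<q}"
    proof (rule inj_onI)
      fix i j assume "i \<in> {..<q}" "j \<in> {..<q}" "geom_sum ?c i mod int q = geom_sum ?c j mod int q"
      thus "i = j" using geom_sum_cong_iff[OF p odd c, of i j 3] by (simp add: cong_def)
    qed
    have "(\<lambda>k. geom_sum ?c k mod int q) ` {..<q} = {0..<int q}"
    proof (rule card_subset_eq)
      show "(\<lambda>k. geom_sum ?c k mod int q) ` {..<q} \<subseteq> {0..<int q}" using p by (auto simp: prime_gt_0_nat)
      show "card ((\<lambda>k. geom_sum ?c k mod int q) ` {..<q}) = card {0..<int q}"
        using card_image[OF inj] by (simp add: nat_power_eq)
    qed simp
    moreover have "?u mod int q \<in> {0..<int q}" using p by (simp add: prime_gt_0_nat)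
    ultimately obtain k where "geom_sum ?c k mod int q = ?u mod int q" by (metis (no_types, lifting) imageE)
    thus ?thesis by (auto simp: cong_def)
  qed
  then obtain k where k: "[geom_sum ?c k = ?u] (mod int q)" by blast
  have kp: "[int k = 1] (mod int p)"
  proof -
    have "[int k = geom_sum ?c k] (mod int p)" by (rule cong_sym[OF geom_sum_cong_p[OF p odd c]])
    also have "[geom_sum ?c k = ?u] (mod int p)" by (rule cong_dvd_modulus[OF k p_dvd_q])
    also have "[?u = 1] (mod int p)" using u by (simp add: cong_iff_dvd_diff)
    finally show ?thesis .
  qed
  obtain k' where k': "k = Suc k'"
    using kp np1 by (cases k) (auto simp: cong_iff_dvd_diff)
  have pk': "p dvd k'" using kp by (simp add: k' cong_iff_dvd_diff)
  have ck: "[?c ^ k = ?c] (mod int q)"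
  proof (rule ccontr)
    assume "\<not> [?c ^ k = ?c] (mod int q)"
    moreover have "?c ^ k - ?c = ?c * (?c ^ k' - 1)" by (simp add: k' algebra_simps)
    ultimately have "\<not> int q dvd ?c ^ k' - 1" unfolding cong_iff_dvd_diff by (metis dvd_mult)
    hence nq: "\<not> int p ^ 3 dvd (?c - 1) * int k'" using power_minus_one_dvd_iff[OF p odd c, of 3 k'] by simp
    have "\<not> p ^ 2 dvd k'"
    proof
      assume "p ^ 2 dvd k'"
      hence "int p ^ 2 dvd int k'" by (metis of_nat_dvd_iff of_nat_power)
      hence "int p * int p ^ 2 dvd (?c - 1) * int k'" using c by (intro mult_dvd_mono)
      thus False using nq by (simp add: power3_eq_cube power2_eq_square mult.assoc)
    qed
    hence "\<not> int p ^ 2 dvd geom_sum ?c k'" using geom_sum_dvd_iff[OF p odd c] by blast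
    moreover have "coprime (int p ^ 2) ?c"
      using coprime_p_power[OF p odd not_dvd_of_cong_one[OF p odd c], of 2] by (simp add: coprime_commute)
    ultimately have "\<not> int p ^ 2 dvd ?c * geom_sum ?c k'" by (simp add: coprime_dvd_mult_right_iff)
    \<comment> \<open>As \<open>k = Suc k'\<close>, dropping the first term of the sum relates
      \<open>u - 1\<close> to a sum of length \<open>k'\<close>, whose divisibility by powers of
      \<open>p\<close> is that of \<open>k'\<close>.\<close>
    moreover have "[?c * geom_sum ?c k' = ?u - 1] (mod int q)"
      using cong_diff[OF k cong_refl[of 1]] by (simp add: k' geom_sum_Suc')
    hence "[?c * geom_sum ?c k' = ?u - 1] (mod int p ^ 2)"
      by (rule cong_dvd_modulus) (simp add: le_imp_power_dvd)
    ultimately have "\<not> int p ^ 2 dvd ?u - 1" using cong_dvd_iff by blast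
    then obtain j where j: "[?c * ?u ^ j = 1] (mod int p ^ 3)" using power_surj_cong_one[OF p odd u _ c] by blast
    let ?\<rho> = "\<tau> \<otimes> \<upsilon> [^] j"
    have \<rho>: "?\<rho> \<in> carrier \<Gamma>" using \<tau> \<upsilon> by simp
    have "[lin ?\<rho> = ?c * lin (\<upsilon> [^] j)] (mod int q)" using coeffs_mult(1)[of \<tau> "\<upsilon> [^] j"] \<tau> \<upsilon> by simp
    also have "[?c * lin (\<upsilon> [^] j) = ?c * ?u ^ j] (mod int q)" by (intro cong_mult cong_refl lin_pow \<upsilon>(1))
    also have "[?c * ?u ^ j = 1] (mod int q)" using j by simp
    finally have l1: "[lin ?\<rho> = 1] (mod int q)" .
    have "[tr ?\<rho> = ?c * tr (\<upsilon> [^] j) + tr \<tau>] (mod int q)" using coeffs_mult(2)[of \<tau> "\<upsilon> [^] j"] \<tau> \<upsilon> by simp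
    also have "[?c * tr (\<upsilon> [^] j) + tr \<tau> = ?c * (tr \<upsilon> * geom_sum ?u j) + 1] (mod int q)"
      by (intro cong_add cong_mult cong_refl tr_pow \<upsilon>(1) \<tau>(2))
    also have "[?c * (tr \<upsilon> * geom_sum ?u j) + 1 = ?c * (0 * geom_sum ?u j) + 1] (mod int q)"
      by (intro cong_add cong_mult cong_refl t0)
    finally have "[tr ?\<rho> = 1] (mod int p)" using cong_dvd_modulus[OF _ p_dvd_q] by simp
    thus False using none[OF \<rho> l1] np1 cong_dvd_iff by blast
  qed
  have "\<upsilon> \<otimes> \<tau> = \<tau> [^] k \<otimes> \<upsilon>"
  proof (rule eq_if_coeffs)
    have "[lin (\<upsilon> \<otimes> \<tau>) = ?u * ?c] (mod int q)" by (rule coeffs_mult(1)[OF \<upsilon>(1) \<tau>(1)])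
    also have "[?u * ?c = ?u * ?c ^ k] (mod int q)" by (intro cong_mult cong_refl cong_sym[OF ck])
    also have "?u * ?c ^ k = ?c ^ k * ?u" by simp
    also have "[?c ^ k * ?u = lin (\<tau> [^] k) * ?u] (mod int q)" by (intro cong_mult cong_refl cong_sym[OF lin_pow] \<tau>(1))
    also have "[lin (\<tau> [^] k) * ?u = lin (\<tau> [^] k \<otimes> \<upsilon>)] (mod int q)"
      by (rule cong_sym[OF coeffs_mult(1)]) (use \<tau> \<upsilon> in simp_all)
    finally show "[lin (\<upsilon> \<otimes> \<tau>) = lin (\<tau> [^] k \<otimes> \<upsilon>)] (mod int q)" .
    have "[tr (\<upsilon> \<otimes> \<tau>) = ?u * tr \<tau> + tr \<upsilon>] (mod int q)" by (rule coeffs_mult(2)[OF \<upsilon>(1) \<tau>(1)])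
    also have "[?u * tr \<tau> + tr \<upsilon> = geom_sum ?c k * 1 + 0] (mod int q)"
      by (intro cong_add cong_mult cong_refl cong_sym[OF k] t0 \<tau>(2))
    also have "geom_sum ?c k * 1 + 0 = lin (\<tau> [^] k) * 0 + geom_sum ?c k" by simp
    also have "[lin (\<tau> [^] k) * 0 + geom_sum ?c k = lin (\<tau> [^] k) * tr \<upsilon> + tr (\<tau> [^] k)] (mod int q)"
      by (intro cong_add cong_mult cong_refl cong_sym[OF t0] cong_sym[OF trk])
    also have "[lin (\<tau> [^] k) * tr \<upsilon> + tr (\<tau> [^] k) = tr (\<tau> [^] k \<otimes> \<upsilon>)] (mod int q)"
      by (rule cong_sym[OF coeffs_mult(2)]) (use \<tau> \<upsilon> in simp_all)
    finally show "[tr (\<upsilon> \<otimes> \<tau>) = tr (\<tau> [^] k \<otimes> \<upsilon>)] (mod int q)" .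
  qed (use \<tau> \<upsilon> in simp_all)
  thus "\<exists>k::nat. \<upsilon> \<otimes> \<tau> = \<tau> [^] k \<otimes> \<upsilon>" by blast
qed

text \<open>Either a translation by a unit exists, or any element moving \<open>x0\<close> to the
  point labelled 1 will do.\<close>

lemma normalized_cycle_exists: "\<exists>\<tau>. normalized_cycle \<tau>"
proof (cases "\<exists>\<rho>\<in>carrier \<Gamma>. [lin \<rho> = 1] (mod int q) \<and> \<not> int p dvd tr \<rho>")
  case True
  thus ?thesis using normalized_cycle_translation by blast
next
  case False
  obtain x1 where x1: "x1 \<in> S" "[g x1 = 1] (mod int q)" using g_surj by blast
  obtain \<tau> where \<tau>: "\<tau> \<in> carrier \<Gamma>" "act \<tau> x0 = x1" using transitive[OF x0(1) x1(1)] by blast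
  have "[tr \<tau> = g x1] (mod int q)" using act_cong[OF \<tau>(1) x0(1)] \<tau>(2) by (simp add: x0(2) cong_sym_eq)
  hence "[tr \<tau> = 1] (mod int q)" using x1(2) cong_trans by blast
  thus ?thesis using normalized_cycle_no_translation[OF _ \<tau>(1)] False by blast
qed

section \<open>The stabilizer of the base point and the semidirect decomposition\<close>

lemma stabilizer_mult:
  "\<sigma> \<in> carrier \<Gamma> \<Longrightarrow> \<rho> \<in> carrier \<Gamma> \<Longrightarrow> act \<sigma> x0 = x0 \<Longrightarrow> act \<rho> x0 = x0 \<Longrightarrow> act (\<sigma> \<otimes> \<rho>) x0 = x0"
  by (simp add: act_mult x0)

lemma stabilizer_pow: "\<sigma> \<in> carrier \<Gamma> \<Longrightarrow> act \<sigma> x0 = x0 \<Longrightarrow> act (\<sigma> [^] k) x0 = x0" for k :: nat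
  by (induction k) (simp_all add: act_one x0 stabilizer_mult)

lemma stabilizer_inv:
  assumes "\<sigma> \<in> carrier \<Gamma>" "act \<sigma> x0 = x0" shows "act (inv \<sigma>) x0 = x0"
proof -
  have "act (inv \<sigma>) (act \<sigma> x0) = act (inv \<sigma> \<otimes> \<sigma>) x0" using assms(1) x0(1) by (simp only: act_mult inv_closed)
  thus ?thesis using assms x0(1) by (simp add: act_one)
qed

text \<open>An element of the stabilizer is determined by its slope, which is a power of a primitive
  root \<open>r\<close> modulo \<open>q\<close>. Take \<open>h\<close> with the least positive
  exponent \<open>m\<close>: division with remainder makes every exponent occurring in the
  stabilizer a multiple of \<open>m\<close>.\<close>

lemma stabilizer_cyclic:
  obtains h D where "h \<in> carrier \<Gamma>" "act h x0 = x0" "D > 0" "D dvd totient q"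
    "\<And>j::nat. h [^] j = \<one> \<longleftrightarrow> D dvd j"
    "\<And>\<upsilon>. \<upsilon> \<in> carrier \<Gamma> \<Longrightarrow> act \<upsilon> x0 = x0 \<Longrightarrow> \<exists>j::nat. \<upsilon> = h [^] j"
proof -
  have q0: "q > 0" using p by (simp add: prime_gt_0_nat)
  obtain r where r: "residue_primroot q r"
    using residue_primroot_odd_prime_power_exists[OF p odd] by (metis zero_less_numeral)
  have ord_r: "[int r ^ e = 1] (mod int q) \<longleftrightarrow> totient q dvd e" for e
  proof -
    have "[r ^ e = 1] (mod q) \<longleftrightarrow> totient q dvd e"
      using r ord_divides[of r e q] by (simp add: residue_primroot_def)
    thus ?thesis using cong_int_iff[of "r ^ e" 1 q] by simp
  qed
  have cop_r: "coprime (int r ^ e) (int q)" for e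
    using r by (simp add: residue_primroot_def coprime_commute)
  have log: "\<exists>e. [lin \<upsilon> = int r ^ e] (mod int q)" if \<upsilon>: "\<upsilon> \<in> carrier \<Gamma>" for \<upsilon>
  proof -
    define v where "v = nat (lin \<upsilon> mod int q)"
    have v: "int v = lin \<upsilon> mod int q" using q0 by (simp add: v_def)
    have "int q \<noteq> 0" using q0 by simp
    hence "coprime (int v) (int q)"
      unfolding v using coprime_mod_left_iff[of "int q" "lin \<upsilon>"] coprime_lin[OF \<upsilon>] by blast
    hence cv: "coprime v q" by (simp only: coprime_int_iff)
    have "v < q" using v q0 by (metis of_nat_less_iff of_nat_0_less_iff pos_mod_bound)
    moreover have "v > 0" using cv q by (cases v) auto
    ultimately have "v \<in> totatives q" using cv by (simp add: totatives_def)
    then obtain e where "v = r ^ e mod q"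
      using bij_betw_imp_surj_on[OF residue_primroot_is_generator[OF q r]] by blast
    hence "[v = r ^ e] (mod q)" by (simp add: cong_def)
    hence "[int v = int (r ^ e)] (mod int q)" by (simp only: cong_int_iff)
    moreover have "[lin \<upsilon> = int v] (mod int q)" unfolding v by (simp add: cong_def)
    ultimately have "[lin \<upsilon> = int (r ^ e)] (mod int q)" by (rule cong_trans[rotated])
    thus ?thesis by (intro exI[of _ e]) simp
  qed
  define P where "P m \<longleftrightarrow> m > 0 \<and> (\<exists>\<upsilon>\<in>carrier \<Gamma>. act \<upsilon> x0 = x0 \<and> [lin \<upsilon> = int r ^ m] (mod int q))" for m
  have lin_one: "[lin \<one> = int r ^ totient q] (mod int q)"
  proof -
    have "[int r ^ totient q = 1] (mod int q)" using ord_r[of "totient q"] by (simp only: dvd_refl)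
    hence "[1 = int r ^ totient q] (mod int q)" by (rule cong_sym)
    thus ?thesis by (rule cong_trans[OF coeffs_one(1)])
  qed
  \<comment> \<open>The identity is counted with exponent \<open>totient q\<close> rather than 0, so
    that a least positive exponent exists even for a trivial stabilizer; in that case
    \<open>m = totient q\<close> and \<open>D = 1\<close>.\<close>
  have Ptot: "P (totient q)"
  proof -
    have "totient q > 0" using q0 by (rule totient_gt_0_iff[THEN iffD2])
    with lin_one show ?thesis unfolding P_def using act_one[OF x0(1)] by blast
  qed
  define m where "m = (LEAST m. P m)"
  have "P m" unfolding m_def using Ptot by (rule LeastI)
  then obtain h where h: "h \<in> carrier \<Gamma>" "act h x0 = x0" "[lin h = int r ^ m] (mod int q)" and m0: "m > 0"
    unfolding P_def by blast
  have hpow: "[lin (h [^] s) = int r ^ (m * s)] (mod int q)" for s :: nat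
    using cong_trans[OF lin_pow[OF h(1)] cong_pow[OF h(3)]] by (simp add: power_mult)
  have m_dvd: "m dvd e" if \<upsilon>: "\<upsilon> \<in> carrier \<Gamma>" "act \<upsilon> x0 = x0" "[lin \<upsilon> = int r ^ e] (mod int q)" for \<upsilon> e
  proof -
    define s t where "s = e div m" and "t = e mod m"
    have e: "e = m * s + t" by (simp add: s_def t_def)
    let ?w = "\<upsilon> \<otimes> inv (h [^] s)"
    have w: "?w \<in> carrier \<Gamma>" "act ?w x0 = x0"
      using \<upsilon> h by (simp_all add: stabilizer_mult stabilizer_inv stabilizer_pow)
    have wh: "?w \<otimes> h [^] s = \<upsilon>" using \<upsilon>(1) h(1) by (simp add: m_assoc)
    have "[lin ?w * int r ^ (m * s) = lin ?w * lin (h [^] s)] (mod int q)"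
      by (intro cong_mult cong_refl cong_sym[OF hpow])
    also have "[lin ?w * lin (h [^] s) = lin \<upsilon>] (mod int q)"
      using cong_sym[OF coeffs_mult(1)[OF w(1), of "h [^] s"]] h(1) unfolding wh by simp
    also have "[lin \<upsilon> = int r ^ e] (mod int q)" by (rule \<upsilon>(3))
    also have "int r ^ e = int r ^ t * int r ^ (m * s)" by (simp add: e power_add)
    finally have "[lin ?w = int r ^ t] (mod int q)" using cong_mult_rcancel[OF cop_r] by blast
    hence "P t" if "t > 0" using that w unfolding P_def by blast
    moreover have "t < m" using m0 by (simp add: t_def)
    ultimately have "t = 0" using not_less_Least[of t P] by (auto simp: m_def)
    thus ?thesis using e by simp
  qed
  have "m dvd totient q"
    using m_dvd[of \<one> "totient q"] lin_one act_one[OF x0(1)] by simp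
  then obtain D where D: "totient q = m * D" ..
  have eq: "\<upsilon> = h [^] s" if "\<upsilon> \<in> carrier \<Gamma>" "act \<upsilon> x0 = x0" "[lin \<upsilon> = int r ^ (m * s)] (mod int q)" for \<upsilon> and s :: nat
  proof (rule eq_if_coeffs)
    show "[lin \<upsilon> = lin (h [^] s)] (mod int q)" using cong_trans[OF that(3) cong_sym[OF hpow]] .
    have "[tr \<upsilon> = 0] (mod int q)" "[tr (h [^] s) = 0] (mod int q)"
      using fixes_iff that h stabilizer_pow by simp_all
    thus "[tr \<upsilon> = tr (h [^] s)] (mod int q)" using cong_trans cong_sym by blast
  qed (use that h in simp_all)
  show thesis
  proof (rule that[OF h(1,2), of D])
    show "D > 0" using D totient_gt_0_iff[of q] q0 by (cases D) auto
    show "D dvd totient q" using D by simp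
    show "h [^] j = \<one> \<longleftrightarrow> D dvd j" for j :: nat
    proof -
      have "h [^] j = \<one> \<longleftrightarrow> [int r ^ (m * j) = 1] (mod int q)"
      proof
        assume "h [^] j = \<one>"
        thus "[int r ^ (m * j) = 1] (mod int q)"
          using hpow[of j] coeffs_one(1) by (metis cong_sym cong_trans)
      next
        assume "[int r ^ (m * j) = 1] (mod int q)"
        hence "[lin \<one> = int r ^ (m * j)] (mod int q)" using coeffs_one(1) by (metis cong_sym cong_trans)
        thus "h [^] j = \<one>" using eq[of \<one> j] act_one[OF x0(1)] by simp
      qed
      also have "\<dots> \<longleftrightarrow> D dvd j" using ord_r D m0 by simp
      finally show ?thesis .
    qed
    fix \<upsilon> assume \<upsilon>: "\<upsilon> \<in> carrier \<Gamma>" "act \<upsilon> x0 = x0"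
    obtain e where e: "[lin \<upsilon> = int r ^ e] (mod int q)" using log \<upsilon> by blast
    obtain s where "e = m * s" using m_dvd[OF \<upsilon> e] ..
    thus "\<exists>j::nat. \<upsilon> = h [^] j" using eq[OF \<upsilon>] e by blast
  qed
qed

text \<open>The powers of \<tau> take \<open>x0\<close> to every point, so each element is a power
  of \<tau> times an element of the stabilizer, and the stabilizer normalizes the group generated by
  \<tau>. Its order \<open>D\<close> divides \<open>p\<^sup>2 (p - 1)\<close>, the number of units
  modulo \<open>p\<^sup>3\<close>.\<close>

theorem semidirect: "\<exists>a d. a \<le> 2 \<and> d dvd p - 1 \<and> is_cyclic_semidirect \<Gamma> q (p ^ a * d)"
proof -
  obtain \<tau> where nc: "normalized_cycle \<tau>" using normalized_cycle_exists by blast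
  have \<tau>: "\<tau> \<in> carrier \<Gamma>" and c: "int p dvd lin \<tau> - 1" and b: "\<not> int p dvd tr \<tau>"
    using nc by (simp_all add: normalized_cycle_def)
  obtain h D where h: "h \<in> carrier \<Gamma>" "act h x0 = x0" and D: "D > 0" "D dvd totient q"
    and hD: "\<And>j::nat. h [^] j = \<one> \<longleftrightarrow> D dvd j"
    and stab: "\<And>\<upsilon>. \<upsilon> \<in> carrier \<Gamma> \<Longrightarrow> act \<upsilon> x0 = x0 \<Longrightarrow> \<exists>j::nat. \<upsilon> = h [^] j"
    by (rule stabilizer_cyclic) blast
  obtain u where u: "h \<otimes> \<tau> = \<tau> [^] (u::nat) \<otimes> h" using nc h unfolding normalized_cycle_def by blast
  have cop: "coprime (tr \<tau>) (int q)" using coprime_p_power[OF p odd b, of 3] by simp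
  have g\<tau>: "[g (act (\<tau> [^] k) x0) = tr \<tau> * geom_sum (lin \<tau>) k] (mod int q)" for k :: nat
    using cong_trans[OF act_cong[OF nat_pow_closed[OF \<tau>] x0(1)], of k] tr_pow[OF \<tau>, of k] by (simp add: x0(2))
  have pt_eq: "act (\<tau> [^] i) x0 = act (\<tau> [^] j) x0 \<longleftrightarrow> [i = j] (mod q)" for i j :: nat
  proof -
    have "act (\<tau> [^] i) x0 = act (\<tau> [^] j) x0 \<longleftrightarrow>
        [g (act (\<tau> [^] i) x0) = g (act (\<tau> [^] j) x0)] (mod int q)"
      by (rule g_inj[symmetric]) (use act_S \<tau> x0 in simp_all)
    also have "\<dots> \<longleftrightarrow> [tr \<tau> * geom_sum (lin \<tau>) i = tr \<tau> * geom_sum (lin \<tau>) j] (mod int q)"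
      using g\<tau>[of i] g\<tau>[of j] cong_sym cong_trans by blast
    also have "\<dots> \<longleftrightarrow> [geom_sum (lin \<tau>) i = geom_sum (lin \<tau>) j] (mod int q)" by (rule cong_mult_lcancel[OF cop])
    finally show ?thesis using geom_sum_cong_iff[OF p odd c, of i j 3] by simp
  qed
  have "card S = q" using bij_betw_same_card[OF bij] by (simp add: nat_power_eq)
  hence finS: "finite S" using q by (metis card.infinite not_less_zero)
  have "inj_on (\<lambda>k. act (\<tau> [^] k) x0) {..<q}"
    by (rule inj_onI) (simp add: pt_eq cong_def)
  hence "(\<lambda>k. act (\<tau> [^] k) x0) ` {..<q} = S"
    using \<open>card S = q\<close> by (intro card_subset_eq finS) (use act_S \<tau> x0 in \<open>auto simp: card_image\<close>)
  hence surj: "\<exists>k. x = act (\<tau> [^] (k::nat)) x0" if "x \<in> S" for x using that by blast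
  \<comment> \<open>An element commuting with the cycle and fixing one of its points fixes them all.
    This gives both that \<tau> has order \<open>q\<close> and that the stabilizer acts faithfully
    on the powers of \<tau>.\<close>
  have triv: "\<sigma> = \<one>" if \<sigma>: "\<sigma> \<in> carrier \<Gamma>" "act \<sigma> x0 = x0" "\<And>k::nat. \<sigma> \<otimes> \<tau> [^] k = \<tau> [^] k \<otimes> \<sigma>" for \<sigma>
  proof (rule faithful[OF \<sigma>(1)])
    fix x assume "x \<in> S"
    then obtain k :: nat where k: "x = act (\<tau> [^] k) x0" using surj by blast
    have "act \<sigma> x = act (\<sigma> \<otimes> \<tau> [^] k) x0" using \<sigma>(1) \<tau> x0(1) by (simp add: k act_mult)
    also have "\<dots> = x" unfolding \<sigma>(3) k using \<sigma>(1,2) \<tau> x0(1) by (simp add: act_mult)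
    finally show "act \<sigma> x = x" .
  qed
  have "act (\<tau> [^] q) x0 = x0" using pt_eq[of q 0] x0 by (simp add: act_one cong_def)
  hence \<tau>q: "\<tau> [^] q = \<one>" by (intro triv) (use \<tau> in \<open>simp_all add: nat_pow_mult add.commute\<close>)
  have \<tau>dvd: "\<tau> [^] i = \<one>" if "q dvd i" for i :: nat
    using that \<tau>q \<tau> by (auto simp: nat_pow_pow[symmetric] elim!: dvdE)
  have "is_cyclic_semidirect \<Gamma> q D"
  proof (rule cyclic_semidirectI[OF q D(1) \<tau> h(1) u])
    show "\<tau> [^] i \<otimes> h [^] j = \<one> \<longleftrightarrow> q dvd i \<and> D dvd j" for i j :: nat
    proof
      assume eq: "\<tau> [^] i \<otimes> h [^] j = \<one>"
      have "act (\<tau> [^] i) x0 = act (\<tau> [^] i \<otimes> h [^] j) x0"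
        using \<tau> h x0(1) by (simp add: act_mult stabilizer_pow)
      hence "act (\<tau> [^] i) x0 = act (\<tau> [^] (0::nat)) x0" by (simp add: eq)
      hence qi: "q dvd i" using pt_eq[of i 0] by (simp only: cong_0_iff)
      thus "q dvd i \<and> D dvd j" using eq \<tau>dvd[OF qi] h(1) hD by simp
    next
      assume "q dvd i \<and> D dvd j"
      thus "\<tau> [^] i \<otimes> h [^] j = \<one>" using \<tau>dvd[of i] hD[of j] by simp
    qed
    show "D dvd j" if j: "[u ^ j = 1] (mod q)" for j
    proof -
      have "h [^] j = \<one>"
      proof (rule triv)
        fix k :: nat
        have "\<tau> [^] (u ^ j * k) = \<tau> [^] k"
        proof -
          show ?thesis
          proof (cases "u ^ j = 0")
            case True
            have "[0 = Suc 0] (mod q)" using j unfolding True by simp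
            thus ?thesis using q by (simp add: cong_def)
          next
            case False
            then obtain s where s: "u ^ j = Suc s" by (cases "u ^ j") auto
            have "[s + 1 = 0 + 1] (mod q)" using j unfolding s by simp
            hence "[s = 0] (mod q)" by (simp only: cong_add_rcancel_nat)
            hence "q dvd s" by (simp only: cong_0_iff)
            hence "\<tau> [^] (s * k) = \<one>" by (intro \<tau>dvd) simp
            thus ?thesis using \<tau> by (simp add: s nat_pow_mult[symmetric])
          qed
        qed
        thus "h [^] j \<otimes> \<tau> [^] k = \<tau> [^] k \<otimes> h [^] j" using pow_commute_relation[OF \<tau> h(1) u] by simp
      qed (use h stabilizer_pow in simp_all)
      thus ?thesis using hD by simp
    qed
    fix x assume x: "x \<in> carrier \<Gamma>"
    obtain k :: nat where k: "act x x0 = act (\<tau> [^] k) x0" using surj[OF act_S[OF x x0(1)]] by blast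
    have "act (inv (\<tau> [^] k) \<otimes> x) x0 = act (inv (\<tau> [^] k)) (act (\<tau> [^] k) x0)" using x \<tau> x0(1) by (simp add: act_mult k)
    also have "\<dots> = act (inv (\<tau> [^] k) \<otimes> \<tau> [^] k) x0" using \<tau> x0(1) by (simp only: act_mult inv_closed nat_pow_closed)
    also have "\<dots> = x0" using \<tau> x0(1) by (simp add: act_one)
    finally obtain j :: nat where "inv (\<tau> [^] k) \<otimes> x = h [^] j"
      using stab[of "inv (\<tau> [^] k) \<otimes> x"] x \<tau> by auto
    hence "\<tau> [^] k \<otimes> h [^] j = \<tau> [^] k \<otimes> (inv (\<tau> [^] k) \<otimes> x)" by simp
    also have "\<dots> = x" using x \<tau> by (simp add: m_assoc[symmetric])
    finally have "x = \<tau> [^] k \<otimes> h [^] j" by (rule sym)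
    thus "\<exists>(i::nat) (j::nat). x = \<tau> [^] i \<otimes> h [^] j" by blast
  qed
  \<comment> \<open>A divisor of a product is a product of divisors, so \<open>D\<close> splits into
    a power of \<open>p\<close> and a divisor of \<open>p - 1\<close>.\<close>
  moreover have "totient q = p ^ 2 * (p - 1)" using p by (simp add: totient_prime_power)
  then obtain b d where bd: "D = b * d" "b dvd p ^ 2" "d dvd p - 1"
    using D(2) division_decomp[of D "p ^ 2" "p - 1"] by auto
  moreover obtain a where "a \<le> 2" "b = p ^ a" using bd(2) divides_primepow_nat[OF p] by blast
  ultimately show ?thesis by blast
qed

end


section \<open>Hopf Galois structures of cyclic type\<close>

context galois_extension
begin

text \<open>Fixing every coset means fixing every conjugate of every element of
  \<open>L\<close>.\<close>

lemma lam_faithful: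
  assumes z: "z \<in> carrier G" "\<And>s. s \<in> S \<Longrightarrow> lam z s = s" shows "z = \<one>\<^bsub>G\<^esub>"
proof (rule faithful[OF z(1)])
  fix h u assume h: "h \<in> carrier G" and u: "u \<in> L"
  have uE: "u \<in> carrier E" using u subfieldE(3)[OF L] by blast
  have "z (h u) = coset_eval (lam (z \<otimes>\<^bsub>G\<^esub> h) B) u"
    using G_mult[OF z(1) h uE] coset_eval_coset[OF G.m_closed[OF z(1) h] u] by simp
  also have "lam (z \<otimes>\<^bsub>G\<^esub> h) B = lam h B"
    using lam_mult[OF z(1) h B_coset] z(2)[OF lam_closed[OF h B_coset]] by simp
  finally show "z (h u) = h u" using coset_eval_coset[OF h u] by simp
qed

lemma lam_transitive:
  assumes "x \<in> S" "y \<in> S" shows "\<exists>z\<in>carrier G. lam z x = y"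
proof -
  obtain g h where gh: "g \<in> carrier G" "x = lam g B" "h \<in> carrier G" "y = lam h B"
    using assms coset_lamE by metis
  have "lam (h \<otimes>\<^bsub>G\<^esub> inv\<^bsub>G\<^esub> g) x = y"
    using gh lam_inv(1)[OF gh(1) B_coset] lam_mult[OF gh(3) G.inv_closed[OF gh(1)] assms(1)] by simp
  thus ?thesis using gh by blast
qed

lemma lam_Bij: "z \<in> carrier G \<Longrightarrow> lam z \<in> Bij S"
  using lam_P by (simp add: BijGroup_def)

text \<open>\<open>conj_translation E K L z n\<close> is the only permutation \<open>m\<close> with
  \<open>lam z (n x) = m (lam z x)\<close> for all cosets \<open>x\<close>.\<close>

lemma greither_pareigis_iff_normalizes:
  assumes "regular_subgroup S N"
  shows "N \<in> greither_pareigis E K L \<longleftrightarrow> (\<forall>z\<in>carrier G. normalizes S (lam z) N)"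
proof -
  have NP: "n \<in> carrier P" if "n \<in> N" for n
    using assms subgroup.mem_carrier that by (metis regular_subgroup_def)
  have conj: "conj_translation E K L z n (lam z x) = lam z (n x)"
    if "z \<in> carrier G" "n \<in> N" "x \<in> S" for z n x
    using conj_apply[OF that(1) NP[OF that(2)] lam_closed[OF that(1,3)]] lam_inv(1)[OF that(1,3)] by simp
  have cP: "conj_translation E K L z n \<in> carrier P" if "z \<in> carrier G" "n \<in> N" for z n
    using that NP lam_P by (simp add: conj_def')
  have eq: "conj_translation E K L z n = m"
    if "z \<in> carrier G" "n \<in> N" "m \<in> N" "\<And>x. x \<in> S \<Longrightarrow> lam z (n x) = m (lam z x)" for z n m
  proof (rule P_eqI[OF cP[OF that(1,2)] NP[OF that(3)]])
    fix s assume s: "s \<in> S"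
    have i: "lam (inv\<^bsub>G\<^esub> z) s \<in> S" using lam_closed[OF G.inv_closed[OF that(1)] s] .
    show "conj_translation E K L z n s = m s"
      using conj_apply[OF that(1) NP[OF that(2)] s] that(4)[OF i] lam_inv(2)[OF that(1) s] by simp
  qed
  show ?thesis
  proof
    assume N: "N \<in> greither_pareigis E K L"
    show "\<forall>z\<in>carrier G. normalizes S (lam z) N"
      unfolding normalizes_def
    proof (intro ballI)
      fix z n assume z: "z \<in> carrier G" and n: "n \<in> N"
      show "\<exists>m\<in>N. \<forall>x\<in>S. lam z (n x) = m (lam z x)"
        using N z n conj[OF z n] by (intro bexI[of _ "conj_translation E K L z n"]) (auto simp: greither_pareigis_def)
    qed
  next
    assume a: "\<forall>z\<in>carrier G. normalizes S (lam z) N"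
    have "conj_translation E K L z n \<in> N" if zn: "z \<in> carrier G" "n \<in> N" for z n
    proof -
      have "normalizes S (lam z) N" using a zn(1) by blast
      then obtain m where "m \<in> N" "\<And>x. x \<in> S \<Longrightarrow> lam z (n x) = m (lam z x)"
        using zn(2) unfolding normalizes_def by blast
      thus ?thesis using eq[OF zn] by simp
    qed
    thus "N \<in> greither_pareigis E K L" using assms by (simp add: greither_pareigis_def)
  qed
qed

lemma gp_of_type_normalizes:
  "gp_of_type T = {N. regular_subgroup S N \<and> P\<lparr>carrier := N\<rparr> \<cong> T \<and> (\<forall>z\<in>carrier G. normalizes S (lam z) N)}"
  using greither_pareigis_iff_normalizes by (auto simp: gp_of_type_def greither_pareigis_def)

theorem semidirect_if_cyclic_type:
  assumes p: "Factorial_Ring.prime p" "odd p" and ne: "gp_of_type (integer_mod_group (p ^ 3)) \<noteq> {}"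
  shows "\<exists>a d. a \<le> 2 \<and> d dvd p - 1 \<and> is_cyclic_semidirect G (p ^ 3) (p ^ a * d)"
proof -
  obtain N where N: "regular_subgroup S N" "P\<lparr>carrier := N\<rparr> \<cong> integer_mod_group (p ^ 3)"
      "\<And>z. z \<in> carrier G \<Longrightarrow> normalizes S (lam z) N"
    using ne unfolding gp_of_type_normalizes by blast
  have q: "p ^ 3 > 1" using one_less_power[OF prime_gt_1_nat[OF p(1)], of 3] by simp
  obtain g where g: "bij_betw g S {0..<int (p ^ 3)}" "g B = 0" "transl_group (p ^ 3) S g = N"
    using regular_cyclic_coordinate[OF q N(1,2) B_coset] by blast
  interpret c: coordinate "p ^ 3" S g by unfold_locales (use q g in auto)
  interpret affine_action G p S g lam B
  proof unfold_locales
    show "affine_in (p ^ 3) S g (lam z)" if "z \<in> carrier G" for z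
      using c.normalizes_iff_affine[OF lam_Bij[OF that]] N(3)[OF that] g(3) by simp
  qed (use p g lam_closed lam_mult lam_one lam_faithful lam_transitive B_coset in auto)
  show ?thesis by (rule semidirect)
qed

lemma normalizes_mult:
  assumes "z \<in> carrier G" "\<rho> \<in> carrier G" "regular_subgroup S N"
    and "normalizes S (lam z) N" "normalizes S (lam \<rho>) N"
  shows "normalizes S (lam (z \<otimes>\<^bsub>G\<^esub> \<rho>)) N"
  unfolding normalizes_def
proof
  fix n assume n: "n \<in> N"
  have nS: "n x \<in> S" if "n \<in> N" "x \<in> S" for n x
    using assms(3) subgroup.mem_carrier P_closed that by (metis regular_subgroup_def)
  obtain m where m: "m \<in> N" "\<And>x. x \<in> S \<Longrightarrow> lam \<rho> (n x) = m (lam \<rho> x)"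
    using assms(5) n unfolding normalizes_def by blast
  obtain m' where m': "m' \<in> N" "\<And>x. x \<in> S \<Longrightarrow> lam z (m x) = m' (lam z x)"
    using assms(4) m(1) unfolding normalizes_def by blast
  have "lam (z \<otimes>\<^bsub>G\<^esub> \<rho>) (n x) = m' (lam (z \<otimes>\<^bsub>G\<^esub> \<rho>) x)" if x: "x \<in> S" for x
    using m(2)[OF x] m'(2)[OF lam_closed[OF assms(2) x]] lam_mult[OF assms(1,2)] nS[OF n x] x by simp
  thus "\<exists>m\<in>N. \<forall>x\<in>S. lam (z \<otimes>\<^bsub>G\<^esub> \<rho>) (n x) = m (lam (z \<otimes>\<^bsub>G\<^esub> \<rho>) x)" using m'(1) by blast
qed

lemma normalizes_pow:
  assumes "z \<in> carrier G" "regular_subgroup S N" "normalizes S (lam z) N"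
  shows "normalizes S (lam (z [^]\<^bsub>G\<^esub> (k::nat))) N"
proof (induction k)
  case 0
  have "n x \<in> S" if "n \<in> N" "x \<in> S" for n x
    using assms(2) subgroup.mem_carrier P_closed that by (metis regular_subgroup_def)
  thus ?case by (auto simp: normalizes_def lam_one)
next
  case (Suc k)
  thus ?case using assms by (simp add: normalizes_mult)
qed

text \<open>Normalization by the whole group reduces to the generators \<open>a\<close> and
  \<upsilon>, where \<upsilon> is \<open>h\<close> corrected by a power of \<open>a\<close> so as to
  fix the trivial coset. Since the powers of \<open>a\<close> act regularly, the cosets can be
  numbered along them, and the count of \<open>cycle_with_power\<close> applies.\<close>

theorem card_cyclic_type:
  assumes p: "Factorial_Ring.prime p" "odd p" and card_S: "card S = p ^ 3"
    and D: "D > 0" and sd: "is_cyclic_semidirect G (p ^ 3) D"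
  obtains u where "\<And>j. [u ^ j = 1] (mod p ^ 3) \<longleftrightarrow> D dvd j"
    "card (gp_of_type (integer_mod_group (p ^ 3))) =
       card {c \<in> {0..<int p ^ 3}. int p dvd c - 1 \<and> int p ^ 3 dvd (c - 1) * (int u - 1)}"
proof -
  let ?q = "p ^ 3"
  have q: "?q > 1" using one_less_power[OF prime_gt_1_nat[OF p(1)], of 3] by simp
  obtain a h u where a: "a \<in> carrier G" and h: "h \<in> carrier G" and rel: "h \<otimes>\<^bsub>G\<^esub> a = a [^]\<^bsub>G\<^esub> (u::nat) \<otimes>\<^bsub>G\<^esub> h"
    and ord_a: "\<And>i::nat. a [^]\<^bsub>G\<^esub> i = \<one>\<^bsub>G\<^esub> \<longleftrightarrow> ?q dvd i" and ord_u: "\<And>j. [u ^ j = 1] (mod ?q) \<longleftrightarrow> D dvd j"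
    and gen: "\<And>x. x \<in> carrier G \<Longrightarrow> \<exists>(i::nat) (j::nat). x = a [^]\<^bsub>G\<^esub> i \<otimes>\<^bsub>G\<^esub> h [^]\<^bsub>G\<^esub> j"
    using G.cyclic_semidirect_generators[OF q D sd] by metis
  \<comment> \<open>The inverse of \<open>u\<close> modulo \<open>q\<close>; it lets a power of
    \<open>a\<close> be moved past \<open>h\<^sup>j\<close> from left to right.\<close>
  obtain w where w: "[u * w = 1] (mod ?q)"
  proof -
    have "[u * u ^ (D - 1) = 1] (mod ?q)" using ord_u[of D] D by (simp flip: power_Suc)
    thus ?thesis using that by blast
  qed
  have pu: "\<not> p dvd u"
  proof
    assume "p dvd u"
    hence "p dvd u * w" by (rule dvd_mult2)
    moreover have "[u * w = 1] (mod p)" by (rule cong_dvd_modulus_nat[OF w]) simp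
    ultimately have "p dvd 1" using cong_dvd_iff by blast
    thus False using prime_gt_1_nat[OF p(1)] by simp
  qed
  note a_cong = G.pow_eq_iff_cong[OF a ord_a, THEN iffD2]
  have fix_mult: "lam (a [^]\<^bsub>G\<^esub> (i * k)) B = B" if "lam (a [^]\<^bsub>G\<^esub> i) B = B" for i k :: nat
  proof (induction k)
    case (Suc k)
    have "lam (a [^]\<^bsub>G\<^esub> (i * Suc k)) B = lam (a [^]\<^bsub>G\<^esub> i) (lam (a [^]\<^bsub>G\<^esub> (i * k)) B)"
      using a lam_mult[OF _ _ B_coset] by (simp add: G.nat_pow_mult[symmetric])
    thus ?case using Suc that by simp
  qed (simp add: lam_one B_coset)
  \<comment> \<open>the conjugates of \<open>a\<^sup>i\<close> are powers of \<open>a\<^sup>i\<close>, so if \<open>a\<^sup>i\<close> fixes one coset then it fixes all of them\<close>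
  have stab: "?q dvd i" if i: "lam (a [^]\<^bsub>G\<^esub> i) B = B" for i :: nat
  proof -
    have "lam (a [^]\<^bsub>G\<^esub> i) s = s" if s: "s \<in> S" for s
    proof -
      obtain x where x: "x \<in> carrier G" "s = lam x B" using coset_lamE[OF s] .
      obtain k j :: nat where kj: "x = a [^]\<^bsub>G\<^esub> k \<otimes>\<^bsub>G\<^esub> h [^]\<^bsub>G\<^esub> j" using gen x by blast
      have "[(u * w) ^ j * i = 1 ^ j * i] (mod ?q)" by (intro cong_mult cong_pow cong_refl w)
      hence ai: "a [^]\<^bsub>G\<^esub> (u ^ j * (i * w ^ j)) = a [^]\<^bsub>G\<^esub> i"
        by (intro a_cong) (simp add: power_mult_distrib mult_ac)
      have "a [^]\<^bsub>G\<^esub> i \<otimes>\<^bsub>G\<^esub> x = a [^]\<^bsub>G\<^esub> k \<otimes>\<^bsub>G\<^esub> (a [^]\<^bsub>G\<^esub> i \<otimes>\<^bsub>G\<^esub> h [^]\<^bsub>G\<^esub> j)"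
      proof -
        have "a [^]\<^bsub>G\<^esub> i \<otimes>\<^bsub>G\<^esub> a [^]\<^bsub>G\<^esub> k = a [^]\<^bsub>G\<^esub> k \<otimes>\<^bsub>G\<^esub> a [^]\<^bsub>G\<^esub> i"
          using a by (simp add: G.nat_pow_mult add.commute)
        thus ?thesis using a h by (simp add: kj G.m_assoc[symmetric])
      qed
      also have "a [^]\<^bsub>G\<^esub> i \<otimes>\<^bsub>G\<^esub> h [^]\<^bsub>G\<^esub> j = h [^]\<^bsub>G\<^esub> j \<otimes>\<^bsub>G\<^esub> a [^]\<^bsub>G\<^esub> (i * w ^ j)"
        using G.pow_commute_relation[OF a h rel, of j "i * w ^ j"] ai by simp
      also have "a [^]\<^bsub>G\<^esub> k \<otimes>\<^bsub>G\<^esub> (h [^]\<^bsub>G\<^esub> j \<otimes>\<^bsub>G\<^esub> a [^]\<^bsub>G\<^esub> (i * w ^ j)) = x \<otimes>\<^bsub>G\<^esub> a [^]\<^bsub>G\<^esub> (i * w ^ j)"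
        using a h by (simp add: kj G.m_assoc)
      finally have "lam (a [^]\<^bsub>G\<^esub> i \<otimes>\<^bsub>G\<^esub> x) B = lam (x \<otimes>\<^bsub>G\<^esub> a [^]\<^bsub>G\<^esub> (i * w ^ j)) B" by simp
      thus ?thesis using a x lam_mult[OF _ _ B_coset] fix_mult[OF i] by simp
    qed
    hence "a [^]\<^bsub>G\<^esub> i = \<one>\<^bsub>G\<^esub>" using a by (intro lam_faithful) simp_all
    thus ?thesis using ord_a by simp
  qed
  define pt where "pt k = lam (a [^]\<^bsub>G\<^esub> k) B" for k :: nat
  have pt_S: "pt k \<in> S" for k using a by (simp add: pt_def lam_closed B_coset)
  have pt_add: "pt (j + k) = lam (a [^]\<^bsub>G\<^esub> j) (pt k)" for j k
    using a lam_mult[OF _ _ B_coset] by (simp add: pt_def G.nat_pow_mult[symmetric])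
  have pt_eq: "pt j = pt k \<longleftrightarrow> [j = k] (mod ?q)" for j k
  proof
    have le: "?q dvd k" if "pt j = pt (j + k)" for j k
    proof -
      have aj: "a [^]\<^bsub>G\<^esub> j \<in> carrier G" using a by simp
      have "lam (a [^]\<^bsub>G\<^esub> j) B = lam (a [^]\<^bsub>G\<^esub> j) (pt k)" using that pt_add by (simp add: pt_def)
      hence "B = pt k" using lam_inv(1)[OF aj B_coset] lam_inv(1)[OF aj pt_S] by metis
      thus ?thesis using stab by (simp add: pt_def)
    qed
    show "[j = k] (mod ?q)" if eq: "pt j = pt k"
    proof (cases "j \<le> k")
      case True
      then obtain m where "k = j + m" using le_Suc_ex by blast
      thus ?thesis using le eq by (simp add: cong_self_add_iff)
    next
      case False
      then obtain m where m: "j = k + m" using le_Suc_ex by (metis nat_le_linear)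
      hence "[k = j] (mod ?q)" using le[of k m] eq by (simp add: cong_self_add_iff)
      thus ?thesis by (rule cong_sym)
    qed
    show "pt j = pt k" if "[j = k] (mod ?q)" using a_cong[OF that] by (simp add: pt_def)
  qed
  have "inj_on pt {..<?q}" by (rule inj_onI) (simp add: pt_eq cong_def)
  hence "pt ` {..<?q} = S" using card_S pt_S by (intro card_subset_eq finite_cosets) (auto simp: card_image)
  hence pt_surj: "\<exists>k. s = pt k" if "s \<in> S" for s using that by blast
  \<comment> \<open>The power of \<open>a\<close> by which \<open>h\<close> moves the trivial coset
    is divided out.\<close>
  obtain k0 where k0: "lam h B = pt k0" using pt_surj[OF lam_closed[OF h B_coset]] by blast
  define \<upsilon> where "\<upsilon> = inv\<^bsub>G\<^esub> (a [^]\<^bsub>G\<^esub> k0) \<otimes>\<^bsub>G\<^esub> h"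
  have \<upsilon>: "\<upsilon> \<in> carrier G" using a h by (simp add: \<upsilon>_def)
  have h\<upsilon>: "h = a [^]\<^bsub>G\<^esub> k0 \<otimes>\<^bsub>G\<^esub> \<upsilon>" using a h by (simp add: \<upsilon>_def G.m_assoc[symmetric])
  have \<upsilon>B: "lam \<upsilon> B = B"
    using a h lam_mult[OF _ h B_coset, of "inv\<^bsub>G\<^esub> (a [^]\<^bsub>G\<^esub> k0)"] lam_inv(1)[OF _ B_coset, of "a [^]\<^bsub>G\<^esub> k0"]
    by (simp add: \<upsilon>_def k0 pt_def)
  have rel\<upsilon>: "\<upsilon> \<otimes>\<^bsub>G\<^esub> a = a [^]\<^bsub>G\<^esub> u \<otimes>\<^bsub>G\<^esub> \<upsilon>"
  proof -
    have c: "inv\<^bsub>G\<^esub> (a [^]\<^bsub>G\<^esub> k0) \<otimes>\<^bsub>G\<^esub> a [^]\<^bsub>G\<^esub> u = a [^]\<^bsub>G\<^esub> u \<otimes>\<^bsub>G\<^esub> inv\<^bsub>G\<^esub> (a [^]\<^bsub>G\<^esub> k0)"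
    proof -
      have "a [^]\<^bsub>G\<^esub> u \<otimes>\<^bsub>G\<^esub> a [^]\<^bsub>G\<^esub> k0 = a [^]\<^bsub>G\<^esub> k0 \<otimes>\<^bsub>G\<^esub> a [^]\<^bsub>G\<^esub> u"
        using a by (simp add: G.nat_pow_mult add.commute)
      hence "inv\<^bsub>G\<^esub> (a [^]\<^bsub>G\<^esub> k0) \<otimes>\<^bsub>G\<^esub> (a [^]\<^bsub>G\<^esub> u \<otimes>\<^bsub>G\<^esub> a [^]\<^bsub>G\<^esub> k0) = a [^]\<^bsub>G\<^esub> u"
        using a by (simp add: G.m_assoc[symmetric])
      thus ?thesis using a by (simp add: G.m_assoc[symmetric] G.inv_solve_right)
    qed
    have "\<upsilon> \<otimes>\<^bsub>G\<^esub> a = inv\<^bsub>G\<^esub> (a [^]\<^bsub>G\<^esub> k0) \<otimes>\<^bsub>G\<^esub> a [^]\<^bsub>G\<^esub> u \<otimes>\<^bsub>G\<^esub> h"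
      using a h rel by (simp add: \<upsilon>_def G.m_assoc)
    thus ?thesis using a h unfolding c by (simp add: \<upsilon>_def G.m_assoc)
  qed
  interpret C: cycle_with_power p 3 S "lam a" "lam \<upsilon>" pt u
  proof unfold_locales
    show "lam a (pt k) = pt (Suc k)" for k using pt_add[of 1 k] a by simp
    show "lam \<upsilon> (pt k) = pt (u * k)" for k
    proof -
      have "lam \<upsilon> (pt k) = lam (\<upsilon> \<otimes>\<^bsub>G\<^esub> a [^]\<^bsub>G\<^esub> k) B" using a \<upsilon> lam_mult[OF _ _ B_coset] by (simp add: pt_def)
      also have "\<upsilon> \<otimes>\<^bsub>G\<^esub> a [^]\<^bsub>G\<^esub> k = a [^]\<^bsub>G\<^esub> (u * k) \<otimes>\<^bsub>G\<^esub> \<upsilon>"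
        using G.pow_commute_relation[OF a \<upsilon> rel\<upsilon>, of 1 k] \<upsilon> by simp
      also have "lam (a [^]\<^bsub>G\<^esub> (u * k) \<otimes>\<^bsub>G\<^esub> \<upsilon>) B = pt (u * k)" using a \<upsilon> lam_mult[OF _ _ B_coset] \<upsilon>B by (simp add: pt_def)
      finally show ?thesis .
    qed
  qed (use p a \<upsilon> lam_Bij pt_S pt_surj pt_eq pu in auto)
  have "normalizes S (lam z) N" if N: "regular_subgroup S N" "normalizes S (lam a) N" "normalizes S (lam \<upsilon>) N"
    and z: "z \<in> carrier G" for z N
  proof -
    have "normalizes S (lam h) N" unfolding h\<upsilon> using a \<upsilon> N by (intro normalizes_mult normalizes_pow) simp_all
    moreover obtain i j :: nat where "z = a [^]\<^bsub>G\<^esub> i \<otimes>\<^bsub>G\<^esub> h [^]\<^bsub>G\<^esub> j" using gen z by blast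
    ultimately show ?thesis using a h N by (auto intro!: normalizes_mult normalizes_pow)
  qed
  hence "gp_of_type (integer_mod_group ?q) = C.normalized"
    using a \<upsilon> by (auto simp: gp_of_type_normalizes C.normalized_def)
  thus thesis using that[OF ord_u] C.card_normalized by simp
qed

end


text \<open>All assumptions of the locale come from one list of generators closed under conjugation:
  finiteness, the fixed fields for \<open>K\<close> and for \<open>L\<close>, and
  faithfulness.\<close>

lemma galois_extension_normal_closure:
  fixes E :: "('e, 'm) ring_scheme"
  assumes "field E" "subfield K E" "subfield L E" "K \<subseteq> L" "ring.dimension E n K L"
    and "separable_extension E K L" "normal_closure E K L"
  shows "galois_extension E K L"
proof -
  interpret field E by fact
  obtain xs where xs: "root_closed_generators K xs" "\<And>z. z \<in> set xs \<Longrightarrow> \<exists>u\<in>L. eval (Irr K u) z = \<zero>\<^bsub>E\<^esub>"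
    using normal_closure_generators[OF assms(2-7)] by blast
  have one: "\<one>\<^bsub>galois_group E K\<^esub> \<in> carrier (galois_group E K)" "\<And>x. x \<in> carrier E \<Longrightarrow> \<one>\<^bsub>galois_group E K\<^esub> x = x"
  proof -
    have "subgroup (carrier (galois_group E K)) (BijGroup (carrier E))"
      using subgroup_galois[OF assms(1) subfieldE(3)[OF assms(2)]] .
    thus "\<one>\<^bsub>galois_group E K\<^esub> \<in> carrier (galois_group E K)"
      using subgroup.one_closed by (fastforce simp: galois_group_def)
    show "\<And>x. x \<in> carrier E \<Longrightarrow> \<one>\<^bsub>galois_group E K\<^esub> x = x"
      by (simp add: galois_group_def BijGroup_def)
  qed
  show ?thesis
  proof (intro galois_extension.intro galois_extension_axioms.intro)
    show "x \<in> K" if "x \<in> carrier E" "\<And>s. s \<in> carrier (galois_group E K) \<Longrightarrow> s x = x" for x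
      using fixed_field[OF assms(2,2) subset_refl xs(1) that(1)] that(2) by blast
    show "x \<in> L" if "x \<in> carrier E" "\<And>s. s \<in> carrier (galois_group E L) \<Longrightarrow> s x = x" for x
      using fixed_field[OF assms(2-4) xs(1) that(1)] that(2) by blast
    show "s = \<one>\<^bsub>galois_group E K\<^esub>"
      if s: "s \<in> carrier (galois_group E K)"
        "\<And>h u. h \<in> carrier (galois_group E K) \<Longrightarrow> u \<in> L \<Longrightarrow> s (h u) = h u" for s
    proof (rule galois_group_faithful[OF assms(2,3) _ xs s(1) one(1)])
      show "(algebraic over K) u" if "u \<in> L" for u using assms(6) that by (simp add: separable_extension_def)
      fix h u assume h: "h \<in> carrier (galois_group E K)" and u: "u \<in> L"
      have "u \<in> carrier E" using u subfieldE(3)[OF assms(3)] by blast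
      hence "h u \<in> carrier E" using ring_hom_closed[OF galois_groupD(1)[OF h]] by simp
      thus "s (h u) = \<one>\<^bsub>galois_group E K\<^esub> (h u)" using s(2)[OF h u] one(2) by simp
    qed
  qed (rule assms finite_galois_group[OF assms(2) xs(1)])+
qed

theorem proposition6:
  fixes E :: "('e, 'm) ring_scheme" and K L :: "'e set" and p :: nat
  assumes "Factorial_Ring.prime p" and "odd p"
    and "field E" and "subfield K E" and "subfield L E" and "K \<subseteq> L"
    and "ring.dimension E (p ^ 3) K L"
    and "separable_extension E K L"
    and "normal_closure E K L"
  shows
    "(hopf_galois_of_type E K L (integer_mod_group (p ^ 3)) \<noteq> {} \<longleftrightarrow>
        (\<exists>a d. a \<le> 2 \<and> d dvd p - 1 \<and>
           is_cyclic_semidirect (galois_group E K) (p ^ 3) (p ^ a * d))) \<and>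
     (\<forall>a d. a \<le> 2 \<and> d dvd p - 1 \<and>
         is_cyclic_semidirect (galois_group E K) (p ^ 3) (p ^ a * d) \<longrightarrow>
        (d > 1 \<longrightarrow>
           num_hopf_galois_of_type E K L (integer_mod_group (p ^ 3)) = 1) \<and>
        (p ^ a * d = 1 \<longrightarrow>
           num_hopf_galois_of_type E K L (integer_mod_group (p ^ 3)) = p ^ 2) \<and>
        ((a = 1 \<or> a = 2) \<and> p ^ a * d = p ^ a \<longrightarrow>
           num_hopf_galois_of_type E K L (integer_mod_group (p ^ 3)) = p ^ (3 - a)))"
proof -
  interpret galois_extension E K L by (rule galois_extension_normal_closure[OF assms(3-9)])
  let ?T = "integer_mod_group (p ^ 3)"
  have p1: "p > 1" using prime_gt_1_nat[OF assms(1)] .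
  have card_gp: "card (gp_of_type ?T) = (if d > 1 then 1 else if a = 0 then p ^ 2 else p ^ (3 - a))"
    if a: "a \<le> 2" and d: "d dvd p - 1" and sd: "is_cyclic_semidirect (galois_group E K) (p ^ 3) (p ^ a * d)" for a d
  proof -
    have "d > 0" using d p1 by (intro Nat.gr0I) auto
    hence "p ^ a * d > 0" using p1 by simp
    then obtain u where u: "\<And>j. [u ^ j = 1] (mod p ^ 3) \<longleftrightarrow> p ^ a * d dvd j"
      "card (gp_of_type ?T) =
         card {c \<in> {0..<int p ^ 3}. int p dvd c - 1 \<and> int p ^ 3 dvd (c - 1) * (int u - 1)}"
      by (rule card_cyclic_type[OF assms(1,2) card_cosets[OF assms(7)] _ sd]) blast
    show ?thesis unfolding u(2) by (rule card_cong_one_solutions[OF assms(1,2) a d u(1)])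
  qed
  have "gp_of_type ?T \<noteq> {} \<longleftrightarrow>
      (\<exists>a d. a \<le> 2 \<and> d dvd p - 1 \<and> is_cyclic_semidirect (galois_group E K) (p ^ 3) (p ^ a * d))"
  proof
    assume "\<exists>a d. a \<le> 2 \<and> d dvd p - 1 \<and> is_cyclic_semidirect (galois_group E K) (p ^ 3) (p ^ a * d)"
    then obtain a d where "a \<le> 2" "d dvd p - 1" "is_cyclic_semidirect (galois_group E K) (p ^ 3) (p ^ a * d)"
      by blast
    hence "card (gp_of_type ?T) > 0" using p1 by (simp add: card_gp)
    thus "gp_of_type ?T \<noteq> {}" by force
  qed (rule semidirect_if_cyclic_type[OF assms(1,2)])
  thus ?thesis
    unfolding hopf_galois_of_type_empty_iff num_hopf_galois_eq
  proof (intro conjI allI impI)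
    fix a d assume *: "a \<le> 2 \<and> d dvd p - 1 \<and> is_cyclic_semidirect (galois_group E K) (p ^ 3) (p ^ a * d)"
    note card = card_gp[OF conjunct1[OF *] conjunct1[OF conjunct2[OF *]] conjunct2[OF conjunct2[OF *]]]
    show "card (gp_of_type ?T) = 1" if "d > 1" using card that by simp
    show "card (gp_of_type ?T) = p ^ 2" if "p ^ a * d = 1" using card that p1 by simp
    show "card (gp_of_type ?T) = p ^ (3 - a)" if "(a = 1 \<or> a = 2) \<and> p ^ a * d = p ^ a"
      using card that p1 by auto
  qed
qed

end
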